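(* Let $G$ be a closed group of Weyl-transitive, type-preserving automorphisms of a thick, locally finite building $(\Delta,\delta)$. Let $g\in G$ and let $a$ be a simplex such that $a$ and $g.a$ are aligned and $q(g.a,a)$ is minimal among all simplices $b$ for which $b$ and $g.b$ are aligned. Then the stabilizer $G_a$ is tidy for $g$ and $s(g)=q(g.a,a)$.
   Context: $(\Delta,\delta)$ is a building of type $(W,S)$, $S$ finite; simplices are spherical residues. Type-preserving automorphisms preserve $\delta$; Weyl-transitive means any two pairs of chambers with equal Weyl distance are mapped to each other by some element of $G$ (so $q_s$, the number of chambers $s$-adjacent to a given chamber, is constant). $G$ has the compact-open topology. A compact open subgroup $U$ is tidy for $g$ if it minimizes $|gUg^{-1}:gUg^{-1}\cap U|$, the minimum being the scale $s(g)$. For residues $\mathcal{A},\mathcal{B}$ let $\operatorname{proj}_{\mathcal{B}}(\mathcal{A})=\{\operatorname{proj}_{\mathcal{B}}(x):x\in\mathcal{A}\}$, $\operatorname{proj}_{\mathcal{B}}(x)$ being the chamber of $\mathcal{B}$ closest to $x$. Simplices $a,b$ with residues $\mathcal{A},\mathcal{B}$ are aligned if $\operatorname{proj}_{\mathcal{B}}(\mathcal{A})=\mathcal{B}$ and $\operatorname{proj}_{\mathcal{A}}(\mathcal{B})=\mathcal{A}$. In the Davis realisation, walls are fixed sets of reflections in apartments; the thickness of a wall $m$ is $q(m)=q_s$ for any panel of cotype $s$ contained in $m$, and $q(a,b)=\prod q(m)$ over the walls $m$ of an apartment containing $a$ and $b$ that separate $a$ from $b$. *)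

theory Defs
  imports "HOL-Algebra.Group" "HOL-Analysis.Function_Topology"
begin

definition word_prod :: "('w,'b) monoid_scheme \<Rightarrow> 'w list \<Rightarrow> 'w" where
  "word_prod W xs = foldr (\<lambda>x y. x \<otimes>\<^bsub>W\<^esub> y) xs \<one>\<^bsub>W\<^esub>"

definition cox_length :: "('w,'b) monoid_scheme \<Rightarrow> 'w set \<Rightarrow> 'w \<Rightarrow> nat" where
  "cox_length W S w = (LEAST n. \<exists>xs. set xs \<subseteq> S \<and> length xs = n \<and> word_prod W xs = w)"

text \<open>Coxeter system: a group generated by a set of involutions satisfying the
  exchange condition (equivalent to the Coxeter presentation, Abramenko--Brown).\<close>
definition coxeter_system :: "('w,'b) monoid_scheme \<Rightarrow> 'w set \<Rightarrow> bool" where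
  "coxeter_system W S \<longleftrightarrow> group W \<and> S \<subseteq> carrier W \<and> \<one>\<^bsub>W\<^esub> \<notin> S \<and>
     (\<forall>s\<in>S. s \<otimes>\<^bsub>W\<^esub> s = \<one>\<^bsub>W\<^esub>) \<and>
     (\<forall>w\<in>carrier W. \<exists>xs. set xs \<subseteq> S \<and> word_prod W xs = w) \<and>
     (\<forall>s\<in>S. \<forall>xs. set xs \<subseteq> S \<and> length xs = cox_length W S (word_prod W xs)
        \<and> cox_length W S (s \<otimes>\<^bsub>W\<^esub> word_prod W xs) \<le> length xs
        \<longrightarrow> (\<exists>i<length xs. s \<otimes>\<^bsub>W\<^esub> word_prod W xs = word_prod W (take i xs @ drop (Suc i) xs)))"

definition std_parabolic :: "('w,'b) monoid_scheme \<Rightarrow> 'w set \<Rightarrow> 'w set" where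
  "std_parabolic W J = {word_prod W xs | xs. set xs \<subseteq> J}"

definition reflections :: "('w,'b) monoid_scheme \<Rightarrow> 'w set \<Rightarrow> 'w set" where
  "reflections W S = {w \<otimes>\<^bsub>W\<^esub> s \<otimes>\<^bsub>W\<^esub> inv\<^bsub>W\<^esub> w | w s. w \<in> carrier W \<and> s \<in> S}"

section \<open>Buildings as W-metric spaces (Abramenko--Brown, Def. 5.1)\<close>

definition is_building :: "('w,'b) monoid_scheme \<Rightarrow> 'w set \<Rightarrow> 'c set \<Rightarrow> ('c \<Rightarrow> 'c \<Rightarrow> 'w) \<Rightarrow> bool" where
  "is_building W S C \<delta> \<longleftrightarrow> coxeter_system W S \<and> finite S \<and> C \<noteq> {} \<and>
     (\<forall>x\<in>C. \<forall>y\<in>C. \<delta> x y \<in> carrier W) \<and>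
     (\<forall>x\<in>C. \<forall>y\<in>C. \<delta> x y = \<one>\<^bsub>W\<^esub> \<longleftrightarrow> x = y) \<and>
     (\<forall>x\<in>C. \<forall>y\<in>C. \<forall>z\<in>C. \<forall>s\<in>S. \<delta> z x = s \<longrightarrow>
        (\<delta> z y = s \<otimes>\<^bsub>W\<^esub> \<delta> x y \<or> \<delta> z y = \<delta> x y) \<and>
        (cox_length W S (s \<otimes>\<^bsub>W\<^esub> \<delta> x y) = Suc (cox_length W S (\<delta> x y))
           \<longrightarrow> \<delta> z y = s \<otimes>\<^bsub>W\<^esub> \<delta> x y)) \<and>
     (\<forall>x\<in>C. \<forall>y\<in>C. \<forall>s\<in>S. \<exists>z\<in>C. \<delta> z x = s \<and> \<delta> z y = s \<otimes>\<^bsub>W\<^esub> \<delta> x y)"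

text \<open>Chambers s-adjacent to x (x's s-panel minus x).\<close>
definition s_adjacent :: "'c set \<Rightarrow> ('c \<Rightarrow> 'c \<Rightarrow> 'w) \<Rightarrow> 'w \<Rightarrow> 'c \<Rightarrow> 'c set" where
  "s_adjacent C \<delta> s x = {y \<in> C. \<delta> x y = s}"

text \<open>Thick: every panel has at least 3 chambers; locally finite: every panel is finite.\<close>
definition thick_building :: "'w set \<Rightarrow> 'c set \<Rightarrow> ('c \<Rightarrow> 'c \<Rightarrow> 'w) \<Rightarrow> bool" where
  "thick_building S C \<delta> \<longleftrightarrow> (\<forall>x\<in>C. \<forall>s\<in>S. infinite (s_adjacent C \<delta> s x) \<or> card (s_adjacent C \<delta> s x) \<ge> 2)"

definition locally_finite_building :: "'w set \<Rightarrow> 'c set \<Rightarrow> ('c \<Rightarrow> 'c \<Rightarrow> 'w) \<Rightarrow> bool" where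
  "locally_finite_building S C \<delta> \<longleftrightarrow> (\<forall>x\<in>C. \<forall>s\<in>S. finite (s_adjacent C \<delta> s x))"

definition residue :: "('w,'b) monoid_scheme \<Rightarrow> 'w set \<Rightarrow> 'c set \<Rightarrow> ('c \<Rightarrow> 'c \<Rightarrow> 'w) \<Rightarrow> 'c \<Rightarrow> 'c set" where
  "residue W J C \<delta> x = {y \<in> C. \<delta> x y \<in> std_parabolic W J}"

definition is_simplex :: "('w,'b) monoid_scheme \<Rightarrow> 'w set \<Rightarrow> 'c set \<Rightarrow> ('c \<Rightarrow> 'c \<Rightarrow> 'w) \<Rightarrow> 'c set \<Rightarrow> bool" where
  "is_simplex W S C \<delta> R \<longleftrightarrow>
     (\<exists>J. J \<subseteq> S \<and> finite (std_parabolic W J) \<and> (\<exists>x\<in>C. R = residue W J C \<delta> x))"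

definition proj :: "('w,'b) monoid_scheme \<Rightarrow> 'w set \<Rightarrow> ('c \<Rightarrow> 'c \<Rightarrow> 'w) \<Rightarrow> 'c set \<Rightarrow> 'c \<Rightarrow> 'c" where
  "proj W S \<delta> R x = (THE y. y \<in> R \<and> (\<forall>z\<in>R. cox_length W S (\<delta> x y) \<le> cox_length W S (\<delta> x z)))"

definition proj_set :: "('w,'b) monoid_scheme \<Rightarrow> 'w set \<Rightarrow> ('c \<Rightarrow> 'c \<Rightarrow> 'w) \<Rightarrow> 'c set \<Rightarrow> 'c set \<Rightarrow> 'c set" where
  "proj_set W S \<delta> B A = proj W S \<delta> B ` A"

definition aligned :: "('w,'b) monoid_scheme \<Rightarrow> 'w set \<Rightarrow> ('c \<Rightarrow> 'c \<Rightarrow> 'w) \<Rightarrow> 'c set \<Rightarrow> 'c set \<Rightarrow> bool" where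
  "aligned W S \<delta> A B \<longleftrightarrow> proj_set W S \<delta> B A = B \<and> proj_set W S \<delta> A B = A"

text \<open>An apartment is the image of an isometric embedding of W (with W-distance u^-1 v).\<close>
definition apartment_map :: "('w,'b) monoid_scheme \<Rightarrow> 'c set \<Rightarrow> ('c \<Rightarrow> 'c \<Rightarrow> 'w) \<Rightarrow> ('w \<Rightarrow> 'c) \<Rightarrow> bool" where
  "apartment_map W C \<delta> \<phi> \<longleftrightarrow> (\<forall>u\<in>carrier W. \<phi> u \<in> C) \<and>
     (\<forall>u\<in>carrier W. \<forall>v\<in>carrier W. \<delta> (\<phi> u) (\<phi> v) = inv\<^bsub>W\<^esub> u \<otimes>\<^bsub>W\<^esub> v)"

text \<open>The two half-apartments (roots) of the wall of the reflection r, in W.\<close>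
definition half_pos :: "('w,'b) monoid_scheme \<Rightarrow> 'w set \<Rightarrow> 'w \<Rightarrow> 'w set" where
  "half_pos W S r = {w \<in> carrier W. cox_length W S w < cox_length W S (r \<otimes>\<^bsub>W\<^esub> w)}"

definition half_neg :: "('w,'b) monoid_scheme \<Rightarrow> 'w set \<Rightarrow> 'w \<Rightarrow> 'w set" where
  "half_neg W S r = {w \<in> carrier W. cox_length W S (r \<otimes>\<^bsub>W\<^esub> w) < cox_length W S w}"

text \<open>The wall of r in the apartment given by phi separates the simplices A and B
  (given as residues meeting the apartment): they lie in opposite open half-spaces.\<close>
definition wall_separates :: "('w,'b) monoid_scheme \<Rightarrow> 'w set \<Rightarrow> ('w \<Rightarrow> 'c) \<Rightarrow> 'w \<Rightarrow> 'c set \<Rightarrow> 'c set \<Rightarrow> bool" where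
  "wall_separates W S \<phi> r A B \<longleftrightarrow>
     (A \<inter> \<phi> ` carrier W \<subseteq> \<phi> ` half_pos W S r \<and> B \<inter> \<phi> ` carrier W \<subseteq> \<phi> ` half_neg W S r) \<or>
     (A \<inter> \<phi> ` carrier W \<subseteq> \<phi> ` half_neg W S r \<and> B \<inter> \<phi> ` carrier W \<subseteq> \<phi> ` half_pos W S r)"

definition q_s :: "'c set \<Rightarrow> ('c \<Rightarrow> 'c \<Rightarrow> 'w) \<Rightarrow> 'w \<Rightarrow> nat" where
  "q_s C \<delta> s = card (s_adjacent C \<delta> s (SOME x. x \<in> C))"

text \<open>Thickness of the wall of r: q_s for a panel of cotype s in that wall, i.e. for s
  with r = w s w^-1.\<close>
definition wall_thickness :: "('w,'b) monoid_scheme \<Rightarrow> 'w set \<Rightarrow> 'c set \<Rightarrow> ('c \<Rightarrow> 'c \<Rightarrow> 'w) \<Rightarrow> 'w \<Rightarrow> nat" where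
  "wall_thickness W S C \<delta> r =
     q_s C \<delta> (SOME s. s \<in> S \<and> (\<exists>w\<in>carrier W. r = w \<otimes>\<^bsub>W\<^esub> s \<otimes>\<^bsub>W\<^esub> inv\<^bsub>W\<^esub> w))"

definition qdist :: "('w,'b) monoid_scheme \<Rightarrow> 'w set \<Rightarrow> 'c set \<Rightarrow> ('c \<Rightarrow> 'c \<Rightarrow> 'w) \<Rightarrow> 'c set \<Rightarrow> 'c set \<Rightarrow> nat" where
  "qdist W S C \<delta> A B =
     (let \<phi> = (SOME \<phi>. apartment_map W C \<delta> \<phi> \<and> A \<inter> \<phi> ` carrier W \<noteq> {} \<and> B \<inter> \<phi> ` carrier W \<noteq> {})
      in \<Prod>r \<in> {r \<in> reflections W S. wall_separates W S \<phi> r A B}. wall_thickness W S C \<delta> r)"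

definition type_pres_aut :: "'c set \<Rightarrow> ('c \<Rightarrow> 'c \<Rightarrow> 'w) \<Rightarrow> ('c \<Rightarrow> 'c) set" where
  "type_pres_aut C \<delta> = {f \<in> extensional C. bij_betw f C C \<and> (\<forall>x\<in>C. \<forall>y\<in>C. \<delta> (f x) (f y) = \<delta> x y)}"

definition perm_top :: "'c set \<Rightarrow> ('c \<Rightarrow> 'c) topology" where
  "perm_top C = product_topology (\<lambda>_. discrete_topology C) C"

definition gmult :: "'c set \<Rightarrow> ('c \<Rightarrow> 'c) \<Rightarrow> ('c \<Rightarrow> 'c) \<Rightarrow> ('c \<Rightarrow> 'c)" where
  "gmult C g h = compose C g h"

definition ginv :: "'c set \<Rightarrow> ('c \<Rightarrow> 'c) \<Rightarrow> ('c \<Rightarrow> 'c)" where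
  "ginv C g = restrict (inv_into C g) C"

definition is_subgroup_of :: "'c set \<Rightarrow> ('c \<Rightarrow> 'c) set \<Rightarrow> ('c \<Rightarrow> 'c) set \<Rightarrow> bool" where
  "is_subgroup_of C H G \<longleftrightarrow> H \<subseteq> G \<and> restrict id C \<in> H \<and>
     (\<forall>g\<in>H. \<forall>h\<in>H. gmult C g h \<in> H) \<and> (\<forall>g\<in>H. ginv C g \<in> H)"

definition closed_aut_group :: "'c set \<Rightarrow> ('c \<Rightarrow> 'c \<Rightarrow> 'w) \<Rightarrow> ('c \<Rightarrow> 'c) set \<Rightarrow> bool" where
  "closed_aut_group C \<delta> G \<longleftrightarrow> is_subgroup_of C G (type_pres_aut C \<delta>) \<and>
     closedin (subtopology (perm_top C) (type_pres_aut C \<delta>)) G"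

definition weyl_transitive :: "'c set \<Rightarrow> ('c \<Rightarrow> 'c \<Rightarrow> 'w) \<Rightarrow> ('c \<Rightarrow> 'c) set \<Rightarrow> bool" where
  "weyl_transitive C \<delta> G \<longleftrightarrow> (\<forall>x\<in>C. \<forall>y\<in>C. \<forall>x'\<in>C. \<forall>y'\<in>C.
     \<delta> x y = \<delta> x' y' \<longrightarrow> (\<exists>g\<in>G. g x = x' \<and> g y = y'))"

definition compact_open_subgroup :: "'c set \<Rightarrow> ('c \<Rightarrow> 'c) set \<Rightarrow> ('c \<Rightarrow> 'c) set \<Rightarrow> bool" where
  "compact_open_subgroup C G U \<longleftrightarrow> is_subgroup_of C U G \<and>
     openin (subtopology (perm_top C) G) U \<and> compactin (subtopology (perm_top C) G) U"

definition conj_set :: "'c set \<Rightarrow> ('c \<Rightarrow> 'c) \<Rightarrow> ('c \<Rightarrow> 'c) set \<Rightarrow> ('c \<Rightarrow> 'c) set" where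
  "conj_set C g U = (\<lambda>u. gmult C (gmult C g u) (ginv C g)) ` U"

definition sg_index :: "'c set \<Rightarrow> ('c \<Rightarrow> 'c) set \<Rightarrow> ('c \<Rightarrow> 'c) set \<Rightarrow> nat" where
  "sg_index C H K = card ((\<lambda>h. gmult C h ` K) ` H)"

definition displacement :: "'c set \<Rightarrow> ('c \<Rightarrow> 'c) \<Rightarrow> ('c \<Rightarrow> 'c) set \<Rightarrow> nat" where
  "displacement C g U = sg_index C (conj_set C g U) (conj_set C g U \<inter> U)"

definition tidy :: "'c set \<Rightarrow> ('c \<Rightarrow> 'c) set \<Rightarrow> ('c \<Rightarrow> 'c) \<Rightarrow> ('c \<Rightarrow> 'c) set \<Rightarrow> bool" where
  "tidy C G g U \<longleftrightarrow> compact_open_subgroup C G U \<and>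
     (\<forall>V. compact_open_subgroup C G V \<longrightarrow> displacement C g U \<le> displacement C g V)"

definition scale :: "'c set \<Rightarrow> ('c \<Rightarrow> 'c) set \<Rightarrow> ('c \<Rightarrow> 'c) \<Rightarrow> nat" where
  "scale C G g = (LEAST n. \<exists>U. compact_open_subgroup C G U \<and> displacement C g U = n)"

definition stabilizer :: "('c \<Rightarrow> 'c) set \<Rightarrow> 'c set \<Rightarrow> ('c \<Rightarrow> 'c) set" where
  "stabilizer G A = {h \<in> G. h ` A = A}"

end

theory Submission imports Defs begin

text \<open>Choose a chamber \<open>x\<close> for which \<open>w = \<delta>(x, g x)\<close> has minimal length. Cyclic shifts of \<open>w\<close> are
  realised by moving \<open>x\<close>, so none of them is shorter than \<open>w\<close>. In the Tits cone, average the functional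
  "sum of the coefficients" over a long part of its \<open>w\<close>-orbit. Every root is then either constantly
  zero along the orbit of the averaged point or nonzero with at most one sign change, and the path from
  the fundamental chamber to that point crosses walls only by cyclic shifts. This gives a cyclic shift
  \<open>v t\<close> of \<open>w\<close> with \<open>v\<close> in a spherical parabolic subgroup \<open>W\<^sub>J\<close> normalised by \<open>t\<close>, where \<open>t\<close> is straight:
  \<open>t\<^sup>n\<close> has length \<open>n\<close> times that of \<open>t\<close>. Hence some residue \<open>b\<close> of type \<open>J\<close> is aligned with \<open>g b\<close>, and
  \<open>q(g\<^sup>n b, b) = q(g b, b)\<^sup>n\<close> for all \<open>n\<close>.

  For aligned residues \<open>a\<close> and \<open>g a\<close> of the same type, \<open>q(g a, a)\<close> is the index of \<open>G\<^sub>a \<inter> G\<^sub>g\<^sub>a\<close> in \<open>G\<^sub>g\<^sub>a\<close>. A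
  compact open subgroup \<open>V\<close> is commensurable with \<open>G\<^sub>b\<close>, so \<open>q(g b, b)\<^sup>n\<close> is at most a constant times the
  \<open>n\<close>-th power of the index belonging to \<open>V\<close>; thus \<open>q(g b, b)\<close> is a lower bound for all these
  indices, and by minimality \<open>q(g a, a)\<close> does not exceed it.\<close>

section \<open>Coxeter groups\<close>

text \<open>An interior point of the Tits cone fixed by \<open>w\<close> need not exist; a point
  whose orbit lies in a wall entirely, or avoids it and crosses it at most once, is enough. The
  values of \<open>ltot\<close> along an orbit may oscillate, but up to shift and sign only finitely
  many root orbits change sign at all, and each of these is periodic or has a constant sign near
  both ends. One long binomial average therefore serves all roots. Averaging proceeds by midpoints
  because the midpoint of a point and its translate lies in a chamber on a minimal gallery between
  their chambers, and such a chamber is reached by rotating a reduced word. Binomial averages need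
  not make a periodic orbit of mean zero vanish exactly, hence the further mean over a full period,
  approached along a segment. For the lower bound, a compact open subgroup and a residue stabiliser
  cannot be compared at a single index. In the growth rate along powers of \<open>g\<close> the
  commensurability constants disappear, and straightness keeps the index at the residue exactly
  multiplicative.\<close>

locale coxeter =
  fixes W :: "('w,'b) monoid_scheme" (structure) and S :: "'w set"
  assumes cox: "coxeter_system W S" and finite_S: "finite S"

sublocale coxeter \<subseteq> group W
  using cox by (simp add: coxeter_system_def)

context coxeter
begin

abbreviation len :: "'w \<Rightarrow> nat" where "len w \<equiv> cox_length W S w"
abbreviation wprod :: "'w list \<Rightarrow> 'w" where "wprod xs \<equiv> word_prod W xs"
abbreviation par :: "'w set \<Rightarrow> 'w set" where "par J \<equiv> std_parabolic W J"

lemma S_carrier [simp]: "s \<in> S \<Longrightarrow> s \<in> carrier W"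
  using cox by (auto simp: coxeter_system_def)

lemma S_sq [simp]: "s \<in> S \<Longrightarrow> s \<otimes> s = \<one>"
  using cox by (auto simp: coxeter_system_def)

lemma one_notin_S [simp]: "\<one> \<notin> S"
  using cox by (auto simp: coxeter_system_def)

lemma S_inv [simp]: "s \<in> S \<Longrightarrow> inv s = s"
  by (rule inv_equality) auto

lemma S_cancel [simp]: "s \<in> S \<Longrightarrow> x \<in> carrier W \<Longrightarrow> s \<otimes> (s \<otimes> x) = x"
  by (simp add: m_assoc[symmetric])

lemma S_cancel_right [simp]: "s \<in> S \<Longrightarrow> x \<in> carrier W \<Longrightarrow> x \<otimes> s \<otimes> s = x"
  by (simp add: m_assoc)

lemma wprod_Nil [simp]: "wprod [] = \<one>" by (simp add: word_prod_def)

lemma wprod_Cons [simp]: "wprod (x # xs) = x \<otimes> wprod xs" by (simp add: word_prod_def)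

lemma wprod_closed [simp]: "set xs \<subseteq> S \<Longrightarrow> wprod xs \<in> carrier W"
  by (induction xs) auto

lemma wprod_append: "set xs \<subseteq> S \<Longrightarrow> set ys \<subseteq> S \<Longrightarrow> wprod (xs @ ys) = wprod xs \<otimes> wprod ys"
  by (induction xs) (auto simp: m_assoc)

lemma wprod_rev: "set xs \<subseteq> S \<Longrightarrow> wprod (rev xs) = inv (wprod xs)"
  by (induction xs) (auto simp: wprod_append inv_mult_group)

lemma ex_word: "w \<in> carrier W \<Longrightarrow> \<exists>xs. set xs \<subseteq> S \<and> wprod xs = w"
  using cox by (auto simp: coxeter_system_def)

lemma len_le: "set xs \<subseteq> S \<Longrightarrow> len (wprod xs) \<le> length xs"
  unfolding cox_length_def by (rule Least_le) auto

lemma reduced_word: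
  assumes "w \<in> carrier W"
  obtains xs where "set xs \<subseteq> S" "length xs = len w" "wprod xs = w"
proof -
  obtain ys where "set ys \<subseteq> S" "wprod ys = w" using ex_word[OF assms] by auto
  then have "\<exists>xs. set xs \<subseteq> S \<and> length xs = len w \<and> wprod xs = w"
    unfolding cox_length_def
    using LeastI[of "\<lambda>n. \<exists>xs. set xs \<subseteq> S \<and> length xs = n \<and> wprod xs = w" "length ys"] by blast
  then show ?thesis using that by blast
qed

lemma len_one [simp]: "len \<one> = 0"
  using len_le[of "[]"] by simp

lemma len_0_iff: "w \<in> carrier W \<Longrightarrow> len w = 0 \<longleftrightarrow> w = \<one>"
  by (erule reduced_word) auto

lemma len_inv_le: "w \<in> carrier W \<Longrightarrow> len (inv w) \<le> len w"
  by (metis len_le length_rev reduced_word set_rev wprod_rev)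

lemma len_inv [simp]: "w \<in> carrier W \<Longrightarrow> len (inv w) = len w"
  by (metis inv_closed inv_inv le_antisym len_inv_le)

lemma len_mult_le: "u \<in> carrier W \<Longrightarrow> v \<in> carrier W \<Longrightarrow> len (u \<otimes> v) \<le> len u + len v"
proof -
  assume u: "u \<in> carrier W" and v: "v \<in> carrier W"
  obtain xs where "set xs \<subseteq> S" "length xs = len u" "wprod xs = u" using reduced_word[OF u] .
  moreover obtain ys where "set ys \<subseteq> S" "length ys = len v" "wprod ys = v" using reduced_word[OF v] .
  ultimately show ?thesis using len_le[of "xs @ ys"] by (simp add: wprod_append)
qed

lemma len_S [simp]: "s \<in> S \<Longrightarrow> len s = 1"
  using len_le[of "[s]"] len_0_iff[of s] one_notin_S by (cases "len s") (auto simp: le_Suc_eq)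

lemma exchange:
  assumes "s \<in> S" "set xs \<subseteq> S" "length xs = len (wprod xs)" "len (s \<otimes> wprod xs) \<le> length xs"
  obtains as b cs where "xs = as @ b # cs" "s \<otimes> wprod xs = wprod (as @ cs)"
proof -
  have "\<exists>i<length xs. s \<otimes> wprod xs = wprod (take i xs @ drop (Suc i) xs)"
    using cox assms unfolding coxeter_system_def by blast
  then obtain i where i: "i < length xs" "s \<otimes> wprod xs = wprod (take i xs @ drop (Suc i) xs)" by auto
  show ?thesis by (rule that[OF id_take_nth_drop[OF i(1)] i(2)])
qed

lemma len_left_cases:
  assumes "s \<in> S" "w \<in> carrier W"
  shows "len (s \<otimes> w) = Suc (len w) \<or> len w = Suc (len (s \<otimes> w))"
proof -
  have 1: "len (s \<otimes> w) \<le> Suc (len w)" using len_mult_le[of s w] assms by simp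
  have 2: "len w \<le> Suc (len (s \<otimes> w))" using len_mult_le[of s "s \<otimes> w"] assms by simp
  have 3: "len (s \<otimes> w) \<noteq> len w"
  proof
    assume eq: "len (s \<otimes> w) = len w"
    obtain xs where xs: "set xs \<subseteq> S" "length xs = len w" "wprod xs = w" using reduced_word assms(2) .
    obtain as b cs where d: "xs = as @ b # cs" "s \<otimes> wprod xs = wprod (as @ cs)"
      by (rule exchange[OF assms(1) xs(1)]) (use xs eq in auto)
    have "len (s \<otimes> w) \<le> length (as @ cs)" using len_le[of "as @ cs"] d xs by auto
    then show False using d xs eq by simp
  qed
  show ?thesis using 1 2 3 by linarith
qed

lemma len_right_inv: "s \<in> S \<Longrightarrow> w \<in> carrier W \<Longrightarrow> len (w \<otimes> s) = len (s \<otimes> inv w)"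
  using len_inv[of "w \<otimes> s"] by (simp add: inv_mult_group)

lemma len_right_cases:
  assumes "s \<in> S" "w \<in> carrier W"
  shows "len (w \<otimes> s) = Suc (len w) \<or> len w = Suc (len (w \<otimes> s))"
  using len_left_cases[of s "inv w"] assms by (simp add: len_right_inv)

lemma exchange_right:
  assumes "s \<in> S" "set xs \<subseteq> S" "length xs = len (wprod xs)" "len (wprod xs \<otimes> s) \<le> length xs"
  obtains as b cs where "xs = as @ b # cs" "wprod xs \<otimes> s = wprod (as @ cs)"
proof -
  have e: "len (s \<otimes> wprod (rev xs)) \<le> length (rev xs)"
    using assms by (simp add: wprod_rev len_right_inv)
  obtain as b cs where d: "rev xs = as @ b # cs" "s \<otimes> wprod (rev xs) = wprod (as @ cs)"
    by (rule exchange[OF assms(1) _ _ e]) (use assms in \<open>auto simp: wprod_rev\<close>)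
  have xs: "xs = rev cs @ b # rev as" using d(1) by (metis append.assoc append_Cons append_Nil rev.simps(2) rev_append rev_rev_ident)
  have sub: "set as \<subseteq> S" "set cs \<subseteq> S" using xs assms(2) by auto
  have "wprod xs \<otimes> s = inv (s \<otimes> wprod (rev xs))"
    using assms by (simp add: wprod_rev inv_mult_group)
  also have "\<dots> = wprod (rev (as @ cs))" using d(2) sub by (subst wprod_rev) auto
  finally show ?thesis using that xs by simp
qed

text \<open>If the tail of the word is already reduced, its first letter must shorten the tail, and
  exchange deletes a second letter together with it.\<close>

lemma deletion:
  assumes "set xs \<subseteq> S" "len (wprod xs) < length xs"
  obtains as a bs b cs where "xs = as @ a # bs @ b # cs" "wprod xs = wprod (as @ bs @ cs)"
proof -
  have "\<exists>as a bs b cs. xs = as @ a # bs @ b # cs \<and> wprod xs = wprod (as @ bs @ cs)"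
    using assms
  proof (induction xs)
    case (Cons x ys)
    show ?case
    proof (cases "len (wprod ys) < length ys")
      case True
      then obtain as a bs b cs where "ys = as @ a # bs @ b # cs" "wprod ys = wprod (as @ bs @ cs)"
        using Cons by auto
      then have "x # ys = (x # as) @ a # bs @ b # cs \<and> wprod (x # ys) = wprod ((x # as) @ bs @ cs)"
        by simp
      then show ?thesis by blast
    next
      case False
      then have red: "length ys = len (wprod ys)" using len_le[of ys] Cons.prems by auto
      obtain as b cs where "ys = as @ b # cs" "x \<otimes> wprod ys = wprod (as @ cs)"
        by (rule exchange[of x ys]) (use Cons.prems red in auto)
      then have "x # ys = [] @ x # as @ b # cs \<and> wprod (x # ys) = wprod ([] @ as @ cs)" by simp
      then show ?thesis by blast
    qed
  qed simp
  then show ?thesis using that by blast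
qed

section \<open>Standard parabolic subgroups and shortest coset representatives\<close>

lemma par_carrier: "J \<subseteq> S \<Longrightarrow> k \<in> par J \<Longrightarrow> k \<in> carrier W"
  by (auto simp: std_parabolic_def)

lemma par_one [simp]: "\<one> \<in> par J"
  unfolding std_parabolic_def by (rule CollectI, rule exI[of _ "[]"]) simp

lemma par_gen: "J \<subseteq> S \<Longrightarrow> s \<in> J \<Longrightarrow> s \<in> par J"
  unfolding std_parabolic_def by (rule CollectI, rule exI[of _ "[s]"]) (auto simp: subset_iff)

lemma par_mult: "J \<subseteq> S \<Longrightarrow> k \<in> par J \<Longrightarrow> k' \<in> par J \<Longrightarrow> k \<otimes> k' \<in> par J"
proof -
  assume J: "J \<subseteq> S" and k: "k \<in> par J" "k' \<in> par J"
  then obtain xs ys where "set xs \<subseteq> J" "k = wprod xs" "set ys \<subseteq> J" "k' = wprod ys"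
    by (auto simp: std_parabolic_def)
  then have "set (xs @ ys) \<subseteq> J" "k \<otimes> k' = wprod (xs @ ys)" using J by (auto simp: wprod_append)
  then show ?thesis unfolding std_parabolic_def by blast
qed

lemma par_inv: "J \<subseteq> S \<Longrightarrow> k \<in> par J \<Longrightarrow> inv k \<in> par J"
proof -
  assume J: "J \<subseteq> S" and k: "k \<in> par J"
  then obtain xs where "set xs \<subseteq> J" "k = wprod xs" by (auto simp: std_parabolic_def)
  then have "set (rev xs) \<subseteq> J" "inv k = wprod (rev xs)" using J by (auto simp: wprod_rev)
  then show ?thesis unfolding std_parabolic_def by blast
qed

text \<open>Deletion only removes letters, so a shortest word over \<open>J\<close> stays over
  \<open>J\<close> and must be reduced over \<open>S\<close>. The length function of the parabolic
  subgroup is thus the restriction of \<open>len\<close>.\<close>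

lemma par_reduced_word:
  assumes "J \<subseteq> S" "k \<in> par J"
  obtains xs where "set xs \<subseteq> J" "length xs = len k" "wprod xs = k"
proof -
  obtain xs0 where "set xs0 \<subseteq> J \<and> wprod xs0 = k" using assms by (auto simp: std_parabolic_def)
  then obtain xs where xs: "set xs \<subseteq> J" "wprod xs = k"
    and min: "\<And>ys. set ys \<subseteq> J \<Longrightarrow> wprod ys = k \<Longrightarrow> length xs \<le> length ys"
    using ex_has_least_nat[of "\<lambda>xs. set xs \<subseteq> J \<and> wprod xs = k" xs0 length] by blast
  have "\<not> len (wprod xs) < length xs"
  proof
    assume l: "len (wprod xs) < length xs"
    obtain as a bs b cs where "xs = as @ a # bs @ b # cs" "wprod xs = wprod (as @ bs @ cs)"
      by (rule deletion[OF _ l]) (use xs assms in auto)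
    then show False using min[of "as @ bs @ cs"] xs by simp
  qed
  then have "length xs = len k" using len_le[of xs] xs assms by auto
  then show ?thesis using that xs by blast
qed

lemma par_len_1:
  assumes "J \<subseteq> S" "k \<in> par J" "len k = 1"
  shows "k \<in> J"
proof -
  obtain xs where xs: "set xs \<subseteq> J" "length xs = len k" "wprod xs = k"
    using par_reduced_word assms(1,2) .
  then obtain x where "xs = [x]" using assms(3) by (cases xs) auto
  then show ?thesis using xs assms(1) by auto
qed

text \<open>For \<open>J \<subseteq> S\<close> \<open>rmin J v\<close> says that \<open>v\<close> is the shortest element of \<open>v W\<^sub>J\<close>.\<close>
definition rmin :: "'w set \<Rightarrow> 'w \<Rightarrow> bool" where
  "rmin J v \<longleftrightarrow> v \<in> carrier W \<and> (\<forall>s\<in>J. len v < len (v \<otimes> s))"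

text \<open>Join reduced words of \<open>v\<close> and \<open>k\<close>. If lengths did not add,
  deletion would remove two letters. Two letters from the part of \<open>k\<close> contradict that
  it is reduced; any other choice leaves a first part shorter than \<open>v\<close> that still
  represents an element of the coset of \<open>v\<close>.\<close>

lemma len_add_of_min:
  assumes J: "J \<subseteq> S" and v: "v \<in> carrier W" and min: "\<And>k. k \<in> par J \<Longrightarrow> len v \<le> len (v \<otimes> k)"
    and k: "k \<in> par J"
  shows "len (v \<otimes> k) = len v + len k"
proof -
  obtain xs where xs: "set xs \<subseteq> S" "length xs = len v" "wprod xs = v" using reduced_word v .
  obtain ys where ys: "set ys \<subseteq> J" "length ys = len k" "wprod ys = k" using par_reduced_word J k .
  have vk: "wprod (xs @ ys) = v \<otimes> k" using xs ys J by (subst wprod_append) auto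
  have "\<not> len (wprod (xs @ ys)) < length (xs @ ys)"
  proof
    assume l: "len (wprod (xs @ ys)) < length (xs @ ys)"
    obtain as a bs b cs where d: "xs @ ys = as @ a # bs @ b # cs" "wprod (xs @ ys) = wprod (as @ bs @ cs)"
      by (rule deletion[OF _ l]) (use xs ys J in auto)
    have key: "len v \<le> length xs'" if "wprod (xs @ ys) = wprod (xs' @ ys')" "set xs' \<subseteq> S" "set ys' \<subseteq> J" for xs' ys'
    proof -
      have c: "wprod ys' \<in> par J" using that by (auto simp: std_parabolic_def)
      have "v \<otimes> k = wprod xs' \<otimes> wprod ys'" using that vk J by (simp add: wprod_append)
      then have "wprod xs' = v \<otimes> (k \<otimes> inv (wprod ys'))"
        using that J v k par_carrier[OF J] c
        by (metis inv_closed inv_solve_right m_assoc m_closed wprod_closed)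
      moreover have "k \<otimes> inv (wprod ys') \<in> par J" using par_mult par_inv J k c by blast
      ultimately show ?thesis using min len_le[OF that(2)] by (metis order_trans)
    qed
    consider (a) "length xs \<le> length as" | (b) "length as < length xs" "length xs \<le> length (as @ a # bs)"
      | (c) "length (as @ a # bs) < length xs" by linarith
    then show False
    proof cases
      case a
      then obtain zs where zs: "as = xs @ zs" "ys = zs @ a # bs @ b # cs"
        using d(1) by (auto simp: append_eq_append_conv2)
      have sub: "set (zs @ bs @ cs) \<subseteq> J" using zs ys by auto
      then have "wprod xs \<otimes> wprod ys = wprod xs \<otimes> wprod (zs @ bs @ cs)"
        using d(2) zs(1) wprod_append[of xs ys] wprod_append[of xs "zs @ bs @ cs"] xs(1)
          subset_trans[OF ys(1) J] subset_trans[OF sub J] by simp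
      then have "wprod ys = wprod (zs @ bs @ cs)"
        using wprod_closed[OF xs(1)] wprod_closed[OF subset_trans[OF ys(1) J]]
          wprod_closed[OF subset_trans[OF sub J]] by simp
      then have "len k \<le> length (zs @ bs @ cs)" using ys len_le[OF subset_trans[OF sub J]] by simp
      then show False using zs ys by simp
    next
      case b
      have as: "xs = take (length xs) (as @ a # bs @ b # cs)" "ys = drop (length xs) (as @ a # bs @ b # cs)"
        using d(1) by (metis append_eq_conv_conj)+
      obtain zs where zs: "xs = as @ a # zs"
        using as(1) b(1) by (cases "length xs - length as") auto
      obtain us where us: "bs = zs @ us" "ys = us @ b # cs"
        using d(1) zs b(2) by (auto simp: append_eq_append_conv2)
      have "len v \<le> length (as @ zs)"
        by (rule key[of "as @ zs" "us @ cs"]) (use d us zs xs ys in auto)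
      then show False using zs xs by simp
    next
      case c
      then obtain zs where zs: "xs = as @ a # bs @ b # zs" "cs = zs @ ys"
        using d(1)
        by (cases "length xs - length (as @ a # bs)") (auto simp: append_eq_append_conv2 append_eq_Cons_conv)
      have "len v \<le> length (as @ bs @ zs)"
        by (rule key[of "as @ bs @ zs" ys]) (use d zs xs ys in auto)
      then show False using zs xs by simp
    qed
  qed
  moreover have "len (wprod (xs @ ys)) \<le> length (xs @ ys)" using len_le[of "xs @ ys"] xs ys J by auto
  ultimately show ?thesis using vk xs ys by simp
qed

lemma rmin_exists:
  assumes J: "J \<subseteq> S" and u: "u \<in> carrier W"
  obtains v k where "rmin J v" "k \<in> par J" "u = v \<otimes> k" "\<And>j. j \<in> par J \<Longrightarrow> len (v \<otimes> j) = len v + len j"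
proof -
  obtain k0 where k0: "k0 \<in> par J" and min: "\<And>k. k \<in> par J \<Longrightarrow> len (u \<otimes> k0) \<le> len (u \<otimes> k)"
    using ex_has_least_nat[of "\<lambda>k. k \<in> par J" \<one> "\<lambda>k. len (u \<otimes> k)"] by auto
  let ?v = "u \<otimes> k0"
  have c: "k0 \<in> carrier W" using k0 par_carrier[OF J] by auto
  have m: "len ?v \<le> len (?v \<otimes> k)" if "k \<in> par J" for k
    using min[of "k0 \<otimes> k"] that k0 u c par_carrier[OF J that] par_mult[OF J] by (simp add: m_assoc)
  have add: "len (?v \<otimes> k) = len ?v + len k" if "k \<in> par J" for k
    using len_add_of_min[OF J _ m that] u c by auto
  have "rmin J ?v" unfolding rmin_def
  proof (intro conjI ballI)
    fix s assume s: "s \<in> J"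
    then show "len ?v < len (?v \<otimes> s)" using add[OF par_gen[OF J s]] J by auto
  qed (use u c in auto)
  moreover have "u = ?v \<otimes> inv k0" using u c by (simp add: m_assoc)
  moreover have "inv k0 \<in> par J" using par_inv J k0 by auto
  ultimately show ?thesis using that add by metis
qed

text \<open>Minimality against single generators suffices: write \<open>v = v0 k0\<close> with
  \<open>v0\<close> globally shortest; a nontrivial \<open>k0\<close> would end in a generator from
  \<open>J\<close> that shortens \<open>v\<close>.\<close>

lemma rmin_add:
  assumes J: "J \<subseteq> S" and v: "rmin J v" and k: "k \<in> par J"
  shows "len (v \<otimes> k) = len v + len k"
proof -
  have vc: "v \<in> carrier W" using v by (simp add: rmin_def)
  obtain v0 k0 where v0: "rmin J v0" "k0 \<in> par J" "v = v0 \<otimes> k0"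
    and add: "\<And>j. j \<in> par J \<Longrightarrow> len (v0 \<otimes> j) = len v0 + len j"
    using rmin_exists[OF J vc] by blast
  have v0c: "v0 \<in> carrier W" using v0 by (simp add: rmin_def)
  have "k0 = \<one>"
  proof (rule ccontr)
    assume n: "k0 \<noteq> \<one>"
    obtain xs where xs: "set xs \<subseteq> J" "length xs = len k0" "wprod xs = k0" using par_reduced_word J v0(2) .
    then have "xs \<noteq> []" using n by auto
    then obtain ys s where ys: "xs = ys @ [s]" by (metis rev_exhaust)
    have sub: "set ys \<subseteq> S" "s \<in> S" "s \<in> J" using ys xs J by auto
    have "k0 = wprod ys \<otimes> s" using ys xs sub by (auto simp: wprod_append)
    then have "v \<otimes> s = v0 \<otimes> wprod ys" using v0 sub v0c by (simp add: m_assoc)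
    then have "len (v \<otimes> s) \<le> len v0 + length ys"
      using len_mult_le[of v0 "wprod ys"] len_le[of ys] sub v0c by simp
    then show False using v sub add[OF v0(2)] v0(3) xs(2) ys by (auto simp: rmin_def)
  qed
  then have "v = v0" using v0 v0c by simp
  then show ?thesis using add k by simp
qed

definition lmin :: "'w set \<Rightarrow> 'w \<Rightarrow> bool" where
  "lmin J v \<longleftrightarrow> v \<in> carrier W \<and> (\<forall>s\<in>J. len v < len (s \<otimes> v))"

lemma lmin_inv: "J \<subseteq> S \<Longrightarrow> v \<in> carrier W \<Longrightarrow> lmin J v \<longleftrightarrow> rmin J (inv v)"
  by (auto simp: lmin_def rmin_def len_right_inv subset_iff)

lemma lmin_add:
  assumes J: "J \<subseteq> S" and v: "lmin J v" and k: "k \<in> par J"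
  shows "len (k \<otimes> v) = len k + len v"
proof -
  have c: "v \<in> carrier W" "k \<in> carrier W" using v k J par_carrier by (auto simp: lmin_def)
  have "len (k \<otimes> v) = len (inv v \<otimes> inv k)" using c len_inv[of "k \<otimes> v"] by (simp add: inv_mult_group)
  also have "\<dots> = len (inv v) + len (inv k)"
    using rmin_add[OF J _ par_inv[OF J k]] v lmin_inv[OF J c(1)] by simp
  finally show ?thesis using c by simp
qed

lemma lmin_exists:
  assumes J: "J \<subseteq> S" and u: "u \<in> carrier W"
  obtains v k where "lmin J v" "k \<in> par J" "u = k \<otimes> v"
proof -
  obtain v k where vk: "rmin J v" "k \<in> par J" "inv u = v \<otimes> k"
    using rmin_exists[OF J inv_closed[OF u]] by blast
  have c: "v \<in> carrier W" "k \<in> carrier W" using vk par_carrier[OF J] by (auto simp: rmin_def)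
  have "u = inv k \<otimes> inv v" using vk(3) u c by (metis inv_inv inv_mult_group)
  moreover have "lmin J (inv v)" using vk c lmin_inv[OF J] by simp
  ultimately show ?thesis using that par_inv[OF J vk(2)] by blast
qed

end

section \<open>The geometric representation\<close>

text \<open>Chebyshev polynomials of the second kind, rescaled so that
  \<open>cheb (2 cos t) n = sin (n t) / sin t\<close>; at \<open>c = 2\<close> they degenerate to
  \<open>n\<close>. They occur as the coefficients of the roots of a rank two subsystem.\<close>

fun cheb :: "real \<Rightarrow> nat \<Rightarrow> real" where
  "cheb c 0 = 0"
| "cheb c (Suc 0) = 1"
| "cheb c (Suc (Suc n)) = c * cheb c (Suc n) - cheb c n"

lemma cheb_2: "cheb 2 n = real n"
  by (induction "2::real" n rule: cheb.induct) auto

lemma cheb_sin: "sin \<theta> * cheb (2 * cos \<theta>) n = sin (real n * \<theta>)"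
proof (induction n rule: induct_nat_012)
  case (ge2 n)
  have "sin (real (Suc (Suc n)) * \<theta>) + sin (real n * \<theta>) = 2 * cos \<theta> * sin (real (Suc n) * \<theta>)"
    using sin_add[of "real (Suc n) * \<theta>" \<theta>] sin_diff[of "real (Suc n) * \<theta>" \<theta>] by (simp add: algebra_simps)
  moreover have "sin \<theta> * cheb (2 * cos \<theta>) (Suc (Suc n)) =
      2 * cos \<theta> * (sin \<theta> * cheb (2 * cos \<theta>) (Suc n)) - sin \<theta> * cheb (2 * cos \<theta>) n"
    by (simp add: algebra_simps)
  ultimately show ?case using ge2 by simp
qed auto

text \<open>Source of the lower bound 1 on root coefficients: the quotient of the two sines is a
  value of \<open>cheb\<close>. Monotonicity up to \<open>pi / 2\<close> is combined with the
  symmetry of sine about that point.\<close>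

lemma sin_ge_sin_pi_div:
  assumes "2 \<le> m" "1 \<le> n" "n < m"
  shows "sin (pi / real m) \<le> sin (real n * (pi / real m))"
proof -
  define \<theta> where "\<theta> = pi / real m"
  have m: "real m * \<theta> = pi" "0 < \<theta>" using assms by (auto simp: \<theta>_def)
  have "2 * \<theta> \<le> real m * \<theta>" using assms m by (intro mult_right_mono) auto
  then have h: "\<theta> \<le> pi / 2" using m by simp
  have n1: "\<theta> \<le> real n * \<theta>" using assms m mult_right_mono[of 1 "real n" \<theta>] by simp
  have "real (Suc n) * \<theta> \<le> real m * \<theta>" using assms m by (intro mult_right_mono) auto
  then have n2: "real n * \<theta> \<le> pi - \<theta>" using m by (simp add: algebra_simps)
  have "sin \<theta> \<le> sin (real n * \<theta>)"
  proof (cases "real n * \<theta> \<le> pi / 2")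
    case True then show ?thesis using sin_monotone_2pi_le[of \<theta> "real n * \<theta>"] n1 m by simp
  next
    case False
    have "sin \<theta> \<le> sin (pi - real n * \<theta>)"
      by (rule sin_monotone_2pi_le) (use m n2 False in linarith)+
    then show ?thesis by (simp add: sin_diff)
  qed
  then show ?thesis by (simp add: \<theta>_def)
qed

lemma cheb_cos:
  assumes "2 \<le> m"
  shows "cheb (2 * cos (pi / real m)) m = 0"
    and "1 \<le> n \<Longrightarrow> n < m \<Longrightarrow> 1 \<le> cheb (2 * cos (pi / real m)) n"
proof -
  have "pi / real m < pi" using assms by (simp add: field_simps)
  then have p: "0 < sin (pi / real m)" using assms by (intro sin_gt_zero) auto
  show "cheb (2 * cos (pi / real m)) m = 0" using cheb_sin[of "pi / real m" m] p assms by simp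
  assume n: "1 \<le> n" "n < m"
  have "sin (pi / real m) \<le> sin (pi / real m) * cheb (2 * cos (pi / real m)) n"
    using cheb_sin[of "pi / real m" n] sin_ge_sin_pi_div[OF assms n] by simp
  then show "1 \<le> cheb (2 * cos (pi / real m)) n" using p by simp
qed

context coxeter
begin

text \<open>Indexed from the right: the word ends with \<open>s\<close> whatever its length.\<close>
fun ralt :: "'w \<Rightarrow> 'w \<Rightarrow> nat \<Rightarrow> 'w list" where
  "ralt s t 0 = []"
| "ralt s t (Suc n) = (if even n then s else t) # ralt s t n"

lemma ralt_length [simp]: "length (ralt s t n) = n" by (induction n) auto

lemma ralt_set: "set (ralt s t n) \<subseteq> {s, t}" by (induction n) auto

lemma ralt_snoc: "ralt s t (Suc n) = ralt t s n @ [s]"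
  by (induction n) auto

lemma ralt_add: "\<exists>xs. set xs \<subseteq> {s, t} \<and> length xs = p \<and> ralt s t (p + n) = xs @ ralt s t n"
proof (induction p)
  case (Suc p)
  then obtain xs where "set xs \<subseteq> {s, t}" "length xs = p" "ralt s t (p + n) = xs @ ralt s t n" by auto
  then show ?case by (intro exI[of _ "(if even (p + n) then s else t) # xs"]) auto
qed simp

definition braid :: "'w \<Rightarrow> 'w \<Rightarrow> nat \<Rightarrow> bool" where
  "braid s t n \<longleftrightarrow> n > 0 \<and> wprod (ralt s t n) = wprod (ralt t s n)"

text \<open>The Coxeter matrix entry \<open>m(s, t)\<close>, read off from the braid relations.
  Without any braid relation the value is meaningless, so \<open>gam\<close> tests for existence
  first.\<close>

definition cm :: "'w \<Rightarrow> 'w \<Rightarrow> nat" where "cm s t = (LEAST n. braid s t n)"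

text \<open>\<open>gam s t = - 2 B(s, t)\<close> for the canonical bilinear form \<open>B\<close>; the last case is \<open>m(s, t) = \<infinity>\<close>.\<close>
definition gam :: "'w \<Rightarrow> 'w \<Rightarrow> real" where
  "gam s t = (if s = t then - 2 else if \<exists>n. braid s t n then 2 * cos (pi / real (cm s t)) else 2)"

lemma braid_sym: "braid s t n \<longleftrightarrow> braid t s n" by (auto simp: braid_def)

lemma gam_sym: "gam s t = gam t s"
proof -
  have "braid s t = braid t s" by (intro ext braid_sym)
  then show ?thesis by (auto simp: gam_def cm_def)
qed

lemma gam_self [simp]: "gam s s = - 2" by (simp add: gam_def)

lemma cm_braid: "braid s t n \<Longrightarrow> braid s t (cm s t)"
  unfolding cm_def by (rule LeastI)

lemma cm_le: "braid s t n \<Longrightarrow> cm s t \<le> n"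
  unfolding cm_def by (rule Least_le)

lemma cm_ge_2:
  assumes "s \<in> S" "t \<in> S" "s \<noteq> t" "braid s t n"
  shows "2 \<le> cm s t"
proof (rule ccontr)
  assume "\<not> 2 \<le> cm s t"
  moreover have b: "braid s t (cm s t)" using cm_braid assms by blast
  ultimately have "cm s t = 1" by (auto simp: braid_def)
  then show False using b assms by (auto simp: braid_def)
qed

text \<open>The braid relation rewrites the last \<open>m\<close> letters so that they begin with
  the letter standing in front of them, and the two equal letters cancel.\<close>

lemma ralt_not_reduced:
  assumes "s \<in> S" "t \<in> S" "braid s t m" "m < n"
  shows "len (wprod (ralt s t n)) < n"
proof -
  obtain k where k: "m = Suc k" using assms(3) by (auto simp: braid_def gr0_conv_Suc)
  define x where "x = (if even m then s else t)"
  obtain p where p: "n = p + Suc m" using assms(4) less_imp_Suc_add by (metis add.commute add_Suc_right)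
  obtain xs where xs: "set xs \<subseteq> {s, t}" "length xs = p" "ralt s t n = xs @ ralt s t (Suc m)"
    using ralt_add[of s t p "Suc m"] p by auto
  have sub: "set xs \<subseteq> S" "set (ralt t s k) \<subseteq> S" "set (ralt s t m) \<subseteq> S" "x \<in> S"
    using xs assms ralt_set[of t s k] ralt_set[of s t m] by (auto simp: x_def)
  have "ralt t s m = x # ralt t s k" using k by (auto simp: x_def)
  then have "wprod (ralt s t (Suc m)) = x \<otimes> (x \<otimes> wprod (ralt t s k))"
    using assms(3) by (simp add: braid_def x_def)
  also have "\<dots> = wprod (ralt t s k)" using sub by simp
  finally have "wprod (ralt s t n) = wprod (xs @ ralt t s k)"
    using xs(3) sub by (simp only: wprod_append) (subst wprod_append, auto simp: x_def)
  then have "len (wprod (ralt s t n)) \<le> p + k" using len_le[of "xs @ ralt t s k"] sub xs(2) by auto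
  then show ?thesis using p k by linarith
qed

lemma reduced_is_ralt:
  assumes "s \<in> S" "t \<in> S" "set xs \<subseteq> {s, t}" "length xs = len (wprod xs)"
  shows "xs = ralt s t (length xs) \<or> xs = ralt t s (length xs)"
  using assms(3,4)
proof (induction xs)
  case (Cons x ys)
  have sub: "set ys \<subseteq> S" "x \<in> S" using Cons.prems assms by auto
  have "len (wprod (x # ys)) \<le> Suc (len (wprod ys))" using len_left_cases[of x "wprod ys"] sub by auto
  then have red: "length ys = len (wprod ys)" using Cons.prems(2) len_le[OF sub(1)] by simp
  have IH: "ys = ralt s t (length ys) \<or> ys = ralt t s (length ys)" using Cons red by auto
  show ?case
  proof (cases ys)
    case Nil then show ?thesis using Cons.prems(1) by auto
  next
    case (Cons y zs)
    have "y \<noteq> x"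
    proof
      assume "y = x"
      then have "wprod (x # ys) = wprod zs" using Cons sub by simp
      then show False using len_le[of zs] Cons sub Cons.prems(2) by simp
    qed
    then show ?thesis using IH Cons Cons.prems(1) by auto
  qed
qed simp

section \<open>Canonical reflections and the action of the group on the root space\<close>

definition bas :: "'w \<Rightarrow> 'w \<Rightarrow> real" where "bas s = (\<lambda>x. if x = s then 1 else 0)"

text \<open>In terms of the canonical form this is \<open>2 B(s, f)\<close>: the minus sign
  compensates the one in \<open>gam\<close>, and \<open>refl s\<close> becomes the orthogonal
  reflection in the simple root of \<open>s\<close>.\<close>

definition phi :: "'w \<Rightarrow> ('w \<Rightarrow> real) \<Rightarrow> real" where "phi s f = - (\<Sum>r\<in>S. gam s r * f r)"

definition refl :: "'w \<Rightarrow> ('w \<Rightarrow> real) \<Rightarrow> ('w \<Rightarrow> real)" where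
  "refl s f = (\<lambda>x. f x - phi s f * bas s x)"

lemma phi_lin: "phi s (\<lambda>x. a * f x + b * g x) = a * phi s f + b * phi s g"
  by (simp add: phi_def sum.distrib sum_distrib_left algebra_simps)

lemma phi_bas: "t \<in> S \<Longrightarrow> phi s (bas t) = - gam s t"
proof -
  assume t: "t \<in> S"
  have "(\<Sum>r\<in>S. gam s r * bas t r) = (\<Sum>r\<in>S. if r = t then gam s t else 0)"
    by (rule sum.cong) (auto simp: bas_def)
  then show ?thesis using t finite_S by (simp add: phi_def)
qed

lemma refl_lin: "refl s (\<lambda>x. a * f x + b * g x) = (\<lambda>x. a * refl s f x + b * refl s g x)"
  by (simp add: refl_def phi_lin algebra_simps)

lemma phi_refl: "s \<in> S \<Longrightarrow> phi t (refl s f) = phi t f + gam t s * phi s f"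
  using phi_lin[of t 1 f "- phi s f" "bas s"] by (simp add: refl_def phi_bas)

lemma refl_refl [simp]: "s \<in> S \<Longrightarrow> refl s (refl s f) = f"
  using phi_refl[of s s f] by (auto simp: refl_def)

definition rword :: "'w list \<Rightarrow> ('w \<Rightarrow> real) \<Rightarrow> ('w \<Rightarrow> real)" where
  "rword xs = foldr (\<lambda>s g. refl s \<circ> g) xs id"

lemma rword_Nil [simp]: "rword [] = id" by (simp add: rword_def)

lemma rword_Cons [simp]: "rword (x # xs) f = refl x (rword xs f)" by (simp add: rword_def)

lemma rword_append [simp]: "rword (xs @ ys) f = rword xs (rword ys f)"
  by (induction xs) auto

lemma rword_lin: "rword xs (\<lambda>x. a * f x + b * g x) = (\<lambda>x. a * rword xs f x + b * rword xs g x)"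
  by (induction xs) (auto simp: refl_lin)

text \<open>The total multiples of \<open>bas s\<close> and \<open>bas t\<close> subtracted by \<open>rword (ralt s t n)\<close>, in terms of
  \<open>P = phi s f\<close> and \<open>Q = phi t f\<close>.\<close>
fun asum :: "real \<Rightarrow> real \<Rightarrow> real \<Rightarrow> bool \<Rightarrow> nat \<Rightarrow> real" where
  "asum c P Q e 0 = 0"
| "asum c P Q e (Suc n) = asum c P Q e n +
     (if even n = e then cheb c (Suc n) * P + cheb c n * Q else 0)"

text \<open>Only the coordinates at \<open>s\<close> and \<open>t\<close> change, by amounts
  governed by the pairings with \<open>s\<close> and \<open>t\<close>. A reflection negates the
  pairing with its own root and adds \<open>c\<close> times it to the other pairing; this is the
  Chebyshev recurrence.\<close>

lemma rword_ralt:
  assumes "s \<in> S" "t \<in> S" "s \<noteq> t"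
  defines "c \<equiv> gam s t"
  shows "rword (ralt s t n) f = (\<lambda>x. f x - asum c (phi s f) (phi t f) True n * bas s x
      - asum c (phi s f) (phi t f) False n * bas t x)
    \<and> phi (if even n then s else t) (rword (ralt s t n) f) = cheb c (Suc n) * phi s f + cheb c n * phi t f
    \<and> phi (if even n then t else s) (rword (ralt s t n) f)
        = (if n = 0 then phi t f else - (cheb c n * phi s f + cheb c (n - 1) * phi t f))"
proof (induction n)
  case (Suc n)
  let ?x = "if even n then s else t" and ?y = "if even n then t else s"
  let ?g = "rword (ralt s t n) f"
  have S: "?x \<in> S" using assms by auto
  have g: "gam ?y ?x = c" using assms gam_sym[of s t] by auto
  have x: "phi ?x ?g = cheb c (Suc n) * phi s f + cheb c n * phi t f" using Suc by blast
  have y: "phi ?y ?g = (if n = 0 then phi t f else - (cheb c n * phi s f + cheb c (n - 1) * phi t f))"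
    using Suc by blast
  have 1: "phi ?x (refl ?x ?g) = - phi ?x ?g" using phi_refl[OF S, of ?x ?g] by simp
  have 2: "phi ?y (refl ?x ?g) = phi ?y ?g + c * phi ?x ?g" using phi_refl[OF S, of ?y ?g] g by simp
  have e: "rword (ralt s t (Suc n)) f = refl ?x ?g" by simp
  have s: "(if even (Suc n) then s else t) = ?y" "(if even (Suc n) then t else s) = ?x" by auto
  have 3: "phi ?y (refl ?x ?g) = cheb c (Suc (Suc n)) * phi s f + cheb c (Suc n) * phi t f"
    unfolding 2 x y by (cases n) (auto simp: algebra_simps)
  have 4: "phi ?x (refl ?x ?g) = (if Suc n = 0 then phi t f else
      - (cheb c (Suc n) * phi s f + cheb c (Suc n - 1) * phi t f))"
    unfolding 1 x by simp
  have 5: "refl ?x ?g = (\<lambda>x. f x - asum c (phi s f) (phi t f) True (Suc n) * bas s x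
      - asum c (phi s f) (phi t f) False (Suc n) * bas t x)"
    unfolding refl_def x using Suc by (auto simp: algebra_simps)
  show ?case unfolding e s using 3 4 5 by blast
qed auto

text \<open>The two alternating words of length \<open>n\<close> subtract the same multiples up to a
  term proportional to \<open>cheb c n\<close>. At \<open>n = m(s, t)\<close> this factor is
  \<open>sin pi / sin (pi / n) = 0\<close>, which yields the braid relation for the
  reflections.\<close>

lemma asum_swap:
  "asum c P Q True n - asum c Q P False n = (if odd n then cheb c n * P else - cheb c n * Q)"
  by (induction n) auto

lemma asum_swap_zero:
  assumes "cheb c n = 0"
  shows "asum c P Q True n = asum c Q P False n"
  using asum_swap[of c P Q n] assms by (simp split: if_splits)

lemma rword_braid:
  assumes "s \<in> S" "t \<in> S" "s \<noteq> t" "braid s t n"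
  shows "rword (ralt s t (cm s t)) = rword (ralt t s (cm s t))"
proof
  fix f
  have g: "gam s t = 2 * cos (pi / real (cm s t))" using assms by (auto simp: gam_def)
  then have c: "cheb (gam s t) (cm s t) = 0" using cheb_cos(1)[OF cm_ge_2[OF assms]] by simp
  show "rword (ralt s t (cm s t)) f = rword (ralt t s (cm s t)) f"
    using rword_ralt[OF assms(1,2,3), of "cm s t" f] rword_ralt[OF assms(2,1) assms(3)[symmetric], of "cm s t" f]
      asum_swap_zero[OF c, of "phi s f" "phi t f"] asum_swap_zero[OF c, of "phi t f" "phi s f"] gam_sym[of s t]
    by (auto simp: algebra_simps)
qed

lemma dihedral_part:
  assumes "s \<in> S" "t \<in> S" "s \<noteq> t" and k: "k \<in> par {s, t}" and d: "len (k \<otimes> s) < len k"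
  shows "k = wprod (ralt s t (len k))" "len k > 0"
proof -
  have J: "{s, t} \<subseteq> S" using assms by auto
  have kc: "k \<in> carrier W" using par_carrier[OF J k] .
  have "k \<otimes> s \<in> par {s, t}" using par_mult[OF J k] par_gen[OF J] by auto
  then obtain xs where xs: "set xs \<subseteq> {s, t}" "length xs = len (k \<otimes> s)" "wprod xs = k \<otimes> s"
    using par_reduced_word[OF J] by blast
  have l: "len k = Suc (len (k \<otimes> s))" using len_right_cases[of s k] assms kc by auto
  have "wprod (xs @ [s]) = wprod xs \<otimes> wprod [s]" using xs J by (intro wprod_append) auto
  then have w: "wprod (xs @ [s]) = k" using xs assms kc by (simp add: m_assoc)
  have "xs @ [s] = ralt s t (length (xs @ [s])) \<or> xs @ [s] = ralt t s (length (xs @ [s]))"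
    by (rule reduced_is_ralt) (use assms xs l w in auto)
  moreover have "xs @ [s] \<noteq> ralt t s (length (xs @ [s]))"
    using ralt_snoc[of t s "length xs"] assms(3) by auto
  ultimately show "k = wprod (ralt s t (len k))" using w xs l by auto
  show "len k > 0" using l by simp
qed

text \<open>The argument of Tits and Matsumoto. If the last letters \<open>s\<close> and
  \<open>t\<close> differ, both are right descents of the product. Factor it as \<open>v k\<close>
  with \<open>v\<close> shortest modulo the dihedral subgroup; then \<open>k\<close> has both
  descents, so it is the longest element there and has an alternating expression ending in either
  letter. \<open>rword_braid\<close> passes between the two, and induction handles the words without
  their last letter.\<close>

lemma rword_unique:
  assumes "set xs \<subseteq> S" "set ys \<subseteq> S" "length xs = len (wprod xs)" "length ys = len (wprod ys)"
    "wprod xs = wprod ys"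
  shows "rword xs = rword ys"
  using assms
proof (induction "length xs" arbitrary: xs ys)
  case 0 then show ?case by simp
next
  case (Suc n)
  obtain xs' s where xs: "xs = xs' @ [s]" using Suc(2) by (cases xs rule: rev_cases) auto
  obtain ys' t where ys: "ys = ys' @ [t]" using Suc by (cases ys rule: rev_cases) auto
  have sub: "set xs' \<subseteq> S" "set ys' \<subseteq> S" "s \<in> S" "t \<in> S" using Suc xs ys by auto
  let ?u = "wprod xs"
  have u: "?u = wprod xs' \<otimes> s" "?u = wprod ys' \<otimes> t" "?u \<in> carrier W"
    using xs ys sub Suc(7) by (auto simp: wprod_append)
  have us: "?u \<otimes> s = wprod xs'" using u(1) sub by simp
  have ut: "?u \<otimes> t = wprod ys'" using u(2) sub by simp
  have l: "len ?u = Suc n" using Suc(2) Suc(5) by simp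
  have lx: "length xs' = n" using Suc(2) xs by simp
  have ly: "length ys' = n" using Suc(6,7) l ys by simp
  have "len (?u \<otimes> s) \<le> n" "len (?u \<otimes> t) \<le> n"
    using us ut len_le[OF sub(1)] len_le[OF sub(2)] lx ly by auto
  then have lu: "len ?u = Suc (len (?u \<otimes> s))" "len ?u = Suc (len (?u \<otimes> t))"
    using len_right_cases[OF sub(3) u(3)] len_right_cases[OF sub(4) u(3)] l by auto
  then have red: "length xs' = len (wprod xs')" "length ys' = len (wprod ys')"
    using us ut l lx ly by auto
  have IH: "rword zs = rword zs'" if "n = length zs" "set zs \<subseteq> S" "set zs' \<subseteq> S"
     "length zs = len (wprod zs)" "length zs' = len (wprod zs')" "wprod zs = wprod zs'" for zs zs'
    using Suc(1)[OF that] .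
  show ?case
  proof (cases "s = t")
    case True
    then have "wprod xs' = wprod ys'" using us ut by simp
    then have "rword xs' = rword ys'" using IH[of xs' ys'] Suc(2) xs sub red by auto
    then show ?thesis using xs ys True by (intro ext) simp
  next
    case False
    have J: "{s, t} \<subseteq> S" using sub by auto
    obtain v k where v: "rmin {s, t} v" "k \<in> par {s, t}" "?u = v \<otimes> k"
      using rmin_exists[OF J u(3)] by blast
    have c: "v \<in> carrier W" "k \<in> carrier W" using v par_carrier[OF J] by (auto simp: rmin_def)
    have p: "s \<in> par {s, t}" "t \<in> par {s, t}" using par_gen[OF J] by auto
    have ls: "len (?u \<otimes> r) = len v + len (k \<otimes> r)" if "r \<in> {s, t}" for r
      using rmin_add[OF J v(1) par_mult[OF J v(2), of r]] that p v c sub by (auto simp: m_assoc)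
    have l0: "len ?u = len v + len k" using rmin_add[OF J v(1,2)] v by simp
    have d: "len (k \<otimes> s) < len k" "len (k \<otimes> t) < len k"
      using ls[of s] ls[of t] l0 lu by auto
    have k1: "k = wprod (ralt s t (len k))" "len k > 0"
      using dihedral_part[OF sub(3,4) False v(2) d(1)] .
    have "{t, s} = {s, t}" by auto
    then have k2: "k = wprod (ralt t s (len k))"
      using dihedral_part(1)[OF sub(4,3) _ _ d(2)] False v(2) by auto
    have b: "braid s t (len k)" using k1 k2 by (auto simp: braid_def)
    \<comment> \<open>A braid relation of length \<open>len k\<close> holds, so
      \<open>m(s, t)\<close> is at most \<open>len k\<close>; if it were smaller, the alternating
      word for \<open>k\<close> would not be reduced.\<close>
    have "\<not> cm s t < len k" using ralt_not_reduced[OF sub(3,4) cm_braid[OF b]] k1 by fastforce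
    then have cm: "cm s t = len k" using cm_le[OF b] by simp
    obtain vs where vs: "set vs \<subseteq> S" "length vs = len v" "wprod vs = v" using reduced_word[OF c(1)] .
    obtain m where m: "len k = Suc m" using k1(2) gr0_conv_Suc by auto
    have rs: "set (ralt a b j) \<subseteq> S" if "{a, b} = {s, t}" for a b j using ralt_set[of a b j] that J by auto
    have main: "rword xs' = rword (vs @ ralt b a m)"
      if ab: "{a, b} = {s, t}" and k: "k = wprod (ralt a b (len k))" and xs': "set xs' \<subseteq> S" "?u \<otimes> a = wprod xs'"
        "length xs' = len (wprod xs')" "length xs' = n" for a b xs'
    proof -
      have aS: "a \<in> S" using ab J by auto
      have ba: "{b, a} = {s, t}" using ab by auto
      have "wprod (ralt a b (Suc m)) = wprod (ralt b a m) \<otimes> a"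
        unfolding ralt_snoc using rs[OF ba] aS by (simp add: wprod_append)
      then have "k = wprod (ralt b a m) \<otimes> a" using k m by (simp del: ralt.simps)
      then have "?u \<otimes> a = v \<otimes> wprod (ralt b a m)" using v c aS rs[OF ba] by (simp add: m_assoc)
      then have e: "wprod xs' = wprod (vs @ ralt b a m)" using xs' vs rs[OF ba] by (simp add: wprod_append)
      moreover have "length (vs @ ralt b a m) = n" using vs l0 l m by simp
      ultimately show ?thesis using xs' vs rs[OF ba] by (intro IH) auto
    qed
    have 1: "rword xs' = rword (vs @ ralt t s m)"
      by (rule main[OF _ k1(1)]) (use sub us red Suc(2) xs in auto)
    have 2: "rword ys' = rword (vs @ ralt s t m)"
      by (rule main[OF _ k2]) (use sub ut red Suc ys l in auto)
    have br: "rword (ralt s t (Suc m)) = rword (ralt t s (Suc m))"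
      using rword_braid[OF sub(3,4) False b] cm m by simp
    show ?thesis
    proof
      fix f
      have "rword xs f = rword vs (rword (ralt s t (Suc m)) f)" unfolding ralt_snoc xs using 1 by simp
      also have "\<dots> = rword vs (rword (ralt t s (Suc m)) f)" using br by simp
      also have "\<dots> = rword ys f" unfolding ralt_snoc ys using 2 by simp
      finally show "rword xs f = rword ys f" .
    qed
  qed
qed

text \<open>By \<open>rword_unique\<close> the chosen reduced word is immaterial. Compatibility with
  arbitrary words, and hence with multiplication, is obtained afterwards letter by letter.\<close>

definition act :: "'w \<Rightarrow> ('w \<Rightarrow> real) \<Rightarrow> ('w \<Rightarrow> real)" where
  "act w = rword (SOME xs. set xs \<subseteq> S \<and> length xs = len w \<and> wprod xs = w)"

lemma act_reduced: "set xs \<subseteq> S \<Longrightarrow> length xs = len (wprod xs) \<Longrightarrow> act (wprod xs) = rword xs"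
proof -
  assume xs: "set xs \<subseteq> S" "length xs = len (wprod xs)"
  let ?P = "\<lambda>ys. set ys \<subseteq> S \<and> length ys = len (wprod xs) \<and> wprod ys = wprod xs"
  have "?P (SOME ys. ?P ys)" by (rule someI[of ?P xs]) (use xs in auto)
  then show ?thesis unfolding act_def using xs by (intro rword_unique) auto
qed

lemma act_Cons: "x \<in> S \<Longrightarrow> w \<in> carrier W \<Longrightarrow> act (x \<otimes> w) f = refl x (act w f)"
proof -
  assume x: "x \<in> S" and w: "w \<in> carrier W"
  have up: "act (x \<otimes> v) f = refl x (act v f)" if v: "v \<in> carrier W" "len (x \<otimes> v) = Suc (len v)" for v
  proof -
    obtain r where r: "set r \<subseteq> S" "length r = len v" "wprod r = v" using reduced_word[OF v(1)] .
    then have "act v = rword r" using act_reduced[of r] by simp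
    moreover have "act (x \<otimes> v) = rword (x # r)" using act_reduced[of "x # r"] r v x by simp
    ultimately show ?thesis by simp
  qed
  show ?thesis
  proof (cases "len (x \<otimes> w) = Suc (len w)")
    case False
    then have "len w = Suc (len (x \<otimes> w))" using len_left_cases[OF x w] by simp
    then have "act w f = refl x (act (x \<otimes> w) f)" using up[of "x \<otimes> w"] x w by simp
    then show ?thesis using x by simp
  qed (rule up[OF w])
qed

lemma act_word: "set xs \<subseteq> S \<Longrightarrow> act (wprod xs) = rword xs"
proof (induction xs)
  case Nil then show ?case using act_reduced[of "[]"] by simp
next
  case (Cons x xs) then show ?case by (intro ext) (simp add: act_Cons)
qed

lemma act_mult: "u \<in> carrier W \<Longrightarrow> v \<in> carrier W \<Longrightarrow> act (u \<otimes> v) f = act u (act v f)"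
proof -
  assume u: "u \<in> carrier W" and v: "v \<in> carrier W"
  obtain xs where "set xs \<subseteq> S" "wprod xs = u" using ex_word[OF u] by auto
  moreover obtain ys where "set ys \<subseteq> S" "wprod ys = v" using ex_word[OF v] by auto
  ultimately show ?thesis using act_word[of "xs @ ys"] act_word[of xs] act_word[of ys]
    by (simp add: wprod_append)
qed

lemma act_one [simp]: "act \<one> f = f" using act_word[of "[]"] by simp

lemma act_S: "s \<in> S \<Longrightarrow> act s f = refl s f" using act_Cons[of s \<one> f] by simp

lemma act_lin: "act u (\<lambda>x. a * f x + b * g x) = (\<lambda>x. a * act u f x + b * act u g x)"
  by (simp add: act_def rword_lin)

lemma act_inv [simp]: "u \<in> carrier W \<Longrightarrow> act u (act (inv u) f) = f" "u \<in> carrier W \<Longrightarrow> act (inv u) (act u f) = f"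
  by (simp_all add: act_mult[symmetric])

text \<open>Coefficients of positive roots do not take values strictly between 0 and 1. This gap keeps
  \<open>ltot\<close> away from 0 on all roots, which the averaging argument needs.\<close>
definition posv :: "('w \<Rightarrow> real) \<Rightarrow> bool" where
  "posv f \<longleftrightarrow> (\<forall>x. f x = 0 \<or> 1 \<le> f x) \<and> (\<exists>x. f x \<noteq> 0) \<and> (\<forall>x. x \<notin> S \<longrightarrow> f x = 0)"

lemma posv_comb:
  assumes "posv f" "posv g" "a = 0 \<or> 1 \<le> a" "b = 0 \<or> 1 \<le> b" "a \<noteq> 0 \<or> b \<noteq> 0"
  shows "posv (\<lambda>x. a * f x + b * g x)"
proof -
  have m: "c * y = 0 \<or> 1 \<le> c * y" if "c = 0 \<or> 1 \<le> c" "y = 0 \<or> 1 \<le> y" for c y :: real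
    using that mult_mono[of 1 c 1 y] by auto
  have nn: "0 \<le> c * y" if "c = 0 \<or> 1 \<le> c" "y = 0 \<or> 1 \<le> y" for c y :: real
    using m[OF that] by auto
  have fx: "f x = 0 \<or> 1 \<le> f x" "g x = 0 \<or> 1 \<le> g x" for x using assms(1,2) by (auto simp: posv_def)
  have ge: "a * f x + b * g x = 0 \<or> 1 \<le> a * f x + b * g x" for x
    using m[OF assms(3) fx(1)] m[OF assms(4) fx(2)] by (smt (verit))
  obtain x where "a * f x \<noteq> 0 \<or> b * g x \<noteq> 0" using assms by (auto simp: posv_def)
  then have "a * f x + b * g x \<noteq> 0"
    using nn[OF assms(3) fx(1), of x] nn[OF assms(4) fx(2), of x] by (smt (verit))
  then show ?thesis using ge assms(1,2) by (auto simp: posv_def)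
qed

lemma posv_bas: "s \<in> S \<Longrightarrow> posv (bas s)" by (auto simp: posv_def bas_def)

lemma refl_bas: "t \<in> S \<Longrightarrow> refl s (bas t) = (\<lambda>x. bas t x + gam s t * bas s x)"
  by (simp add: refl_def phi_bas)

lemma rword_ralt_bas:
  assumes "s \<in> S" "t \<in> S" "s \<noteq> t"
  shows "rword (ralt t s n) (bas s) = (\<lambda>x. cheb (gam s t) (if even n then Suc n else n) * bas s x
     + cheb (gam s t) (if even n then n else Suc n) * bas t x)"
proof (induction n)
  case (Suc n)
  show ?case
  proof (cases "even n")
    case True
    then have "rword (ralt t s (Suc n)) (bas s) =
       (\<lambda>x. cheb (gam s t) (Suc n) * refl t (bas s) x + cheb (gam s t) n * refl t (bas t) x)"
      using Suc by (simp add: refl_lin)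
    then show ?thesis using True assms gam_sym[of s t] by (auto simp: refl_bas algebra_simps)
  next
    case False
    then have "rword (ralt t s (Suc n)) (bas s) =
       (\<lambda>x. cheb (gam s t) n * refl s (bas s) x + cheb (gam s t) (Suc n) * refl s (bas t) x)"
      using Suc by (simp add: refl_lin)
    then show ?thesis using False assms by (auto simp: refl_bas algebra_simps)
  qed
qed simp

text \<open>Choose a right descent \<open>t\<close> of \<open>u\<close> and factor
  \<open>u = v k\<close> along the dihedral subgroup of \<open>s\<close> and \<open>t\<close>. By
  induction \<open>v\<close> is positive on both simple roots, and \<open>k\<close> is an
  alternating word ending in \<open>t\<close>, so it sends \<open>bas s\<close> to a combination
  whose coefficients are two consecutive values of \<open>cheb\<close>.\<close>

lemma act_bas_pos:
  assumes "u \<in> carrier W" "s \<in> S" "len u < len (u \<otimes> s)"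
  shows "posv (act u (bas s))"
  using assms
proof (induction "len u" arbitrary: u s rule: less_induct)
  case less
  show ?case
  proof (cases "u = \<one>")
    case True then show ?thesis using posv_bas less by simp
  next
    case False
    obtain xs where xs: "set xs \<subseteq> S" "length xs = len u" "wprod xs = u" using reduced_word less(2) .
    then have "xs \<noteq> []" using False by auto
    then obtain ys t where ys: "xs = ys @ [t]" by (metis rev_exhaust)
    have sub: "set ys \<subseteq> S" "t \<in> S" using xs ys by auto
    have "u \<otimes> t = wprod ys" using xs ys sub by (auto simp: wprod_append)
    then have ut: "len (u \<otimes> t) < len u" using len_le[OF sub(1)] xs ys by simp
    then have st: "s \<noteq> t" using less by auto
    have J: "{s, t} \<subseteq> S" using sub less by auto
    obtain v k where v: "rmin {s, t} v" "k \<in> par {s, t}" "u = v \<otimes> k"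
      using rmin_exists[OF J less(2)] by blast
    have c: "v \<in> carrier W" "k \<in> carrier W" using v par_carrier[OF J] by (auto simp: rmin_def)
    have ls: "len (u \<otimes> r) = len v + len (k \<otimes> r)" if "r \<in> {s, t}" for r
      using rmin_add[OF J v(1) par_mult[OF J v(2), of r]] that par_gen[OF J] v c sub less by (auto simp: m_assoc)
    have l0: "len u = len v + len k" using rmin_add[OF J v(1,2)] v by simp
    have kt: "len (k \<otimes> t) < len k" using ls[of t] l0 ut by simp
    have ks: "\<not> len (k \<otimes> s) < len k" using ls[of s] l0 less by simp
    have "{t, s} = {s, t}" by auto
    then have k: "k = wprod (ralt t s (len k))" "len k > 0"
      using dihedral_part[OF sub(2) less(3) _ _ kt] st v(2) by auto
    define n where "n = len k"
    have IH: "posv (act v (bas r))" if "r \<in> {s, t}" for r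
      using less(1)[of v r] l0 k(2) c v(1) that J by (auto simp: rmin_def)
    have sp: "(cheb (gam s t) n = 0 \<or> 1 \<le> cheb (gam s t) n) \<and>
      (cheb (gam s t) (Suc n) = 0 \<or> 1 \<le> cheb (gam s t) (Suc n)) \<and>
      (cheb (gam s t) n \<noteq> 0 \<or> cheb (gam s t) (Suc n) \<noteq> 0)"
    proof (cases "\<exists>j. braid s t j")
      case False
      then have "gam s t = 2" using st by (auto simp: gam_def)
      then show ?thesis by (auto simp: cheb_2)
    next
      case True
      then have b: "braid s t (cm s t)" using cm_braid by blast
      have g: "gam s t = 2 * cos (pi / real (cm s t))" using True st by (auto simp: gam_def)
      have m2: "2 \<le> cm s t" using cm_ge_2[OF less(3) sub(2) st b] .
      \<comment> \<open>At \<open>n = m(s, t)\<close> the element \<open>k\<close> would also be a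
        word ending in \<open>s\<close>, and \<open>s\<close> would shorten it. Below that value
        both coefficients are 0 or at least 1.\<close>
      have "n \<noteq> cm s t"
      proof
        assume e: "n = cm s t"
        obtain j where j: "n = Suc j" using k(2) n_def gr0_conv_Suc by auto
        have r: "set (ralt t s j) \<subseteq> S" using ralt_set[of t s j] J by auto
        have "k = wprod (ralt s t n)" using b e k(1) by (simp add: braid_def n_def)
        also have "\<dots> = wprod (ralt t s j) \<otimes> s" unfolding j ralt_snoc using r less(3) by (simp add: wprod_append)
        finally have "k \<otimes> s = wprod (ralt t s j)" using r less(3) by simp
        then have "len (k \<otimes> s) \<le> j" using len_le[OF r] by simp
        then show False using ks j n_def by simp
      qed
      moreover have "\<not> cm s t < n"
        using ralt_not_reduced[OF sub(2) less(3), of "cm s t" n] b braid_sym k(1) n_def by fastforce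
      ultimately have n: "n < cm s t" "1 \<le> n" using k(2) n_def by auto
      have 1: "1 \<le> cheb (gam s t) n" using cheb_cos(2)[OF m2 n(2,1)] g by simp
      have "cheb (gam s t) (Suc n) = 0 \<or> 1 \<le> cheb (gam s t) (Suc n)"
        using cheb_cos(1)[OF m2] cheb_cos(2)[OF m2, of "Suc n"] g n by (cases "Suc n = cm s t") auto
      then show ?thesis using 1 by auto
    qed
    have rs: "set (ralt t s n) \<subseteq> S" using ralt_set[of t s n] J by auto
    have "act u (bas s) = act v (rword (ralt t s n) (bas s))"
      using v(3) act_mult[OF c] act_word[OF rs] k(1) n_def by simp
    also have "\<dots> = (\<lambda>x. cheb (gam s t) (if even n then Suc n else n) * act v (bas s) x
     + cheb (gam s t) (if even n then n else Suc n) * act v (bas t) x)"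
      unfolding rword_ralt_bas[OF less(3) sub(2) st] by (rule act_lin)
    finally show ?thesis using posv_comb[OF IH[of s] IH[of t]] sp by auto
  qed
qed

lemma act_bas_neg:
  assumes "u \<in> carrier W" "s \<in> S" "len (u \<otimes> s) < len u"
  shows "posv (\<lambda>x. - act u (bas s) x)"
proof -
  have "posv (act (u \<otimes> s) (bas s))" using act_bas_pos[of "u \<otimes> s" s] assms by simp
  moreover have "act (u \<otimes> s) (bas s) = act u (\<lambda>x. (-1) * bas s x + 0 * bas s x)"
    using assms by (simp add: act_mult act_S refl_bas)
  moreover have "\<dots> = (\<lambda>x. - act u (bas s) x)" by (subst act_lin) simp
  ultimately show ?thesis by simp
qed

end

section \<open>Roots and points of the Tits cone\<close>

context coxeter
begin

definition negv :: "('w \<Rightarrow> real) \<Rightarrow> bool" where "negv f \<longleftrightarrow> posv (\<lambda>x. - f x)"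

definition roots :: "('w \<Rightarrow> real) set" where
  "roots = {act u (bas s) |u s. u \<in> carrier W \<and> s \<in> S}"

lemma rootsI: "u \<in> carrier W \<Longrightarrow> s \<in> S \<Longrightarrow> act u (bas s) \<in> roots"
  by (auto simp: roots_def)

lemma bas_roots [simp]: "s \<in> S \<Longrightarrow> bas s \<in> roots"
  using rootsI[of \<one> s] by simp

lemma act_roots [simp]: "v \<in> carrier W \<Longrightarrow> b \<in> roots \<Longrightarrow> act v b \<in> roots"
  by (auto simp: roots_def act_mult[symmetric]) (metis m_closed)

lemma refl_roots [simp]: "s \<in> S \<Longrightarrow> b \<in> roots \<Longrightarrow> refl s b \<in> roots"
  by (metis act_S act_roots S_carrier)

lemma act_uminus: "act u (\<lambda>x. - f x) = (\<lambda>x. - act u f x)"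
  using act_lin[of u "-1" f 0 f] by simp

lemma uminus_roots: "b \<in> roots \<Longrightarrow> (\<lambda>x. - b x) \<in> roots"
proof -
  assume "b \<in> roots"
  then obtain u s where us: "u \<in> carrier W" "s \<in> S" "b = act u (bas s)" by (auto simp: roots_def)
  have "act (u \<otimes> s) (bas s) = (\<lambda>x. - b x)"
    using us by (simp add: act_mult act_S refl_bas act_uminus)
  then show ?thesis using rootsI[of "u \<otimes> s" s] us by simp
qed

lemma root_sign:
  assumes "u \<in> carrier W" "s \<in> S"
  shows "posv (act u (bas s)) \<longleftrightarrow> len u < len (u \<otimes> s)" "negv (act u (bas s)) \<longleftrightarrow> len (u \<otimes> s) < len u"
proof -
  have n: "\<not> (posv f \<and> negv f)" for f
    by (auto simp: posv_def negv_def) (smt (verit))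
  show "posv (act u (bas s)) \<longleftrightarrow> len u < len (u \<otimes> s)" "negv (act u (bas s)) \<longleftrightarrow> len (u \<otimes> s) < len u"
    using len_right_cases[OF assms(2,1)] act_bas_pos[OF assms] act_bas_neg[OF assms] n[of "act u (bas s)"]
    by (auto simp: negv_def[of "act u (bas s)"])
qed

lemma not_posv_negv: "posv f \<Longrightarrow> \<not> negv f"
  by (auto simp: posv_def negv_def) (smt (verit))

lemma roots_pos_or_neg: "b \<in> roots \<Longrightarrow> posv b \<or> negv b"
  unfolding roots_def using root_sign len_right_cases by fastforce

lemma negv_uminus [simp]: "negv (\<lambda>x. - f x) \<longleftrightarrow> posv f" "posv (\<lambda>x. - f x) \<longleftrightarrow> negv f"
  by (simp_all add: negv_def)

lemma left_root_sign:
  assumes "u \<in> carrier W" "s \<in> S"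
  shows "posv (act (inv u) (bas s)) \<longleftrightarrow> len u < len (s \<otimes> u)" "negv (act (inv u) (bas s)) \<longleftrightarrow> len (s \<otimes> u) < len u"
  using root_sign[of "inv u" s] assms by (simp_all add: len_right_inv)

lemma posv_nonneg: "posv f \<Longrightarrow> 0 \<le> f x"
  unfolding posv_def by (metis dual_order.refl order_trans zero_le_one)

lemma posv_supp: "posv f \<Longrightarrow> x \<notin> S \<Longrightarrow> f x = 0" by (simp add: posv_def)

text \<open>The multiple and its inverse are both coefficients of a positive root, hence both at least 1.\<close>
lemma root_multiple:
  assumes b: "b \<in> roots" "posv b" and s: "s \<in> S" and c: "b = (\<lambda>x. c * bas s x)"
  shows "b = bas s"
proof -
  obtain u r where u: "u \<in> carrier W" "r \<in> S" "b = act u (bas r)" using b by (auto simp: roots_def)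
  obtain x where x: "b x \<noteq> 0" using b(2) by (auto simp: posv_def)
  then have "x = s" "c \<noteq> 0" using c by (auto simp: bas_def split: if_splits)
  moreover have bs: "b s = c" using c by (simp add: bas_def)
  ultimately have c1: "1 \<le> c" using b(2) unfolding posv_def by metis
  have "bas r = act (inv u) b" using u by simp
  also have "\<dots> = (\<lambda>x. c * act (inv u) (bas s) x)"
    unfolding c using act_lin[of "inv u" c "bas s" 0 "bas s"] by simp
  finally have e: "bas r = (\<lambda>x. c * act (inv u) (bas s) x)" .
  define d where "d = act (inv u) (bas s) r"
  have d: "1 = c * d" using fun_cong[OF e, of r] by (simp add: bas_def d_def)
  have "act (inv u) (bas s) \<in> roots" using u s by simp
  then have "d = 0 \<or> 1 \<le> \<bar>d\<bar>"
    using roots_pos_or_neg[of "act (inv u) (bas s)"] unfolding d_def negv_def posv_def by (smt (verit))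
  then have "1 \<le> d" using d c1 by (smt (verit) mult_nonneg_nonpos mult_zero_right)
  then have "c \<le> 1" using d c1 mult_left_mono[of 1 d c] by simp
  then show ?thesis using c c1 by simp
qed

text \<open>Only the coordinate at \<open>s\<close> changes under \<open>refl s\<close>, so a
  positive root that turns negative is supported at \<open>s\<close> alone.\<close>

lemma refl_pos:
  assumes b: "b \<in> roots" "posv b" and s: "s \<in> S" and n: "b \<noteq> bas s"
  shows "posv (refl s b)"
proof (rule ccontr)
  assume "\<not> posv (refl s b)"
  moreover have "refl s b \<in> roots" using act_roots[of s b] s b by (simp add: act_S)
  ultimately have neg: "negv (refl s b)" using roots_pos_or_neg by blast
  have "b x = 0" if "x \<noteq> s" for x
  proof -
    have "refl s b x = b x" using that by (simp add: refl_def bas_def)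
    then show ?thesis using neg b(2) unfolding negv_def posv_def by (smt (verit))
  qed
  then have "b = (\<lambda>x. b s * bas s x)" by (auto simp: bas_def)
  then show False using root_multiple[OF b s] n by blast
qed

text \<open>The inverse of \<open>u s\<close> sends \<open>bas t\<close> to the negative of
  \<open>bas s\<close>, so \<open>t\<close> is a left descent of \<open>u s\<close>. Exchange
  removes a letter from a reduced word of \<open>u\<close> followed by \<open>s\<close>. Removing
  the final \<open>s\<close> gives the claim; removing an earlier letter would make \<open>t\<close>
  a left descent of \<open>u\<close>, although \<open>inv u\<close> sends \<open>bas t\<close> to
  the positive root \<open>bas s\<close>.\<close>

lemma simple_root_eq:
  assumes u: "u \<in> carrier W" and s: "s \<in> S" and t: "t \<in> S" and e: "act u (bas s) = bas t"
  shows "u \<otimes> s = t \<otimes> u"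
proof -
  have "posv (act u (bas s))" using e posv_bas t by simp
  then have l: "len (u \<otimes> s) = Suc (len u)" using root_sign[OF u s] len_right_cases[OF s u] by auto
  obtain xs where xs: "set xs \<subseteq> S" "length xs = len u" "wprod xs = u" using reduced_word[OF u] .
  have "act (inv (u \<otimes> s)) (bas t) = act s (act (inv u) (act u (bas s)))"
    using e u s by (simp add: inv_mult_group act_mult)
  also have "\<dots> = (\<lambda>x. - bas s x)" using u s by (simp add: act_S refl_bas)
  finally have "negv (act (inv (u \<otimes> s)) (bas t))" using posv_bas[OF s] by simp
  then have lt: "len (t \<otimes> (u \<otimes> s)) < len (u \<otimes> s)" using left_root_sign[of "u \<otimes> s" t] u s t by simp
  have w: "wprod (xs @ [s]) = u \<otimes> s" using xs s by (simp add: wprod_append)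
  obtain as b cs where d: "xs @ [s] = as @ b # cs" "t \<otimes> wprod (xs @ [s]) = wprod (as @ cs)"
    by (rule exchange[of t "xs @ [s]"]) (use xs s t w l lt in auto)
  show ?thesis
  proof (cases cs rule: rev_cases)
    case Nil
    then have "t \<otimes> (u \<otimes> s) = u" using d w xs by simp
    then have "t \<otimes> (t \<otimes> (u \<otimes> s)) = t \<otimes> u" by simp
    then show ?thesis using t u s by simp
  next
    case (snoc ds x)
    then have ds: "xs = as @ b # ds" "x = s" using d(1) by auto
    have sub: "set as \<subseteq> S" "set ds \<subseteq> S" using ds xs by auto
    have "t \<otimes> (u \<otimes> s) = wprod (as @ ds) \<otimes> s"
      using d(2) w snoc ds sub s by (simp add: wprod_append m_assoc)
    then have "t \<otimes> u \<otimes> s = wprod (as @ ds) \<otimes> s" using t u s by (simp add: m_assoc)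
    then have "t \<otimes> u = wprod (as @ ds)" using t u s sub by simp
    then have "len (t \<otimes> u) < len u" using len_le[of "as @ ds"] sub ds xs by simp
    then have "negv (act (inv u) (bas t))" using left_root_sign[OF u t] by simp
    moreover have "act (inv u) (bas t) = bas s" using e u by (metis act_inv(2))
    ultimately show ?thesis using not_posv_negv[OF posv_bas[OF s]] by simp
  qed
qed

text \<open>This makes the reflection attached to a root well defined.\<close>

lemma act_eq_conj:
  assumes "u \<in> carrier W" "v \<in> carrier W" "s \<in> S" "t \<in> S" "act u (bas s) = act v (bas t)"
  shows "u \<otimes> s \<otimes> inv u = v \<otimes> t \<otimes> inv v"
proof -
  have "act (inv v \<otimes> u) (bas s) = bas t" using assms by (simp add: act_mult)
  then have "inv v \<otimes> u \<otimes> s = t \<otimes> (inv v \<otimes> u)" using simple_root_eq[of "inv v \<otimes> u" s t] assms by simp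
  then have "v \<otimes> (inv v \<otimes> u \<otimes> s) \<otimes> inv u = v \<otimes> (t \<otimes> (inv v \<otimes> u)) \<otimes> inv u" by simp
  moreover have "v \<otimes> (inv v \<otimes> u \<otimes> s) = u \<otimes> s" using assms by (simp add: m_assoc[symmetric])
  moreover have "v \<otimes> (t \<otimes> (inv v \<otimes> u)) \<otimes> inv u = v \<otimes> t \<otimes> inv v" using assms by (simp add: m_assoc)
  ultimately show ?thesis by simp
qed

text \<open>By \<open>refl_pos\<close>, appending a letter \<open>s\<close> to the word adds at most
  \<open>bas s\<close> to the inversions, up to the bijection \<open>refl s\<close>.\<close>

lemma finite_inversions: "u \<in> carrier W \<Longrightarrow> finite {b \<in> roots. posv b \<and> negv (act u b)}"
proof -
  have main: "set xs \<subseteq> S \<Longrightarrow> finite {b \<in> roots. posv b \<and> negv (act (wprod xs) b)}" for xs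
  proof (induction xs rule: rev_induct)
    case Nil then show ?case using not_posv_negv by (auto intro: finite_subset[of _ "{}"])
  next
    case (snoc s xs)
    let ?A = "{b \<in> roots. posv b \<and> negv (act (wprod xs) b)}"
    have "b \<in> insert (bas s) (refl s ` ?A)" if b: "b \<in> roots" "posv b" "negv (act (wprod (xs @ [s])) b)" for b
    proof (cases "b = bas s")
      case False
      have "posv (refl s b)" using refl_pos[OF b(1,2) _ False] snoc.prems by simp
      moreover have "refl s b \<in> roots" using act_roots[of s b] snoc.prems b by (simp add: act_S)
      moreover have "negv (act (wprod xs) (refl s b))"
        using b(3) snoc.prems by (simp add: wprod_append act_mult act_S)
      moreover have "b = refl s (refl s b)" using snoc.prems by simp
      ultimately show ?thesis by blast
    qed simp
    then have "{b \<in> roots. posv b \<and> negv (act (wprod (xs @ [s])) b)} \<subseteq> insert (bas s) (refl s ` ?A)" by blast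
    then show ?case using snoc by (auto intro: finite_subset)
  qed
  assume "u \<in> carrier W"
  then show ?thesis using ex_word main by blast
qed

text \<open>Letters of \<open>y\<close> are moved over to \<open>x\<close> one at a time. The simple
  root of the first letter is inverted by \<open>inv y\<close>, so by hypothesis \<open>x\<close>
  keeps it positive and that letter lengthens \<open>x\<close>.\<close>

lemma len_add_of_roots:
  assumes "x \<in> carrier W" "y \<in> carrier W"
    "\<And>b. b \<in> roots \<Longrightarrow> posv b \<Longrightarrow> negv (act (inv y) b) \<Longrightarrow> \<not> negv (act x b)"
  shows "len (x \<otimes> y) = len x + len y"
  using assms
proof (induction "len y" arbitrary: x y)
  case 0
  then show ?case using len_0_iff[of y] by simp
next
  case (Suc n)
  obtain ys where ys: "set ys \<subseteq> S" "length ys = len y" "wprod ys = y" using reduced_word Suc(4) .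
  then obtain s zs where zs: "ys = s # zs" using Suc(2) by (cases ys) auto
  define y' where "y' = wprod zs"
  have s: "s \<in> S" "y' \<in> carrier W" "y = s \<otimes> y'" using ys zs by (auto simp: y'_def)
  have y': "s \<otimes> y = y'" using s by simp
  have "len y' \<le> n" using len_le[of zs] ys zs Suc(2) by (simp add: y'_def)
  then have l: "len y' = n" "len (s \<otimes> y') = Suc (len y')"
    using len_left_cases[of s y'] s Suc(2) by auto
  have "negv (act (inv y) (bas s))" using left_root_sign[of y s] Suc(4) s l y' by simp
  then have "\<not> negv (act x (bas s))" using Suc(5)[of "bas s"] s posv_bas by simp
  then have xs: "len (x \<otimes> s) = Suc (len x)"
    using root_sign[of x s] len_right_cases[of s x] Suc(3) s by auto
  have "len ((x \<otimes> s) \<otimes> y') = len (x \<otimes> s) + len y'"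
  proof (rule Suc(1))
    fix b assume b: "b \<in> roots" "posv b" "negv (act (inv y') b)"
    have n: "b \<noteq> bas s"
    proof
      assume "b = bas s"
      then have "len (s \<otimes> y') < len y'" using b(3) left_root_sign[of y' s] s by simp
      then show False using l by simp
    qed
    have p: "posv (refl s b)" "refl s b \<in> roots"
      using refl_pos[OF b(1,2) s(1) n] act_roots[of s b] s b by (auto simp: act_S)
    have "act (inv y) (refl s b) = act (inv y') b"
      using s by (simp add: inv_mult_group act_mult act_S)
    then have "\<not> negv (act x (refl s b))" using Suc(5)[OF p(2,1)] b(3) by simp
    then show "\<not> negv (act (x \<otimes> s) b)" using s Suc(3) by (simp add: act_mult act_S)
  qed (use l s Suc(3) in auto)
  then show ?case using s Suc(3) xs l Suc(2) by (simp add: m_assoc)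
qed

text \<open>A positive root supported on \<open>J\<close> is a nonnegative combination of simple
  roots, each of which \<open>v\<close> keeps positive.\<close>

lemma rmin_J_pos:
  assumes J: "J \<subseteq> S" and v: "rmin J v" and b: "b \<in> roots" "posv b" "\<forall>x. x \<notin> J \<longrightarrow> b x = 0"
  shows "posv (act v b)"
proof -
  have vc: "v \<in> carrier W" using v by (simp add: rmin_def)
  have p: "posv (act v (bas s))" if "s \<in> J" for s using v root_sign[of v s] that J by (auto simp: rmin_def)
  have fJ: "finite J" using J finite_S finite_subset by blast
  have lin: "act v (\<lambda>x. \<Sum>s\<in>K. c s * bas s x) = (\<lambda>x. \<Sum>s\<in>K. c s * act v (bas s) x)" if "finite K" for K c
    using that
  proof (induction K)
    case empty then show ?case using act_lin[of v 0 "bas undefined" 0 "bas undefined"] by simp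
  next
    case (insert k K)
    then show ?case using act_lin[of v "c k" "bas k" 1 "\<lambda>x. \<Sum>s\<in>K. c s * bas s x"] by simp
  qed
  have "b x = (\<Sum>s\<in>J. b s * bas s x)" for x
  proof -
    have "(\<Sum>s\<in>J. b s * bas s x) = (\<Sum>s\<in>J. if s = x then b x else 0)"
      by (rule sum.cong) (auto simp: bas_def)
    then show ?thesis using fJ b(3) by auto
  qed
  then have beq: "b = (\<lambda>x. \<Sum>s\<in>J. b s * bas s x)" by blast
  have "act v b = (\<lambda>x. \<Sum>s\<in>J. b s * act v (bas s) x)"
    by (rule trans[OF arg_cong[OF beq, of "act v"] lin[OF fJ, of b]])
  then have "0 \<le> act v b x" for x
  proof -
    have "0 \<le> (\<Sum>s\<in>J. b s * act v (bas s) x)"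
    proof (rule sum_nonneg)
      fix s assume "s \<in> J"
      then have "0 \<le> act v (bas s) x" "0 \<le> b s" using p[of s] b(2) posv_nonneg by auto
      then show "0 \<le> b s * act v (bas s) x" by simp
    qed
    then show ?thesis using \<open>act v b = _\<close> by simp
  qed
  then have "\<not> negv (act v b)" unfolding negv_def posv_def by (smt (verit))
  then show ?thesis using roots_pos_or_neg[of "act v b"] vc b by auto
qed

section \<open>Linear functionals, chambers and separating walls\<close>

definition ltot :: "('w \<Rightarrow> real) \<Rightarrow> real" where "ltot f = (\<Sum>s\<in>S. f s)"

text \<open>The gap in \<open>posv\<close> becomes a uniform gap: no root has an \<open>ltot\<close>
  value strictly between -1 and 1.\<close>

lemma ltot_pos: "posv f \<Longrightarrow> 1 \<le> ltot f"
proof -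
  assume f: "posv f"
  then obtain x where x: "x \<in> S" "1 \<le> f x" unfolding posv_def by metis
  have "f x \<le> ltot f" unfolding ltot_def
    by (rule member_le_sum[OF x(1)]) (use f finite_S in \<open>auto simp: posv_def, smt (verit)\<close>)
  then show ?thesis using x by simp
qed

lemma ltot_neg: "negv f \<Longrightarrow> ltot f \<le> -1"
  using ltot_pos[of "\<lambda>x. - f x"] by (simp add: ltot_def sum_negf)

definition linf :: "(('w \<Rightarrow> real) \<Rightarrow> real) \<Rightarrow> bool" where
  "linf q \<longleftrightarrow> (\<forall>a b f g. q (\<lambda>x. a * f x + b * g x) = a * q f + b * q g)"

text \<open>Interior points of the Tits cone, as functionals on the root space.\<close>
definition point :: "(('w \<Rightarrow> real) \<Rightarrow> real) \<Rightarrow> bool" where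
  "point q \<longleftrightarrow> linf q \<and> (\<forall>u\<in>carrier W. finite {b \<in> roots. posv b \<and> q (act u b) \<le> 0})"

lemma linfD: "linf q \<Longrightarrow> q (\<lambda>x. a * f x + b * g x) = a * q f + b * q g"
  by (simp add: linf_def)

lemma linf_uminus: "linf q \<Longrightarrow> q (\<lambda>x. - f x) = - q f"
  using linfD[of q "-1" f 0 f] by simp

lemma linf_act: "linf q \<Longrightarrow> linf (\<lambda>f. q (act u f))"
  by (simp add: linf_def act_lin)

lemma linf_sum_bas:
  assumes "linf q" "\<forall>x. x \<notin> S \<longrightarrow> f x = 0"
  shows "q f = (\<Sum>s\<in>S. f s * q (bas s))"
proof -
  have lin: "q (\<lambda>x. \<Sum>s\<in>K. c s * bas s x) = (\<Sum>s\<in>K. c s * q (bas s))" if "finite K" for K c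
    using that
  proof (induction K)
    case empty then show ?case using linfD[OF assms(1), of 0 "bas undefined" 0 "bas undefined"] by simp
  next
    case (insert k K)
    then show ?case using linfD[OF assms(1), of "c k" "bas k" 1 "\<lambda>x. \<Sum>s\<in>K. c s * bas s x"] by simp
  qed
  have "f x = (\<Sum>s\<in>S. f s * bas s x)" for x
  proof -
    have "(\<Sum>s\<in>S. f s * bas s x) = (\<Sum>s\<in>S. if s = x then f x else 0)"
      by (rule sum.cong) (auto simp: bas_def)
    then show ?thesis using finite_S assms(2) by auto
  qed
  then have "f = (\<lambda>x. \<Sum>s\<in>S. f s * bas s x)" by blast
  then show ?thesis using lin[OF finite_S, of f] by metis
qed

lemma point_ltot: "point ltot"
proof -
  have l: "linf ltot" by (simp add: linf_def ltot_def sum.distrib sum_distrib_left)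
  have "finite {b \<in> roots. posv b \<and> ltot (act u b) \<le> 0}" if u: "u \<in> carrier W" for u
  proof (rule finite_subset[OF _ finite_inversions[OF u]], safe)
    fix b assume b: "b \<in> roots" "posv b" "ltot (act u b) \<le> 0"
    then have "\<not> posv (act u b)" using ltot_pos[of "act u b"] by auto
    then show "negv (act u b)" using roots_pos_or_neg[of "act u b"] u b by auto
  qed
  then show ?thesis using l by (simp add: point_def)
qed

lemma point_act: "point q \<Longrightarrow> z \<in> carrier W \<Longrightarrow> point (\<lambda>f. q (act z f))"
  by (auto simp: point_def linf_act act_mult[symmetric])

lemma point_comb:
  assumes "point p" "point q" "0 \<le> a" "0 \<le> b" "a + b > (0::real)"
  shows "point (\<lambda>f. a * p f + b * q f)"
proof -
  have l: "linf (\<lambda>f. a * p f + b * q f)"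
    using assms(1,2) by (simp add: point_def linf_def algebra_simps)
  have "finite {d \<in> roots. posv d \<and> a * p (act u d) + b * q (act u d) \<le> 0}" if u: "u \<in> carrier W" for u
  proof (rule finite_subset)
    show "finite ({d \<in> roots. posv d \<and> p (act u d) \<le> 0} \<union> {d \<in> roots. posv d \<and> q (act u d) \<le> 0})"
      using assms u by (auto simp: point_def)
    have "p (act u d) \<le> 0 \<or> q (act u d) \<le> 0" if "a * p (act u d) + b * q (act u d) \<le> 0" for d
    proof (rule ccontr)
      assume "\<not> ?thesis"
      then have "0 \<le> a * p (act u d)" "0 \<le> b * q (act u d)" "0 < a * p (act u d) \<or> 0 < b * q (act u d)"
        using assms by (auto simp: zero_less_mult_iff)
      then show False using that by linarith
    qed
    then show "{d \<in> roots. posv d \<and> a * p (act u d) + b * q (act u d) \<le> 0}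
       \<subseteq> {d \<in> roots. posv d \<and> p (act u d) \<le> 0} \<union> {d \<in> roots. posv d \<and> q (act u d) \<le> 0}" by blast
  qed
  then show ?thesis using l by (simp add: point_def)
qed

text \<open>The closed chamber \<open>u D\<close> contains \<open>q\<close>, where \<open>D\<close> is the fundamental one.\<close>
definition chamber_has :: "'w \<Rightarrow> (('w \<Rightarrow> real) \<Rightarrow> real) \<Rightarrow> bool" where
  "chamber_has u q \<longleftrightarrow> (\<forall>s\<in>S. 0 \<le> q (act u (bas s)))"

lemma chamber_has_pos:
  assumes "chamber_has u q" "linf q" "posv b"
  shows "0 \<le> q (act u b)"
proof -
  have "q (act u b) = (\<Sum>s\<in>S. b s * q (act u (bas s)))"
    using linf_sum_bas[OF linf_act[OF assms(2)], of b u] assms(3) by (auto simp: posv_def)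
  also have "\<dots> \<ge> 0"
    by (rule sum_nonneg, rule mult_nonneg_nonneg)
      (use assms in \<open>auto simp: chamber_has_def posv_def, smt (verit)\<close>)
  finally show ?thesis .
qed

text \<open>The number of walls strictly separating the chamber \<open>u\<close> from
  \<open>q\<close>. It is finite for a \<open>point\<close> and serves as the measure by which walks
  towards \<open>q\<close> terminate.\<close>

definition ndist :: "(('w \<Rightarrow> real) \<Rightarrow> real) \<Rightarrow> 'w \<Rightarrow> nat" where
  "ndist q u = card {b \<in> roots. posv b \<and> q (act u b) < 0}"

text \<open>Crossing the wall of \<open>bas s\<close> removes that root from the count, and
  \<open>refl s\<close> injects the remaining ones.\<close>

lemma ndist_step:
  assumes q: "point q" and u: "u \<in> carrier W" and s: "s \<in> S" and n: "q (act u (bas s)) < 0"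
  shows "ndist q (u \<otimes> s) < ndist q u"
proof -
  let ?A = "\<lambda>u. {b \<in> roots. posv b \<and> q (act u b) < 0}"
  have fin: "finite (?A u)"
    using q u by (auto simp: point_def intro: finite_subset[of _ "{b \<in> roots. posv b \<and> q (act u b) \<le> 0}"])
  have l: "linf q" using q by (simp add: point_def)
  have sub: "refl s ` ?A (u \<otimes> s) \<subseteq> ?A u - {bas s}"
  proof safe
    fix b assume b: "b \<in> roots" "posv b" "q (act (u \<otimes> s) b) < 0"
    have n1: "b \<noteq> bas s"
    proof
      assume "b = bas s"
      then have "q (act (u \<otimes> s) b) = - q (act u (bas s))"
        using u s l by (simp add: act_mult act_S refl_bas act_uminus linf_uminus)
      then show False using b n by simp
    qed
    show "refl s b \<in> roots" using act_roots[of s b] s b by (simp add: act_S)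
    show "posv (refl s b)" using refl_pos[OF b(1,2) s n1] .
    show "q (act u (refl s b)) < 0" using b u s by (simp add: act_mult act_S)
    assume "refl s b = bas s"
    then have "b = (\<lambda>x. - bas s x)" using s refl_refl[of s b] by (simp add: refl_bas)
    then show False using b(2) posv_bas[OF s] not_posv_negv by auto
  qed
  have "inj_on (refl s) (?A (u \<otimes> s))" by (rule inj_on_inverseI[of _ "refl s"]) (use s in simp)
  then have "ndist q (u \<otimes> s) = card (refl s ` ?A (u \<otimes> s))" by (simp add: ndist_def card_image)
  also have "\<dots> \<le> card (?A u - {bas s})" using sub fin by (intro card_mono) auto
  also have "\<dots> < card (?A u)" using fin n s posv_bas by (intro psubset_card_mono) auto
  finally show ?thesis by (simp add: ndist_def)
qed

end

section \<open>Averages of integer sequences\<close>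

definition smooth :: "(int \<Rightarrow> real) \<Rightarrow> int \<Rightarrow> real" where
  "smooth h = (\<lambda>n. (h n + h (n + 1)) / 2)"

definition window :: "nat \<Rightarrow> (int \<Rightarrow> real) \<Rightarrow> int \<Rightarrow> real" where
  "window M h = (\<lambda>n. (\<Sum>j<M. h (n + int j)) / real M)"

lemma smooth_pow_Suc: "(smooth ^^ Suc N) h n = ((smooth ^^ N) h n + (smooth ^^ N) h (n + 1)) / 2"
  by (simp add: smooth_def)

lemma smooth_sum: "(smooth ^^ N) h n = (\<Sum>j\<le>N. real (N choose j) * h (n + int j)) / 2 ^ N"
proof (induction N arbitrary: n)
  case (Suc N)
  have 1: "(\<Sum>j\<le>N. real (N choose j) * h (n + int j)) =
      h n + (\<Sum>j\<le>N. real (N choose Suc j) * h (n + int (Suc j)))"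
  proof -
    have "(\<Sum>j\<le>N. real (N choose j) * h (n + int j)) = (\<Sum>j\<le>Suc N. real (N choose j) * h (n + int j))"
      by simp
    then show ?thesis by (simp add: sum.atMost_Suc_shift del: sum.atMost_Suc)
  qed
  have "(\<Sum>j\<le>Suc N. real (Suc N choose j) * h (n + int j)) =
     h n + (\<Sum>j\<le>N. real (Suc N choose Suc j) * h (n + int (Suc j)))"
    by (simp add: sum.atMost_Suc_shift del: sum.atMost_Suc)
  also have "\<dots> = (\<Sum>j\<le>N. real (N choose j) * h (n + int j)) + (\<Sum>j\<le>N. real (N choose j) * h (n + 1 + int j))"
    unfolding 1 by (simp add: sum.distrib algebra_simps)
  finally show ?case unfolding smooth_pow_Suc Suc.IH by (simp add: add_divide_distrib)
qed simp

lemma smooth_lin: "(smooth ^^ N) (\<lambda>n. a * h n + b * g n) n = a * (smooth ^^ N) h n + b * (smooth ^^ N) g n"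
  by (induction N arbitrary: n) (auto simp: smooth_def algebra_simps add_divide_distrib)

lemma smooth_uminus: "(smooth ^^ N) (\<lambda>n. - h n) n = - (smooth ^^ N) h n"
  using smooth_lin[of N "-1" h 0 h n] by simp

lemma smooth_shift: "(smooth ^^ N) (\<lambda>n. h (n + k)) n = (smooth ^^ N) h (n + k)"
  by (induction N arbitrary: n) (auto simp: smooth_def algebra_simps)

lemma smooth_mono_pos: "\<forall>n. 0 < (smooth ^^ N) h n \<Longrightarrow> N \<le> N' \<Longrightarrow> 0 < (smooth ^^ N') h n"
proof (induction N' arbitrary: n)
  case (Suc N') then show ?case by (cases "N \<le> N'") (auto simp: smooth_pow_Suc le_Suc_eq simp del: funpow.simps intro: add_pos_pos)
qed simp

text \<open>Squaring makes the bound \<open>1 / sqrt (2 k + 1)\<close> inductive: consecutive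
  normalised central coefficients have ratio \<open>(2 k + 1) / (2 k + 2)\<close>, and
  \<open>(2 k + 1) (2 k + 3)\<close> is at most \<open>(2 k + 2)^2\<close>.\<close>

lemma central_binomial_bound: "(real ((2 * k) choose k) / 4 ^ k)\<^sup>2 * (2 * real k + 1) \<le> 1"
proof (induction k)
  case (Suc k)
  define A where "A = real (2 * k choose k)"
  define B where "B = real (Suc (2 * k) choose Suc k)"
  define D where "D = real (2 * Suc k choose Suc k)"
  define x where "x = real k"
  have "Suc (2 * k) * (2 * k choose k) = (Suc (2 * k) choose Suc k) * Suc k"
    by (rule Suc_times_binomial_eq)
  from arg_cong[OF this, of real] have b1: "(2 * x + 1) * A = B * (x + 1)"
    unfolding A_def B_def x_def of_nat_mult by (simp add: algebra_simps)
  have "Suc (2 * k) choose k = Suc (2 * k) choose Suc k"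
    using binomial_symmetric[of k "Suc (2 * k)"] by simp
  then have "Suc (Suc (2 * k)) * (Suc (2 * k) choose Suc k) = (2 * Suc k choose Suc k) * Suc k"
    using Suc_times_binomial_eq[of "Suc (2 * k)" k] by simp
  from arg_cong[OF this, of real] have "(2 * x + 2) * B = D * (x + 1)"
    unfolding D_def B_def x_def of_nat_mult by (simp add: algebra_simps)
  then have "(D - 2 * B) * (x + 1) = 0" by (simp add: algebra_simps)
  moreover have x: "0 \<le> x" by (simp add: x_def)
  ultimately have "D = 2 * B" by simp
  define y where "y = x + 1"
  define z where "z = 2 * x + 1"
  have y: "0 < y" "0 \<le> z" using x by (auto simp: y_def z_def)
  have "B = z * A / y" using b1 y by (simp add: field_simps y_def z_def)
  then have D: "D = 2 * z * A / y" using \<open>D = 2 * B\<close> by simp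
  define a where "a = A / 4 ^ k"
  define r where "r = z / (2 * y)"
  have e: "D / 4 ^ Suc k = a * r" unfolding D a_def r_def using y by simp
  have "z * (z * (2 * x + 3)) \<le> z * (4 * y\<^sup>2)"
    using y by (intro mult_left_mono) (auto simp: y_def z_def power2_eq_square algebra_simps)
  moreover have "r\<^sup>2 * (2 * x + 3) = z * (z * (2 * x + 3)) / (4 * y\<^sup>2)"
    by (simp add: r_def power_divide power2_eq_square)
  ultimately have r: "r\<^sup>2 * (2 * x + 3) \<le> z" using y by (simp add: pos_divide_le_eq)
  have "(a * r)\<^sup>2 * (2 * x + 3) = a\<^sup>2 * (r\<^sup>2 * (2 * x + 3))" by (simp add: power_mult_distrib)
  also have "\<dots> \<le> a\<^sup>2 * z" using r by (intro mult_left_mono) auto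
  also have "\<dots> \<le> 1" using Suc by (simp add: a_def A_def x_def z_def)
  finally have "(a * r)\<^sup>2 * (2 * x + 3) \<le> 1" .
  then have "(D / 4 ^ Suc k)\<^sup>2 * (2 * x + 3) \<le> 1" unfolding e .
  then show ?case by (simp add: D_def x_def algebra_simps)
qed simp

lemma binomial_small:
  assumes "0 < e"
  obtains N where "\<And>j. real (N choose j) / 2 ^ N \<le> e"
proof -
  obtain k where k: "1 / e\<^sup>2 < real k" using reals_Archimedean2 by blast
  have "real ((2 * k) choose j) / 2 ^ (2 * k) \<le> e" for j
  proof -
    have "(2 * k) choose j \<le> (2 * k) choose k" using binomial_maximum[of "2 * k" j] by simp
    then have "real ((2 * k) choose j) / 2 ^ (2 * k) \<le> real ((2 * k) choose k) / 4 ^ k"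
      by (simp add: power_mult divide_right_mono)
    moreover have "real ((2 * k) choose k) / 4 ^ k \<le> e"
    proof (rule ccontr)
      assume "\<not> ?thesis"
      then have "e\<^sup>2 < (real ((2 * k) choose k) / 4 ^ k)\<^sup>2" using assms by (intro power_strict_mono) auto
      then have "e\<^sup>2 * (2 * real k + 1) < (real ((2 * k) choose k) / 4 ^ k)\<^sup>2 * (2 * real k + 1)"
        by (intro mult_strict_right_mono) auto
      also have "\<dots> \<le> 1" by (rule central_binomial_bound)
      finally have "e\<^sup>2 * (2 * real k + 1) < 1" .
      moreover have "1 < e\<^sup>2 * real k" using k assms by (simp add: field_simps)
      moreover have "e\<^sup>2 * real k \<le> e\<^sup>2 * (2 * real k + 1)" by (intro mult_left_mono) auto
      ultimately show False by simp
    qed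
    ultimately show ?thesis by simp
  qed
  then show ?thesis using that by blast
qed

text \<open>Uniformity in \<open>n\<close> is the point. The weights of a long binomial average are
  individually tiny, so the finitely many indices where \<open>h\<close> is small carry little total
  weight wherever the averaging interval lies.\<close>

lemma eventually_pos_of_finite:
  assumes e: "0 < e" and fin: "finite {n. h n < (e::real)}"
  shows "\<exists>N0. \<forall>N\<ge>N0. \<forall>n. 0 < (smooth ^^ N) h n"
proof -
  let ?K = "{n. h n < e}"
  define B where "B = (\<Sum>n\<in>?K. \<bar>h n\<bar>)"
  have B: "0 \<le> B" by (simp add: B_def sum_nonneg)
  have hB: "- B \<le> h n" for n
  proof (cases "n \<in> ?K")
    case True
    then have "\<bar>h n\<bar> \<le> B" unfolding B_def using fin by (intro member_le_sum) auto
    then show ?thesis by linarith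
  qed (use e B in auto)
  \<comment> \<open>Since \<open>h\<close> is at least \<open>- B\<close>, an exceptional index
    costs at most \<open>e + B\<close> times its weight. With all weights at most \<open>d\<close>,
    the total loss stays below \<open>e\<close>.\<close>
  define d where "d = e / (2 * (e + B) * (real (card ?K) + 1))"
  have d: "0 < d" using e B by (simp add: d_def)
  have dK: "(e + B) * (real (card ?K) * d) < e"
  proof -
    have "(e + B) * ((real (card ?K) + 1) * d) = e / 2"
    proof -
      define k where "k = real (card ?K) + 1"
      define m where "m = e + B"
      have "0 < k" "0 < m" using e B by (auto simp: k_def m_def)
      moreover have "d = e / (2 * m * k)" by (simp add: d_def k_def m_def)
      ultimately have "m * (k * d) = e / 2" by simp
      then show ?thesis by (simp only: k_def m_def)
    qed
    moreover have "(e + B) * (real (card ?K) * d) \<le> (e + B) * ((real (card ?K) + 1) * d)"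
      using e B d by (intro mult_left_mono mult_right_mono) auto
    ultimately show ?thesis using e by simp
  qed
  obtain N where N: "\<And>j. real (N choose j) / 2 ^ N \<le> d" using binomial_small[OF d] by blast
  have "0 < (smooth ^^ N) h n" for n
  proof -
    let ?b = "\<lambda>j. real (N choose j) / 2 ^ N"
    let ?J = "{j\<in>{..N}. n + int j \<in> ?K}"
    have one: "(\<Sum>j\<le>N. ?b j) = 1"
    proof -
      have "(\<Sum>j\<le>N. real (N choose j)) = 2 ^ N"
        using arg_cong[OF choose_row_sum[of N], of real] by simp
      then show ?thesis by (simp add: sum_divide_distrib[symmetric])
    qed
    have "card ?J \<le> card ?K"
      by (rule card_inj_on_le[of "\<lambda>j. n + int j"]) (use fin in \<open>auto simp: inj_on_def\<close>)
    have "(\<Sum>j\<in>?J. ?b j) \<le> (\<Sum>j\<in>?J. d)" by (rule sum_mono) (rule N)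
    also have "\<dots> = real (card ?J) * d" by simp
    also have "\<dots> \<le> real (card ?K) * d" using \<open>card ?J \<le> card ?K\<close> d by (intro mult_right_mono) auto
    finally have J: "(\<Sum>j\<in>?J. ?b j) \<le> real (card ?K) * d" .
    have "(\<Sum>j\<le>N. if n + int j \<in> ?K then ?b j else 0) = (\<Sum>j\<in>?J. ?b j)"
      by (rule sum.inter_filter[symmetric]) simp
    then have s: "(\<Sum>j\<le>N. ?b j * (e - (e + B) * (if n + int j \<in> ?K then 1 else 0)))
        = e - (e + B) * (\<Sum>j\<in>?J. ?b j)"
    proof -
      assume a: "(\<Sum>j\<le>N. if n + int j \<in> ?K then ?b j else 0) = (\<Sum>j\<in>?J. ?b j)"
      have "(\<Sum>j\<le>N. ?b j * (e - (e + B) * (if n + int j \<in> ?K then 1 else 0)))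
        = (\<Sum>j\<le>N. e * ?b j - (e + B) * (if n + int j \<in> ?K then ?b j else 0))"
        by (rule sum.cong) (auto simp: algebra_simps)
      also have "\<dots> = e * (\<Sum>j\<le>N. ?b j) - (e + B) * (\<Sum>j\<le>N. if n + int j \<in> ?K then ?b j else 0)"
        by (simp only: sum_subtractf sum_distrib_left)
      finally show ?thesis using a one by simp
    qed
    have "e - (e + B) * (\<Sum>j\<in>?J. ?b j) \<le> (\<Sum>j\<le>N. ?b j * h (n + int j))"
      unfolding s[symmetric]
      by (intro sum_mono mult_left_mono) (use hB in \<open>auto simp: not_less\<close>)
    moreover have "(e + B) * (\<Sum>j\<in>?J. ?b j) < e"
      using mult_left_mono[OF J, of "e + B"] dK e B by linarith
    ultimately have "0 < (\<Sum>j\<le>N. ?b j * h (n + int j))" by linarith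
    then show ?thesis unfolding smooth_sum by (simp add: sum_divide_distrib)
  qed
  then show ?thesis using smooth_mono_pos by blast
qed

text \<open>Smoothing does not commute with multiplication by the index; the commutator is a shift.\<close>
lemma smooth_index: "(smooth ^^ Suc N) (\<lambda>m. real_of_int m * h m) n =
    real_of_int n * (smooth ^^ Suc N) h n + (real N + 1) / 2 * (smooth ^^ N) h (n + 1)"
proof (induction N arbitrary: n)
  case (Suc N)
  show ?case
    unfolding smooth_pow_Suc[of "Suc N"] Suc.IH unfolding smooth_pow_Suc[of N] by (simp add: field_simps)
qed (simp add: smooth_def field_simps)

text \<open>The first condition is linear in \<open>H\<close>, hence inherited by averages, and it rules out
  \<open>H n \<ge> 0 \<ge> H (n + 1)\<close>.\<close>
definition crossing :: "nat \<Rightarrow> (int \<Rightarrow> real) \<Rightarrow> bool" where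
  "crossing N H \<longleftrightarrow> (\<forall>n. 0 < real_of_int n * H n + (real_of_int n + real N + 1) * H (n + 1)) \<and>
     (\<forall>n\<ge>1. 0 < H n) \<and> (\<forall>n. n + int N \<le> -1 \<longrightarrow> H n < 0)"

lemma crossing_step: "crossing N H \<Longrightarrow> 0 \<le> H n \<Longrightarrow> 0 < H (n + 1)"
proof -
  assume c: "crossing N H" and h: "0 \<le> H n"
  show ?thesis
  proof (cases "n \<ge> 0")
    case True then show ?thesis using c by (simp add: crossing_def)
  next
    case False
    have "\<not> n + int N \<le> -1" using c h by (force simp: crossing_def)
    then have p: "0 < real_of_int n + real N + 1" by linarith
    have "real_of_int n * H n \<le> 0" using False h by (simp add: mult_nonpos_nonneg)
    then have "0 < (real_of_int n + real N + 1) * H (n + 1)" using c unfolding crossing_def by (smt (verit))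
    then show ?thesis using p by (simp add: zero_less_mult_iff)
  qed
qed

lemma crossing_comb:
  assumes "crossing N H" "crossing N K" "0 \<le> a" "0 \<le> b" "0 < a + b"
  shows "crossing N (\<lambda>n. a * H n + b * K n)"
proof -
  have p: "0 < a * x + b * y" if "0 < x" "0 < y" for x y :: real
    using that assms by (smt (verit) mult_nonneg_nonneg mult_pos_pos)
  have 1: "real_of_int n * (a * H n + b * K n) + (real_of_int n + real N + 1) * (a * H (n + 1) + b * K (n + 1))
     = a * (real_of_int n * H n + (real_of_int n + real N + 1) * H (n + 1)) +
       b * (real_of_int n * K n + (real_of_int n + real N + 1) * K (n + 1))" for n
    by (simp add: algebra_simps)
  have 2: "a * x + b * y < 0" if "x < 0" "y < 0" for x y :: real
    using p[of "- x" "- y"] that by simp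
  show ?thesis using assms(1,2) unfolding crossing_def 1 by (auto intro: p 2)
qed

text \<open>The product of \<open>m\<close> and \<open>h m\<close> is at least 1 outside a finite
  interval, so its averages become positive; through \<open>smooth_index\<close> this is the linear
  condition in \<open>crossing\<close>. The two sign conditions come from one-sided truncations of
  \<open>h\<close>.\<close>

lemma eventually_crossing:
  assumes hp: "\<And>m. m \<ge> M0 \<Longrightarrow> 1 \<le> h m" and hm: "\<And>m. m \<le> - M0 \<Longrightarrow> h m \<le> -1"
  shows "\<exists>N0. \<forall>N\<ge>N0. crossing N ((smooth ^^ N) h)"
proof -
  define L where "L = max 1 \<bar>M0\<bar>"
  have L: "1 \<le> L" "M0 \<le> L" "- L \<le> - M0" "- L \<le> -1" by (auto simp: L_def)
  have "1 \<le> real_of_int m * h m" if "m \<notin> {-L..L}" for m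
  proof (cases "m > L")
    case True
    then have "1 \<le> real_of_int m" "1 \<le> h m" using L hp[of m] by (linarith, simp)
    then show ?thesis using mult_mono[of 1 "real_of_int m" 1 "h m"] by simp
  next
    case False
    then have "m < - L" using that by simp
    then have "real_of_int m \<le> -1" "h m \<le> -1" using L hm[of m] by (linarith, simp)
    then show ?thesis using mult_mono[of 1 "- real_of_int m" 1 "- h m"] by simp
  qed
  then have "{m. real_of_int m * h m < 1} \<subseteq> {-L..L}" by force
  then have "finite {m. real_of_int m * h m < 1}" by (rule finite_subset) simp
  then obtain N1 where N1: "\<And>N n. N \<ge> N1 \<Longrightarrow> 0 < (smooth ^^ N) (\<lambda>m. real_of_int m * h m) n"
    using eventually_pos_of_finite[OF zero_less_one, of "\<lambda>m. real_of_int m * h m"] by blast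
  \<comment> \<open>The average at \<open>n\<close> involves only the indices from \<open>n\<close>
    to \<open>n + N\<close>. Replacing \<open>h\<close> by 1 below index 1 hence leaves the averages
    at \<open>n \<ge> 1\<close> unchanged; \<open>hl\<close> treats \<open>n + N \<le> -1\<close> in
    the same way, with the sign reversed.\<close>
  define hr where "hr = (\<lambda>m. if m \<ge> 1 then h m else 1)"
  have "1 \<le> hr m" if "m \<notin> {-L..L}" for m using hp[of m] L that by (auto simp: hr_def)
  then have "{m. hr m < 1} \<subseteq> {-L..L}" by force
  then have "finite {m. hr m < 1}" by (rule finite_subset) simp
  then obtain N2 where N2: "\<And>N n. N \<ge> N2 \<Longrightarrow> 0 < (smooth ^^ N) hr n"
    using eventually_pos_of_finite[OF zero_less_one] by blast
  define hl where "hl = (\<lambda>m. if m \<le> -1 then - h m else 1)"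
  have "1 \<le> hl m" if "m \<notin> {-L..L}" for m using hm[of m] L that by (auto simp: hl_def)
  then have "{m. hl m < 1} \<subseteq> {-L..L}" by force
  then have "finite {m. hl m < 1}" by (rule finite_subset) simp
  then obtain N3 where N3: "\<And>N n. N \<ge> N3 \<Longrightarrow> 0 < (smooth ^^ N) hl n"
    using eventually_pos_of_finite[OF zero_less_one] by blast
  have "crossing N ((smooth ^^ N) h)" if N: "N \<ge> max N1 (max N2 N3)" for N
    unfolding crossing_def
  proof (intro conjI allI impI)
    fix n
    \<comment> \<open>\<open>smooth_index\<close> mixes the orders \<open>N\<close> and
      \<open>N + 1\<close>; expanding one smoothing step and doubling gives the condition at order
      \<open>N\<close>.\<close>
    have "0 < (smooth ^^ Suc N) (\<lambda>m. real_of_int m * h m) n" using N1[of "Suc N"] N by simp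
    then have "0 < real_of_int n * (smooth ^^ Suc N) h n + (real N + 1) / 2 * (smooth ^^ N) h (n + 1)"
      unfolding smooth_index .
    then show "0 < real_of_int n * (smooth ^^ N) h n + (real_of_int n + real N + 1) * (smooth ^^ N) h (n + 1)"
      unfolding smooth_pow_Suc by (simp add: field_simps)
  next
    fix n :: int assume n: "1 \<le> n"
    have "(smooth ^^ N) hr n = (smooth ^^ N) h n" unfolding smooth_sum using n by (simp add: hr_def)
    then show "0 < (smooth ^^ N) h n" using N2[of N n] N by simp
  next
    fix n assume n: "n + int N \<le> -1"
    have "(smooth ^^ N) hl n = (smooth ^^ N) (\<lambda>m. - h m) n" unfolding smooth_sum
      by (rule arg_cong[of _ _ "\<lambda>x. x / 2 ^ N"], rule sum.cong) (use n in \<open>auto simp: hl_def\<close>)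
    then show "(smooth ^^ N) h n < 0" using N3[of N n] N by (simp add: smooth_uminus)
  qed
  then show ?thesis by blast
qed

lemma window_periodic:
  assumes "\<And>n. g (n + int M) = (g n :: real)"
  shows "(\<Sum>j<M. g (n + int j)) = (\<Sum>j<M. g (int j))"
proof -
  have step: "(\<Sum>j<M. g (k + 1 + int j)) = (\<Sum>j<M. g (k + int j))" for k
  proof -
    have "g k + (\<Sum>j<M. g (k + int (Suc j))) = (\<Sum>j<Suc M. g (k + int j))"
      by (subst sum.lessThan_Suc_shift) simp
    also have "\<dots> = (\<Sum>j<M. g (k + int j)) + g k" using assms[of k] by simp
    finally show ?thesis by (simp add: algebra_simps)
  qed
  show ?thesis
  proof (induction n rule: int_induct[where k = 0])
    case (step1 i) then show ?case using step[of i] by simp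
  next
    case (step2 i) then show ?case using step[of "i - 1"] by simp
  qed simp
qed

lemma smooth_periodic:
  assumes "\<And>n. h (n + k) = (h n :: real)"
  shows "(smooth ^^ N) h (n + k) = (smooth ^^ N) h n"
  using smooth_shift[of N h k n] assms by simp

lemma smooth_window: "(smooth ^^ N) (window M h) = window M ((smooth ^^ N) h)"
proof (induction N)
  case (Suc N)
  have "(smooth ^^ Suc N) (window M h) = smooth (window M ((smooth ^^ N) h))" using Suc by simp
  also have "\<dots> = window M ((smooth ^^ Suc N) h)"
    by (rule ext) (simp add: smooth_def window_def sum.distrib sum_divide_distrib[symmetric] add_divide_distrib algebra_simps)
  finally show ?case .
qed simp

lemma smooth_const: "(smooth ^^ N) (\<lambda>n. c) = (\<lambda>n. c)"
  by (induction N) (auto simp: smooth_def)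

text \<open>A block of \<open>M\<close> smoothing steps meets every residue class modulo
  \<open>M\<close>, each with weight at least \<open>1 / 2^M\<close>. The possible deficit below the
  mean \<open>c\<close> therefore shrinks by the factor \<open>th\<close> with every block.\<close>

lemma eventually_pos_of_periodic:
  assumes M: "0 < M" and per: "\<And>n. h (n + int M) = (h n :: real)" and sum: "0 < (\<Sum>j<M. h (int j))"
  shows "\<exists>N0. \<forall>N\<ge>N0. \<forall>n. 0 < (smooth ^^ N) h n"
proof -
  define s where "s = (\<Sum>j<M. h (int j))"
  define c where "c = s / real M"
  define th where "th = 1 - real M / 2 ^ M"
  have lt: "real M < 2 ^ M" using less_exp[of M] by (metis of_nat_less_iff of_nat_numeral of_nat_power)
  then have th: "0 \<le> th" "th < 1" using M by (auto simp: th_def field_simps)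
  have sumN: "(\<Sum>j<M. (smooth ^^ N) h (int j)) = s" for N
  proof (induction N)
    case (Suc N)
    have "(\<Sum>j<M. (smooth ^^ N) h (1 + int j)) = (\<Sum>j<M. (smooth ^^ N) h (int j))"
      by (rule window_periodic) (rule smooth_periodic[where h = h and k = "int M", OF per])
    then show ?case using Suc unfolding smooth_pow_Suc
      by (simp add: sum.distrib sum_divide_distrib[symmetric] add.commute)
  qed (simp add: s_def)
  define D where "D = (\<Sum>j<M. \<bar>h (int j)\<bar>) + \<bar>c\<bar>"
  have lo: "c - D \<le> h n" for n
  proof -
    have "h n = h (n mod int M)"
    proof -
      have "h (i + int M * k) = h i" for i k
      proof (induction k rule: int_induct[where k = 0])
        case (step1 k) then show ?case using per[of "i + int M * k"] by (simp add: algebra_simps)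
      next
        case (step2 k) then show ?case using per[of "i + int M * (k - 1)"] by (simp add: algebra_simps)
      qed simp
      from this[of "n mod int M" "n div int M"] show ?thesis by (simp add: mult.commute)
    qed
    moreover have "n mod int M = int (nat (n mod int M))" "nat (n mod int M) < M"
      using M by (auto simp: nat_less_iff)
    ultimately have "\<bar>h n\<bar> \<le> (\<Sum>j<M. \<bar>h (int j)\<bar>)"
      using member_le_sum[of "nat (n mod int M)" "{..<M}" "\<lambda>j. \<bar>h (int j)\<bar>"] by auto
    then show ?thesis unfolding D_def by linarith
  qed
  have bound: "c - th ^ k * D \<le> (smooth ^^ (k * M)) h n" for k n
  proof (induction k arbitrary: n)
    case 0 then show ?case using lo by simp
  next
    case (Suc k)
    let ?g = "(smooth ^^ (k * M)) h" and ?m = "c - th ^ k * D"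
    \<comment> \<open>Weight 1 is split off from each position \<open>j < M\<close>. These positions
      run over a full period and contribute exactly \<open>s\<close>; on the remaining weight, in
      total \<open>2^M - M\<close>, the previous lower bound \<open>?m\<close> is used.\<close>
    let ?i = "\<lambda>j. if j < M then 1 else (0::real)"
    have e: "(smooth ^^ (Suc k * M)) h = (smooth ^^ M) ?g" by (simp add: funpow_add)
    have w: "(\<Sum>j<M. ?g (n + int j)) = s"
      using window_periodic[of ?g M n] smooth_periodic[where h = h and k = "int M", OF per] sumN by simp
    have row: "(\<Sum>j\<le>M. real (M choose j)) = 2 ^ M"
      using arg_cong[OF choose_row_sum[of M], of real] by simp
    have ind: "(\<Sum>j\<le>M. ?i j * f j) = (\<Sum>j<M. f j)" for f :: "nat \<Rightarrow> real"
      by (simp add: lessThan_Suc_atMost[symmetric])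
    have "(\<Sum>j\<le>M. (real (M choose j) - ?i j) * ?m) \<le> (\<Sum>j\<le>M. (real (M choose j) - ?i j) * ?g (n + int j))"
    proof (intro sum_mono mult_left_mono)
      fix j assume "j \<in> {..M}"
      then have "0 < M choose j" by simp
      then have "1 \<le> real (M choose j)" by linarith
      then show "0 \<le> real (M choose j) - ?i j" by simp
    qed (rule Suc)
    moreover have "(\<Sum>j\<le>M. (real (M choose j) - ?i j) * ?m) = (2 ^ M - real M) * ?m"
      using ind[of "\<lambda>_. 1"] row by (simp add: sum_distrib_right[symmetric] sum_subtractf)
    moreover have "(\<Sum>j\<le>M. (real (M choose j) - ?i j) * ?g (n + int j)) =
       (\<Sum>j\<le>M. real (M choose j) * ?g (n + int j)) - s"
      using ind[of "\<lambda>j. ?g (n + int j)"] w by (simp add: left_diff_distrib sum_subtractf)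
    ultimately have "(s + (2 ^ M - real M) * ?m) / 2 ^ M \<le> (smooth ^^ M) ?g n"
      unfolding smooth_sum[of M ?g] by (intro divide_right_mono) auto
    moreover have "(s + (2 ^ M - real M) * ?m) / 2 ^ M = c - th ^ Suc k * D"
    proof -
      have "s = real M * c" using M by (simp add: c_def)
      then show ?thesis by (simp add: th_def field_simps)
    qed
    ultimately show ?case unfolding e by simp
  qed
  have c: "0 < c" using sum M by (simp add: c_def s_def)
  have lim: "(\<lambda>k. th ^ k * D) \<longlonglongrightarrow> 0 * D" by (intro tendsto_mult LIMSEQ_realpow_zero th tendsto_const)
  then have "\<forall>\<^sub>F k in sequentially. th ^ k * D < c" using c order_tendstoD(2)[OF lim, of c] by simp
  then obtain k where "th ^ k * D < c" by (auto simp: eventually_sequentially)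
  then have "0 < (smooth ^^ (k * M)) h n" for n using bound[of k n] by linarith
  then show ?thesis using smooth_mono_pos by blast
qed

definition blend :: "nat \<Rightarrow> nat \<Rightarrow> (int \<Rightarrow> real) \<Rightarrow> real \<Rightarrow> int \<Rightarrow> real" where
  "blend M N h s n = (1 - s) * (smooth ^^ N) h n + s * (smooth ^^ N) (window M h) n"

text \<open>The sign patterns allowed along the whole segment from the smoothed sequence to its
  smoothed window mean: a constant sign, or one crossing in a fixed direction. The last alternative
  constrains the end point only; that suffices, because a wall through the end point never has to be
  crossed.\<close>

definition tame :: "nat \<Rightarrow> nat \<Rightarrow> (int \<Rightarrow> real) \<Rightarrow> bool" where
  "tame M N h \<longleftrightarrow> (\<forall>s\<in>{0..1}. \<forall>n. 0 < blend M N h s n) \<or> (\<forall>s\<in>{0..1}. \<forall>n. blend M N h s n < 0) \<or>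
     (\<forall>s\<in>{0..1}. \<forall>n. 0 \<le> blend M N h s n \<longrightarrow> 0 < blend M N h s (n + 1)) \<or>
     (\<forall>s\<in>{0..1}. \<forall>n. blend M N h s n \<le> 0 \<longrightarrow> blend M N h s (n + 1) < 0) \<or>
     (\<forall>n. (smooth ^^ N) (window M h) n = 0)"

lemma window_uminus: "window M (\<lambda>n. - h n) = (\<lambda>n. - window M h n)"
  by (simp add: window_def sum_negf)

lemma blend_uminus: "blend M N (\<lambda>n. - h n) s n = - blend M N h s n"
  by (simp add: blend_def window_uminus smooth_uminus)

lemma tame_uminus: "tame M N (\<lambda>n. - h n) \<longleftrightarrow> tame M N h"
  unfolding tame_def blend_uminus window_uminus smooth_uminus by auto

lemma window_ge: "0 < M \<Longrightarrow> (\<And>j. j < M \<Longrightarrow> 1 \<le> h (n + int j)) \<Longrightarrow> 1 \<le> window M h n"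
  unfolding window_def using sum_mono[of "{..<M}" "\<lambda>_. 1" "\<lambda>j. h (n + int j)"] by (simp add: field_simps)

lemma window_le: "0 < M \<Longrightarrow> (\<And>j. j < M \<Longrightarrow> h (n + int j) \<le> -1) \<Longrightarrow> window M h n \<le> -1"
  using window_ge[of M "\<lambda>n. - h n" n] by (simp add: window_uminus)

lemma blend_pos: "\<forall>n. 0 < (smooth ^^ N) h n \<Longrightarrow> \<forall>n. 0 < (smooth ^^ N) (window M h) n \<Longrightarrow>
    s \<in> {0..1} \<Longrightarrow> 0 < blend M N h s n"
proof -
  assume a: "\<forall>n. 0 < (smooth ^^ N) h n" "\<forall>n. 0 < (smooth ^^ N) (window M h) n" "s \<in> {0..1}"
  have "0 \<le> (1 - s) * (smooth ^^ N) h n" "0 \<le> s * (smooth ^^ N) (window M h) n"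
    "0 < (1 - s) * (smooth ^^ N) h n \<or> 0 < s * (smooth ^^ N) (window M h) n"
    using a(3) a(1)[rule_format, of n] a(2)[rule_format, of n] by (auto simp: zero_less_mult_iff)
  then show ?thesis unfolding blend_def by linarith
qed

lemma tame_const: "0 < M \<Longrightarrow> \<forall>n. 1 \<le> h n \<Longrightarrow> tame M N h"
proof -
  assume M: "0 < M" and h: "\<forall>n. 1 \<le> h n"
  have "0 < (smooth ^^ N) g n" if "\<forall>n. 1 \<le> g n" for g n
    using smooth_mono_pos[of 0 g N n] that by (simp add: less_le_trans[OF zero_less_one])
  then have "\<forall>s\<in>{0..1}. \<forall>n. 0 < blend M N h s n" using h window_ge[OF M, of h] by (intro ballI allI blend_pos) auto
  then show ?thesis by (simp add: tame_def)
qed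

text \<open>Equal signs at both ends leave finitely many exceptional indices. Opposite signs give a
  \<open>crossing\<close>, whose linear form passes it on to every blend.\<close>

lemma eventually_tame_aux:
  assumes M: "0 < M" and R: "\<And>m. R \<le> m \<Longrightarrow> 1 \<le> h m"
    and L: "(\<forall>m\<le>L. 1 \<le> h m) \<or> (\<forall>m\<le>L. h m \<le> -1)"
  shows "\<exists>N0. \<forall>N\<ge>N0. tame M N h"
proof -
  define K where "K = max \<bar>R\<bar> \<bar>L\<bar> + int M"
  have K: "R \<le> K" "- K \<le> L - int M" "0 \<le> K" by (auto simp: K_def)
  show ?thesis
  proof (cases "\<forall>m\<le>L. 1 \<le> h m")
    case True
    have 1: "1 \<le> h m" "1 \<le> window M h m" if "m \<notin> {-K..K}" for m
    proof -
      have "1 \<le> h (m + int j)" if "j < M \<or> j = 0" for j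
        using R[of "m + int j"] True K \<open>m \<notin> {-K..K}\<close> that by (cases "m > K") auto
      then show "1 \<le> h m" "1 \<le> window M h m" using window_ge[OF M, of h m] by (force, auto)
    qed
    have "{m. h m < 1} \<subseteq> {-K..K}" "{m. window M h m < 1} \<subseteq> {-K..K}" using 1 by (force, force)
    then have fin: "finite {m. h m < 1}" "finite {m. window M h m < 1}" by (auto intro: finite_subset)
    obtain N1 N2 where "\<And>N n. N \<ge> N1 \<Longrightarrow> 0 < (smooth ^^ N) h n"
      "\<And>N n. N \<ge> N2 \<Longrightarrow> 0 < (smooth ^^ N) (window M h) n"
      using eventually_pos_of_finite[OF zero_less_one fin(1)] eventually_pos_of_finite[OF zero_less_one fin(2)]
      by blast
    then have "tame M N h" if "N \<ge> max N1 N2" for N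
      using that blend_pos[of N h M] by (auto simp: tame_def)
    then show ?thesis by blast
  next
    case False
    then have L': "\<And>m. m \<le> L \<Longrightarrow> h m \<le> -1" using L by auto
    have w: "1 \<le> window M h m" if "m \<ge> K" for m using window_ge[OF M, of h m] R K that by auto
    have w': "window M h m \<le> -1" if "m \<le> - K" for m using window_le[OF M, of h m] L' K that by auto
    obtain N1 where N1: "\<And>N. N \<ge> N1 \<Longrightarrow> crossing N ((smooth ^^ N) h)"
    proof -
      have "1 \<le> h m" if "m \<ge> K" for m using R[of m] K that by simp
      moreover have "h m \<le> -1" if "m \<le> - K" for m using L'[of m] K that by simp
      ultimately show ?thesis using eventually_crossing[of K h] that by blast
    qed
    obtain N2 where N2: "\<And>N. N \<ge> N2 \<Longrightarrow> crossing N ((smooth ^^ N) (window M h))"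
      using eventually_crossing[of K "window M h"] w w' by blast
    have "tame M N h" if "N \<ge> max N1 N2" for N
    proof -
      have "crossing N (blend M N h s)" if "s \<in> {0..1}" for s
      proof -
        have "crossing N (\<lambda>n. (1 - s) * (smooth ^^ N) h n + s * (smooth ^^ N) (window M h) n)"
          by (rule crossing_comb) (use N1[of N] N2[of N] \<open>N \<ge> max N1 N2\<close> that in auto)
        then show ?thesis by (simp add: blend_def[abs_def])
      qed
      then show ?thesis using crossing_step unfolding tame_def by blast
    qed
    then show ?thesis by blast
  qed
qed

lemma eventually_tame:
  assumes M: "0 < M" and R: "(\<forall>m\<ge>R. 1 \<le> h m) \<or> (\<forall>m\<ge>R. h m \<le> -1)"
    and L: "(\<forall>m\<le>L. 1 \<le> h m) \<or> (\<forall>m\<le>L. h m \<le> -1)"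
  shows "\<exists>N0. \<forall>N\<ge>N0. tame M N h"
proof (cases "\<forall>m\<ge>R. 1 \<le> h m")
  case True then show ?thesis using eventually_tame_aux[OF M _ L] by blast
next
  case False
  have "\<exists>N0. \<forall>N\<ge>N0. tame M N (\<lambda>n. - h n)"
    by (rule eventually_tame_aux[OF M, of R _ L]) (use False R L in auto)
  then show ?thesis by (simp add: tame_uminus)
qed

text \<open>The mean over a period is the constant \<open>c\<close>. If \<open>c\<close> is nonzero,
  smoothing gives the whole orbit its sign; if it is zero, the last alternative of
  \<open>tame\<close> applies.\<close>

lemma eventually_tame_periodic:
  assumes M: "0 < M" and per: "\<And>n. h (n + int M) = h n"
  shows "\<exists>N0. \<forall>N\<ge>N0. tame M N h"
proof -
  define c where "c = (\<Sum>j<M. h (int j)) / real M"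
  have w: "window M h = (\<lambda>n. c)" using window_periodic[of h M, OF per] by (simp add: window_def c_def)
  have pos: "\<exists>N0. \<forall>N\<ge>N0. tame M N g"
    if g: "\<And>n. g (n + int M) = g n" "0 < (\<Sum>j<M. g (int j))" for g
  proof -
    have "window M g = (\<lambda>n. (\<Sum>j<M. g (int j)) / real M)" using window_periodic[of g M, OF g(1)] by (simp add: window_def)
    then have "\<forall>n. 0 < (smooth ^^ N) (window M g) n" for N using g(2) M by (simp add: smooth_const)
    moreover obtain N0 where "\<And>N n. N \<ge> N0 \<Longrightarrow> 0 < (smooth ^^ N) g n"
      using eventually_pos_of_periodic[OF M g] by blast
    ultimately have "tame M N g" if "N \<ge> N0" for N using blend_pos[of N g M] that by (auto simp: tame_def)
    then show ?thesis by blast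
  qed
  consider "0 < c" | "c = 0" | "c < 0" by linarith
  then show ?thesis
  proof cases
    case 1 then show ?thesis using pos[of h] per M by (simp add: c_def zero_less_divide_iff)
  next
    case 2 then show ?thesis using w by (auto simp: tame_def smooth_const)
  next
    case 3
    then have "\<exists>N0. \<forall>N\<ge>N0. tame M N (\<lambda>n. - h n)"
      using pos[of "\<lambda>n. - h n"] per M by (simp add: c_def sum_negf divide_less_0_iff)
    then show ?thesis by (simp add: tame_uminus)
  qed
qed

lemma tame_shift: "tame M N (\<lambda>n. h (n + k)) \<longleftrightarrow> tame M N h"
proof -
  have w: "window M (\<lambda>n. h (n + k)) = (\<lambda>n. window M h (n + k))"
    by (simp add: window_def algebra_simps)
  have b: "blend M N (\<lambda>n. h (n + k)) s n = blend M N h s (n + k)" for s n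
    unfolding blend_def w by (simp add: smooth_shift)
  have b1: "blend M N h s (n + 1 + k) = blend M N h s (n + k + 1)" for s n by (simp add: algebra_simps)
  have all: "(\<forall>n. P (n + k)) \<longleftrightarrow> (\<forall>n. P n)" for P :: "int \<Rightarrow> bool"
    by (metis diff_add_cancel)
  show ?thesis unfolding tame_def b w smooth_shift b1
    using all[of "\<lambda>n. 0 < blend M N h s n" for s] all[of "\<lambda>n. blend M N h s n < 0" for s]
      all[of "\<lambda>n. 0 \<le> blend M N h s n \<longrightarrow> 0 < blend M N h s (n + 1)" for s]
      all[of "\<lambda>n. blend M N h s n \<le> 0 \<longrightarrow> blend M N h s (n + 1) < 0" for s]
      all[of "\<lambda>n. (smooth ^^ N) (window M h) n = 0"] by simp
qed

text \<open>Read along the orbit of a point: a wall contains all translates of the point or none,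
  and in the latter case it is crossed at most once.\<close>

definition clean :: "(int \<Rightarrow> real) \<Rightarrow> bool" where
  "clean H \<longleftrightarrow> (\<forall>n. H n = 0) \<or> (\<forall>n. 0 < H n) \<or> (\<forall>n. H n < 0) \<or>
     ((\<forall>n. H n \<noteq> 0) \<and> (\<forall>n. 0 \<le> H n \<longrightarrow> 0 < H (n + 1))) \<or>
     ((\<forall>n. H n \<noteq> 0) \<and> (\<forall>n. H n \<le> 0 \<longrightarrow> H (n + 1) < 0))"

lemma step_pos_mono:
  fixes H :: "int \<Rightarrow> real"
  assumes "\<forall>n. 0 \<le> H n \<longrightarrow> 0 < (H (n + 1) :: real)" "0 \<le> H n" "n < m"
  shows "0 < H m"
proof -
  have "0 < H (n + 1 + int j)" for j
  proof (induction j)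
    case (Suc j)
    then have "0 < H (n + 1 + int j + 1)" using assms(1) less_imp_le by blast
    then show ?case by (simp add: algebra_simps)
  qed (use assms in auto)
  from this[of "nat (m - n - 1)"] show ?thesis using assms(3) by simp
qed

lemma clean_uminus: "clean (\<lambda>n. - H n) \<longleftrightarrow> clean H"
  unfolding clean_def by auto

lemma clean_zero: "clean H \<Longrightarrow> H n = 0 \<Longrightarrow> H m = 0"
  unfolding clean_def by (metis less_irrefl)

lemma clean_no_return:
  assumes "clean H" "i < j" "j < k" "H i < 0" "0 < H j" "H k < 0"
  shows False
proof -
  have n: "\<forall>n. H n \<le> 0 \<longrightarrow> H (n + 1) < 0 \<Longrightarrow> H j < 0"
    using step_pos_mono[of "\<lambda>n. - H n" i j] assms by simp
  have p: "\<forall>n. 0 \<le> H n \<longrightarrow> 0 < H (n + 1) \<Longrightarrow> 0 < H k"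
    using step_pos_mono[of H j k] assms by simp
  show False using assms n p unfolding clean_def by (smt (verit))
qed

text \<open>A sequence with one upward crossing may still vanish at one index, so it is mixed with
  its shift. The mixture can vanish only at the index where \<open>G\<close> passes from negative to
  positive, and there only for a single \<open>s\<close>.\<close>

lemma clean_shift_comb_aux:
  fixes G :: "int \<Rightarrow> real"
  assumes G: "\<forall>n. 0 \<le> G n \<longrightarrow> 0 < (G (n + 1) :: real)"
  shows "finite {s. 0 < s \<and> s < 1 \<and> (\<exists>n. (1 - s) * G n + s * G (n + 1) = 0)}" (is "finite ?B")
    and "0 < s \<Longrightarrow> s < 1 \<Longrightarrow> s \<notin> {s. 0 < s \<and> s < 1 \<and> (\<exists>n. (1 - s) * G n + s * G (n + 1) = 0)} \<Longrightarrow>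
      clean (\<lambda>n. (1 - s) * G n + s * G (n + 1))"
proof -
  have sg: "G n < 0 \<and> 0 < G (n + 1)" if s: "0 < s" "s < 1" and e: "(1 - s) * G n + s * G (n + 1) = 0" for s n
  proof -
    have "\<not> 0 \<le> G n"
    proof
      assume "0 \<le> G n"
      then have "0 < s * G (n + 1)" "0 \<le> (1 - s) * G n" using G s by auto
      then show False using e by linarith
    qed
    moreover from this have "(1 - s) * G n < 0" using s by (simp add: mult_pos_neg)
    then have "0 < s * G (n + 1)" using e by linarith
    then have "0 < G (n + 1)" using s by (simp add: zero_less_mult_iff)
    ultimately show ?thesis by simp
  qed
  have single: "s = s'" if ss: "s \<in> ?B" "s' \<in> ?B" for s s'
  proof -
    obtain n where n: "(1 - s) * G n + s * G (n + 1) = 0" using ss(1) by blast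
    obtain m where m: "(1 - s') * G m + s' * G (m + 1) = 0" using ss(2) by blast
    have a: "G n < 0 \<and> 0 < G (n + 1)" "G m < 0 \<and> 0 < G (m + 1)"
      using sg[OF _ _ n] sg[OF _ _ m] ss by auto
    have "\<not> i < j" if "0 < G (i + 1)" "G j < 0" for i j
      using step_pos_mono[OF G, of "i + 1" j] that by (cases "j = i + 1") auto
    then have nm: "n = m" using a by (meson linorder_neqE)
    have "(s - s') * (G (n + 1) - G n) = 0" using n m unfolding nm by (simp add: algebra_simps)
    then show ?thesis using a nm by simp
  qed
  show "finite ?B"
  proof (cases "?B = {}")
    case False
    then obtain x where x: "x \<in> ?B" by blast
    have "?B \<subseteq> {x}" using single[OF _ x] by blast
    then show ?thesis by (rule finite_subset) simp
  qed (simp only: finite.emptyI)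
  assume s: "0 < s" "s < 1" "s \<notin> ?B"
  have "0 < (1 - s) * G (n + 1) + s * G (n + 1 + 1)" if "0 \<le> (1 - s) * G n + s * G (n + 1)" for n
  proof -
    have "0 < G (n + 1)"
    proof (rule ccontr)
      assume "\<not> 0 < G (n + 1)"
      then have "G n < 0" "G (n + 1) \<le> 0" using G by (force, simp)
      then have "(1 - s) * G n < 0" "s * G (n + 1) \<le> 0" using s by (auto simp: mult_pos_neg mult_nonneg_nonpos)
      then show False using that by linarith
    qed
    moreover from this have "0 < G (n + 1 + 1)" using G less_imp_le by blast
    ultimately show ?thesis using s by (simp add: add_pos_pos)
  qed
  then show "clean (\<lambda>n. (1 - s) * G n + s * G (n + 1))" using s unfolding clean_def by blast
qed

lemma tame_imp_clean:
  assumes "tame M N h"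
  obtains B where "finite B"
    "\<And>s. 0 < s \<Longrightarrow> s < 1 \<Longrightarrow> s \<notin> B \<Longrightarrow>
      clean (\<lambda>n. (1 - s) * (smooth ^^ N) (window M h) n + s * (smooth ^^ N) (window M h) (n + 1))"
proof -
  define G where "G = (smooth ^^ N) (window M h)"
  have b: "blend M N h 1 n = G n" for n by (simp add: blend_def G_def)
  have one: "(1::real) \<in> {0..1}" by simp
  have "(\<forall>n. 0 < G n) \<or> (\<forall>n. G n < 0) \<or> (\<forall>n. 0 \<le> G n \<longrightarrow> 0 < G (n + 1)) \<or>
     (\<forall>n. G n \<le> 0 \<longrightarrow> G (n + 1) < 0) \<or> (\<forall>n. G n = 0)"
    using assms one unfolding tame_def b[symmetric] G_def[symmetric] by blast
  then consider "\<forall>n. 0 < G n" | "\<forall>n. G n < 0" | "\<forall>n. G n = 0" | "\<forall>n. 0 \<le> G n \<longrightarrow> 0 < G (n + 1)"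
    | "\<forall>n. G n \<le> 0 \<longrightarrow> G (n + 1) < 0" by blast
  then have "\<exists>B. finite B \<and> (\<forall>s. 0 < s \<longrightarrow> s < 1 \<longrightarrow> s \<notin> B \<longrightarrow> clean (\<lambda>n. (1 - s) * G n + s * G (n + 1)))"
  proof cases
    case 1
    then have "clean (\<lambda>n. (1 - s) * G n + s * G (n + 1))" if "0 < s" "s < 1" for s
      using that by (auto simp: clean_def add_pos_pos)
    then show ?thesis by blast
  next
    case 2
    then have "clean (\<lambda>n. (1 - s) * G n + s * G (n + 1))" if "0 < s" "s < 1" for s
      using that by (auto simp: clean_def add_neg_neg mult_pos_neg)
    then show ?thesis by blast
  next
    case 3
    then show ?thesis by (auto simp: clean_def)
  next
    case 4
    show ?thesis using clean_shift_comb_aux[OF 4] by blast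
  next
    case 5
    then have 6: "\<forall>n. 0 \<le> - G n \<longrightarrow> 0 < - G (n + 1)" by simp
    have e: "(\<lambda>n. (1 - s) * - G n + s * - G (n + 1)) = (\<lambda>n. - ((1 - s) * G n + s * G (n + 1)))" for s
      by (simp add: algebra_simps)
    show ?thesis
      using clean_shift_comb_aux[of "\<lambda>n. - G n", OF 6, unfolded e clean_uminus] by blast
  qed
  then show ?thesis using that G_def by blast
qed

section \<open>Cyclic shifts\<close>

context coxeter
begin

text \<open>An elementary cyclic shift; the descent condition makes the result no longer than
  \<open>w\<close>.\<close>

definition shift_step :: "'w \<Rightarrow> 'w \<Rightarrow> bool" where
  "shift_step w w' \<longleftrightarrow> (\<exists>s\<in>S. w' = s \<otimes> w \<otimes> s \<and> (len (s \<otimes> w) < len w \<or> len (w \<otimes> s) < len w))"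

abbreviation reach :: "'w \<Rightarrow> 'w \<Rightarrow> bool" where "reach \<equiv> shift_step\<^sup>*\<^sup>*"

lemma reach_carrier: "reach w w' \<Longrightarrow> w \<in> carrier W \<Longrightarrow> w' \<in> carrier W"
  by (induction rule: rtranclp_induct) (auto simp: shift_step_def)

definition lossless :: "'w \<Rightarrow> bool" where
  "lossless w \<longleftrightarrow> w \<in> carrier W \<and> (\<forall>w'. reach w w' \<longrightarrow> len w' = len w)"

lemma lossless_reach: "lossless w \<Longrightarrow> reach w w' \<Longrightarrow> lossless w'"
  unfolding lossless_def by (metis reach_carrier rtranclp_trans)

text \<open>The letters of \<open>k\<close> are carried from the front to the back one at a time.
  Each move is a cyclic shift, and losslessness forces the letter removed in front to lengthen the
  word again at the back, so the factorisation stays reduced.\<close>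

lemma prefix_reach:
  assumes "lossless (k \<otimes> v)" "k \<in> carrier W" "v \<in> carrier W" "len (k \<otimes> v) = len k + len v"
  shows "reach (k \<otimes> v) (v \<otimes> k)"
  using assms
proof (induction "len k" arbitrary: k v)
  case 0
  then have "k = \<one>" using len_0_iff by simp
  then show ?case using 0 by simp
next
  case (Suc n)
  obtain xs where xs: "set xs \<subseteq> S" "length xs = len k" "wprod xs = k" using reduced_word Suc(4) .
  then obtain s zs where zs: "xs = s # zs" using Suc(2) by (cases xs) auto
  define k' where "k' = wprod zs"
  have s: "s \<in> S" "k' \<in> carrier W" "k = s \<otimes> k'" using xs zs by (auto simp: k'_def)
  have "len k' \<le> n" using len_le[of zs] xs zs Suc(2) by (simp add: k'_def)
  then have l: "len k' = n" using len_left_cases[of s k'] s Suc(2) by auto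
  let ?w = "k \<otimes> v" and ?w1 = "k' \<otimes> (v \<otimes> s)"
  have sw: "s \<otimes> ?w = k' \<otimes> v" using s Suc(5) by (simp add: m_assoc)
  have "len (s \<otimes> ?w) < len ?w" using len_mult_le[of k' v] s Suc(2,5,6) sw l by simp
  moreover have "?w1 = s \<otimes> ?w \<otimes> s" using sw s Suc(5) by (simp add: m_assoc)
  ultimately have st: "shift_step ?w ?w1" using s unfolding shift_step_def by blast
  then have ll: "lossless ?w1" using lossless_reach[OF Suc(3)] by blast
  have lw: "len ?w1 = len ?w" using Suc(3) st unfolding lossless_def by blast
  have "len ?w1 \<le> len k' + len (v \<otimes> s)" using len_mult_le[of k' "v \<otimes> s"] s Suc(5) by simp
  moreover have "len (v \<otimes> s) \<le> Suc (len v)" using len_right_cases[of s v] s Suc(5) by auto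
  ultimately have "len ?w1 = len k' + len (v \<otimes> s)" using lw Suc(2,6) l by simp
  then have "reach ?w1 ((v \<otimes> s) \<otimes> k')" using Suc(1)[of k' "v \<otimes> s"] l ll s Suc(5) by simp
  moreover have "(v \<otimes> s) \<otimes> k' = v \<otimes> k" using s Suc(5) by (simp add: m_assoc)
  ultimately show ?case using st by (metis converse_rtranclp_into_rtranclp)
qed

text \<open>The Weyl distance from the chamber \<open>u\<close> to the chamber \<open>w u\<close>;
  passing from \<open>u\<close> to \<open>u s\<close> conjugates it by \<open>s\<close>.\<close>

definition cj :: "'w \<Rightarrow> 'w \<Rightarrow> 'w" where "cj w u = inv u \<otimes> w \<otimes> u"

lemma cj_closed [simp]: "w \<in> carrier W \<Longrightarrow> u \<in> carrier W \<Longrightarrow> cj w u \<in> carrier W"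
  by (simp add: cj_def)

lemma mult_cj: "w \<in> carrier W \<Longrightarrow> u \<in> carrier W \<Longrightarrow> u \<otimes> cj w u = w \<otimes> u"
  by (simp add: cj_def m_assoc[symmetric])

lemma mult_inv_cj: "w \<in> carrier W \<Longrightarrow> u \<in> carrier W \<Longrightarrow> u \<otimes> inv (cj w u) = inv w \<otimes> u"
  by (simp add: cj_def inv_mult_group m_assoc[symmetric])

lemma cj_mult: "w \<in> carrier W \<Longrightarrow> u \<in> carrier W \<Longrightarrow> k \<in> carrier W \<Longrightarrow> cj w (u \<otimes> k) = inv k \<otimes> cj w u \<otimes> k"
  by (simp add: cj_def inv_mult_group m_assoc)

lemma act_act_cj:
  assumes "w \<in> carrier W" "u \<in> carrier W"
  shows "act w (act u f) = act u (act (cj w u) f)" "act (inv w) (act u f) = act u (act (inv (cj w u)) f)"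
  using assms by (simp_all add: act_mult[symmetric] mult_cj mult_inv_cj)

lemma not_pos_negv: "b \<in> roots \<Longrightarrow> \<not> posv b \<Longrightarrow> negv b"
  using roots_pos_or_neg by blast

text \<open>Among the chambers on minimal galleries from \<open>u\<close> to \<open>w u\<close>, one with the fewest walls between
  it and the new point contains that point.\<close>
lemma move_to_average:
  assumes w: "w \<in> carrier W" and u: "u \<in> carrier W" and q: "point q" and has: "chamber_has u q"
    and ll: "lossless (cj w u)" and s: "0 \<le> s" "s \<le> 1"
  shows "\<exists>u'\<in>carrier W. reach (cj w u) (cj w u') \<and>
    chamber_has u' (\<lambda>f. (1 - s) * q f + s * q (act (inv w) f))"
proof -
  let ?q = "\<lambda>f. (1 - s) * q f + s * q (act (inv w) f)"
  let ?w = "cj w u"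
  have wc: "?w \<in> carrier W" using w u by simp
  have q': "point ?q" by (rule point_comb) (use q point_act w s in auto)
  have lq: "linf q" using q by (simp add: point_def)
  let ?P = "\<lambda>k. k \<in> carrier W \<and> len ?w = len k + len (inv k \<otimes> ?w)"
  have "?P \<one>" using wc by simp
  then obtain k where k: "?P k" and min: "\<And>k'. ?P k' \<Longrightarrow> ndist ?q (u \<otimes> k) \<le> ndist ?q (u \<otimes> k')"
    using ex_has_least_nat[of ?P \<one> "\<lambda>k. ndist ?q (u \<otimes> k)"] by blast
  define v where "v = inv k \<otimes> ?w"
  have c: "k \<in> carrier W" "v \<in> carrier W" "u \<otimes> k \<in> carrier W" using k wc u by (auto simp: v_def)
  have kv: "?w = k \<otimes> v" using c wc by (simp add: v_def m_assoc[symmetric])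
  have "chamber_has (u \<otimes> k) ?q"
  proof (rule ccontr)
    assume "\<not> chamber_has (u \<otimes> k) ?q"
    then obtain r where r: "r \<in> S" "?q (act (u \<otimes> k) (bas r)) < 0" unfolding chamber_has_def by auto
    let ?a = "act (u \<otimes> k) (bas r)"
    \<comment> \<open>A wall with the averaged point on its far side has \<open>q\<close> or its
      translate there. These points lie in the chambers \<open>u\<close> and \<open>w u\<close>, so
      the wall separates \<open>u k\<close> from one of the two. Crossing it therefore stays on a
      minimal gallery between them.\<close>
    have two: "len (k \<otimes> r) < len k \<or> len (r \<otimes> v) < len v"
    proof (cases "q ?a < 0")
      case True
      have "q (act u (act k (bas r))) < 0" using True u c by (simp add: act_mult)
      then have "\<not> posv (act k (bas r))" using chamber_has_pos[OF has lq] by (metis not_less)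
      then show ?thesis using not_pos_negv root_sign[OF c(1) r(1)] rootsI[OF c(1) r(1)] by blast
    next
      case False
      have "q (act (inv w) ?a) < 0"
      proof (rule ccontr)
        assume "\<not> ?thesis"
        then have "0 \<le> s * q (act (inv w) ?a)" "0 \<le> (1 - s) * q ?a" using False s by auto
        then show False using r(2) by linarith
      qed
      moreover have "act (inv w) ?a = act u (act (inv v) (bas r))"
        using w u c act_act_cj(2)[OF w u] kv by (simp add: act_mult inv_mult_group)
      ultimately have "\<not> posv (act (inv v) (bas r))" using chamber_has_pos[OF has lq] by (metis not_less)
      then have "negv (act (inv v) (bas r))" using not_pos_negv[OF rootsI[of "inv v" r]] c r by simp
      then show ?thesis using left_root_sign[OF c(2) r(1)] by blast
    qed
    have e: "inv (k \<otimes> r) \<otimes> ?w = r \<otimes> v" using c r wc by (simp add: inv_mult_group v_def m_assoc)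
    have "len ?w \<le> len (k \<otimes> r) + len (r \<otimes> v)"
    proof -
      have "(k \<otimes> r) \<otimes> (r \<otimes> v) = ?w" using c r kv by (simp add: m_assoc)
      then show ?thesis using len_mult_le[of "k \<otimes> r" "r \<otimes> v"] c r by simp
    qed
    moreover have "len (k \<otimes> r) + len (r \<otimes> v) \<le> len k + len v"
      using two len_right_cases[OF r(1) c(1)] len_left_cases[OF r(1) c(2)] by auto
    ultimately have "?P (k \<otimes> r)" using e k c r by (simp add: v_def)
    then have "ndist ?q (u \<otimes> k) \<le> ndist ?q (u \<otimes> (k \<otimes> r))" by (rule min)
    moreover have "ndist ?q (u \<otimes> k \<otimes> r) < ndist ?q (u \<otimes> k)" by (rule ndist_step[OF q' c(3) r])
    ultimately show False using u c r by (simp add: m_assoc)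
  qed
  moreover have "reach ?w (cj w (u \<otimes> k))"
  proof -
    have e: "cj w (u \<otimes> k) = v \<otimes> k" using cj_mult[OF w u c(1)] by (simp add: v_def)
    have "len ?w = len k + len v" using k by (simp add: v_def)
    then have "reach (k \<otimes> v) (v \<otimes> k)" using prefix_reach[OF _ c(1,2)] ll kv by simp
    then show ?thesis unfolding e by (subst kv)
  qed
  ultimately show ?thesis using c(3) by blast
qed

text \<open>The first wall met on the way to \<open>q1\<close> is crossed, and \<open>cond\<close> makes that crossing a cyclic shift.\<close>
lemma move_along_segment:
  assumes w: "w \<in> carrier W" and u: "u \<in> carrier W" and q0: "point q0" and q1: "point q1"
    and has: "chamber_has u q0"
    and cond: "\<And>t b. 0 \<le> t \<Longrightarrow> t \<le> 1 \<Longrightarrow> b \<in> roots \<Longrightarrow> (1 - t) * q0 b + t * q1 b = 0 \<Longrightarrow> q1 b < 0 \<Longrightarrow>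
      (1 - t) * q0 (act (inv w) b) + t * q1 (act (inv w) b) < 0 \<or> (1 - t) * q0 (act w b) + t * q1 (act w b) < 0"
  shows "\<exists>u'\<in>carrier W. reach (cj w u) (cj w u') \<and> chamber_has u' q1"
proof -
  let ?m = "\<lambda>t f. (1 - t) * q0 f + t * q1 f"
  let ?P = "\<lambda>u'. u' \<in> carrier W \<and> reach (cj w u) (cj w u') \<and> (\<exists>t. 0 \<le> t \<and> t \<le> 1 \<and> chamber_has u' (?m t))"
  have "?P u" using u has by (auto simp: chamber_has_def intro!: exI[of _ 0])
  then obtain v where v: "?P v" and min: "\<And>v'. ?P v' \<Longrightarrow> ndist q1 v \<le> ndist q1 v'"
    using ex_has_least_nat[of ?P u "ndist q1"] by blast
  obtain t where t: "0 \<le> t" "t \<le> 1" "chamber_has v (?m t)" using v by blast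
  have vc: "v \<in> carrier W" using v by blast
  let ?a = "\<lambda>r. act v (bas r)"
  have "chamber_has v q1"
  proof (rule ccontr)
    assume n: "\<not> chamber_has v q1"
    let ?X = "{r \<in> S. q1 (?a r) < 0}"
    have X: "?X \<noteq> {}" "finite ?X" using n finite_S by (auto simp: chamber_has_def not_le)
    \<comment> \<open>The parameter at which the segment from the current point to \<open>q1\<close>
      meets the wall of \<open>?a r\<close>; the smallest one belongs to the first wall met.\<close>
    let ?l = "\<lambda>r. ?m t (?a r) / (?m t (?a r) - q1 (?a r))"
    obtain r where "is_arg_min ?l (\<lambda>r. r \<in> ?X) r"
      using ex_is_arg_min_if_finite[OF X(2,1), of ?l] by blast
    then have ia: "r \<in> ?X \<and> (\<forall>p. p \<in> ?X \<longrightarrow> ?l r \<le> ?l p)" by (rule iffD1[OF is_arg_min_linorder])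
    then have r: "r \<in> ?X" and rmin: "\<And>p. p \<in> ?X \<Longrightarrow> ?l r \<le> ?l p" by blast+
    define l where "l = ?l r"
    have m0: "0 \<le> ?m t (?a p)" if "p \<in> S" for p using t(3) that by (simp add: chamber_has_def)
    have rS: "r \<in> S" "q1 (?a r) < 0" using r by auto
    have d: "0 < ?m t (?a r) - q1 (?a r)" using m0[OF rS(1)] rS(2) by linarith
    have l: "0 \<le> l" "l \<le> 1" using d m0[OF rS(1)] rS(2) by (auto simp: l_def divide_le_eq_1)
    \<comment> \<open>Converts the parameter on the remaining piece of the segment into one on the
      whole segment from \<open>q0\<close> to \<open>q1\<close>.\<close>
    define t' where "t' = t + (1 - t) * l"
    have t': "0 \<le> t'" "t' \<le> 1"
    proof -
      show "0 \<le> t'" using t l by (simp add: t'_def)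
      have "(1 - t) * l \<le> (1 - t) * 1" using t l by (intro mult_left_mono) auto
      then show "t' \<le> 1" by (simp add: t'_def)
    qed
    have mt': "?m t' f = (1 - l) * ?m t f + l * q1 f" for f by (simp add: t'_def algebra_simps)
    have zero: "?m t' (?a r) = 0"
    proof -
      have "l * (?m t (?a r) - q1 (?a r)) = ?m t (?a r)" using d by (simp add: l_def)
      then show ?thesis unfolding mt' by (simp add: algebra_simps)
    qed
    have hast': "chamber_has v (?m t')" unfolding chamber_has_def
    proof
      fix p assume p: "p \<in> S"
      show "0 \<le> ?m t' (?a p)"
      proof (cases "p \<in> ?X")
        case True
        have d: "0 < ?m t (?a p) - q1 (?a p)" using m0[OF p] True by auto
        have "l \<le> ?l p" using rmin[OF True] by (simp add: l_def)
        then have "l * (?m t (?a p) - q1 (?a p)) \<le> ?m t (?a p)" using d by (simp add: pos_le_divide_eq)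
        then show ?thesis unfolding mt' by (simp add: algebra_simps)
      next
        case False
        then have "0 \<le> q1 (?a p)" using p by auto
        then have "0 \<le> (1 - l) * ?m t (?a p)" "0 \<le> l * q1 (?a p)" using m0[OF p] l by auto
        then show ?thesis unfolding mt' by linarith
      qed
    qed
    have pt': "point (?m t')" by (rule point_comb) (use q0 q1 t' in auto)
    have lin: "linf (?m t')" using pt' by (simp add: point_def)
    let ?w = "cj w v"
    have wc: "?w \<in> carrier W" using w vc by simp
    have "len (r \<otimes> ?w) < len ?w \<or> len (?w \<otimes> r) < len ?w"
    proof -
      consider "?m t' (act (inv w) (?a r)) < 0" | "?m t' (act w (?a r)) < 0"
        using cond[OF t' rootsI[OF vc rS(1)] zero rS(2)] by blast
      then show ?thesis
      proof cases
        case 1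
        then have "\<not> posv (act (inv ?w) (bas r))"
          using chamber_has_pos[OF hast' lin] unfolding act_act_cj(2)[OF w vc] by (metis not_less)
        then have "negv (act (inv ?w) (bas r))" using not_pos_negv[OF rootsI[of "inv ?w" r]] wc rS by simp
        then show ?thesis using left_root_sign[OF wc rS(1)] by blast
      next
        case 2
        then have "\<not> posv (act ?w (bas r))"
          using chamber_has_pos[OF hast' lin] unfolding act_act_cj(1)[OF w vc] by (metis not_less)
        then have "negv (act ?w (bas r))" using not_pos_negv[OF rootsI[of ?w r]] wc rS by simp
        then show ?thesis using root_sign[OF wc rS(1)] by blast
      qed
    qed
    then have "shift_step ?w (cj w (v \<otimes> r))"
      using rS cj_mult[OF w vc, of r] unfolding shift_step_def by auto
    then have reach': "reach (cj w u) (cj w (v \<otimes> r))" using v by (meson rtranclp.rtrancl_into_rtrancl)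
    \<comment> \<open>The point lies on the common wall, hence in the closed chamber on the other
      side too. Minimality of \<open>ndist\<close> is thereby contradicted at the same parameter
      \<open>t'\<close>.\<close>
    have "chamber_has (v \<otimes> r) (?m t')" unfolding chamber_has_def
    proof
      fix p assume p: "p \<in> S"
      have "act (v \<otimes> r) (bas p) = (\<lambda>x. 1 * ?a p x + gam r p * ?a r x)"
        using vc rS p act_lin[of v 1 "bas p" "gam r p" "bas r"] by (simp add: act_mult act_S refl_bas)
      then have "?m t' (act (v \<otimes> r) (bas p)) = 1 * ?m t' (?a p) + gam r p * ?m t' (?a r)"
        using linfD[OF lin, of 1 "?a p" "gam r p" "?a r"] by simp
      then show "0 \<le> ?m t' (act (v \<otimes> r) (bas p))" using zero hast' p by (simp add: chamber_has_def)
    qed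
    then have "?P (v \<otimes> r)" using vc rS reach' t' by auto
    then have "ndist q1 v \<le> ndist q1 (v \<otimes> r)" by (rule min)
    then show False using ndist_step[OF q1 vc rS] by simp
  qed
  then show ?thesis using v by blast
qed

end

section \<open>Straight conjugates\<close>

lemma eventually_constant_right:
  fixes P :: "int \<Rightarrow> bool"
  assumes "finite {n. P n \<noteq> P (n + 1)}"
  shows "\<exists>R. \<forall>m\<ge>R. P m = P R"
proof -
  obtain R where R: "\<And>n. n \<ge> R \<Longrightarrow> P n = P (n + 1)"
  proof (cases "{n. P n \<noteq> P (n + 1)} = {}")
    case True
    then have "P n = P (n + 1)" for n by blast
    then show ?thesis by (rule that)
  next
    case False
    have "P n = P (n + 1)" if n: "n \<ge> Max {n. P n \<noteq> P (n + 1)} + 1" for n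
    proof (rule ccontr)
      assume "P n \<noteq> P (n + 1)"
      then have "n \<le> Max {n. P n \<noteq> P (n + 1)}" by (intro Max_ge[OF assms]) simp
      then show False using n by simp
    qed
    then show ?thesis by (rule that)
  qed
  have "P m = P R" if "m \<ge> R" for m
    using that
  proof (induction m rule: int_ge_induct)
    case (step i) then show ?case using R[of i] by simp
  qed simp
  then show ?thesis by blast
qed

lemma eventually_constant_left:
  fixes P :: "int \<Rightarrow> bool"
  assumes "finite {n. P n \<noteq> P (n + 1)}"
  shows "\<exists>L. \<forall>m\<le>L. P m = P L"
proof -
  obtain L where L: "\<And>n. n < L \<Longrightarrow> P n = P (n + 1)"
  proof (cases "{n. P n \<noteq> P (n + 1)} = {}")
    case True
    then have "P n = P (n + 1)" for n by blast
    then show ?thesis by (rule that)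
  next
    case False
    have "P n = P (n + 1)" if n: "n < Min {n. P n \<noteq> P (n + 1)}" for n
    proof (rule ccontr)
      assume "P n \<noteq> P (n + 1)"
      then have "Min {n. P n \<noteq> P (n + 1)} \<le> n" by (intro Min_le[OF assms]) simp
      then show False using n by simp
    qed
    then show ?thesis by (rule that)
  qed
  have "P m = P L" if "m \<le> L" for m
    using that
  proof (induction m rule: int_le_induct)
    case (step i) then show ?case using L[of "i - 1"] by simp
  qed simp
  then show ?thesis by blast
qed

context coxeter
begin

definition orb :: "'w \<Rightarrow> (('w \<Rightarrow> real) \<Rightarrow> real) \<Rightarrow> ('w \<Rightarrow> real) \<Rightarrow> int \<Rightarrow> real" where
  "orb z q f n = q (act (z [^] n) f)"

definition psmooth :: "'w \<Rightarrow> (('w \<Rightarrow> real) \<Rightarrow> real) \<Rightarrow> (('w \<Rightarrow> real) \<Rightarrow> real)" where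
  "psmooth z q = (\<lambda>f. (1 - 1/2) * q f + 1/2 * q (act z f))"

definition pwindow :: "'w \<Rightarrow> nat \<Rightarrow> (('w \<Rightarrow> real) \<Rightarrow> real) \<Rightarrow> (('w \<Rightarrow> real) \<Rightarrow> real)" where
  "pwindow z M q = (\<lambda>f. (\<Sum>j<M. q (act (z [^] int j) f)) / real M)"

lemma act_pow_add: "z \<in> carrier W \<Longrightarrow> act (z [^] (i::int)) (act (z [^] (j::int)) f) = act (z [^] (i + j)) f"
  by (simp add: act_mult[symmetric] int_pow_mult)

lemma act_pow_1: "z \<in> carrier W \<Longrightarrow> act z (act (z [^] (n::int)) f) = act (z [^] (n + 1)) f"
  using act_pow_add[of z 1 n f] by (simp add: add.commute int_pow_1)

lemma orb_psmooth: "z \<in> carrier W \<Longrightarrow> orb z (psmooth z q) f = smooth (orb z q f)"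
  by (rule ext) (simp add: orb_def psmooth_def smooth_def act_pow_1)

lemma orb_psmooth_pow: "z \<in> carrier W \<Longrightarrow> orb z ((psmooth z ^^ N) q) f = (smooth ^^ N) (orb z q f)"
  by (induction N) (auto simp: orb_psmooth)

lemma orb_pwindow: "z \<in> carrier W \<Longrightarrow> orb z (pwindow z M q) f = window M (orb z q f)"
  by (rule ext) (simp add: orb_def pwindow_def window_def act_pow_add add.commute)

lemma orb_shift: "z \<in> carrier W \<Longrightarrow> orb z q (act (z [^] k) f) = (\<lambda>n. orb z q f (n + k))"
  by (rule ext) (simp add: orb_def act_pow_add)

lemma orb_uminus: "linf q \<Longrightarrow> orb z q (\<lambda>x. - f x) = (\<lambda>n. - orb z q f n)"
  by (rule ext) (simp add: orb_def act_uminus linf_uminus)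

lemma orb_0: "orb z q f 0 = q f" by (simp add: orb_def)

lemma orb_1: "z \<in> carrier W \<Longrightarrow> orb z q f 1 = q (act z f)" by (simp add: orb_def int_pow_1)

lemma orb_m1: "w \<in> carrier W \<Longrightarrow> orb (inv w) q f (- 1) = q (act w f)"
  by (simp add: orb_def int_pow_neg int_pow_1)

lemma orb_neg: "w \<in> carrier W \<Longrightarrow> orb (inv w) q f (- int m) = q (act (w [^] m) f)"
  by (simp add: orb_def int_pow_neg int_pow_int nat_pow_inv)

lemma point_psmooth: "z \<in> carrier W \<Longrightarrow> point q \<Longrightarrow> point (psmooth z q)"
  unfolding psmooth_def by (rule point_comb) (auto simp: point_act)

lemma point_psmooth_pow: "z \<in> carrier W \<Longrightarrow> point q \<Longrightarrow> point ((psmooth z ^^ N) q)"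
  by (induction N) (auto simp: point_psmooth)

lemma point_pwindow:
  assumes z: "z \<in> carrier W" and q: "point q" and M: "0 < M"
  shows "point (pwindow z M q)"
proof -
  have "point (\<lambda>f. \<Sum>j<Suc n. q (act (z [^] int j) f))" for n
  proof (induction n)
    case 0 show ?case using q by simp
  next
    case (Suc n)
    have "point (\<lambda>f. 1 * (\<Sum>j<Suc n. q (act (z [^] int j) f)) + 1 * q (act (z [^] int (Suc n)) f))"
      by (rule point_comb[OF Suc]) (use point_act[OF q] z in auto)
    then show ?case by simp
  qed
  from this[of "M - 1"] have p: "point (\<lambda>f. \<Sum>j<M. q (act (z [^] int j) f))" using M by simp
  have "point (\<lambda>f. (1 / real M) * (\<Sum>j<M. q (act (z [^] int j) f)) + 0 * (\<Sum>j<M. q (act (z [^] int j) f)))"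
    by (rule point_comb[OF p p]) (use M in auto)
  then show ?thesis by (simp add: pwindow_def)
qed

lemma orb_ltot_ge: "z \<in> carrier W \<Longrightarrow> b \<in> roots \<Longrightarrow>
    (posv (act (z [^] n) b) \<longrightarrow> 1 \<le> orb z ltot b n) \<and> (\<not> posv (act (z [^] n) b) \<longrightarrow> orb z ltot b n \<le> -1)"
  using ltot_pos ltot_neg not_pos_negv[of "act (z [^] n) b"] by (auto simp: orb_def)

lemma orbit_cases:
  assumes z: "z \<in> carrier W" and b: "b \<in> roots"
  shows "(\<forall>n. 1 \<le> orb z ltot b n) \<or> (\<forall>n. orb z ltot b n \<le> -1) \<or>
    (\<exists>n::int. posv (act (z [^] n) b) \<noteq> posv (act (z [^] (n + 1)) b))"
proof (rule ccontr)
  assume n: "\<not> ?thesis"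
  then have st: "posv (act (z [^] n) b) = posv (act (z [^] (n + 1)) b)" for n :: int by blast
  have "posv (act (z [^] n) b) = posv b" for n :: int
  proof (induction n rule: int_induct[where k = 0])
    case (step1 i) then show ?case using st[of i] by simp
  next
    case (step2 i) then show ?case using st[of "i - 1"] by simp
  qed simp
  then show False using n orb_ltot_ge[OF z b] by blast
qed

text \<open>Up to shift and sign only finitely many root orbits change sign, because at the change
  the current root is an inversion of \<open>z\<close> or the negative of one. Hence one averaging
  length can serve all roots.\<close>

lemma sign_change:
  assumes z: "z \<in> carrier W" and b: "b \<in> roots"
    and c: "posv (act (z [^] (n::int)) b) \<noteq> posv (act (z [^] (n + 1)) b)"
  shows "act (z [^] n) b \<in> {b \<in> roots. posv b \<and> negv (act z b)} \<or>
    (\<lambda>x. - act (z [^] n) b x) \<in> {b \<in> roots. posv b \<and> negv (act z b)}"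
proof -
  let ?c = "act (z [^] n) b"
  have r: "?c \<in> roots" "act z ?c \<in> roots" using z b by auto
  have c': "posv ?c \<noteq> posv (act z ?c)" using c by (simp add: act_pow_1[OF z])
  show ?thesis
  proof (cases "posv ?c")
    case True
    then show ?thesis using r c' not_pos_negv by auto
  next
    case False
    then have "negv ?c" "posv (act z ?c)" using r c' not_pos_negv by auto
    then show ?thesis using uminus_roots[OF r(1)] by (simp add: act_uminus)
  qed
qed

text \<open>For a periodic root the values have period \<open>M\<close>. Otherwise the orbit is
  injective and meets the finite set of inversions and their negatives finitely often, so both ends
  have constant sign, with the gap supplied by \<open>ltot\<close>.\<close>

lemma eventually_tame_orbit:
  assumes z: "z \<in> carrier W" and b: "b \<in> roots" and M: "0 < M"
    and per: "(\<exists>k>0. act (z [^] int k) b = b) \<Longrightarrow> act (z [^] int M) b = b"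
  shows "\<exists>N0. \<forall>N\<ge>N0. tame M N (orb z ltot b)"
proof (cases "\<exists>k>0. act (z [^] int k) b = b")
  case True
  have "orb z ltot b (n + int M) = orb z ltot b n" for n
    using per[OF True] act_pow_add[OF z, of n "int M" b] by (simp add: orb_def)
  then show ?thesis by (rule eventually_tame_periodic[OF M])
next
  case False
  let ?E = "{b \<in> roots. posv b \<and> negv (act z b)}"
  have inj: "inj (\<lambda>n. act (z [^] (n::int)) b)"
  proof (rule ccontr)
    assume "\<not> inj (\<lambda>n. act (z [^] (n::int)) b)"
    then obtain n m where nm: "n < m" "act (z [^] (n::int)) b = act (z [^] (m::int)) b"
      unfolding inj_def by (metis linorder_neqE)
    then have "act (z [^] (- n)) (act (z [^] n) b) = act (z [^] (- n)) (act (z [^] m) b)" by simp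
    then have "b = act (z [^] (m - n)) b" using z by (simp add: act_pow_add)
    then have "act (z [^] int (nat (m - n))) b = b \<and> 0 < nat (m - n)" using nm by simp
    then show False using False by blast
  qed
  have fE: "finite (?E \<union> (\<lambda>f x. - f x) ` ?E)" using finite_inversions[OF z] by blast
  have "{n. posv (act (z [^] (n::int)) b) \<noteq> posv (act (z [^] (n + 1)) b)} \<subseteq>
     (\<lambda>n. act (z [^] n) b) -` (?E \<union> (\<lambda>f x. - f x) ` ?E)"
  proof
    fix n :: int assume "n \<in> {n. posv (act (z [^] n) b) \<noteq> posv (act (z [^] (n + 1)) b)}"
    then have "posv (act (z [^] n) b) \<noteq> posv (act (z [^] (n + 1)) b)" by blast
    from sign_change[OF z b this] show "n \<in> (\<lambda>n. act (z [^] n) b) -` (?E \<union> (\<lambda>f x. - f x) ` ?E)"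
    proof
      assume "(\<lambda>x. - act (z [^] n) b x) \<in> ?E"
      then have "(\<lambda>f x. - f x) (\<lambda>x. - act (z [^] n) b x) \<in> (\<lambda>f x. - f x) ` ?E" by (rule imageI)
      then show ?thesis by simp
    qed simp
  qed
  then have fin: "finite {n. posv (act (z [^] (n::int)) b) \<noteq> posv (act (z [^] (n + 1)) b)}"
    using finite_vimageI[OF fE inj] finite_subset by blast
  obtain R where R: "\<And>m. m \<ge> R \<Longrightarrow> posv (act (z [^] (m::int)) b) = posv (act (z [^] R) b)"
    using eventually_constant_right[OF fin] by blast
  obtain L where L: "\<And>m. m \<le> L \<Longrightarrow> posv (act (z [^] (m::int)) b) = posv (act (z [^] L) b)"
    using eventually_constant_left[OF fin] by blast
  show ?thesis
  proof (rule eventually_tame[OF M])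
    show "(\<forall>m\<ge>R. 1 \<le> orb z ltot b m) \<or> (\<forall>m\<ge>R. orb z ltot b m \<le> - 1)"
      using R orb_ltot_ge[OF z b] by blast
    show "(\<forall>m\<le>L. 1 \<le> orb z ltot b m) \<or> (\<forall>m\<le>L. orb z ltot b m \<le> - 1)"
      using L orb_ltot_ge[OF z b] by blast
  qed
qed

lemma common_period:
  assumes z: "z \<in> carrier W" and fin: "finite E"
  shows "\<exists>M>0. \<forall>b\<in>E. (\<exists>k>0. act (z [^] int k) b = b) \<longrightarrow> act (z [^] int M) b = b"
  using fin
proof (induction E)
  case empty then show ?case by (intro exI[of _ 1]) simp
next
  case (insert b E)
  then obtain M where M: "M > 0" "\<forall>b\<in>E. (\<exists>k>0. act (z [^] int k) b = b) \<longrightarrow> act (z [^] int M) b = b"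
    by blast
  have mult: "act (z [^] int (k * j)) c = c" if "act (z [^] int k) c = c" for k j c
  proof (induction j)
    case (Suc j)
    have "act (z [^] int (k * Suc j)) c = act (z [^] int k) (act (z [^] int (k * j)) c)"
      using z by (simp add: act_pow_add)
    then show ?case using Suc that by simp
  qed simp
  show ?case
  proof (cases "\<exists>k>0. act (z [^] int k) b = b")
    case True
    then obtain k where k: "k > 0" "act (z [^] int k) b = b" by blast
    have "act (z [^] int (k * M)) b = b" by (rule mult[OF k(2)])
    moreover have "act (z [^] int (M * k)) c = c" if "c \<in> E" "\<exists>k>0. act (z [^] int k) c = c" for c
      using mult M(2) that by blast
    ultimately have "\<forall>c\<in>insert b E. (\<exists>k>0. act (z [^] int k) c = c) \<longrightarrow> act (z [^] int (k * M)) c = c"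
      by (simp add: mult.commute)
    then show ?thesis using k M(1) by (intro exI[of _ "k * M"]) auto
  next
    case False then show ?thesis using M by blast
  qed
qed

text \<open>The point \<open>q\<close> is the average over a common period of the periodic inversions of \<open>inv w\<close>, of a
  long binomial average of \<open>ltot\<close>, mixed generically with its translate.\<close>
lemma straight_point:
  assumes ll: "lossless w"
  obtains u q where "u \<in> carrier W" "reach w (cj w u)" "point q" "chamber_has u q"
    "\<And>b. b \<in> roots \<Longrightarrow> clean (orb (inv w) q b)"
proof -
  have w: "w \<in> carrier W" using ll by (simp add: lossless_def)
  define z where "z = inv w"
  have z: "z \<in> carrier W" using w by (simp add: z_def)
  let ?E = "{b \<in> roots. posv b \<and> negv (act z b)}"
  have fE: "finite ?E" by (rule finite_inversions[OF z])
  obtain M where M: "M > 0"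
    "\<And>b. b \<in> ?E \<Longrightarrow> (\<exists>k>0. act (z [^] int k) b = b) \<Longrightarrow> act (z [^] int M) b = b"
    using common_period[OF z fE] by blast
  have "\<forall>b\<in>?E. \<exists>N0. \<forall>N\<ge>N0. tame M N (orb z ltot b)"
    using eventually_tame_orbit[OF z _ M(1)] M(2) by blast
  from bchoice[OF this] obtain N0 where "\<forall>b\<in>?E. \<forall>N\<ge>N0 b. tame M N (orb z ltot b)" by blast
  then have N0: "\<And>b N. b \<in> ?E \<Longrightarrow> N \<ge> N0 b \<Longrightarrow> tame M N (orb z ltot b)" by blast
  \<comment> \<open>The sum bounds every \<open>N0 b\<close> and also makes sense when there are no
    inversions.\<close>
  define N where "N = (\<Sum>b\<in>?E. N0 b)"
  have tE: "tame M N (orb z ltot b)" if "b \<in> ?E" for b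
    using N0[OF that, of N] member_le_sum[OF that, of N0] fE by (simp add: N_def)
  have ll0: "linf ltot" using point_ltot by (simp add: point_def)
  have change: "\<exists>c n. c \<in> ?E \<and> (b = act (z [^] (n::int)) c \<or> b = (\<lambda>x. - act (z [^] n) c x))"
    if b: "b \<in> roots" "posv (act (z [^] (n::int)) b) \<noteq> posv (act (z [^] (n + 1)) b)" for b n
    using sign_change[OF z that]
  proof
    assume "act (z [^] n) b \<in> ?E"
    moreover have "b = act (z [^] (- n)) (act (z [^] n) b)" using z by (simp add: act_pow_add)
    ultimately show ?thesis by blast
  next
    assume "(\<lambda>x. - act (z [^] n) b x) \<in> ?E"
    moreover have "b = (\<lambda>x. - act (z [^] (- n)) (\<lambda>x. - act (z [^] n) b x) x)"
      using z by (simp add: act_uminus act_pow_add)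
    ultimately show ?thesis by blast
  qed
  \<comment> \<open>A root whose orbit changes sign reduces to the finite set by shift and negation,
    both of which preserve \<open>tame\<close>; the remaining orbits have values of one sign,
    bounded away from 0.\<close>
  have tame: "tame M N (orb z ltot b)" if b: "b \<in> roots" for b
    using orbit_cases[OF z b]
  proof (elim disjE exE)
    assume "\<forall>n. 1 \<le> orb z ltot b n" then show ?thesis by (rule tame_const[OF M(1)])
  next
    assume o: "\<forall>n. orb z ltot b n \<le> - 1"
    have "1 \<le> - orb z ltot b n" for n using o[rule_format, of n] by linarith
    then have "tame M N (\<lambda>n. - orb z ltot b n)" by (intro tame_const[OF M(1)] allI) blast
    then show ?thesis by (simp add: tame_uminus)
  next
    fix n assume "posv (act (z [^] (n::int)) b) \<noteq> posv (act (z [^] (n + 1)) b)"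
    then obtain c k where c: "c \<in> ?E" "b = act (z [^] (k::int)) c \<or> b = (\<lambda>x. - act (z [^] k) c x)"
      using change[OF b] by blast
    have "tame M N (orb z ltot (act (z [^] k) c))"
      using tE[OF c(1)] orb_shift[OF z, of ltot k c] tame_shift by simp
    then show ?thesis using c(2) orb_uminus[OF ll0] tame_uminus by auto
  qed
  define p where "p = (\<lambda>n. (psmooth z ^^ n) ltot)"
  have pp: "point (p n)" for n unfolding p_def by (rule point_psmooth_pow[OF z point_ltot])
  define a where "a = pwindow z M (p N)"
  have pa: "point a" unfolding a_def by (rule point_pwindow[OF z pp M(1)])
  have op: "orb z (p n) b = (smooth ^^ n) (orb z ltot b)" for n b
    unfolding p_def by (rule orb_psmooth_pow[OF z])
  have oa: "orb z a b = (smooth ^^ N) (window M (orb z ltot b))" for b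
    unfolding a_def orb_pwindow[OF z] op smooth_window ..
  have cj1: "cj w \<one> = w" using w by (simp add: cj_def)
  have ph1: "\<exists>u\<in>carrier W. reach w (cj w u) \<and> chamber_has u (p n)" for n
  proof (induction n)
    case 0
    have "chamber_has \<one> (p 0)" using ltot_pos[OF posv_bas]
      by (auto simp: chamber_has_def p_def intro: order_trans[OF zero_le_one])
    then show ?case using cj1 by (intro bexI[of _ \<one>]) auto
  next
    case (Suc n)
    then obtain u where u: "u \<in> carrier W" "reach w (cj w u)" "chamber_has u (p n)" by blast
    obtain u' where u': "u' \<in> carrier W" "reach (cj w u) (cj w u')"
       "chamber_has u' (\<lambda>f. (1 - 1/2) * p n f + 1/2 * p n (act (inv w) f))"
      using move_to_average[OF w u(1) pp u(3) lossless_reach[OF ll u(2)], of "1/2"] by auto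
    have "(\<lambda>f. (1 - 1/2) * p n f + 1/2 * p n (act (inv w) f)) = p (Suc n)"
      by (simp add: p_def psmooth_def z_def)
    then show ?case using u u' by (metis rtranclp_trans)
  qed
  obtain u where u: "u \<in> carrier W" "reach w (cj w u)" "chamber_has u (p N)" using ph1 by blast
  have bl: "orb z (\<lambda>f. (1 - t) * p N f + t * a f) b n = blend M N (orb z ltot b) t n" for t b n
    unfolding blend_def op[symmetric] oa[symmetric] by (simp add: orb_def)
  \<comment> \<open>For a wall met on the segment the value at orbit index 0 is zero, and
    \<open>tame\<close> makes the value at index 1 or -1 negative. This is the condition under which
    the crossing is a cyclic shift.\<close>
  have "\<exists>u'\<in>carrier W. reach (cj w u) (cj w u') \<and> chamber_has u' a"
  proof (rule move_along_segment[OF w u(1) pp pa u(3)])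
    fix t b assume t: "0 \<le> t" "t \<le> 1" and b: "b \<in> roots"
      and zero: "(1 - t) * p N b + t * a b = 0" and neg: "a b < (0::real)"
    let ?B = "blend M N (orb z ltot b) t"
    have b0: "?B 0 = 0" using bl[of t b 0] zero by (simp add: orb_0)
    have b1: "?B 1 = (1 - t) * p N (act z b) + t * a (act z b)" using bl[of t b 1] by (simp add: orb_1[OF z])
    have bm: "?B (-1) = (1 - t) * p N (act w b) + t * a (act w b)"
      using bl[of t b "-1"] by (simp add: z_def orb_m1[OF w])
    have an: "orb z a b 0 < 0" using neg by (simp add: orb_0)
    have tt: "t \<in> {0..1}" using t by simp
    have alt: "?B 1 < 0 \<or> ?B (-1) < 0"
      using tame[OF b] unfolding tame_def
    proof (elim disjE)
      assume "\<forall>s\<in>{0..1}. \<forall>n. 0 < blend M N (orb z ltot b) s n"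
      then show ?thesis using tt b0 by (metis less_irrefl)
    next
      assume "\<forall>s\<in>{0..1}. \<forall>n. blend M N (orb z ltot b) s n < 0"
      then show ?thesis using tt by blast
    next
      assume "\<forall>s\<in>{0..1}. \<forall>n. 0 \<le> blend M N (orb z ltot b) s n \<longrightarrow> 0 < blend M N (orb z ltot b) s (n + 1)"
      then have "0 \<le> ?B (-1) \<longrightarrow> 0 < ?B (-1 + 1)" using tt by blast
      then show ?thesis using b0 by auto
    next
      assume "\<forall>s\<in>{0..1}. \<forall>n. blend M N (orb z ltot b) s n \<le> 0 \<longrightarrow> blend M N (orb z ltot b) s (n + 1) < 0"
      then have "?B 0 \<le> 0 \<longrightarrow> ?B (0 + 1) < 0" using tt by blast
      then show ?thesis using b0 by auto
    next
      assume "\<forall>n. (smooth ^^ N) (window M (orb z ltot b)) n = 0"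
      then show ?thesis using an oa[of b] by simp
    qed
    show "(1 - t) * p N (act (inv w) b) + t * a (act (inv w) b) < 0 \<or> (1 - t) * p N (act w b) + t * a (act w b) < 0"
      using alt unfolding b1 bm z_def[symmetric] .
  qed
  then obtain v where v: "v \<in> carrier W" "reach w (cj w v)" "chamber_has v a"
    using u(2) by (meson rtranclp_trans)
  have "\<forall>b\<in>?E. \<exists>B. finite B \<and> (\<forall>s. 0 < s \<longrightarrow> s < 1 \<longrightarrow> s \<notin> B \<longrightarrow>
      clean (\<lambda>n. (1 - s) * orb z a b n + s * orb z a b (n + 1)))"
  proof
    fix b assume "b \<in> ?E"
    from tame_imp_clean[OF tE[OF this]] obtain B where "finite B"
      "\<And>s. 0 < s \<Longrightarrow> s < 1 \<Longrightarrow> s \<notin> B \<Longrightarrow> clean (\<lambda>n. (1 - s) * (smooth ^^ N) (window M (orb z ltot b)) n +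
          s * (smooth ^^ N) (window M (orb z ltot b)) (n + 1))" by blast
    then show "\<exists>B. finite B \<and> (\<forall>s. 0 < s \<longrightarrow> s < 1 \<longrightarrow> s \<notin> B \<longrightarrow>
      clean (\<lambda>n. (1 - s) * orb z a b n + s * orb z a b (n + 1)))"
      unfolding oa by blast
  qed
  from bchoice[OF this] obtain Bd where Bd0: "\<forall>b\<in>?E. finite (Bd b) \<and> (\<forall>s. 0 < s \<longrightarrow> s < 1 \<longrightarrow> s \<notin> Bd b \<longrightarrow>
      clean (\<lambda>n. (1 - s) * orb z a b n + s * orb z a b (n + 1)))" by blast
  then have Bd: "\<And>b. b \<in> ?E \<Longrightarrow> finite (Bd b)"
    "\<And>b s. b \<in> ?E \<Longrightarrow> 0 < s \<Longrightarrow> s < 1 \<Longrightarrow> s \<notin> Bd b \<Longrightarrow> clean (\<lambda>n. (1 - s) * orb z a b n + s * orb z a b (n + 1))"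
    by (blast, blast)
  \<comment> \<open>Each inversion forbids finitely many mixing parameters, so a common admissible
    one remains in the open interval.\<close>
  have "finite (\<Union>b\<in>?E. Bd b)" using fE Bd(1) by blast
  moreover have "infinite {0<..<1::real}" by simp
  ultimately obtain s where s: "s \<in> {0<..<1}" "s \<notin> (\<Union>b\<in>?E. Bd b)" by (meson finite_subset subsetI)
  define q where "q = (\<lambda>f. (1 - s) * a f + s * a (act z f))"
  have pq: "point q" unfolding q_def by (rule point_comb) (use pa point_act[OF pa z] s in auto)
  have lq: "linf q" using pq by (simp add: point_def)
  have oq: "orb z q b = (\<lambda>n. (1 - s) * orb z a b n + s * orb z a b (n + 1))" for b
    by (rule ext) (simp add: orb_def q_def act_pow_1[OF z])
  have cE: "clean (orb z q b)" if "b \<in> ?E" for b unfolding oq using Bd(2)[OF that] s that by simp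
  have clean_sh: "clean H \<Longrightarrow> clean (\<lambda>n. H (n + k))" for H k
  proof -
    have e: "n + 1 + k = n + k + 1" for n by simp
    show "clean H \<Longrightarrow> clean (\<lambda>n. H (n + k))" unfolding clean_def e by blast
  qed
  have final: "clean (orb z q b)" if b: "b \<in> roots" for b
    using orbit_cases[OF z b]
  proof (elim disjE exE)
    assume o: "\<forall>n. 1 \<le> orb z ltot b n"
    have "\<forall>n. 0 < (smooth ^^ N) (window M (orb z ltot b)) n"
      using smooth_mono_pos[of 0 "window M (orb z ltot b)" N] window_ge[OF M(1), of "orb z ltot b"] o
      by (simp add: less_le_trans[OF zero_less_one])
    then show ?thesis unfolding oq oa clean_def using s by (simp add: add_pos_pos)
  next
    assume o: "\<forall>n. orb z ltot b n \<le> - 1"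
    have "1 \<le> - orb z ltot b n" for n using o[rule_format, of n] by linarith
    then have "1 \<le> window M (\<lambda>n. - orb z ltot b n) n" for n by (intro window_ge[OF M(1)]) blast
    then have "\<forall>n. 0 < (smooth ^^ N) (window M (\<lambda>n. - orb z ltot b n)) n"
      using smooth_mono_pos[of 0 "window M (\<lambda>n. - orb z ltot b n)" N] by (simp add: less_le_trans[OF zero_less_one])
    then have "\<forall>n. (smooth ^^ N) (window M (orb z ltot b)) n < 0" by (simp add: window_uminus smooth_uminus)
    then show ?thesis unfolding oq oa clean_def using s by (simp add: add_neg_neg mult_pos_neg)
  next
    fix n assume "posv (act (z [^] (n::int)) b) \<noteq> posv (act (z [^] (n + 1)) b)"
    then obtain c k where c: "c \<in> ?E" "b = act (z [^] (k::int)) c \<or> b = (\<lambda>x. - act (z [^] k) c x)"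
      using change[OF b] by blast
    have "clean (orb z q (act (z [^] k) c))"
      unfolding orb_shift[OF z] by (rule clean_sh[OF cE[OF c(1)]])
    then show ?thesis using c(2) orb_uminus[OF lq] clean_uminus by auto
  qed
  obtain u' where u': "u' \<in> carrier W" "reach (cj w v) (cj w u')" "chamber_has u' q"
    using move_to_average[OF w v(1) pa v(3) lossless_reach[OF ll v(2)], of s] s unfolding q_def z_def by auto
  show ?thesis
    by (rule that[OF u'(1) _ pq u'(3)]) (use u' v final z_def in \<open>auto intro: rtranclp_trans\<close>)
qed

end

section \<open>Splitting a lossless element into a spherical part and a straight part\<close>

context coxeter
begin

text \<open>Each letter of a reduced word contributes a new inverted root. This bounds the lengths
  in a parabolic subgroup by the number of walls through a point.\<close>

lemma len_le_inversions: "k \<in> carrier W \<Longrightarrow> len k \<le> card {b \<in> roots. posv b \<and> negv (act (inv k) b)}"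
proof (induction "len k" arbitrary: k)
  case (Suc n)
  obtain xs where xs: "set xs \<subseteq> S" "length xs = len k" "wprod xs = k" using reduced_word Suc(3) .
  then obtain ys s where ys: "xs = ys @ [s]" using Suc(2) by (cases xs rule: rev_cases) auto
  define j where "j = wprod ys"
  have s: "s \<in> S" "j \<in> carrier W" "k = j \<otimes> s" using xs ys by (auto simp: j_def wprod_append)
  have "len j \<le> n" using len_le[of ys] xs ys Suc(2) by (simp add: j_def)
  then have l: "len j = n" using len_right_cases[of s j] s Suc(2) by auto
  let ?I = "\<lambda>k. {b \<in> roots. posv b \<and> negv (act (inv k) b)}"
  have p: "posv (act j (bas s))" using root_sign[of j s] s l Suc(2) by simp
  have k: "act (inv k) b = refl s (act (inv j) b)" for b
    using s by (simp add: inv_mult_group act_mult act_S)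
  have sub: "insert (act j (bas s)) (?I j) \<subseteq> ?I k"
  proof
    fix b assume "b \<in> insert (act j (bas s)) (?I j)"
    then consider "b = act j (bas s)" | "b \<in> ?I j" by blast
    then show "b \<in> ?I k"
    proof cases
      case 1
      then show ?thesis using p s k posv_bas by (simp add: refl_bas)
    next
      case 2
      let ?c = "\<lambda>x. - act (inv j) b x"
      have c: "?c \<in> roots" "posv ?c" using 2 s uminus_roots by auto
      have "?c \<noteq> bas s"
      proof
        assume e: "?c = bas s"
        have "act j ?c = (\<lambda>x. - b x)" using s by (simp add: act_uminus)
        then have "posv (\<lambda>x. - b x)" using p e by simp
        then show False using 2 not_posv_negv by auto
      qed
      then have "posv (refl s ?c)" using refl_pos[OF c s(1)] by simp
      moreover have "refl s ?c = (\<lambda>x. - refl s (act (inv j) b) x)"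
        using refl_lin[of s "-1" "act (inv j) b" 0 "bas s"] by simp
      ultimately show ?thesis using 2 k by simp
    qed
  qed
  have "act j (bas s) \<notin> ?I j" using s posv_bas[OF s(1)] not_posv_negv by simp
  then have "Suc (card (?I j)) = card (insert (act j (bas s)) (?I j))"
    using finite_inversions[of "inv j"] s by simp
  also have "\<dots> \<le> card (?I k)" by (rule card_mono[OF _ sub]) (use finite_inversions[of "inv k"] Suc(3) in simp)
  finally show ?case using Suc(1)[of j] l s Suc(2) by simp
qed simp

text \<open>For \<open>J \<subseteq> S\<close> conjugation by \<open>t\<close> permutes
  \<open>J\<close>, and \<open>t\<close> is shortest in its coset. Such elements are the Weyl
  distances between corresponding chambers of parallel residues of type \<open>J\<close>.\<close>

definition normalizes :: "'w set \<Rightarrow> 'w \<Rightarrow> bool" where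
  "normalizes J t \<longleftrightarrow> rmin J t \<and> (\<forall>s\<in>J. \<exists>s'\<in>J. t \<otimes> s = s' \<otimes> t)"

lemma normalizes_par:
  assumes J: "J \<subseteq> S" and t: "t \<in> carrier W" "\<forall>s\<in>J. \<exists>s'\<in>J. t \<otimes> s = s' \<otimes> t" and k: "k \<in> par J"
  shows "\<exists>k'\<in>par J. t \<otimes> k = k' \<otimes> t"
proof -
  have main: "set xs \<subseteq> J \<Longrightarrow> \<exists>k'\<in>par J. t \<otimes> wprod xs = k' \<otimes> t" for xs
  proof (induction xs)
    case Nil then show ?case using t by (intro bexI[of _ \<one>]) auto
  next
    case (Cons x xs)
    then obtain k' where k': "k' \<in> par J" "t \<otimes> wprod xs = k' \<otimes> t" by auto
    obtain x' where x': "x' \<in> J" "t \<otimes> x = x' \<otimes> t" using t Cons by auto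
    have c: "wprod xs \<in> carrier W" "x \<in> carrier W" "x' \<in> carrier W" "k' \<in> carrier W"
      using Cons J x' k' par_carrier[OF J] by (auto intro: wprod_closed)
    have "t \<otimes> wprod (x # xs) = (t \<otimes> x) \<otimes> wprod xs" using c t by (simp add: m_assoc)
    also have "\<dots> = x' \<otimes> (t \<otimes> wprod xs)" using c t x' by (simp add: m_assoc)
    also have "\<dots> = (x' \<otimes> k') \<otimes> t" using c t k' by (simp add: m_assoc)
    finally show ?case using par_mult[OF J par_gen[OF J x'(1)] k'(1)] by blast
  qed
  show ?thesis using k main by (auto simp: std_parabolic_def)
qed

text \<open>Conjugation by \<open>t\<close> is an injective self-map of the finite set
  \<open>J\<close>, hence onto.\<close>

lemma normalizes_gens_inv:
  assumes J: "J \<subseteq> S" and t: "t \<in> carrier W" and norm: "\<forall>s\<in>J. \<exists>s'\<in>J. t \<otimes> s = s' \<otimes> t"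
  shows "\<forall>s\<in>J. \<exists>s'\<in>J. inv t \<otimes> s = s' \<otimes> inv t"
proof
  fix s assume s: "s \<in> J"
  let ?f = "\<lambda>s. t \<otimes> s \<otimes> inv t"
  have fJ: "finite J" using J finite_S finite_subset by blast
  have Jc: "x \<in> carrier W" if "x \<in> J" for x using J that by auto
  have sub: "?f ` J \<subseteq> J"
  proof
    fix y assume "y \<in> ?f ` J"
    then obtain x where x: "x \<in> J" "y = t \<otimes> x \<otimes> inv t" by blast
    obtain x' where x': "x' \<in> J" "t \<otimes> x = x' \<otimes> t" using norm x by blast
    then show "y \<in> J" using x t Jc[OF x'(1)] by (simp add: m_assoc)
  qed
  have "inj_on ?f J" by (rule inj_onI) (use t Jc in simp)
  then have "?f ` J = J" by (rule endo_inj_surj[OF fJ sub])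
  then obtain x where x: "x \<in> J" "s = t \<otimes> x \<otimes> inv t" using s by blast
  have "inv t \<otimes> s = x \<otimes> inv t" using x Jc t by (simp add: m_assoc[symmetric])
  then show "\<exists>s'\<in>J. inv t \<otimes> s = s' \<otimes> inv t" using x by blast
qed

lemma normalizes_lmin:
  assumes J: "J \<subseteq> S" and n: "normalizes J t"
  shows "lmin J t"
proof -
  have t: "t \<in> carrier W" and r: "\<And>s. s \<in> J \<Longrightarrow> len t < len (t \<otimes> s)"
    using n by (auto simp: normalizes_def rmin_def)
  have "len t < len (s \<otimes> t)" if s: "s \<in> J" for s
  proof -
    obtain s' where s': "s' \<in> J" "inv t \<otimes> s = s' \<otimes> inv t"
      using normalizes_gens_inv[OF J t] n s by (auto simp: normalizes_def)
    have c: "s \<in> carrier W" "s' \<in> carrier W" using s s' J by auto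
    have "t \<otimes> (inv t \<otimes> s) \<otimes> t = t \<otimes> (s' \<otimes> inv t) \<otimes> t" using s' by simp
    moreover have "t \<otimes> (inv t \<otimes> s) \<otimes> t = s \<otimes> t" using t c by (simp add: m_assoc[symmetric])
    moreover have "t \<otimes> (s' \<otimes> inv t) \<otimes> t = t \<otimes> s'" using t c by (simp add: m_assoc)
    ultimately have "s \<otimes> t = t \<otimes> s'" by simp
    then show ?thesis using r[OF s'(1)] by simp
  qed
  then show ?thesis using t by (simp add: lmin_def)
qed

lemma normalizes_inv:
  assumes J: "J \<subseteq> S" and n: "normalizes J t"
  shows "normalizes J (inv t)"
proof -
  have t: "t \<in> carrier W" using n by (simp add: normalizes_def rmin_def)
  then show ?thesis using normalizes_lmin[OF J n] lmin_inv[OF J t] normalizes_gens_inv[OF J t] n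
    by (simp add: normalizes_def)
qed

text \<open>Seen from the chamber \<open>u\<close> the point becomes \<open>p\<close>, and
  \<open>J\<close> collects the walls of the fundamental chamber through \<open>p\<close>. Cleanness
  says that \<open>w'\<close> permutes the roots vanishing at \<open>p\<close>; the positive ones
  among them are those supported on \<open>J\<close>. Dividing by a factor in \<open>par J\<close>
  leaves a shortest \<open>t\<close> that preserves these positive roots, and therefore
  \<open>J\<close>. Straightness expresses that no wall is crossed twice.\<close>

lemma straight_decomposition:
  assumes ll: "lossless w"
  shows "\<exists>J t v. J \<subseteq> S \<and> finite (par J) \<and> v \<in> par J \<and> normalizes J t \<and> reach w (v \<otimes> t) \<and>
    (\<forall>n::nat. len (t [^] n) = n * len t)"
proof -
  have w: "w \<in> carrier W" using ll by (simp add: lossless_def)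
  obtain u q where u: "u \<in> carrier W" "reach w (cj w u)" and pq: "point q" and has: "chamber_has u q"
    and cl: "\<And>b. b \<in> roots \<Longrightarrow> clean (orb (inv w) q b)" using straight_point[OF ll] by blast
  define w' where "w' = cj w u"
  have w': "w' \<in> carrier W" using w u by (simp add: w'_def)
  define p where "p = (\<lambda>f. q (act u f))"
  have lq: "linf q" using pq by (simp add: point_def)
  have lp: "linf p" unfolding p_def by (rule linf_act[OF lq])
  have p0: "0 \<le> p b" if "posv b" for b using chamber_has_pos[OF has lq that] by (simp add: p_def)
  have pneg: "p b \<le> 0" if "negv b" for b using p0[of "\<lambda>x. - b x"] that linf_uminus[OF lp] by simp
  define J where "J = {s \<in> S. p (bas s) = 0}"
  have J: "J \<subseteq> S" by (auto simp: J_def)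
  have supp: "p b = 0 \<longleftrightarrow> (\<forall>x. x \<notin> J \<longrightarrow> b x = 0)" if b: "posv b" for b
  proof -
    have e: "p b = (\<Sum>s\<in>S. b s * p (bas s))" using linf_sum_bas[OF lp] b by (simp add: posv_def)
    have nn: "\<And>s. s \<in> S \<Longrightarrow> 0 \<le> b s * p (bas s)" using p0[OF posv_bas] posv_nonneg[OF b] by simp
    have "p b = 0 \<longleftrightarrow> (\<forall>s\<in>S. b s * p (bas s) = 0)"
      unfolding e by (rule sum_nonneg_eq_0_iff[OF finite_S nn])
    also have "\<dots> \<longleftrightarrow> (\<forall>x. x \<notin> J \<longrightarrow> b x = 0)" using posv_supp[OF b] by (auto simp: J_def)
    finally show ?thesis .
  qed
  have p_refl: "p (refl s f) = p f" if "s \<in> J" for s f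
    using linfD[OF lp, of 1 f "- phi s f" "bas s"] that by (simp add: refl_def J_def)
  have p_par: "p (act k f) = p f" if k: "k \<in> par J" for k f
  proof -
    have "set xs \<subseteq> J \<Longrightarrow> p (act (wprod xs) f) = p f" for xs
    proof (induction xs)
      case (Cons x xs)
      have "set xs \<subseteq> S" "x \<in> S" using Cons J by auto
      then have "act (wprod (x # xs)) f = refl x (act (wprod xs) f)" by (simp add: act_Cons)
      then show ?case using Cons p_refl by simp
    qed simp
    then show ?thesis using k by (auto simp: std_parabolic_def)
  qed
  let ?F = "{b \<in> roots. posv b \<and> p b = 0}"
  have fF: "finite ?F"
    using pq u by (auto simp: point_def p_def intro: finite_subset[of _ "{b \<in> roots. posv b \<and> q (act u b) \<le> 0}"])
  define H where "H = (\<lambda>b. orb (inv w) q (act u b))"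
  have clH: "clean (H b)" if "b \<in> roots" for b unfolding H_def using cl that u by simp
  have H0: "H b 0 = p b" for b by (simp add: H_def orb_0 p_def)
  have H1: "H b 1 = p (act (inv w') b)" for b
    using w u by (simp add: H_def orb_1 p_def w'_def act_act_cj(2))
  have pw: "act (w [^] m) (act u f) = act u (act (w' [^] m) f)" for m :: nat and f
  proof (induction m arbitrary: f)
    case (Suc m)
    have "act (w [^] Suc m) (act u f) = act (w [^] m) (act w (act u f))" using w by (simp add: act_mult)
    also have "\<dots> = act u (act (w' [^] m) (act w' f))" unfolding act_act_cj(1)[OF w u(1)] w'_def[symmetric] Suc ..
    finally show ?case using w' by (simp add: act_mult)
  qed simp
  have Hn: "H b (- int m) = p (act (w' [^] m) b)" for b m
    using w by (simp add: H_def orb_neg pw p_def)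
  have Hm1: "H b (- 1) = p (act w' b)" for b using Hn[of b 1] w' by simp
  have zero: "p (act w' b) = 0 \<longleftrightarrow> p b = 0" "p (act (inv w') b) = 0 \<longleftrightarrow> p b = 0" if "b \<in> roots" for b
  proof -
    have e: "H b i = 0 \<longleftrightarrow> H b j = 0" for i j
      using clean_zero[OF clH[OF that], of i j] clean_zero[OF clH[OF that], of j i] by blast
    show "p (act w' b) = 0 \<longleftrightarrow> p b = 0" using e[of "- 1" 0] unfolding H0 Hm1 .
    show "p (act (inv w') b) = 0 \<longleftrightarrow> p b = 0" using e[of 1 0] unfolding H0 H1 .
  qed
  \<comment> \<open>An element of \<open>par J\<close> fixes \<open>p\<close>, so every positive
    root it inverts vanishes at \<open>p\<close>. Only finitely many do, since \<open>p\<close> is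
    an interior point of the Tits cone, and this bounds the length.\<close>
  have fin: "finite (par J)"
  proof -
    have "len k \<le> card ?F" if k: "k \<in> par J" for k
    proof -
      have kc: "k \<in> carrier W" using par_carrier[OF J k] .
      have "{b \<in> roots. posv b \<and> negv (act (inv k) b)} \<subseteq> ?F"
      proof safe
        fix b assume b: "b \<in> roots" "posv b" "negv (act (inv k) b)"
        have "p (act (inv k) b) = p b" using p_par[OF par_inv[OF J k]] .
        then show "p b = 0" using pneg[OF b(3)] p0[OF b(2)] by simp
      qed
      then show ?thesis using len_le_inversions[OF kc] card_mono[OF fF] order_trans by blast
    qed
    then have "par J \<subseteq> wprod ` {xs. set xs \<subseteq> S \<and> length xs \<le> card ?F}"
      using J par_carrier[OF J] reduced_word by (force intro: reduced_word)
    then show ?thesis using finite_lists_length_le[OF finite_S] finite_subset by blast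
  qed
  obtain t v where t: "lmin J t" and v: "v \<in> par J" and vt: "w' = v \<otimes> t" using lmin_exists[OF J w'] .
  have c: "t \<in> carrier W" "v \<in> carrier W" using t v par_carrier[OF J] by (auto simp: lmin_def)
  have it: "rmin J (inv t)" using t lmin_inv[OF J c(1)] by simp
  have it_eq: "inv t = inv w' \<otimes> v" using vt c by (simp add: inv_mult_group m_assoc)
  have map: "act (inv t) b \<in> ?F" if b: "b \<in> ?F" for b
  proof -
    have "posv (act (inv t) b)" using rmin_J_pos[OF J it] b supp by blast
    moreover have "p (act (inv t) b) = 0"
      unfolding it_eq using b c w' zero(2)[of "act v b"] p_par[OF v] by (simp add: act_mult)
    ultimately show ?thesis using b c by simp
  qed
  have inj: "inj_on (act (inv t)) ?F" by (rule inj_on_inverseI[of _ "act t"]) (use c in simp)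
  have img: "act (inv t) ` ?F = ?F" by (rule endo_inj_surj[OF fF _ inj]) (use map in blast)
  have map': "act t b \<in> ?F" if b: "b \<in> ?F" for b
  proof -
    have "b \<in> act (inv t) ` ?F" unfolding img by (rule b)
    then obtain d where "d \<in> ?F" "b = act (inv t) d" by (rule imageE) blast
    then show ?thesis using c(1) by simp
  qed
  have basF: "bas s \<in> ?F" if "s \<in> J" for s using that posv_bas by (auto simp: J_def)
  have rt: "rmin J t" unfolding rmin_def
  proof (intro conjI ballI)
    fix s assume s: "s \<in> J"
    then have "posv (act t (bas s))" using map'[OF basF] by blast
    then show "len t < len (t \<otimes> s)" using root_sign(1)[OF c(1), of s] s J by blast
  qed (use c in simp)
  have norm: "\<exists>s'\<in>J. t \<otimes> s = s' \<otimes> t" if s: "s \<in> J" for s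
  proof -
    define b where "b = act t (bas s)"
    have b: "b \<in> roots" "posv b" "p b = 0" using map'[OF basF[OF s]] by (auto simp: b_def)
    have sS: "s \<in> S" using s J by blast
    have bJ: "b x = 0" if "x \<notin> J" for x using supp[OF b(2)] b(3) that by blast
    obtain r where r: "b r \<noteq> 0" using b(2) by (auto simp: posv_def)
    then have rJ: "r \<in> J" "r \<in> S" using bJ J by auto
    have pos: "posv (act (inv t) (bas y))" if "y \<in> J" for y using map[OF basF[OF that]] by blast
    \<comment> \<open>In the expansion of \<open>inv t b = bas s\<close> along the simple roots of
      \<open>b\<close> all terms are nonnegative, so nothing cancels and every term is supported at
      \<open>s\<close>.\<close>
    have "act (inv t) (bas r) x = 0" if x: "x \<noteq> s" for x
    proof -
      have lx: "linf (\<lambda>f. act (inv t) f x)" by (simp add: linf_def act_lin)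
      have "act (inv t) b = bas s" using c by (simp add: b_def)
      then have "0 = act (inv t) b x" using x by (simp add: bas_def)
      also have "\<dots> = (\<Sum>y\<in>S. b y * act (inv t) (bas y) x)"
        by (rule linf_sum_bas[OF lx]) (use posv_supp[OF b(2)] in blast)
      finally have z: "(\<Sum>y\<in>S. b y * act (inv t) (bas y) x) = 0" by simp
      have nn: "0 \<le> b y * act (inv t) (bas y) x" if "y \<in> S" for y
      proof (cases "y \<in> J")
        case True then show ?thesis using posv_nonneg[OF b(2)] posv_nonneg[OF pos] by simp
      next
        case False then show ?thesis using bJ by simp
      qed
      have "\<forall>y\<in>S. b y * act (inv t) (bas y) x = 0"
        using iffD1[OF sum_nonneg_eq_0_iff[OF finite_S nn] z] by blast
      then have "b r * act (inv t) (bas r) x = 0" using rJ by blast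
      then show ?thesis using r by simp
    qed
    then have "act (inv t) (bas r) = (\<lambda>x. act (inv t) (bas r) s * bas s x)" by (auto simp: bas_def)
    moreover have "act (inv t) (bas r) \<in> roots" using c rJ by simp
    ultimately have "act (inv t) (bas r) = bas s" using root_multiple pos[OF rJ(1)] sS by blast
    then have "act t (bas s) = bas r" using c by (metis act_inv(1))
    then have "t \<otimes> s = r \<otimes> t" by (rule simple_root_eq[OF c(1) sS rJ(2)])
    then show ?thesis using rJ by blast
  qed
  \<comment> \<open>The powers of \<open>w'\<close> and of \<open>t\<close> differ by a left factor
    in \<open>par J\<close>, which \<open>p\<close> does not see.\<close>
  have pt: "p (act (w' [^] m) f) = p (act (t [^] m) f)" for m :: nat and f
  proof -
    have "\<exists>k\<in>par J. w' [^] m = k \<otimes> t [^] m"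
    proof (induction m)
      case 0 then show ?case by (intro bexI[of _ \<one>]) auto
    next
      case (Suc m)
      then obtain k where k: "k \<in> par J" "w' [^] m = k \<otimes> t [^] m" by blast
      have "\<exists>k'\<in>par J. t [^] m \<otimes> v = k' \<otimes> t [^] m"
      proof (rule normalizes_par[OF J _ _ v])
        show "\<forall>s\<in>J. \<exists>s'\<in>J. t [^] m \<otimes> s = s' \<otimes> t [^] m"
        proof (induction m)
          case 0
          have "\<one> \<otimes> s = s \<otimes> \<one>" if "s \<in> J" for s using that J by (simp add: subset_iff)
          then show ?case by auto
        next
          case (Suc m)
          show ?case
          proof
            fix s assume s: "s \<in> J"
            obtain s' where s': "s' \<in> J" "t \<otimes> s = s' \<otimes> t" using norm s by blast
            obtain s'' where s'': "s'' \<in> J" "t [^] m \<otimes> s' = s'' \<otimes> t [^] m" using Suc s' by blast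
            have sc: "s \<in> carrier W" "s' \<in> carrier W" "s'' \<in> carrier W" using s s' s'' J by auto
            have "t [^] Suc m \<otimes> s = t [^] m \<otimes> (t \<otimes> s)" using c sc by (simp add: m_assoc)
            also have "\<dots> = (t [^] m \<otimes> s') \<otimes> t" unfolding s'(2) using c sc by (simp add: m_assoc)
            also have "\<dots> = s'' \<otimes> t [^] Suc m" unfolding s''(2) using c sc by (simp add: m_assoc)
            finally show "\<exists>s'\<in>J. t [^] Suc m \<otimes> s = s' \<otimes> t [^] Suc m" using s'' by blast
          qed
        qed
      qed (use c in simp)
      then obtain k' where k': "k' \<in> par J" "t [^] m \<otimes> v = k' \<otimes> t [^] m" by blast
      have kc: "k \<in> carrier W" "k' \<in> carrier W" using k k' par_carrier[OF J] by auto
      have "w' [^] Suc m = k \<otimes> t [^] m \<otimes> (v \<otimes> t)" using k vt by simp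
      also have "\<dots> = k \<otimes> (t [^] m \<otimes> v) \<otimes> t" using c kc by (simp add: m_assoc)
      also have "\<dots> = (k \<otimes> k') \<otimes> t [^] Suc m" unfolding k'(2) using c kc by (simp add: m_assoc)
      finally show ?case using par_mult[OF J k(1) k'(1)] by blast
    qed
    then obtain k where k: "k \<in> par J" "w' [^] m = k \<otimes> t [^] m" by blast
    then show ?thesis using p_par[OF k(1)] par_carrier[OF J] c by (simp add: act_mult)
  qed
  have straight: "len (t [^] n) = n * len t" for n :: nat
  proof (induction n)
    case (Suc n)
    have "len (t [^] n \<otimes> t) = len (t [^] n) + len t"
    proof (rule len_add_of_roots)
      fix b assume b: "b \<in> roots" "posv b" "negv (act (inv t) b)"
      \<comment> \<open>Otherwise the values along the orbit would be negative at index
        \<open>-n\<close>, positive at 0 and negative at 1.\<close>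
      show "\<not> negv (act (t [^] n) b)"
      proof
        assume neg: "negv (act (t [^] n) b)"
        have n: "n \<noteq> 0"
        proof
          assume "n = 0"
          then show False using neg b(2) not_posv_negv by simp
        qed
        have "p b \<noteq> 0"
        proof
          assume "p b = 0"
          then have "act (inv t) b \<in> ?F" using map[of b] b by blast
          then show False using b(3) not_posv_negv by blast
        qed
        then have pb: "0 < H b 0" using p0[OF b(2)] by (simp add: H0)
        have nz: "H b i \<noteq> 0" for i using clean_zero[OF clH[OF b(1)], of i 0] pb by auto
        have "H b (- int n) \<le> 0" unfolding Hn pt by (rule pneg[OF neg])
        then have n1: "H b (- int n) < 0" using nz[of "- int n"] by simp
        obtain v' where v': "v' \<in> par J" "inv t \<otimes> inv v = v' \<otimes> inv t"
        proof -
          have "\<forall>s\<in>J. \<exists>s'\<in>J. inv t \<otimes> s = s' \<otimes> inv t"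
            using normalizes_gens_inv[OF J c(1)] norm by blast
          from normalizes_par[OF J _ this par_inv[OF J v]] show ?thesis using that c by blast
        qed
        have "inv w' = inv t \<otimes> inv v" using vt c by (simp add: inv_mult_group)
        then have "H b 1 = p (act (inv t) b)"
          unfolding H1 using v' c par_carrier[OF J] p_par[OF v'(1)] by (simp add: act_mult)
        then have "H b 1 \<le> 0" using pneg[OF b(3)] by simp
        then have n2: "H b 1 < 0" using nz[of 1] by simp
        show False by (rule clean_no_return[OF clH[OF b(1)] _ _ n1 pb n2]) (use n in auto)
      qed
    qed (use c in auto)
    then show ?case using Suc c by simp
  qed simp
  have "reach w (v \<otimes> t)" using u vt by (simp add: w'_def)
  then show ?thesis using J fin v rt norm straight unfolding normalizes_def by blast
qed

end

section \<open>Buildings\<close>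

locale building =
  fixes W :: "('w,'b) monoid_scheme" (structure) and S :: "'w set" and C :: "'c set"
    and \<delta> :: "'c \<Rightarrow> 'c \<Rightarrow> 'w"
  assumes bld: "is_building W S C \<delta>"

lemma (in building) coxeter_finite: "coxeter_system W S \<and> finite S"
  using bld unfolding is_building_def by (elim conjE) (intro conjI)

sublocale building \<subseteq> coxeter
  using coxeter_finite by (intro coxeter.intro) (elim conjE, assumption)+

context building
begin

lemma dist_closed [simp]:
  assumes "x \<in> C" "y \<in> C"
  shows "\<delta> x y \<in> carrier W"
proof -
  have "\<forall>x\<in>C. \<forall>y\<in>C. \<delta> x y \<in> carrier W" using bld unfolding is_building_def by (elim conjE)
  then show ?thesis using assms by blast
qed

lemma dist_one_iff: "x \<in> C \<Longrightarrow> y \<in> C \<Longrightarrow> \<delta> x y = \<one> \<longleftrightarrow> x = y"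
  using bld unfolding is_building_def by blast

lemma dist_self [simp]: "x \<in> C \<Longrightarrow> \<delta> x x = \<one>"
  using dist_one_iff by blast

lemma dist_step: "x \<in> C \<Longrightarrow> y \<in> C \<Longrightarrow> z \<in> C \<Longrightarrow> \<delta> z x \<in> S \<Longrightarrow>
    \<delta> z y = \<delta> z x \<otimes> \<delta> x y \<or> \<delta> z y = \<delta> x y"
  using bld unfolding is_building_def by blast

lemma dist_step_up: "x \<in> C \<Longrightarrow> y \<in> C \<Longrightarrow> z \<in> C \<Longrightarrow> \<delta> z x \<in> S \<Longrightarrow>
    len (\<delta> z x \<otimes> \<delta> x y) = Suc (len (\<delta> x y)) \<Longrightarrow> \<delta> z y = \<delta> z x \<otimes> \<delta> x y"
  using bld unfolding is_building_def by blast

lemma ex_adjacent: "x \<in> C \<Longrightarrow> y \<in> C \<Longrightarrow> s \<in> S \<Longrightarrow> \<exists>z\<in>C. \<delta> z x = s \<and> \<delta> z y = s \<otimes> \<delta> x y"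
  using bld unfolding is_building_def by blast

lemma adjacent_sym: "x \<in> C \<Longrightarrow> z \<in> C \<Longrightarrow> \<delta> z x \<in> S \<Longrightarrow> \<delta> x z = \<delta> z x"
proof -
  assume a: "x \<in> C" "z \<in> C" "\<delta> z x \<in> S"
  have "\<delta> z z = \<delta> z x \<otimes> \<delta> x z \<or> \<delta> z z = \<delta> x z" by (rule dist_step) (use a in auto)
  then show ?thesis
  proof
    assume "\<delta> z z = \<delta> z x \<otimes> \<delta> x z"
    from arg_cong[OF this, of "\<lambda>v. \<delta> z x \<otimes> v"] show ?thesis using a by simp
  next
    assume "\<delta> z z = \<delta> x z"
    then have "\<delta> x z = \<one>" using a by simp
    then have "x = z" using a dist_one_iff[of x z] by blast
    then show ?thesis by simp
  qed
qed

text \<open>For a word over \<open>S\<close> consecutive chambers are adjacent and distinct, with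
  the word as the type of the gallery.\<close>

fun gallery :: "'w list \<Rightarrow> 'c \<Rightarrow> 'c \<Rightarrow> bool" where
  "gallery [] x y \<longleftrightarrow> x = y"
| "gallery (s # ss) x y \<longleftrightarrow> (\<exists>z\<in>C. \<delta> x z = s \<and> gallery ss z y)"

lemma gallery_exists:
  "x \<in> C \<Longrightarrow> y \<in> C \<Longrightarrow> set xs \<subseteq> S \<Longrightarrow> wprod xs = \<delta> x y \<Longrightarrow> gallery xs x y"
proof (induction xs arbitrary: x)
  case Nil
  then have "\<delta> x y = \<one>" by simp
  then show ?case using Nil dist_one_iff[of x y] by simp
next
  case (Cons s xs)
  have s: "s \<in> S" "set xs \<subseteq> S" using Cons by auto
  obtain z where z: "z \<in> C" "\<delta> z x = s" "\<delta> z y = s \<otimes> \<delta> x y" using ex_adjacent Cons s by blast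
  have "wprod xs = \<delta> z y" using z(3) Cons.prems(4) s by (simp add: Cons.prems(4)[symmetric])
  then have "gallery xs z y" using Cons z s by simp
  moreover have "\<delta> x z = s" using adjacent_sym[of x z] z s Cons by simp
  ultimately show ?case using z by auto
qed

lemma gallery_append: "gallery (xs @ ys) x y \<longleftrightarrow> (\<exists>z. gallery xs x z \<and> gallery ys z y)"
  by (induction xs arbitrary: x) auto

lemma gallery_closed: "gallery xs x y \<Longrightarrow> x \<in> C \<Longrightarrow> y \<in> C"
  by (induction xs arbitrary: x) auto

lemma gallery_rev: "x \<in> C \<Longrightarrow> set xs \<subseteq> S \<Longrightarrow> gallery xs x y \<Longrightarrow> gallery (rev xs) y x"
proof (induction xs arbitrary: x)
  case (Cons s xs)
  then obtain z where z: "z \<in> C" "\<delta> x z = s" "gallery xs z y" by auto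
  then have "gallery (rev xs) y z" using Cons by auto
  moreover have "\<delta> z x = s" using adjacent_sym[of z x] z Cons by auto
  ultimately show ?case using z Cons by (auto simp: gallery_append)
qed simp

text \<open>Prepending a letter to a reduced word raises the length, the case in which the axioms
  leave only one value for the distance.\<close>

lemma gallery_dist:
  "x \<in> C \<Longrightarrow> set xs \<subseteq> S \<Longrightarrow> length xs = len (wprod xs) \<Longrightarrow> gallery xs x y \<Longrightarrow> \<delta> x y = wprod xs"
proof (induction xs arbitrary: x)
  case (Cons s xs)
  then obtain z where z: "z \<in> C" "\<delta> x z = s" "gallery xs z y" by auto
  have s: "s \<in> S" "set xs \<subseteq> S" using Cons by auto
  have y: "y \<in> C" using gallery_closed z by blast
  have "len (wprod (s # xs)) \<le> Suc (len (wprod xs))" using len_left_cases[of s "wprod xs"] s by auto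
  then have l: "length xs = len (wprod xs)" using Cons.prems(3) len_le[OF s(2)] by simp
  then have d: "\<delta> z y = wprod xs" using Cons.IH z s by blast
  have "\<delta> x y = \<delta> x z \<otimes> \<delta> z y"
    by (rule dist_step_up) (use z y s d l Cons.prems in auto)
  then show ?case using z d by simp
qed simp

lemma dist_sym: "x \<in> C \<Longrightarrow> y \<in> C \<Longrightarrow> \<delta> y x = inv (\<delta> x y)"
proof -
  assume x: "x \<in> C" and y: "y \<in> C"
  obtain xs where xs: "set xs \<subseteq> S" "length xs = len (\<delta> x y)" "wprod xs = \<delta> x y"
    using reduced_word[OF dist_closed[OF x y]] .
  have "gallery (rev xs) y x" using gallery_rev[OF x xs(1)] gallery_exists[OF x y xs(1,3)] by simp
  moreover have "length (rev xs) = len (wprod (rev xs))" using xs x y by (simp add: wprod_rev)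
  ultimately have "\<delta> y x = wprod (rev xs)" using gallery_dist[OF y, of "rev xs"] xs by simp
  then show ?thesis using xs by (simp add: wprod_rev)
qed

text \<open>Galleries exist for every word representing the distance, reduced or not, so an
  arbitrary factorisation can be realised.\<close>

lemma dist_split:
  assumes "x \<in> C" "z \<in> C" "u \<in> carrier W" "v \<in> carrier W" "\<delta> x z = u \<otimes> v"
  obtains y where "y \<in> C" "\<delta> x y = u" "\<delta> y z = v"
proof -
  obtain xs where xs: "set xs \<subseteq> S" "length xs = len u" "wprod xs = u" using reduced_word assms(3) .
  obtain ys where ys: "set ys \<subseteq> S" "length ys = len v" "wprod ys = v" using reduced_word assms(4) .
  have "gallery (xs @ ys) x z" by (rule gallery_exists) (use assms xs ys in \<open>auto simp: wprod_append\<close>)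
  then obtain y where y: "gallery xs x y" "gallery ys y z" by (auto simp: gallery_append)
  have "y \<in> C" using gallery_closed y(1) assms(1) by blast
  moreover have "\<delta> x y = u" using gallery_dist[OF assms(1) xs(1) _ y(1)] xs by simp
  moreover have "\<delta> y z = v" using gallery_dist[OF \<open>y \<in> C\<close> ys(1) _ y(2)] ys by simp
  ultimately show ?thesis using that by blast
qed

lemma dist_add:
  assumes "x \<in> C" "y \<in> C" "z \<in> C" "len (\<delta> x y \<otimes> \<delta> y z) = len (\<delta> x y) + len (\<delta> y z)"
  shows "\<delta> x z = \<delta> x y \<otimes> \<delta> y z"
proof -
  obtain xs where xs: "set xs \<subseteq> S" "length xs = len (\<delta> x y)" "wprod xs = \<delta> x y"
    using reduced_word[OF dist_closed[OF assms(1,2)]] .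
  obtain ys where ys: "set ys \<subseteq> S" "length ys = len (\<delta> y z)" "wprod ys = \<delta> y z"
    using reduced_word[OF dist_closed[OF assms(2,3)]] .
  have "gallery (xs @ ys) x z"
    unfolding gallery_append using gallery_exists[OF assms(1,2) xs(1,3)] gallery_exists[OF assms(2,3) ys(1,3)] by blast
  then have "\<delta> x z = wprod (xs @ ys)"
    by (intro gallery_dist) (use assms xs ys in \<open>auto simp: wprod_append\<close>)
  then show ?thesis using xs ys by (simp add: wprod_append)
qed

lemma dist_step_right: "x \<in> C \<Longrightarrow> y \<in> C \<Longrightarrow> z \<in> C \<Longrightarrow> \<delta> y z \<in> S \<Longrightarrow>
    \<delta> x z = \<delta> x y \<otimes> \<delta> y z \<or> \<delta> x z = \<delta> x y"
proof -
  assume a: "x \<in> C" "y \<in> C" "z \<in> C" "\<delta> y z \<in> S"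
  have zy: "\<delta> z y = \<delta> y z" using adjacent_sym[of z y] a by simp
  have "\<delta> z x = \<delta> z y \<otimes> \<delta> y x \<or> \<delta> z x = \<delta> y x" by (rule dist_step) (use a zy in auto)
  then show ?thesis using a zy dist_sym[of z x] dist_sym[of y x] by (auto simp: inv_mult_group)
qed

lemma ex_adjacent_right: "x \<in> C \<Longrightarrow> y \<in> C \<Longrightarrow> s \<in> S \<Longrightarrow> \<exists>z\<in>C. \<delta> y z = s \<and> \<delta> x z = \<delta> x y \<otimes> s"
proof -
  assume a: "x \<in> C" "y \<in> C" "s \<in> S"
  obtain z where z: "z \<in> C" "\<delta> z y = s" "\<delta> z x = s \<otimes> \<delta> y x" using ex_adjacent[OF a(2,1,3)] by blast
  have "\<delta> y z = s" using adjacent_sym[of y z] z a by simp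
  moreover have "\<delta> x z = \<delta> x y \<otimes> s" using z a dist_sym[of z x] dist_sym[of y x] by (simp add: inv_mult_group)
  ultimately show ?thesis using z by blast
qed

text \<open>Compare the first chambers \<open>a\<close> and \<open>b\<close> on galleries towards
  \<open>y\<close> and \<open>y'\<close>. If they were distinct they would be
  \<open>s\<close>-adjacent to each other, and the distance from \<open>a\<close> to
  \<open>z\<close> would be longer than the known one. So they agree, and induction continues from
  there.\<close>

lemma split_unique:
  assumes "x \<in> C" "y \<in> C" "y' \<in> C" "z \<in> C" "\<delta> x y = \<delta> x y'" "\<delta> y z = \<delta> y' z"
    "len (\<delta> x y \<otimes> \<delta> y z) = len (\<delta> x y) + len (\<delta> y z)"
  shows "y = y'"
  using assms
proof (induction "len (\<delta> x y)" arbitrary: x)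
  case 0
  then have "\<delta> x y = \<one>" using len_0_iff by simp
  then show ?case using 0 dist_one_iff by metis
next
  case (Suc n)
  let ?u = "\<delta> x y" and ?v = "\<delta> y z"
  obtain xs where xs: "set xs \<subseteq> S" "length xs = len ?u" "wprod xs = ?u" using reduced_word[OF dist_closed[OF Suc(3,4)]] by blast
  then obtain s ys where ys: "xs = s # ys" using Suc(2) by (cases xs) auto
  define u' where "u' = wprod ys"
  have s: "s \<in> S" "u' \<in> carrier W" "?u = s \<otimes> u'" using xs ys by (auto simp: u'_def)
  have "len u' \<le> n" using len_le[of ys] xs ys Suc(2) by (simp add: u'_def)
  then have l: "len u' = n" using len_left_cases[of s u'] s Suc(2) by auto
  have sc: "s \<in> carrier W" using s by simp
  obtain a where a: "a \<in> C" "\<delta> x a = s" "\<delta> a y = u'"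
    using dist_split[OF Suc(3,4) sc s(2,3)] .
  obtain b where b: "b \<in> C" "\<delta> x b = s" "\<delta> b y' = u'"
    using dist_split[OF Suc(3,5) sc s(2)] s(3) Suc(7) by metis
  have vc: "?v \<in> carrier W" using Suc by simp
  have l1: "len (s \<otimes> (u' \<otimes> ?v)) = Suc n + len ?v" using Suc(9) s vc Suc(2) by (simp add: m_assoc)
  have l2: "len (u' \<otimes> ?v) = n + len ?v"
    using l1 len_mult_le[of u' ?v] s vc l len_left_cases[of s "u' \<otimes> ?v"] by auto
  have az: "\<delta> a z = u' \<otimes> ?v" using dist_add[of a y z] a Suc l l2 by simp
  have bz: "\<delta> b z = u' \<otimes> ?v" using dist_add[of b y' z] b Suc l l2 by simp
  have "a = b"
  proof (rule ccontr)
    assume ne: "a \<noteq> b"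
    have "\<delta> a x = s" using adjacent_sym[of a x] a Suc s by simp
    then have "\<delta> a b = s \<otimes> s \<or> \<delta> a b = s" using dist_step[of x b a] a b Suc s by simp
    then have ab: "\<delta> a b = s" using ne dist_one_iff a b s by auto
    have "\<delta> a z = s \<otimes> (u' \<otimes> ?v)" using dist_step_up[of b z a] a b ab bz l1 l2 s Suc by simp
    then show False using az l1 l2 by simp
  qed
  show ?case
    by (rule Suc(1)[of a]) (use a b \<open>a = b\<close> Suc l l2 in auto)
qed

section \<open>Spheres, residues, projections and alignment\<close>

definition sphere :: "'c \<Rightarrow> 'w \<Rightarrow> 'c set" where "sphere x w = {y \<in> C. \<delta> x y = w}"

lemma sphere_add_bij:
  assumes x: "x \<in> C" and uv: "u \<in> carrier W" "v \<in> carrier W" "len (u \<otimes> v) = len u + len v"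
  shows "bij_betw snd (SIGMA y:sphere x u. sphere y v) (sphere x (u \<otimes> v))"
proof (rule bij_betw_imageI)
  show "inj_on snd (SIGMA y:sphere x u. sphere y v)"
  proof (rule inj_onI, clarsimp simp: sphere_def)
    fix y y' z assume "y \<in> C" "y' \<in> C" "z \<in> C" "u = \<delta> x y" "v = \<delta> y z" "\<delta> x y' = \<delta> x y" "\<delta> y' z = \<delta> y z"
    then show "y = y'" using split_unique[of x y y' z] x uv by simp
  qed
  show "snd ` (SIGMA y:sphere x u. sphere y v) = sphere x (u \<otimes> v)"
  proof (intro Set.set_eqI iffI)
    fix z assume "z \<in> snd ` (SIGMA y:sphere x u. sphere y v)"
    then obtain y where "y \<in> C" "z \<in> C" "\<delta> x y = u" "\<delta> y z = v" by (auto simp: sphere_def)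
    then show "z \<in> sphere x (u \<otimes> v)" using dist_add[of x y z] x uv by (simp add: sphere_def)
  next
    fix z assume z: "z \<in> sphere x (u \<otimes> v)"
    then have "z \<in> C" "\<delta> x z = u \<otimes> v" by (auto simp: sphere_def)
    then obtain y where "y \<in> C" "\<delta> x y = u" "\<delta> y z = v" using dist_split[OF x _ uv(1,2)] by metis
    then have "(y, z) \<in> (SIGMA y:sphere x u. sphere y v)" using z by (auto simp: sphere_def)
    then show "z \<in> snd ` (SIGMA y:sphere x u. sphere y v)" by (metis image_eqI snd_conv)
  qed
qed

lemma gallery_par:
  "J \<subseteq> S \<Longrightarrow> x \<in> C \<Longrightarrow> set xs \<subseteq> J \<Longrightarrow> gallery xs x y \<Longrightarrow> \<delta> x y \<in> par J"
proof (induction xs arbitrary: x)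
  case (Cons s xs)
  then obtain z where z: "z \<in> C" "\<delta> x z = s" "gallery xs z y" by auto
  then have d: "\<delta> z y \<in> par J" using Cons by auto
  have y: "y \<in> C" using gallery_closed z by blast
  have sJ: "s \<in> J" "s \<in> S" using Cons by auto
  have "\<delta> x y = s \<otimes> \<delta> z y \<or> \<delta> x y = \<delta> z y" using dist_step[of z y x] z y Cons sJ by auto
  then show ?case using d par_mult[OF Cons.prems(1) par_gen[OF Cons.prems(1) sJ(1)] d] by auto
qed simp

lemma par_trans:
  assumes J: "J \<subseteq> S" and x: "x \<in> C" "y \<in> C" "z \<in> C" and "\<delta> x y \<in> par J" "\<delta> y z \<in> par J"
  shows "\<delta> x z \<in> par J"
proof -
  obtain xs where xs: "set xs \<subseteq> J" "wprod xs = \<delta> x y" using assms by (auto simp: std_parabolic_def)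
  obtain ys where ys: "set ys \<subseteq> J" "wprod ys = \<delta> y z" using assms by (auto simp: std_parabolic_def)
  have "gallery (xs @ ys) x z"
    unfolding gallery_append using gallery_exists[OF x(1,2) _ xs(2)] gallery_exists[OF x(2,3) _ ys(2)] xs ys J by blast
  then show ?thesis using gallery_par[OF J x(1), of "xs @ ys"] xs ys by simp
qed

abbreviation res :: "'w set \<Rightarrow> 'c \<Rightarrow> 'c set" where "res J x \<equiv> residue W J C \<delta> x"

lemma res_self: "x \<in> C \<Longrightarrow> x \<in> res J x" by (simp add: residue_def)

lemma res_sub: "res J x \<subseteq> C" by (auto simp: residue_def)

lemma res_eq: "J \<subseteq> S \<Longrightarrow> x \<in> C \<Longrightarrow> y \<in> res J x \<Longrightarrow> res J y = res J x"
proof -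
  assume J: "J \<subseteq> S" and x: "x \<in> C" and y: "y \<in> res J x"
  have y': "y \<in> C" "\<delta> x y \<in> par J" using y by (auto simp: residue_def)
  have yx: "\<delta> y x \<in> par J" using par_inv[OF J y'(2)] dist_sym[OF x y'(1)] by simp
  show ?thesis
    unfolding residue_def using par_trans[OF J x y'(1) _ y'(2)] par_trans[OF J y'(1) x _ yx] by blast
qed

lemma res_dist: "J \<subseteq> S \<Longrightarrow> x \<in> C \<Longrightarrow> y \<in> res J x \<Longrightarrow> z \<in> res J x \<Longrightarrow> \<delta> y z \<in> par J"
  using res_eq[of J x y] by (auto simp: residue_def)

text \<open>The gate property of residues: lengths add because the distance to \<open>y\<close> is
  shortest in its coset, and then distances multiply.\<close>

lemma gate:
  assumes J: "J \<subseteq> S" and x: "x \<in> C" and y: "y \<in> C" and r: "rmin J (\<delta> x y)" and z: "z \<in> res J y"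
  shows "\<delta> x z = \<delta> x y \<otimes> \<delta> y z" "len (\<delta> x z) = len (\<delta> x y) + len (\<delta> y z)"
proof -
  have z': "z \<in> C" "\<delta> y z \<in> par J" using z by (auto simp: residue_def)
  have l: "len (\<delta> x y \<otimes> \<delta> y z) = len (\<delta> x y) + len (\<delta> y z)" by (rule rmin_add[OF J r z'(2)])
  show 1: "\<delta> x z = \<delta> x y \<otimes> \<delta> y z" by (rule dist_add[OF x y z'(1) l])
  show "len (\<delta> x z) = len (\<delta> x y) + len (\<delta> y z)" unfolding 1 by (rule l)
qed

lemma proj_gate:
  assumes J: "J \<subseteq> S" and x: "x \<in> C" and y: "y \<in> C" and r: "rmin J (\<delta> x y)"
  shows "proj W S \<delta> (res J y) x = y"
  unfolding proj_def
proof (rule the_equality)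
  show "y \<in> res J y \<and> (\<forall>z\<in>res J y. len (\<delta> x y) \<le> len (\<delta> x z))"
  proof (intro conjI ballI res_self[OF y])
    fix z assume "z \<in> res J y"
    from gate(2)[OF assms this] show "len (\<delta> x y) \<le> len (\<delta> x z)" by simp
  qed
next
  fix y' assume a: "y' \<in> res J y \<and> (\<forall>z\<in>res J y. len (\<delta> x y') \<le> len (\<delta> x z))"
  then have "len (\<delta> x y') \<le> len (\<delta> x y)" using res_self[OF y] by blast
  then have "len (\<delta> y y') = 0" using gate(2)[OF assms] a by force
  moreover have "y' \<in> C" using a res_sub by blast
  ultimately show "y' = y" using len_0_iff[of "\<delta> y y'"] dist_one_iff y by auto
qed

lemma gate_exists:
  assumes J: "J \<subseteq> S" and x: "x \<in> C" and y0: "y0 \<in> C"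
  obtains y where "y \<in> res J y0" "rmin J (\<delta> x y)"
proof -
  obtain y where y: "y \<in> res J y0" and min: "\<And>z. z \<in> res J y0 \<Longrightarrow> len (\<delta> x y) \<le> len (\<delta> x z)"
    using ex_has_least_nat[of "\<lambda>z. z \<in> res J y0" y0 "\<lambda>z. len (\<delta> x z)"] res_self[OF y0] by blast
  have yC: "y \<in> C" using y res_sub by blast
  have "len (\<delta> x y) < len (\<delta> x y \<otimes> s)" if s: "s \<in> J" for s
  proof -
    have sS: "s \<in> S" using s J by blast
    obtain z where z: "z \<in> C" "\<delta> y z = s" "\<delta> x z = \<delta> x y \<otimes> s" using ex_adjacent_right[OF x yC sS] by blast
    have "z \<in> res J y" using z par_gen[OF J s] by (simp add: residue_def)
    then have "len (\<delta> x y) \<le> len (\<delta> x y \<otimes> s)" using min[of z] res_eq[OF J y0 y] z by simp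
    then show ?thesis using len_right_cases[OF sS dist_closed[OF x yC]] by auto
  qed
  then show ?thesis using that[OF y] x yC by (simp add: rmin_def)
qed

text \<open>With \<open>k\<close> the distance from \<open>x'\<close> to \<open>x\<close>, normality
  rewrites \<open>k t\<close> as \<open>t k'\<close>; splitting the distance from \<open>x'\<close>
  to \<open>y\<close> after \<open>t\<close> gives \<open>y'\<close>.\<close>

lemma normal_shift:
  assumes J: "J \<subseteq> S" and x: "x \<in> C" and y: "y \<in> C" and n: "normalizes J (\<delta> x y)" and x': "x' \<in> res J x"
  obtains y' where "y' \<in> res J y" "\<delta> x' y' = \<delta> x y"
proof -
  let ?t = "\<delta> x y"
  have x'C: "x' \<in> C" "\<delta> x' x \<in> par J" using x' res_sub res_dist[OF J x x' res_self[OF x]] by auto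
  let ?k = "\<delta> x' x"
  have kc: "?k \<in> carrier W" using x'C x by simp
  have tc: "?t \<in> carrier W" using x y by simp
  have "len (?k \<otimes> ?t) = len ?k + len ?t" by (rule lmin_add[OF J normalizes_lmin[OF J n] x'C(2)])
  then have d: "\<delta> x' y = ?k \<otimes> ?t" using dist_add[OF x'C(1) x y] by simp
  have ni: "\<forall>s\<in>J. \<exists>s'\<in>J. inv ?t \<otimes> s = s' \<otimes> inv ?t"
    using normalizes_inv[OF J n] by (simp add: normalizes_def)
  obtain k' where k': "k' \<in> par J" "inv ?t \<otimes> ?k = k' \<otimes> inv ?t"
    using normalizes_par[OF J inv_closed[OF tc] ni x'C(2)] by blast
  have k'c: "k' \<in> carrier W" using par_carrier[OF J k'(1)] .
  have "?t \<otimes> (inv ?t \<otimes> ?k) \<otimes> ?t = ?t \<otimes> (k' \<otimes> inv ?t) \<otimes> ?t" using k'(2) by simp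
  moreover have "?t \<otimes> (inv ?t \<otimes> ?k) \<otimes> ?t = ?k \<otimes> ?t" using tc kc by (simp add: m_assoc[symmetric])
  moreover have "?t \<otimes> (k' \<otimes> inv ?t) \<otimes> ?t = ?t \<otimes> k'" using tc k'c by (simp add: m_assoc)
  ultimately have "?k \<otimes> ?t = ?t \<otimes> k'" by simp
  then have "\<delta> x' y = ?t \<otimes> k'" using d by simp
  then obtain y' where y': "y' \<in> C" "\<delta> x' y' = ?t" "\<delta> y' y = k'" using dist_split[OF x'C(1) y tc k'c] by blast
  have "\<delta> y y' \<in> par J" using dist_sym[OF y'(1) y] y' par_inv[OF J k'(1)] by simp
  then show ?thesis using that[of y'] y' by (simp add: residue_def)
qed

lemma proj_set_normal:
  assumes J: "J \<subseteq> S" and x: "x \<in> C" and y: "y \<in> C" and n: "normalizes J (\<delta> x y)"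
  shows "proj_set W S \<delta> (res J y) (res J x) = res J y"
proof (intro Set.set_eqI iffI)
  have pr: "proj W S \<delta> (res J y) x' = y'" if "x' \<in> res J x" "y' \<in> res J y" "\<delta> x' y' = \<delta> x y" for x' y'
  proof -
    have "x' \<in> C" "y' \<in> C" using that res_sub by auto
    then show ?thesis using proj_gate[OF J, of x' y'] n res_eq[OF J y that(2)] that(3) by (simp add: normalizes_def)
  qed
  fix y'
  {
    assume "y' \<in> proj_set W S \<delta> (res J y) (res J x)"
    then obtain x' where x': "x' \<in> res J x" "y' = proj W S \<delta> (res J y) x'" by (auto simp: proj_set_def)
    obtain y'' where "y'' \<in> res J y" "\<delta> x' y'' = \<delta> x y" using normal_shift[OF assms x'(1)] .
    then show "y' \<in> res J y" using pr[OF x'(1)] x'(2) by simp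
  next
    assume y': "y' \<in> res J y"
    have "normalizes J (\<delta> y x)" using normalizes_inv[OF J n] dist_sym[OF x y] by simp
    then obtain x' where x': "x' \<in> res J x" "\<delta> y' x' = \<delta> y x" using normal_shift[OF J y x _ y'] by blast
    have c: "x' \<in> C" "y' \<in> C" using x' y' res_sub by auto
    have "\<delta> x' y' = \<delta> x y" using dist_sym[OF c(2,1)] dist_sym[OF y x] x'(2) by simp
    then have "proj W S \<delta> (res J y) x' = y'" using pr[OF x'(1) y'] by simp
    then show "y' \<in> proj_set W S \<delta> (res J y) (res J x)" using x'(1) by (auto simp: proj_set_def)
  }
qed

lemma aligned_normal:
  assumes J: "J \<subseteq> S" and x: "x \<in> C" and y: "y \<in> C" and n: "normalizes J (\<delta> x y)"
  shows "aligned W S \<delta> (res J x) (res J y)"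
proof -
  have "normalizes J (\<delta> y x)" using normalizes_inv[OF J n] dist_sym[OF x y] by simp
  then show ?thesis unfolding aligned_def
    using proj_set_normal[OF J x y n] proj_set_normal[OF J y x] by blast
qed

text \<open>A closest pair \<open>x\<close>, \<open>y\<close> has a distance \<open>t\<close> that
  is shortest on both sides. For \<open>s\<close> in \<open>J\<close>, an \<open>s\<close>-neighbour
  \<open>y'\<close> of \<open>y\<close> is the projection of some \<open>x'\<close>, so the distance
  \<open>k t\<close> from \<open>x'\<close> to \<open>y\<close> has \<open>s\<close> as a right
  descent. Exchange deletes a letter of \<open>k\<close>, since deleting one of \<open>t\<close>
  would contradict minimality. Hence \<open>t s = j t\<close> with \<open>j\<close> in
  \<open>par J\<close>, and comparing lengths shows that \<open>j\<close> is a generator.\<close>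

lemma normal_of_aligned:
  assumes J: "J \<subseteq> S" and x0: "x0 \<in> C" and y0: "y0 \<in> C"
    and al: "proj_set W S \<delta> (res J y0) (res J x0) = res J y0"
  obtains x y where "x \<in> res J x0" "y \<in> res J y0" "normalizes J (\<delta> x y)"
proof -
  obtain p where p: "p \<in> res J x0 \<times> res J y0"
    and min: "\<And>p'. p' \<in> res J x0 \<times> res J y0 \<Longrightarrow> len (\<delta> (fst p) (snd p)) \<le> len (\<delta> (fst p') (snd p'))"
    using ex_has_least_nat[of "\<lambda>p. p \<in> res J x0 \<times> res J y0" "(x0, y0)" "\<lambda>p. len (\<delta> (fst p) (snd p))"]
      res_self[OF x0] res_self[OF y0] by blast
  obtain x y where xy: "p = (x, y)" using prod.exhaust by blast
  have x: "x \<in> res J x0" "x \<in> C" and y: "y \<in> res J y0" "y \<in> C" using p xy res_sub by auto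
  have rx: "res J x = res J x0" and ry: "res J y = res J y0" using res_eq[OF J x0 x(1)] res_eq[OF J y0 y(1)] by auto
  let ?t = "\<delta> x y"
  have m: "len ?t \<le> len (\<delta> x' y')" if "x' \<in> res J x" "y' \<in> res J y" for x' y'
    using min[of "(x', y')"] that xy rx ry by simp
  have tc: "?t \<in> carrier W" using x y by simp
  have rm: "rmin J ?t" unfolding rmin_def
  proof (intro conjI ballI tc)
    fix s assume s: "s \<in> J"
    then have sS: "s \<in> S" using J by blast
    obtain z where z: "z \<in> C" "\<delta> y z = s" "\<delta> x z = ?t \<otimes> s" using ex_adjacent_right[OF x(2) y(2) sS] by blast
    have "z \<in> res J y" using z par_gen[OF J s] by (simp add: residue_def)
    then have "len ?t \<le> len (?t \<otimes> s)" using m[OF res_self[OF x(2)]] z by metis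
    then show "len ?t < len (?t \<otimes> s)" using len_right_cases[OF sS tc] by auto
  qed
  have lm: "lmin J ?t" unfolding lmin_def
  proof (intro conjI ballI tc)
    fix s assume s: "s \<in> J"
    then have sS: "s \<in> S" using J by blast
    obtain z where z: "z \<in> C" "\<delta> z x = s" "\<delta> z y = s \<otimes> ?t" using ex_adjacent[OF x(2) y(2) sS] by blast
    have "\<delta> x z = s" using adjacent_sym[of x z] z x sS by simp
    then have "z \<in> res J x" using z par_gen[OF J s] by (simp add: residue_def)
    then have "len ?t \<le> len (s \<otimes> ?t)" using m[OF _ res_self[OF y(2)]] z by metis
    then show "len ?t < len (s \<otimes> ?t)" using len_left_cases[OF sS tc] by auto
  qed
  have "\<exists>s'\<in>J. ?t \<otimes> s = s' \<otimes> ?t" if s: "s \<in> J" for s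
  proof -
    have sS: "s \<in> S" and sc: "s \<in> carrier W" using s J by auto
    obtain y' where y': "y' \<in> C" "\<delta> y y' = s" using ex_adjacent_right[OF x(2) y(2) sS] by blast
    have y'r: "y' \<in> res J y" using y' par_gen[OF J s] by (simp add: residue_def)
    then have "y' \<in> proj_set W S \<delta> (res J y) (res J x)" using al rx ry by simp
    then obtain x' where x': "x' \<in> res J x" "y' = proj W S \<delta> (res J y) x'"
      by (auto simp: proj_set_def)
    have x'C: "x' \<in> C" using x' res_sub by blast
    have rm': "rmin J (\<delta> x' y')"
    proof -
      obtain g where g: "g \<in> res J y" "rmin J (\<delta> x' g)" using gate_exists[OF J x'C y(2)] .
      have gC: "g \<in> C" using g res_sub by blast
      have "proj W S \<delta> (res J y) x' = g" using proj_gate[OF J x'C gC g(2)] res_eq[OF J y(2) g(1)] by simp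
      then show ?thesis using x' g by simp
    qed
    let ?m = "\<delta> x' y'" and ?k = "\<delta> x' x"
    have k: "?k \<in> par J" using res_dist[OF J x(2) x'(1) res_self[OF x(2)]] .
    have c: "?m \<in> carrier W" "?k \<in> carrier W" using x'C y' x by auto
    have "\<delta> y' y = s" using adjacent_sym[of y' y] y' y sS by simp
    moreover have "y \<in> res J y'" using res_eq[OF J y(2) y'r] res_self[OF y(2)] by simp
    ultimately have d1: "\<delta> x' y = ?m \<otimes> s" "len (\<delta> x' y) = Suc (len ?m)"
      using gate[OF J x'C y'(1) rm', of y] sS by auto
    have l: "len (?k \<otimes> ?t) = len ?k + len ?t" by (rule lmin_add[OF J lm k])
    have d2: "\<delta> x' y = ?k \<otimes> ?t" by (rule dist_add[OF x'C x(2) y(2) l])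
    have kts: "?k \<otimes> ?t \<otimes> s = ?m" using d1 d2 sS c by (metis S_cancel_right)
    obtain ks where ks: "set ks \<subseteq> J" "length ks = len ?k" "wprod ks = ?k" using par_reduced_word J k .
    obtain ts where ts: "set ts \<subseteq> S" "length ts = len ?t" "wprod ts = ?t" using reduced_word tc .
    have ksS: "set ks \<subseteq> S" using ks J by blast
    have w: "wprod (ks @ ts) = ?k \<otimes> ?t" using ks ts ksS by (simp add: wprod_append)
    obtain as b cs where e: "ks @ ts = as @ b # cs" "wprod (ks @ ts) \<otimes> s = wprod (as @ cs)"
      by (rule exchange_right[OF sS, of "ks @ ts"]) (use ksS ks ts w l kts d1 d2 in auto)
    show ?thesis
    proof (cases "length as < length ks")
      case True
      obtain ds where ds: "ks = as @ b # ds" "cs = ds @ ts"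
        using e(1) True by (cases "length ks - length as") (auto simp: append_eq_append_conv2 append_eq_Cons_conv)
      let ?j = "wprod (as @ ds)"
      have js: "set (as @ ds) \<subseteq> J" using ds ks by auto
      then have jp: "?j \<in> par J" unfolding std_parabolic_def by blast
      have jc: "?j \<in> carrier W" using par_carrier[OF J jp] .
      have "?k \<otimes> ?t \<otimes> s = ?j \<otimes> ?t"
        using e(2) w ds(2) ts subset_trans[OF js J] tc by (simp add: wprod_append m_assoc)
      then have "?t \<otimes> s = (inv ?k \<otimes> ?j) \<otimes> ?t"
        using c tc sc jc by (metis inv_solve_left m_assoc m_closed inv_closed)
      moreover have i: "inv ?k \<otimes> ?j \<in> par J" using par_mult[OF J par_inv[OF J k] jp] .
      moreover have "len (?t \<otimes> s) = Suc (len ?t)"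
        using rm s len_right_cases[OF sS tc] by (auto simp: rmin_def)
      ultimately have "len (inv ?k \<otimes> ?j) = 1" using lmin_add[OF J lm i] by simp
      then have "inv ?k \<otimes> ?j \<in> J" using par_len_1[OF J i] by simp
      then show ?thesis using \<open>?t \<otimes> s = (inv ?k \<otimes> ?j) \<otimes> ?t\<close> by blast
    next
      case False
      then obtain ds where ds: "as = ks @ ds" "ts = ds @ b # cs"
        using e(1) by (auto simp: append_eq_append_conv2)
      have sub: "set (ds @ cs) \<subseteq> S" using ds ts by auto
      have "?k \<otimes> (?t \<otimes> s) = ?k \<otimes> wprod (ds @ cs)"
        using e(2) w ds ks ksS sub c tc sc by (simp add: wprod_append m_assoc)
      then have "?t \<otimes> s = wprod (ds @ cs)" using c tc sc wprod_closed[OF sub] by simp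
      then have "len (?t \<otimes> s) < len ?t" using len_le[OF sub] ds ts by simp
      then show ?thesis using rm s by (auto simp: rmin_def)
    qed
  qed
  then show ?thesis using that[of x y] x y rm by (simp add: normalizes_def)
qed

text \<open>Conjugation by \<open>s\<close> is realised by moving \<open>x\<close> to a suitable
  \<open>s\<close>-neighbour. The axioms allow one other outcome, a shorter displacement, which
  \<open>min_displacement\<close> excludes through the choice of its chamber.\<close>

lemma displacement_lift:
  assumes g: "bij_betw g C C" "\<And>x y. x \<in> C \<Longrightarrow> y \<in> C \<Longrightarrow> \<delta> (g x) (g y) = \<delta> x y"
    and x: "x \<in> C" and st: "shift_step (\<delta> x (g x)) w'"
  shows "\<exists>y\<in>C. \<delta> y (g y) = w' \<or> len (\<delta> y (g y)) < len (\<delta> x (g x))"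
proof -
  have gC: "g y \<in> C" if "y \<in> C" for y using g(1) that by (auto simp: bij_betw_def)
  let ?w = "\<delta> x (g x)"
  have wc: "?w \<in> carrier W" using x gC by simp
  obtain s where s: "s \<in> S" "w' = s \<otimes> ?w \<otimes> s" and l: "len (s \<otimes> ?w) < len ?w \<or> len (?w \<otimes> s) < len ?w"
    using st by (auto simp: shift_step_def)
  from l show ?thesis
  proof
    assume l: "len (s \<otimes> ?w) < len ?w"
    obtain y where y: "y \<in> C" "\<delta> y x = s" "\<delta> y (g x) = s \<otimes> ?w" using ex_adjacent[OF x gC[OF x] s(1)] by blast
    have "\<delta> (g x) (g y) = s" using g(2)[OF x y(1)] adjacent_sym[of x y] y x s by simp
    then have "\<delta> y (g y) = s \<otimes> ?w \<otimes> s \<or> \<delta> y (g y) = s \<otimes> ?w"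
      using dist_step_right[of y "g x" "g y"] y x gC s by simp
    then show ?thesis using y s l by (intro bexI[of _ y]) auto
  next
    assume l: "len (?w \<otimes> s) < len ?w"
    obtain z where z: "z \<in> C" "\<delta> (g x) z = s" "\<delta> x z = ?w \<otimes> s" using ex_adjacent_right[OF x gC[OF x] s(1)] by blast
    obtain y where y: "y \<in> C" "z = g y" using g(1) z(1) by (auto simp: bij_betw_def)
    have yx: "\<delta> y x = s" using g(2)[OF x y(1)] z y adjacent_sym[of y x] x s by simp
    then have "\<delta> y z = s \<otimes> (?w \<otimes> s) \<or> \<delta> y z = ?w \<otimes> s"
      using dist_step[of x z y] x y z s by simp
    then show ?thesis using y s l wc by (intro bexI[of _ y]) (auto simp: m_assoc)
  qed
qed

lemma shift_step_len: "w \<in> carrier W \<Longrightarrow> shift_step w w' \<Longrightarrow> len w' \<le> len w"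
proof -
  assume w: "w \<in> carrier W" and "shift_step w w'"
  then obtain s where s: "s \<in> S" "w' = s \<otimes> w \<otimes> s" and l: "len (s \<otimes> w) < len w \<or> len (w \<otimes> s) < len w"
    by (auto simp: shift_step_def)
  from l show ?thesis
  proof
    assume "len (s \<otimes> w) < len w"
    then show ?thesis using len_mult_le[of "s \<otimes> w" s] s w by simp
  next
    assume "len (w \<otimes> s) < len w"
    then show ?thesis using len_mult_le[of s "w \<otimes> s"] s w by (simp add: m_assoc)
  qed
qed

lemma min_displacement:
  assumes g: "bij_betw g C C" "\<And>x y. x \<in> C \<Longrightarrow> y \<in> C \<Longrightarrow> \<delta> (g x) (g y) = \<delta> x y"
  obtains x where "x \<in> C" "lossless (\<delta> x (g x))"
    "\<And>w'. reach (\<delta> x (g x)) w' \<Longrightarrow> \<exists>y\<in>C. \<delta> y (g y) = w'"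
proof -
  have gC: "g y \<in> C" if "y \<in> C" for y using g(1) that by (auto simp: bij_betw_def)
  obtain x0 where "x0 \<in> C" using bld by (auto simp: is_building_def)
  then obtain x where x: "x \<in> C" and min: "\<And>y. y \<in> C \<Longrightarrow> len (\<delta> x (g x)) \<le> len (\<delta> y (g y))"
    using ex_has_least_nat[of "\<lambda>x. x \<in> C" x0 "\<lambda>x. len (\<delta> x (g x))"] by blast
  let ?w = "\<delta> x (g x)"
  have key: "(\<exists>y\<in>C. \<delta> y (g y) = w') \<and> len w' = len ?w" if "reach ?w w'" for w'
    using that
  proof (induction rule: rtranclp_induct)
    case base then show ?case using x by blast
  next
    case (step v w')
    then obtain y where y: "y \<in> C" "\<delta> y (g y) = v" by blast
    then obtain y' where y': "y' \<in> C" "\<delta> y' (g y') = w' \<or> len (\<delta> y' (g y')) < len v"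
      using displacement_lift[OF g y(1), of w'] step by auto
    then have e: "\<delta> y' (g y') = w'" using min[OF y'(1)] step by auto
    have "len w' \<le> len v" using shift_step_len[of v w'] step y gC by auto
    then have "len w' = len ?w" using step(3) min[OF y'(1)] e by simp
    then show ?case using e y' by blast
  qed
  have "lossless ?w" unfolding lossless_def
  proof (intro conjI allI impI)
    show "?w \<in> carrier W" using x gC by simp
    fix w' assume "reach ?w w'"
    then show "len w' = len ?w" using key by blast
  qed
  then show ?thesis using that[OF x] key by blast
qed

end

section \<open>Apartments and walls\<close>

context building
begin

text \<open>Each step of a gallery from \<open>y\<close> to \<open>z\<close> multiplies the distance
  from \<open>x\<close> by its letter or leaves it unchanged, so the quotient is the product of a
  subword.\<close>

lemma dist_factor:
  assumes "x \<in> C" "y \<in> C" "z \<in> C"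
  shows "\<exists>f\<in>carrier W. \<delta> x z = \<delta> x y \<otimes> f \<and> len f \<le> len (\<delta> y z)"
proof -
  have main: "\<exists>ys. set ys \<subseteq> S \<and> length ys \<le> length xs \<and> \<delta> x z = \<delta> x y \<otimes> wprod ys"
    if "y \<in> C" "set xs \<subseteq> S" "gallery xs y z" for xs y
    using that
  proof (induction xs arbitrary: y)
    case Nil then show ?case using assms by (intro exI[of _ "[]"]) auto
  next
    case (Cons s xs)
    then obtain v where v: "v \<in> C" "\<delta> y v = s" "gallery xs v z" by auto
    obtain ys where ys: "set ys \<subseteq> S" "length ys \<le> length xs" "\<delta> x z = \<delta> x v \<otimes> wprod ys"
      using Cons.IH[OF v(1) _ v(3)] Cons.prems by auto
    have s: "s \<in> S" using Cons by simp
    have "\<delta> x v = \<delta> x y \<otimes> s \<or> \<delta> x v = \<delta> x y"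
      using dist_step_right[of x y v] assms Cons.prems v s by simp
    then show ?case
    proof
      assume "\<delta> x v = \<delta> x y \<otimes> s"
      then show ?thesis using ys s assms Cons.prems by (intro exI[of _ "s # ys"]) (auto simp: m_assoc)
    next
      assume "\<delta> x v = \<delta> x y"
      then show ?thesis using ys by (intro exI[of _ ys]) auto
    qed
  qed
  obtain xs where xs: "set xs \<subseteq> S" "length xs = len (\<delta> y z)" "wprod xs = \<delta> y z"
    using reduced_word[OF dist_closed[OF assms(2,3)]] .
  obtain ys where ys: "set ys \<subseteq> S" "length ys \<le> length xs" "\<delta> x z = \<delta> x y \<otimes> wprod ys"
    using main[OF assms(2) xs(1) gallery_exists[OF assms(2,3) xs(1,3)]] by blast
  then show ?thesis using len_le[of ys] xs by (intro bexI[of _ "wprod ys"]) auto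
qed

text \<open>The neighbour \<open>c\<close> of \<open>x\<close> was chosen for \<open>y\<close>; it
  fits \<open>z\<close> as well if both lie beyond the wall of \<open>s\<close>. The chamber
  \<open>y\<close> is moved along a reduced gallery to \<open>z\<close>, and this gallery never
  crosses that wall.\<close>

lemma fold_dist:
  assumes "x \<in> C" "y \<in> C" "z \<in> C" "c \<in> C" "s \<in> S" "\<delta> c x = s" "\<delta> c y = s \<otimes> \<delta> x y"
    "\<delta> x z = \<delta> x y \<otimes> \<delta> y z" "len (s \<otimes> \<delta> x y) < len (\<delta> x y)" "len (s \<otimes> \<delta> x z) < len (\<delta> x z)"
  shows "\<delta> c z = s \<otimes> \<delta> x z"
  using assms
proof (induction "len (\<delta> y z)" arbitrary: y)
  case 0
  have "\<delta> y z = \<one>" using 0(1) len_0_iff[OF dist_closed[OF 0(3,4)]] by simp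
  then have "y = z" using dist_one_iff[OF 0(3,4)] by blast
  then show ?case using 0(8) by simp
next
  case (Suc n)
  note y = Suc(4) and d = Suc(8,9,10,11,12)
  let ?d = "\<delta> x y" and ?e = "\<delta> y z"
  have cc: "?d \<in> carrier W" "?e \<in> carrier W" using Suc by auto
  obtain xs where xs: "set xs \<subseteq> S" "length xs = len ?e" "wprod xs = ?e" using reduced_word[OF cc(2)] .
  then obtain r ys where ys: "xs = r # ys" using Suc(2) by (cases xs) auto
  define e' where "e' = wprod ys"
  have r: "r \<in> S" "e' \<in> carrier W" "?e = r \<otimes> e'" using xs ys by (auto simp: e'_def)
  have "len e' \<le> n" using len_le[of ys] xs ys Suc(2) by (simp add: e'_def)
  then have l: "len e' = n" using len_left_cases[of r e'] r Suc(2) by auto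
  have rc: "r \<in> carrier W" using r by simp
  obtain v where v: "v \<in> C" "\<delta> y v = r" "\<delta> v z = e'" using dist_split[OF y Suc(5) rc r(2,3)] .
  \<comment> \<open>Without the factor \<open>r\<close> the rest of the way would be too short to
    account for the distance to \<open>z\<close>.\<close>
  have xv: "\<delta> x v = ?d \<otimes> r"
  proof (rule ccontr)
    assume "\<delta> x v \<noteq> ?d \<otimes> r"
    then have e: "\<delta> x v = ?d" using dist_step_right[of x y v] Suc v r by simp
    obtain f where f: "f \<in> carrier W" "\<delta> x z = \<delta> x v \<otimes> f" "len f \<le> len (\<delta> v z)"
      using dist_factor[OF Suc(3) v(1) Suc(5)] by blast
    then have "f = ?e" using e Suc(10) cc by simp
    then show False using f v l Suc(2) by simp
  qed
  \<comment> \<open>If the step from \<open>y\<close> to \<open>v\<close> crossed the wall, the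
    reduced gallery could not cross it again, and \<open>z\<close> would lie on the side of
    \<open>x\<close>.\<close>
  have less: "len (s \<otimes> \<delta> x v) < len (\<delta> x v)"
  proof (rule ccontr)
    assume n: "\<not> ?thesis"
    have vc: "\<delta> x v \<in> carrier W" using Suc v by simp
    have p: "posv (act (inv (\<delta> x v)) (bas s))"
      using n left_root_sign(1)[OF vc Suc(7)] len_left_cases[OF Suc(7) vc] by auto
    let ?b = "act (inv ?d) (bas s)"
    have b: "?b \<in> roots" "negv ?b" using left_root_sign(2)[OF cc(1) Suc(7)] Suc(11) cc Suc(7) by auto
    let ?c = "\<lambda>x. - ?b x"
    have c: "?c \<in> roots" "posv ?c" using uminus_roots[OF b(1)] b(2) by auto
    have "refl r ?c = (\<lambda>x. - refl r ?b x)" using refl_lin[of r "-1" ?b 0 "bas s"] by simp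
    moreover have "refl r ?b = act (inv (\<delta> x v)) (bas s)"
      unfolding xv using cc r by (simp add: inv_mult_group act_mult act_S)
    ultimately have "\<not> posv (refl r ?c)" using p not_posv_negv by simp
    then have cr: "?c = bas r" using refl_pos[OF c r(1)] by blast
    have "posv (act (inv e') (bas r))"
      using left_root_sign(1)[OF r(2,1)] l Suc(2) r(3) by simp
    moreover have "act (inv e') (bas r) = act (inv (\<delta> x z)) (bas s)"
    proof -
      have "act (inv (\<delta> x z)) (bas s) = act (inv e') (refl r ?b)"
        using Suc(10) r cc Suc(7) by (simp add: inv_mult_group act_mult act_S)
      also have "refl r ?b = (\<lambda>x. - refl r ?c x)" using refl_lin[of r "-1" ?c 0 "bas s"] by simp
      also have "\<dots> = bas r" unfolding cr using r by (simp add: refl_bas)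
      finally show ?thesis by simp
    qed
    ultimately have "\<not> len (s \<otimes> \<delta> x z) < len (\<delta> x z)"
      using left_root_sign(1)[OF dist_closed[OF Suc(3,5)] Suc(7)] by auto
    then show False using Suc(12) by simp
  qed
  have cv: "\<delta> c v = s \<otimes> \<delta> x v"
  proof (rule ccontr)
    assume n: "\<delta> c v \<noteq> s \<otimes> \<delta> x v"
    then have e1: "\<delta> c v = \<delta> x v" using dist_step[of x v c] Suc v by simp
    have "\<delta> c v = s \<otimes> ?d \<otimes> r \<or> \<delta> c v = s \<otimes> ?d"
      using dist_step_right[of c y v] Suc v r by simp
    then have "\<delta> c v = s \<otimes> ?d" using n xv cc Suc(7) r by (auto simp: m_assoc)
    then have "\<delta> x v = s \<otimes> ?d" using e1 by simp
    then show False using less Suc(11) cc Suc(7) by simp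
  qed
  show ?case
    by (rule Suc(1)[of v]) (use Suc v xv cv less l r cc in \<open>auto simp: m_assoc\<close>)
qed

text \<open>Partial isometries from \<open>W\<close> to the building, encoded as graphs.\<close>
definition pisom :: "('w \<times> 'c) set \<Rightarrow> bool" where
  "pisom R \<longleftrightarrow> R \<subseteq> carrier W \<times> C \<and> (\<forall>(u, a)\<in>R. \<forall>(v, b)\<in>R. \<delta> a b = inv u \<otimes> v)"

lemma pisomD: "pisom R \<Longrightarrow> (u, a) \<in> R \<Longrightarrow> (v, b) \<in> R \<Longrightarrow>
    u \<in> carrier W \<and> v \<in> carrier W \<and> a \<in> C \<and> b \<in> C \<and> \<delta> a b = inv u \<otimes> v"
  unfolding pisom_def by blast

text \<open>The image of \<open>u s\<close> has to be an \<open>s\<close>-neighbour of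
  \<open>a\<close>. If no image lies beyond the wall, any neighbour works. Otherwise one image
  \<open>b1\<close> beyond it dictates the neighbour, and \<open>fold_dist\<close> shows that this
  choice suits all the others.\<close>

lemma pisom_extend:
  assumes R: "pisom R" and u: "(u, a) \<in> R" and s: "s \<in> S"
  shows "\<exists>c\<in>C. pisom (insert (u \<otimes> s, c) R)"
proof -
  have uc: "u \<in> carrier W" "a \<in> C" using pisomD[OF R u u] by auto
  have d: "\<delta> a b = inv u \<otimes> v" "b \<in> C" "v \<in> carrier W" if "(v, b) \<in> R" for v b
    using pisomD[OF R u that] by auto
  have "\<exists>c\<in>C. \<delta> c a = s \<and> (\<forall>(v, b)\<in>R. \<delta> c b = s \<otimes> \<delta> a b)"
  proof (cases "\<exists>(v, b)\<in>R. len (s \<otimes> \<delta> a b) < len (\<delta> a b)")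
    case False
    obtain c where c: "c \<in> C" "\<delta> c a = s" using ex_adjacent[OF uc(2) uc(2) s] by blast
    have "\<delta> c b = s \<otimes> \<delta> a b" if vb: "(v, b) \<in> R" for v b
    proof -
      have "\<not> len (s \<otimes> \<delta> a b) < len (\<delta> a b)" using False vb by blast
      then have "len (s \<otimes> \<delta> a b) = Suc (len (\<delta> a b))"
        using len_left_cases[OF s dist_closed[OF uc(2) d(2)[OF vb]]] by linarith
      then show ?thesis using dist_step_up[of a b c] c uc d(2)[OF vb] s by simp
    qed
    then show ?thesis using c by blast
  next
    case True
    then obtain v1 b1 where 1: "(v1, b1) \<in> R" "len (s \<otimes> \<delta> a b1) < len (\<delta> a b1)" by blast
    obtain c where c: "c \<in> C" "\<delta> c a = s" "\<delta> c b1 = s \<otimes> \<delta> a b1"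
      using ex_adjacent[OF uc(2) d(2)[OF 1(1)] s] by blast
    have "\<delta> c b = s \<otimes> \<delta> a b" if vb: "(v, b) \<in> R" for v b
    proof (cases "len (s \<otimes> \<delta> a b) < len (\<delta> a b)")
      case True
      have "\<delta> b1 b = inv v1 \<otimes> v" using pisomD[OF R 1(1) vb] by simp
      then have "\<delta> a b = \<delta> a b1 \<otimes> \<delta> b1 b"
        using d(1)[OF vb] d(1)[OF 1(1)] d(3)[OF vb] d(3)[OF 1(1)] uc
        by (simp add: m_assoc) (simp add: m_assoc[symmetric])
      then show ?thesis
        using fold_dist[OF uc(2) d(2)[OF 1(1)] d(2)[OF vb] c(1) s c(2,3)] 1(2) True by blast
    next
      case False
      then have "len (s \<otimes> \<delta> a b) = Suc (len (\<delta> a b))"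
        using len_left_cases[OF s dist_closed[OF uc(2) d(2)[OF vb]]] by linarith
      then show ?thesis using dist_step_up[of a b c] c uc d(2)[OF vb] s by simp
    qed
    then show ?thesis using c by blast
  qed
  then obtain c where c: "c \<in> C" "\<And>v b. (v, b) \<in> R \<Longrightarrow> \<delta> c b = s \<otimes> \<delta> a b" by blast
  have cb: "\<delta> c b = inv (u \<otimes> s) \<otimes> v" if vb: "(v, b) \<in> R" for v b
    using c(2)[OF vb] d[OF vb] uc s by (simp add: inv_mult_group m_assoc)
  have bc: "\<delta> b c = inv v \<otimes> (u \<otimes> s)" if vb: "(v, b) \<in> R" for v b
    using dist_sym[OF c(1) d(2)[OF vb]] cb[OF vb] d(3)[OF vb] uc s by (simp add: inv_mult_group m_assoc)
  have "pisom (insert (u \<otimes> s, c) R)"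
    unfolding pisom_def
  proof (intro conjI ballI, goal_cases)
    case 1 then show ?case using R c uc s by (auto simp: pisom_def)
  next
    case (2 p)
    show ?case
    proof (cases p, clarify)
      fix u' a' v' b' assume p: "p = (u', a')" and q: "(v', b') \<in> insert (u \<otimes> s, c) R"
      have p': "(u', a') \<in> insert (u \<otimes> s, c) R" using 2 p by simp
      have us: "u \<otimes> s \<in> carrier W" using uc s by simp
      show "\<delta> a' b' = inv u' \<otimes> v'"
        using p' q cb[of v' b'] bc[of u' a'] pisomD[OF R, of u' a' v' b'] c(1) us by auto
    qed
  qed
  then show ?thesis using c by blast
qed

text \<open>By Zorn there is a maximal partial isometry; its domain is closed under right
  multiplication by generators, hence all of \<open>W\<close>.\<close>

lemma apartment_exists:
  assumes x: "x \<in> C" and y: "y \<in> C"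
  obtains \<phi> where "apartment_map W C \<delta> \<phi>" "x \<in> \<phi> ` carrier W" "y \<in> \<phi> ` carrier W"
proof -
  let ?R0 = "{(\<one>, x), (\<delta> x y, y)}"
  let ?A = "{R. pisom R \<and> ?R0 \<subseteq> R}"
  have R0: "?R0 \<in> ?A" using x y dist_sym[OF x y] by (auto simp: pisom_def)
  have "\<exists>M\<in>?A. \<forall>X\<in>?A. M \<subseteq> X \<longrightarrow> X = M"
  proof (rule subset_Zorn_nonempty)
    show "?A \<noteq> {}" using R0 by blast
    fix D assume D: "D \<noteq> {}" "subset.chain ?A D"
    have el: "R \<in> ?A" if "R \<in> D" for R using D(2) that unfolding subset.chain_def by blast
    have "pisom (\<Union>D)" unfolding pisom_def
    proof (intro conjI)
      show "\<Union>D \<subseteq> carrier W \<times> C" using el unfolding pisom_def by blast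
      show "\<forall>(u, a)\<in>\<Union>D. \<forall>(v, b)\<in>\<Union>D. \<delta> a b = inv u \<otimes> v"
      proof clarify
        fix u a v b X Y assume a: "(u, a) \<in> X" "X \<in> D" "(v, b) \<in> Y" "Y \<in> D"
        have "X \<subseteq> Y \<or> Y \<subseteq> X" using D(2) a unfolding subset.chain_def by blast
        then obtain Z where "Z \<in> D" "(u, a) \<in> Z" "(v, b) \<in> Z" using a by blast
        then show "\<delta> a b = inv u \<otimes> v" using el[of Z] pisomD[of Z u a v b] by blast
      qed
    qed
    moreover have "?R0 \<subseteq> \<Union>D" using D(1) el by blast
    ultimately show "\<Union>D \<in> ?A" by blast
  qed
  then obtain M where M0: "M \<in> ?A" "\<forall>X\<in>?A. M \<subseteq> X \<longrightarrow> X = M"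
    by (rule bexE) (rule that)
  then have M: "pisom M" "?R0 \<subseteq> M" by auto
  have max: "X = M" if "pisom X" "M \<subseteq> X" for X
  proof -
    have "X \<in> ?A" using that M(2) by (intro CollectI conjI) (rule that(1), rule subset_trans)
    then show ?thesis using M0(2) that(2) by blast
  qed
  have dom: "u \<in> Domain M" if u: "u \<in> carrier W" for u
  proof -
    have "set xs \<subseteq> S \<Longrightarrow> wprod xs \<in> Domain M" for xs
    proof (induction xs rule: rev_induct)
      case Nil then show ?case using M(2) by auto
    next
      case (snoc s xs)
      then obtain a where a: "(wprod xs, a) \<in> M" by auto
      have s: "s \<in> S" "set xs \<subseteq> S" using snoc by auto
      obtain c where "pisom (insert (wprod xs \<otimes> s, c) M)" using pisom_extend[OF M(1) a s(1)] by blast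
      then have "(wprod xs \<otimes> s, c) \<in> M" using max by blast
      then show ?case using s by (auto simp: wprod_append)
    qed
    then show ?thesis using ex_word[OF u] by blast
  qed
  define \<phi> where "\<phi> = (\<lambda>u. SOME a. (u, a) \<in> M)"
  have ph: "(u, \<phi> u) \<in> M" if "u \<in> carrier W" for u
    unfolding \<phi>_def using dom[OF that] by (metis Domain.cases someI_ex)
  have val: "\<phi> u = a" if "(u, a) \<in> M" for u a
  proof -
    have c: "u \<in> carrier W" "a \<in> C" using pisomD[OF M(1) that that] by auto
    have "\<delta> a (\<phi> u) = inv u \<otimes> u" "\<phi> u \<in> C" using pisomD[OF M(1) that ph[OF c(1)]] by auto
    then show ?thesis using c dist_one_iff[of a "\<phi> u"] by simp
  qed
  have "apartment_map W C \<delta> \<phi>" unfolding apartment_map_def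
    using pisomD[OF M(1) ph ph] by blast
  moreover have "\<phi> \<one> = x" "\<phi> (\<delta> x y) = y" using val M(2) by auto
  moreover have "x \<in> \<phi> ` carrier W" "y \<in> \<phi> ` carrier W"
    using calculation(2,3) x y by (metis imageI one_closed, metis imageI dist_closed)
  ultimately show ?thesis using that by blast
qed

end

section \<open>Reflections, half-spaces and the walls crossed by reduced words\<close>

context coxeter
begin

lemma inversion_in_word:
  "set xs \<subseteq> S \<Longrightarrow> b \<in> roots \<Longrightarrow> posv b \<Longrightarrow> negv (act (inv (wprod xs)) b) \<Longrightarrow>
    \<exists>i<length xs. b = act (wprod (take i xs)) (bas (xs ! i))"
proof (induction xs arbitrary: b)
  case Nil then show ?case using not_posv_negv by simp
next
  case (Cons s xs)
  have s: "s \<in> S" "set xs \<subseteq> S" using Cons by auto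
  show ?case
  proof (cases "b = bas s")
    case True then show ?thesis by (intro exI[of _ 0]) auto
  next
    case False
    have "negv (act (inv (wprod xs)) (refl s b))"
      using Cons.prems(4) s by (simp add: inv_mult_group act_mult act_S)
    then obtain i where i: "i < length xs" "refl s b = act (wprod (take i xs)) (bas (xs ! i))"
      using Cons.IH[OF s(2), of "refl s b"] refl_pos[OF Cons.prems(2,3) s(1) False] s(1) Cons.prems(2) by auto
    have "set (take i xs) \<subseteq> S" using s(2) set_take_subset[of i xs] by blast
    then have "act (wprod (take (Suc i) (s # xs))) (bas ((s # xs) ! Suc i)) = refl s (refl s b)"
      using i s by (simp add: act_Cons)
    then have "b = act (wprod (take (Suc i) (s # xs))) (bas ((s # xs) ! Suc i))" using s(1) by simp
    then show ?thesis using i(1) by (intro exI[of _ "Suc i"] conjI) (simp only: length_Cons Suc_less_eq)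
  qed
qed

lemma act_refl_root:
  assumes "z \<in> carrier W" "s \<in> S"
  shows "act (z \<otimes> s \<otimes> inv z) (act z (bas s)) = (\<lambda>x. - act z (bas s) x)"
proof -
  have "act (z \<otimes> s \<otimes> inv z) (act z (bas s)) = act z (act s (bas s))"
    using assms by (simp add: act_mult)
  then show ?thesis using assms by (simp add: act_S refl_bas act_uminus)
qed

text \<open>If the root is negative on the chamber \<open>w\<close>, it belongs to a letter of a
  reduced word of \<open>w\<close>, and multiplying by \<open>r\<close> deletes that letter. The
  positive case follows by exchanging \<open>w\<close> and \<open>r w\<close>.\<close>

lemma wall_side:
  assumes z: "z \<in> carrier W" and s: "s \<in> S" and w: "w \<in> carrier W" and p: "posv (act z (bas s))"
  defines "r \<equiv> z \<otimes> s \<otimes> inv z"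
  shows "w \<in> half_pos W S r \<longleftrightarrow> posv (act (inv w) (act z (bas s)))"
    "w \<in> half_neg W S r \<longleftrightarrow> negv (act (inv w) (act z (bas s)))"
proof -
  let ?b = "act z (bas s)"
  have b: "?b \<in> roots" using z s by simp
  have rc: "r \<in> carrier W" using z s by (simp add: r_def)
  have rr: "r \<otimes> (r \<otimes> v) = v" if "v \<in> carrier W" for v
  proof -
    have "r \<otimes> r = z \<otimes> (s \<otimes> (inv z \<otimes> z) \<otimes> s) \<otimes> inv z" unfolding r_def using z s by (simp only: m_assoc m_closed inv_closed S_carrier)
    then have "r \<otimes> r = \<one>" using z s by simp
    then show ?thesis using that rc by (simp add: m_assoc[symmetric])
  qed
  have ri: "inv r = r"
  proof (rule inv_equality)
    show "r \<otimes> r = \<one>" using rr[of \<one>] rc by simp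
  qed (use rc in auto)
  have neg: "len (r \<otimes> v) < len v" if v: "v \<in> carrier W" "negv (act (inv v) ?b)" for v
  proof -
    obtain xs where xs: "set xs \<subseteq> S" "length xs = len v" "wprod xs = v" using reduced_word v(1) .
    obtain i where i: "i < length xs" "?b = act (wprod (take i xs)) (bas (xs ! i))"
      using inversion_in_word[OF xs(1) b p] v(2) xs by auto
    define as where "as = take i xs"
    define cs where "cs = drop (Suc i) xs"
    define t where "t = xs ! i"
    have e: "xs = as @ t # cs" unfolding as_def cs_def t_def by (rule id_take_nth_drop[OF i(1)])
    have sub: "set as \<subseteq> S" "set cs \<subseteq> S" "t \<in> S" using e xs by auto
    have rt: "r = wprod as \<otimes> t \<otimes> inv (wprod as)"
      unfolding r_def by (rule act_eq_conj) (use i z s sub as_def t_def in auto)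
    have "v = wprod as \<otimes> (t \<otimes> wprod cs)" using xs(3) e sub by (simp add: wprod_append)
    then have "r \<otimes> v = wprod as \<otimes> t \<otimes> (inv (wprod as) \<otimes> wprod as) \<otimes> (t \<otimes> wprod cs)"
      unfolding rt using sub by (simp only: m_assoc m_closed inv_closed S_carrier wprod_closed)
    then have "r \<otimes> v = wprod (as @ cs)" using sub by (simp add: wprod_append m_assoc)
    then have "len (r \<otimes> v) \<le> length (as @ cs)" using len_le[of "as @ cs"] sub by simp
    then show ?thesis using xs e by simp
  qed
  have pos: "len v < len (r \<otimes> v)" if v: "v \<in> carrier W" "posv (act (inv v) ?b)" for v
  proof -
    have "act (inv (r \<otimes> v)) ?b = (\<lambda>x. - act (inv v) ?b x)"
      using v rc z s act_refl_root[OF z s] by (simp add: inv_mult_group ri act_mult act_uminus r_def)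
    then have "negv (act (inv (r \<otimes> v)) ?b)" using v(2) by simp
    then show ?thesis using neg[of "r \<otimes> v"] rr v rc by simp
  qed
  have or: "posv (act (inv w) ?b) \<or> negv (act (inv w) ?b)" using roots_pos_or_neg[of "act (inv w) ?b"] w b by simp
  show "w \<in> half_pos W S r \<longleftrightarrow> posv (act (inv w) ?b)" "w \<in> half_neg W S r \<longleftrightarrow> negv (act (inv w) ?b)"
    using or neg[OF w] pos[OF w] w by (auto simp: half_pos_def half_neg_def)
qed

lemma reflection_pos_root:
  assumes "r \<in> reflections W S"
  obtains z s where "z \<in> carrier W" "s \<in> S" "r = z \<otimes> s \<otimes> inv z" "posv (act z (bas s))"
proof -
  obtain z s where z: "z \<in> carrier W" "s \<in> S" "r = z \<otimes> s \<otimes> inv z" using assms by (auto simp: reflections_def)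
  show ?thesis
  proof (cases "posv (act z (bas s))")
    case True then show ?thesis using that z by blast
  next
    case False
    then have "negv (act z (bas s))" using not_pos_negv[of "act z (bas s)"] z by simp
    then have "posv (act (z \<otimes> s) (bas s))" using z by (simp add: act_mult act_S refl_bas act_uminus)
    moreover have "z \<otimes> s \<otimes> s \<otimes> inv (z \<otimes> s) = r" using z by (simp add: inv_mult_group m_assoc)
    ultimately show ?thesis using that[of "z \<otimes> s" s] z by simp
  qed
qed

lemma act_par_outside:
  assumes J: "J \<subseteq> S" and k: "k \<in> par J" and x: "x \<notin> J"
  shows "act k f x = f x"
proof -
  have "set xs \<subseteq> J \<Longrightarrow> act (wprod xs) f x = f x" for xs
  proof (induction xs)
    case (Cons y xs)
    have "set xs \<subseteq> S" "y \<in> S" "y \<noteq> x" using Cons J x by auto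
    then have "act (wprod (y # xs)) f x = act (wprod xs) f x" by (simp add: act_Cons refl_def bas_def)
    then show ?case using Cons by simp
  qed simp
  then show ?thesis using k by (auto simp: std_parabolic_def)
qed

text \<open>A positive root not kept positive by \<open>t\<close> has a nonzero coefficient outside
  \<open>J\<close>, and \<open>par J\<close> leaves that coefficient unchanged. So a wall crossed
  between two parallel residues cuts neither of them.\<close>

lemma par_sign_stable:
  assumes J: "J \<subseteq> S" and r: "rmin J t" and k: "k \<in> par J" and b: "b \<in> roots" "posv b" "\<not> posv (act t b)"
  shows "posv (act k b)"
proof (rule ccontr)
  assume n: "\<not> posv (act k b)"
  then have neg: "negv (act k b)" using not_pos_negv[of "act k b"] b par_carrier[OF J k] by simp
  have "b x = 0" if "x \<notin> J" for x
  proof -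
    have "act k b x = b x" by (rule act_par_outside[OF J k that])
    moreover have "0 \<le> - act k b x" using neg posv_nonneg unfolding negv_def by fastforce
    ultimately show ?thesis using posv_nonneg[OF b(2), of x] by simp
  qed
  then show False using rmin_J_pos[OF J r b(1,2)] b(3) by blast
qed

text \<open>If the walls at two positions coincided, both letters could be deleted.\<close>

lemma reduced_reflections_inj:
  assumes xs: "set xs \<subseteq> S" "length xs = len (wprod xs)"
  shows "inj_on (\<lambda>i. wprod (take i xs) \<otimes> xs ! i \<otimes> inv (wprod (take i xs))) {..<length xs}"
proof -
  let ?p = "\<lambda>i. wprod (take i xs)"
  have sub: "set (take i xs) \<subseteq> S" "set (drop i xs) \<subseteq> S" for i
    using xs(1) set_take_subset[of i xs] set_drop_subset[of i xs] by auto
  have pc: "?p i \<in> carrier W" for i using sub by simp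
  have xS: "xs ! i \<in> S" if "i < length xs" for i using that xs(1) by auto
  have False if ij: "i < j" "j < length xs" and e: "?p i \<otimes> xs ! i \<otimes> inv (?p i) = ?p j \<otimes> xs ! j \<otimes> inv (?p j)" for i j
  proof -
    define m where "m = drop (Suc i) (take j xs)"
    have m: "take j xs = take i xs @ xs ! i # m" "set m \<subseteq> S"
    proof -
      have "take j xs = take i (take j xs) @ take j xs ! i # drop (Suc i) (take j xs)"
        by (rule id_take_nth_drop) (use ij in simp)
      then show "take j xs = take i xs @ xs ! i # m" using ij by (simp add: m_def min_def)
      show "set m \<subseteq> S" unfolding m_def using sub(1)[of j] set_drop_subset by fastforce
    qed
    have c: "xs ! i \<in> S" "xs ! j \<in> S" "wprod m \<in> carrier W" using xS ij m by auto
    have pj: "?p j = ?p i \<otimes> (xs ! i \<otimes> wprod m)" using m sub c by (simp add: wprod_append)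
    have "?p j \<otimes> xs ! j = ?p j \<otimes> xs ! j \<otimes> inv (?p j) \<otimes> ?p j" using c pc by (simp add: m_assoc)
    also have "\<dots> = ?p i \<otimes> xs ! i \<otimes> inv (?p i) \<otimes> (?p i \<otimes> (xs ! i \<otimes> wprod m))" using e pj by simp
    also have "\<dots> = ?p i \<otimes> xs ! i \<otimes> (inv (?p i) \<otimes> ?p i) \<otimes> (xs ! i \<otimes> wprod m)"
      using c pc by (simp only: m_assoc m_closed inv_closed S_carrier)
    also have "\<dots> = ?p i \<otimes> wprod m" using c pc by (simp add: m_assoc)
    finally have "wprod xs = wprod (take i xs @ m @ drop (Suc j) xs)"
    proof -
      assume a: "?p j \<otimes> xs ! j = ?p i \<otimes> wprod m"
      have "xs = take j xs @ xs ! j # drop (Suc j) xs" by (rule id_take_nth_drop) (use ij in simp)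
      then have "wprod xs = ?p j \<otimes> (xs ! j \<otimes> wprod (drop (Suc j) xs))"
        using sub c by (metis wprod_append wprod_Cons insert_subset list.set(2))
      also have "\<dots> = (?p i \<otimes> wprod m) \<otimes> wprod (drop (Suc j) xs)" using a c pc sub by (simp add: m_assoc[symmetric])
      also have "\<dots> = wprod (take i xs @ m @ drop (Suc j) xs)" using sub m c pc by (simp add: wprod_append m_assoc)
      finally show ?thesis .
    qed
    moreover have "set (take i xs @ m @ drop (Suc j) xs) \<subseteq> S" using sub m by simp
    ultimately have "len (wprod xs) \<le> length (take i xs @ m @ drop (Suc j) xs)" using len_le by metis
    also have "\<dots> < length xs" using ij by (simp add: m_def)
    finally show False using xs by simp
  qed
  then show ?thesis by (intro inj_onI) (metis lessThan_iff linorder_neqE_nat)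
qed

end

section \<open>Wall thickness and spheres\<close>

text \<open>Isolates the counting from the group: constancy of sphere sizes is assumed here and
  supplied later by Weyl-transitivity.\<close>

locale hom_building = building W S C \<delta>
  for W :: "('w,'b) monoid_scheme" (structure) and S C \<delta> +
  fixes Q :: "'w \<Rightarrow> nat"
  assumes sph: "x \<in> C \<Longrightarrow> w \<in> carrier W \<Longrightarrow> finite (sphere x w) \<and> card (sphere x w) = Q w"

context building
begin

lemma sphere_nonempty:
  assumes x: "x \<in> C" and w: "w \<in> carrier W"
  shows "sphere x w \<noteq> {}"
proof -
  have "set xs \<subseteq> S \<Longrightarrow> \<exists>y\<in>C. \<delta> x y = wprod xs" for xs
  proof (induction xs rule: rev_induct)
    case Nil then show ?case using x by (intro bexI[of _ x]) auto
  next
    case (snoc s xs)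
    then obtain y where y: "y \<in> C" "\<delta> x y = wprod xs" by auto
    have s: "s \<in> S" "set xs \<subseteq> S" using snoc by auto
    obtain z where "z \<in> C" "\<delta> x z = \<delta> x y \<otimes> s" using ex_adjacent_right[OF x y(1) s(1)] by blast
    then show ?case using y s by (auto simp: wprod_append)
  qed
  then obtain y where "y \<in> C" "\<delta> x y = w" using ex_word[OF w] by blast
  then show ?thesis by (auto simp: sphere_def)
qed

end

context hom_building
begin

lemma base_chamber: obtains x where "x \<in> C" "(SOME x. x \<in> C) = x"
proof -
  have "C \<noteq> {}" using bld unfolding is_building_def by blast
  then show ?thesis using that some_in_eq by blast
qed

lemma Q_pos: "w \<in> carrier W \<Longrightarrow> 0 < Q w"
proof -
  assume w: "w \<in> carrier W"
  obtain x where x: "x \<in> C" using base_chamber by blast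
  show ?thesis using sph[OF x w] sphere_nonempty[OF x w] by (metis card_gt_0_iff)
qed

lemma Q_one: "Q \<one> = 1"
proof -
  obtain x where x: "x \<in> C" using base_chamber by blast
  have "sphere x \<one> = {x}" using x dist_one_iff[OF x] by (auto simp: sphere_def)
  then show ?thesis using sph[OF x one_closed] by simp
qed

lemma Q_mult:
  assumes u: "u \<in> carrier W" and v: "v \<in> carrier W" and l: "len (u \<otimes> v) = len u + len v"
  shows "Q (u \<otimes> v) = Q u * Q v"
proof -
  obtain x where x: "x \<in> C" using base_chamber by blast
  have "Q (u \<otimes> v) = card (sphere x (u \<otimes> v))" using sph[OF x] u v by simp
  also have "\<dots> = card (SIGMA y:sphere x u. sphere y v)"
    using bij_betw_same_card[OF sphere_add_bij[OF x u v l]] by simp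
  also have "\<dots> = (\<Sum>y\<in>sphere x u. card (sphere y v))"
    by (rule card_SigmaI) (use sph x u v in \<open>auto simp: sphere_def\<close>)
  also have "\<dots> = (\<Sum>y\<in>sphere x u. Q v)"
    by (rule sum.cong) (use sph v in \<open>auto simp: sphere_def\<close>)
  also have "\<dots> = Q u * Q v" using sph[OF x u] by simp
  finally show ?thesis .
qed

lemma Q_word:
  "set xs \<subseteq> S \<Longrightarrow> length xs = len (wprod xs) \<Longrightarrow> Q (wprod xs) = (\<Prod>i<length xs. Q (xs ! i))"
proof (induction xs)
  case Nil then show ?case by (simp add: Q_one)
next
  case (Cons s xs)
  have s: "s \<in> S" "set xs \<subseteq> S" using Cons by auto
  have "len (wprod (s # xs)) \<le> Suc (len (wprod xs))" using len_left_cases[of s "wprod xs"] s by auto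
  then have l: "length xs = len (wprod xs)" using Cons.prems(2) len_le[OF s(2)] by simp
  have "Q (wprod (s # xs)) = Q s * Q (wprod xs)"
    using Q_mult[of s "wprod xs"] s l Cons.prems(2) by simp
  then show ?case using Cons.IH[OF s(2) l] by (simp only: prod.lessThan_Suc_shift length_Cons) simp
qed

text \<open>When lengths add, counting the sphere of \<open>s z = z t\<close> in two ways gives the
  claim. When \<open>t\<close> shortens \<open>z\<close>, the element \<open>z t\<close> takes the
  place of \<open>z\<close>.\<close>

lemma Q_conj:
  assumes s: "s \<in> S" and t: "t \<in> S" and z: "z \<in> carrier W" and e: "s \<otimes> z = z \<otimes> t"
  shows "Q s = Q t"
proof -
  have key: "Q s = Q t" if y: "y \<in> carrier W" "s \<otimes> y = y \<otimes> t" "len y < len (y \<otimes> t)" for y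
  proof -
    have "len (y \<otimes> t) = Suc (len y)" using len_right_cases[OF t y(1)] y(3) by auto
    then have "Q (y \<otimes> t) = Q y * Q t" "Q (s \<otimes> y) = Q s * Q y"
      using Q_mult[of y t] Q_mult[of s y] y s t by simp_all
    then show ?thesis using y(2) Q_pos[OF y(1)] by simp
  qed
  show ?thesis
  proof (cases "len z < len (z \<otimes> t)")
    case True then show ?thesis using key[of z] z e by simp
  next
    case False
    then have "len (z \<otimes> t) < len (z \<otimes> t \<otimes> t)" using len_right_cases[OF t z] z t by auto
    moreover have "s \<otimes> (z \<otimes> t) = (z \<otimes> t) \<otimes> t" using e s t z by (simp add: m_assoc[symmetric])
    ultimately show ?thesis using key[of "z \<otimes> t"] z t by simp
  qed
qed

text \<open>The choice inside \<open>wall_thickness\<close> is harmless: generators conjugate to the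
  same reflection have spheres of equal size by \<open>Q_conj\<close>.\<close>

lemma wall_thickness_conj:
  assumes z: "z \<in> carrier W" and s: "s \<in> S"
  shows "wall_thickness W S C \<delta> (z \<otimes> s \<otimes> inv z) = Q s"
proof -
  let ?P = "\<lambda>t. t \<in> S \<and> (\<exists>w\<in>carrier W. z \<otimes> s \<otimes> inv z = w \<otimes> t \<otimes> inv w)"
  have "?P s" using z s by blast
  then have "?P (SOME t. ?P t)" by (rule someI)
  then obtain t w where t: "t = (SOME t. ?P t)" "t \<in> S" "w \<in> carrier W" "z \<otimes> s \<otimes> inv z = w \<otimes> t \<otimes> inv w" by blast
  have "Q t = Q s" if t: "t \<in> S" "w \<in> carrier W" "z \<otimes> s \<otimes> inv z = w \<otimes> t \<otimes> inv w" for t w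
  proof -
    have "t \<otimes> (inv w \<otimes> z) = inv w \<otimes> (w \<otimes> t \<otimes> inv w) \<otimes> z" using t(1,2) z by (simp add: m_assoc[symmetric])
    also have "\<dots> = inv w \<otimes> (z \<otimes> s \<otimes> inv z) \<otimes> z" using t(3) by simp
    also have "\<dots> = (inv w \<otimes> z) \<otimes> s" using t(1,2) z s by (simp add: m_assoc)
    finally show ?thesis using Q_conj[of t s "inv w \<otimes> z"] t(1,2) z s by simp
  qed
  from this[OF t(2-4)] have "Q t = Q s" .
  moreover have "q_s C \<delta> t = Q t"
  proof -
    obtain x where x: "x \<in> C" "(SOME x. x \<in> C) = x" using base_chamber .
    have "s_adjacent C \<delta> t x = sphere x t" by (simp add: s_adjacent_def sphere_def)
    then show ?thesis using sph[OF x(1), of t] t(2) x(2) by (simp add: q_s_def)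
  qed
  ultimately show ?thesis unfolding wall_thickness_def t(1) by simp
qed

text \<open>A wall between the two cosets separates \<open>u\<close> from \<open>u t\<close> and is
  therefore crossed by any reduced gallery between them. Conversely, by
  \<open>par_sign_stable\<close>, each coset lies entirely on one side of a wall so crossed.\<close>

lemma separating_walls:
  assumes J: "J \<subseteq> S" and n: "normalizes J t" and u: "u \<in> carrier W"
    and xs: "set xs \<subseteq> S" "length xs = len t" "wprod xs = t"
  defines "p \<equiv> \<lambda>i. wprod (take i xs)"
  shows "{r \<in> reflections W S.
      (\<forall>k\<in>par J. u \<otimes> k \<in> half_pos W S r) \<and> (\<forall>k\<in>par J. u \<otimes> t \<otimes> k \<in> half_neg W S r) \<or>
      (\<forall>k\<in>par J. u \<otimes> k \<in> half_neg W S r) \<and> (\<forall>k\<in>par J. u \<otimes> t \<otimes> k \<in> half_pos W S r)}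
    = (\<lambda>i. u \<otimes> p i \<otimes> xs ! i \<otimes> inv (u \<otimes> p i)) ` {..<length xs}" (is "?D = ?r ` _")
proof (rule Set.set_eqI, rule iffI)
  have t: "t \<in> carrier W" using xs by auto
  have rt: "rmin J t" "rmin J (inv t)" using n normalizes_inv[OF J n] by (auto simp: normalizes_def)
  have pc: "p i \<in> carrier W" for i unfolding p_def using xs(1) set_take_subset[of i xs] by (intro wprod_closed) blast
  have xS: "xs ! i \<in> S" if "i < length xs" for i using that xs(1) by auto
  fix r
  {
    assume r: "r \<in> ?D"
    then obtain z s where z: "z \<in> carrier W" "s \<in> S" "r = z \<otimes> s \<otimes> inv z" "posv (act z (bas s))"
      using reflection_pos_root by blast
    let ?b = "act z (bas s)"
    have b: "?b \<in> roots" using z by simp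
    have side: "w \<in> half_pos W S r \<longleftrightarrow> posv (act (inv w) ?b)" "w \<in> half_neg W S r \<longleftrightarrow> negv (act (inv w) ?b)"
      if "w \<in> carrier W" for w using wall_side[OF z(1,2) that z(4)] z(3) by auto
    have ut: "act (inv (u \<otimes> t)) ?b = act (inv t) (act (inv u) ?b)"
      using u t by (simp add: inv_mult_group act_mult)
    have "(u \<in> half_pos W S r \<and> u \<otimes> t \<in> half_neg W S r) \<or> (u \<in> half_neg W S r \<and> u \<otimes> t \<in> half_pos W S r)"
      using r par_one[of J] u t by (auto dest!: bspec[of _ _ \<one>])
    then show "r \<in> ?r ` {..<length xs}"
    proof
      assume a: "u \<in> half_pos W S r \<and> u \<otimes> t \<in> half_neg W S r"
      then have "posv (act (inv u) ?b)" "negv (act (inv t) (act (inv u) ?b))"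
        using side u t ut by auto
      then obtain i where i: "i < length xs" "act (inv u) ?b = act (p i) (bas (xs ! i))"
        using inversion_in_word[OF xs(1), of "act (inv u) ?b"] xs(3) b u unfolding p_def by auto
      have "?b = act u (act (inv u) ?b)" using u by simp
      then have "?b = act (u \<otimes> p i) (bas (xs ! i))" using i u pc by (simp add: act_mult)
      then have "r = ?r i" unfolding z(3) using act_eq_conj[OF z(1) _ z(2) xS[OF i(1)]] u pc by simp
      then show ?thesis using i by blast
    next
      assume a: "u \<in> half_neg W S r \<and> u \<otimes> t \<in> half_pos W S r"
      let ?c = "\<lambda>x. - act (inv u) ?b x"
      have "negv (act (inv u) ?b)" "posv (act (inv t) (act (inv u) ?b))"
        using side u t ut a by auto
      then have c: "posv ?c" "negv (act (inv t) ?c)" "?c \<in> roots"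
        using uminus_roots[of "act (inv u) ?b"] b u by (auto simp: act_uminus)
      then obtain i where i: "i < length xs" "?c = act (p i) (bas (xs ! i))"
        using inversion_in_word[OF xs(1), of ?c] xs(3) unfolding p_def by auto
      have "act (z \<otimes> s) (bas s) = (\<lambda>x. - ?b x)" using z by (simp add: act_mult act_S refl_bas act_uminus)
      also have "\<dots> = act u ?c" using u by (simp add: act_uminus)
      also have "\<dots> = act (u \<otimes> p i) (bas (xs ! i))" unfolding i(2) using u pc by (simp add: act_mult)
      finally have "z \<otimes> s \<otimes> s \<otimes> inv (z \<otimes> s) = ?r i"
        using act_eq_conj[of "z \<otimes> s" "u \<otimes> p i" s "xs ! i"] z u pc xS[OF i(1)] by simp
      then have "r = ?r i" unfolding z(3) using z by (simp add: inv_mult_group m_assoc)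
      then show ?thesis using i by blast
    qed
  next
    assume "r \<in> ?r ` {..<length xs}"
    then obtain i where i: "i < length xs" "r = ?r i" by blast
    let ?s = "xs ! i" and ?rest = "wprod (drop (Suc i) xs)"
    have s: "?s \<in> S" using xS i by blast
    have rc: "?rest \<in> carrier W" "set (drop (Suc i) xs) \<subseteq> S" "set (take i xs) \<subseteq> S"
      using xs(1) set_drop_subset[of "Suc i" xs] set_take_subset[of i xs] by auto
    have tt: "t = p i \<otimes> (?s \<otimes> ?rest)"
    proof -
      have "t = wprod (take i xs @ ?s # drop (Suc i) xs)" using xs(3) id_take_nth_drop[OF i(1)] by simp
      then show ?thesis using rc s by (simp add: wprod_append p_def)
    qed
    have l: "len (p i) \<le> i" "len ?rest \<le> length xs - Suc i"
      using len_le[OF rc(3)] len_le[OF rc(2)] i by (auto simp: p_def)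
    have "len t \<le> len (p i \<otimes> ?s) + len ?rest" using tt len_mult_le[of "p i \<otimes> ?s" ?rest] pc s rc by (simp add: m_assoc)
    then have l1: "len (p i) < len (p i \<otimes> ?s)" using l xs(2) i by linarith
    have "len t \<le> len (p i) + len (?s \<otimes> ?rest)" using tt len_mult_le[of "p i" "?s \<otimes> ?rest"] pc s rc by simp
    then have l2: "len ?rest < len (?s \<otimes> ?rest)" using l xs(2) i by linarith
    let ?c = "act (p i) (bas ?s)"
    have c: "?c \<in> roots" "posv ?c" using root_sign(1)[OF pc s] l1 pc s by auto
    have tc: "act (inv t) ?c = (\<lambda>x. - act (inv ?rest) (bas ?s) x)"
      using pc s rc by (simp add: tt inv_mult_group act_mult act_S refl_bas act_uminus)
    have "posv (act (inv ?rest) (bas ?s))" using left_root_sign(1)[OF rc(1) s] l2 by simp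
    then have ntc: "negv (act (inv t) ?c)" using tc by simp
    have k1: "posv (act (inv k) ?c)" if k: "k \<in> par J" for k
      using par_sign_stable[OF J rt(2) par_inv[OF J k] c] ntc not_posv_negv by blast
    let ?d = "\<lambda>x. - act (inv t) ?c x"
    have d: "?d \<in> roots" "posv ?d" using uminus_roots[of "act (inv t) ?c"] c t ntc by auto
    have "act t ?d = (\<lambda>x. - ?c x)" using t by (simp add: act_uminus)
    then have "\<not> posv (act t ?d)" using c not_posv_negv by auto
    then have "posv (act (inv k) ?d)" if k: "k \<in> par J" for k
      using par_sign_stable[OF J rt(1) par_inv[OF J k] d] by blast
    then have k2: "negv (act (inv k) (act (inv t) ?c))" if k: "k \<in> par J" for k
      using k by (simp add: act_uminus)
    have z: "u \<otimes> p i \<in> carrier W" using u pc by simp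
    have kc: "k \<in> carrier W" if "k \<in> par J" for k using par_carrier[OF J that] .
    have refl: "r \<in> reflections W S" unfolding i(2) reflections_def using z s by blast
    have e1: "act (inv (u \<otimes> k)) (act (u \<otimes> p i) (bas ?s)) = act (inv k) ?c"
      and e2: "act (inv (u \<otimes> t \<otimes> k)) (act (u \<otimes> p i) (bas ?s)) = act (inv k) (act (inv t) ?c)"
      if "k \<in> par J" for k
      using kc[OF that] u t pc by (simp_all add: inv_mult_group act_mult)
    show "r \<in> ?D"
    proof (cases "posv (act (u \<otimes> p i) (bas ?s))")
      case True
      have "u \<otimes> k \<in> half_pos W S r" "u \<otimes> t \<otimes> k \<in> half_neg W S r" if k: "k \<in> par J" for k
        unfolding i(2) using wall_side[OF z s _ True] e1[OF k] e2[OF k] k1[OF k] k2[OF k] u t kc[OF k] by auto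
      then show ?thesis using refl by blast
    next
      case False
      \<comment> \<open>The root of the crossed wall is negative as seen from the base chamber. Its
        opposite belongs to the same reflection, with the two half-spaces exchanged.\<close>
      let ?z = "u \<otimes> p i \<otimes> ?s"
      have zc: "?z \<in> carrier W" using z s by simp
      have zz: "act ?z (bas ?s) = (\<lambda>x. - act (u \<otimes> p i) (bas ?s) x)"
        using z s by (simp add: act_mult[of "u \<otimes> p i" ?s] act_S refl_bas act_uminus)
      then have pz: "posv (act ?z (bas ?s))" using False not_pos_negv[of "act (u \<otimes> p i) (bas ?s)"] z s by simp
      have rz: "r = ?z \<otimes> ?s \<otimes> inv ?z" unfolding i(2) using z s by (simp add: inv_mult_group[of "u \<otimes> p i" ?s] m_assoc)
      have "u \<otimes> k \<in> half_neg W S r" "u \<otimes> t \<otimes> k \<in> half_pos W S r" if k: "k \<in> par J" for k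
        unfolding rz using wall_side[OF zc s _ pz] e1[OF k] e2[OF k] k1[OF k] k2[OF k] u t kc[OF k]
        by (auto simp: zz act_uminus)
      then show ?thesis using refl by blast
    qed
  }
qed

text \<open>The apartment chosen by \<open>qdist\<close> is only known to meet both residues.
  Normality shows that it does so in the cosets of \<open>u\<close> and \<open>u t\<close> for some
  \<open>u\<close>, after which the product runs over the letters of a reduced word of
  \<open>t\<close>.\<close>

lemma qdist_normal:
  assumes J: "J \<subseteq> S" and x: "x \<in> C" and y: "y \<in> C" and n: "normalizes J (\<delta> x y)"
  shows "qdist W S C \<delta> (res J x) (res J y) = Q (\<delta> x y)"
proof -
  let ?A = "res J x" and ?B = "res J y" and ?t = "\<delta> x y"
  let ?P = "\<lambda>\<phi>. apartment_map W C \<delta> \<phi> \<and> ?A \<inter> \<phi> ` carrier W \<noteq> {} \<and> ?B \<inter> \<phi> ` carrier W \<noteq> {}"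
  define \<phi> where "\<phi> = (SOME \<phi>. ?P \<phi>)"
  obtain \<psi> where "apartment_map W C \<delta> \<psi>" "x \<in> \<psi> ` carrier W" "y \<in> \<psi> ` carrier W"
    using apartment_exists[OF x y] .
  then have "?P \<psi>" using res_self[OF x] res_self[OF y] by blast
  from someI[of ?P, OF this] have P: "?P \<phi>" unfolding \<phi>_def .
  have ap: "\<phi> w \<in> C" if "w \<in> carrier W" for w using P that by (simp add: apartment_map_def)
  have ad: "\<delta> (\<phi> w) (\<phi> v) = inv w \<otimes> v" if "w \<in> carrier W" "v \<in> carrier W" for w v
    using P that by (simp add: apartment_map_def)
  have inj: "w = v" if "w \<in> carrier W" "v \<in> carrier W" "\<phi> w = \<phi> v" for w v
  proof -
    have "inv w \<otimes> v = \<one>" using ad[OF that(1,2)] that ap dist_self by simp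
    then show ?thesis using that by (metis inv_equality inv_inv inv_closed)
  qed
  obtain u where u: "u \<in> carrier W" "\<phi> u \<in> ?A" using P by blast
  obtain v where v: "v \<in> carrier W" "\<phi> v \<in> ?B" using P by blast
  have t: "?t \<in> carrier W" using x y by simp
  obtain y' where y': "y' \<in> ?B" "\<delta> (\<phi> u) y' = ?t" using normal_shift[OF J x y n u(2)] .
  have y'C: "y' \<in> C" using y' res_sub by blast
  define k where "k = \<delta> y' (\<phi> v)"
  have k: "k \<in> par J" unfolding k_def by (rule res_dist[OF J y y'(1) v(2)])
  have kc: "k \<in> carrier W" using par_carrier[OF J k] .
  have "\<delta> (\<phi> u) (\<phi> v) = ?t \<otimes> k"
    using gate(1)[OF J ap[OF u(1)] y'C, of "\<phi> v"] y'(2) n res_eq[OF J y y'(1)] v(2) by (simp add: normalizes_def k_def)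
  then have "inv u \<otimes> v = ?t \<otimes> k" using ad u v by simp
  then have vk: "v = u \<otimes> ?t \<otimes> k" using u v t kc by (metis inv_solve_left m_assoc m_closed)
  have memA: "\<phi> w \<in> ?A \<longleftrightarrow> inv u \<otimes> w \<in> par J" if w: "w \<in> carrier W" for w
    unfolding res_eq[OF J x u(2), symmetric] using ap[OF w] ad[OF u(1) w] by (simp add: residue_def)
  have memB: "\<phi> w \<in> ?B \<longleftrightarrow> inv (u \<otimes> ?t) \<otimes> w \<in> par J" if w: "w \<in> carrier W" for w
  proof -
    have 1: "inv v \<otimes> w = inv k \<otimes> (inv (u \<otimes> ?t) \<otimes> w)" unfolding vk using u t kc w by (simp add: inv_mult_group m_assoc)
    then have 2: "inv (u \<otimes> ?t) \<otimes> w = k \<otimes> (inv v \<otimes> w)" using u t kc w v(1) by (simp add: m_assoc[symmetric])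
    have "\<phi> w \<in> ?B \<longleftrightarrow> inv v \<otimes> w \<in> par J"
      unfolding res_eq[OF J y v(2), symmetric] using ap[OF w] ad[OF v(1) w] by (simp add: residue_def)
    also have "\<dots> \<longleftrightarrow> inv (u \<otimes> ?t) \<otimes> w \<in> par J"
      using 1 2 par_mult[OF J k] par_mult[OF J par_inv[OF J k]] by metis
    finally show ?thesis .
  qed
  have sub: "R \<inter> \<phi> ` carrier W \<subseteq> \<phi> ` H \<longleftrightarrow> (\<forall>k\<in>par J. a \<otimes> k \<in> H)"
    if a: "a \<in> carrier W" and R: "\<And>w. w \<in> carrier W \<Longrightarrow> \<phi> w \<in> R \<longleftrightarrow> inv a \<otimes> w \<in> par J" and H: "H \<subseteq> carrier W"
    for R a H
  proof
    assume s: "R \<inter> \<phi> ` carrier W \<subseteq> \<phi> ` H"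
    show "\<forall>k\<in>par J. a \<otimes> k \<in> H"
    proof
      fix k assume k: "k \<in> par J"
      have kc: "k \<in> carrier W" using par_carrier[OF J k] .
      have "inv a \<otimes> (a \<otimes> k) = k" using a kc by (simp add: m_assoc[symmetric])
      then have "\<phi> (a \<otimes> k) \<in> R" using R[of "a \<otimes> k"] a kc k by simp
      then have "\<phi> (a \<otimes> k) \<in> \<phi> ` H" using s a kc by blast
      then obtain h where "h \<in> H" "\<phi> (a \<otimes> k) = \<phi> h" by blast
      then show "a \<otimes> k \<in> H" using inj[of "a \<otimes> k" h] H a kc by auto
    qed
  next
    assume s: "\<forall>k\<in>par J. a \<otimes> k \<in> H"
    show "R \<inter> \<phi> ` carrier W \<subseteq> \<phi> ` H"
    proof
      fix c assume "c \<in> R \<inter> \<phi> ` carrier W"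
      then obtain w where w: "w \<in> carrier W" "c = \<phi> w" "\<phi> w \<in> R" by blast
      then have "a \<otimes> (inv a \<otimes> w) \<in> H" using R[OF w(1)] s by blast
      then have "w \<in> H" using a w by (simp add: m_assoc[symmetric])
      then show "c \<in> \<phi> ` H" using w by blast
    qed
  qed
  have half: "half_pos W S r \<subseteq> carrier W" "half_neg W S r \<subseteq> carrier W" for r
    by (auto simp: half_pos_def half_neg_def)
  have utc: "u \<otimes> ?t \<in> carrier W" using u t by simp
  have ws: "wall_separates W S \<phi> r ?A ?B \<longleftrightarrow>
      (\<forall>k\<in>par J. u \<otimes> k \<in> half_pos W S r) \<and> (\<forall>k\<in>par J. u \<otimes> ?t \<otimes> k \<in> half_neg W S r) \<or>
      (\<forall>k\<in>par J. u \<otimes> k \<in> half_neg W S r) \<and> (\<forall>k\<in>par J. u \<otimes> ?t \<otimes> k \<in> half_pos W S r)" for r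
    unfolding wall_separates_def
    using sub[OF u(1) memA half(1)[of r]] sub[OF u(1) memA half(2)[of r]]
      sub[OF utc memB half(1)[of r]] sub[OF utc memB half(2)[of r]] by simp
  obtain xs where xs: "set xs \<subseteq> S" "length xs = len ?t" "wprod xs = ?t" using reduced_word[OF t] .
  let ?p = "\<lambda>i. wprod (take i xs)"
  let ?r = "\<lambda>i. u \<otimes> ?p i \<otimes> xs ! i \<otimes> inv (u \<otimes> ?p i)"
  have pc: "?p i \<in> carrier W" for i using xs(1) set_take_subset[of i xs] by (intro wprod_closed) blast
  have xS: "xs ! i \<in> S" if "i < length xs" for i using that xs(1) by auto
  have D: "{r \<in> reflections W S. wall_separates W S \<phi> r ?A ?B} = ?r ` {..<length xs}"
    unfolding ws by (rule separating_walls[OF J n u(1) xs])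
  have ir: "inj_on ?r {..<length xs}"
  proof (rule inj_onI)
    fix i j assume ij: "i \<in> {..<length xs}" "j \<in> {..<length xs}" "?r i = ?r j"
    have e: "?p i \<otimes> xs ! i \<otimes> inv (?p i) = inv u \<otimes> ?r i \<otimes> u" if "i < length xs" for i
    proof -
      have "inv u \<otimes> ?r i \<otimes> u = (inv u \<otimes> u) \<otimes> (?p i \<otimes> xs ! i \<otimes> inv (?p i)) \<otimes> (inv u \<otimes> u)"
        using u pc xS[OF that] by (simp only: m_assoc m_closed inv_closed S_carrier inv_mult_group)
      then show ?thesis using u pc xS[OF that] by simp
    qed
    have "?p i \<otimes> xs ! i \<otimes> inv (?p i) = ?p j \<otimes> xs ! j \<otimes> inv (?p j)" using e ij by simp
    moreover have "inj_on (\<lambda>i. ?p i \<otimes> xs ! i \<otimes> inv (?p i)) {..<length xs}"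
      by (rule reduced_reflections_inj) (use xs in auto)
    ultimately show "i = j" using ij by (auto dest: inj_onD)
  qed
  have "qdist W S C \<delta> ?A ?B =
      (\<Prod>r\<in>{r \<in> reflections W S. wall_separates W S \<phi> r ?A ?B}. wall_thickness W S C \<delta> r)"
    by (simp only: qdist_def Let_def \<phi>_def)
  also have "\<dots> = (\<Prod>r\<in>?r ` {..<length xs}. wall_thickness W S C \<delta> r)" unfolding D ..
  also have "\<dots> = (\<Prod>i<length xs. wall_thickness W S C \<delta> (?r i))" by (rule prod.reindex_cong[OF ir]) auto
  also have "\<dots> = (\<Prod>i<length xs. Q (xs ! i))"
    by (rule prod.cong) (use wall_thickness_conj u pc xS in auto)
  also have "\<dots> = Q ?t" using Q_word[of xs] xs by simp
  finally show ?thesis .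
qed

text \<open>By \<open>Q_word\<close> the value is a product over letters, insensitive to their
  order.\<close>

lemma Q_inv:
  assumes w: "w \<in> carrier W"
  shows "Q (inv w) = Q w"
proof -
  obtain xs where xs: "set xs \<subseteq> S" "length xs = len w" "wprod xs = w" using reduced_word[OF w] .
  have l: "length (rev xs) = len (wprod (rev xs))" using xs w by (simp add: wprod_rev)
  have "Q (inv w) = (\<Prod>i<length xs. Q (rev xs ! i))" using Q_word[of "rev xs"] xs l by (simp add: wprod_rev)
  also have "\<dots> = prod_list (map Q (rev xs))" by (subst prod.list_conv_set_nth) (simp add: atLeast0LessThan)
  also have "\<dots> = prod_list (map Q xs)" by (simp add: rev_map[symmetric])
  also have "\<dots> = (\<Prod>i<length xs. Q (xs ! i))" by (subst prod.list_conv_set_nth) (simp add: atLeast0LessThan)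
  also have "\<dots> = Q w" using Q_word[of xs] xs by simp
  finally show ?thesis .
qed

lemma Q_pow:
  assumes t: "t \<in> carrier W" and s: "\<And>n::nat. len (t [^] n) = n * len t"
  shows "Q (t [^] (n::nat)) = Q t ^ n"
proof (induction n)
  case (Suc n)
  have "len (t [^] n \<otimes> t) = len (t [^] n) + len t" using s[of n] s[of "Suc n"] by simp
  then show ?case using Q_mult[of "t [^] n" t] t Suc by simp
qed (simp add: Q_one)

end

section \<open>Indices of commensurable subgroups\<close>

context group
begin

text \<open>\<open>cov n H K\<close>: the index of \<open>K\<close> in \<open>H\<close> is finite and at most \<open>n\<close>.\<close>
definition cov :: "nat \<Rightarrow> 'a set \<Rightarrow> 'a set \<Rightarrow> bool" where
  "cov n H K \<longleftrightarrow> (\<exists>F. finite F \<and> card F \<le> n \<and> F \<subseteq> H \<and> (\<forall>h\<in>H. \<exists>f\<in>F. inv f \<otimes> h \<in> K))"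

definition cosets :: "'a set \<Rightarrow> 'a set \<Rightarrow> 'a set set" where
  "cosets H K = (\<lambda>h. (\<otimes>) h ` K) ` H"

lemma coset_eq_iff:
  assumes K: "subgroup K G" and h: "h \<in> carrier G" and f: "f \<in> carrier G"
  shows "(\<otimes>) h ` K = (\<otimes>) f ` K \<longleftrightarrow> inv f \<otimes> h \<in> K"
proof
  have Kc: "k \<in> carrier G" if "k \<in> K" for k using subgroup.mem_carrier[OF K that] .
  {
    assume e: "(\<otimes>) h ` K = (\<otimes>) f ` K"
    have "h \<otimes> \<one> \<in> (\<otimes>) h ` K" using subgroup.one_closed[OF K] by blast
    then have "h \<in> (\<otimes>) f ` K" using e h by simp
    then obtain k where "k \<in> K" "h = f \<otimes> k" by blast
    then show "inv f \<otimes> h \<in> K" using f Kc by (simp add: m_assoc[symmetric])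
  next
    assume i: "inv f \<otimes> h \<in> K"
    show "(\<otimes>) h ` K = (\<otimes>) f ` K"
    proof
      show "(\<otimes>) h ` K \<subseteq> (\<otimes>) f ` K"
      proof (rule image_subsetI)
        fix k assume k: "k \<in> K"
        have "h \<otimes> k = f \<otimes> (inv f \<otimes> h \<otimes> k)" using f h Kc[OF k] by (simp add: m_assoc[symmetric])
        then show "h \<otimes> k \<in> (\<otimes>) f ` K" using subgroup.m_closed[OF K i k] by blast
      qed
      show "(\<otimes>) f ` K \<subseteq> (\<otimes>) h ` K"
      proof (rule image_subsetI)
        fix k assume k: "k \<in> K"
        have "inv (inv f \<otimes> h) \<otimes> k \<in> K" using subgroup.m_closed[OF K subgroup.m_inv_closed[OF K i] k] .
        moreover have "f \<otimes> k = h \<otimes> (inv (inv f \<otimes> h) \<otimes> k)"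
          using f h Kc[OF k] by (simp add: inv_mult_group m_assoc[symmetric])
        ultimately show "f \<otimes> k \<in> (\<otimes>) h ` K" by blast
      qed
    qed
  }
qed

lemma cov_iff:
  assumes H: "H \<subseteq> carrier G" and K: "subgroup K G"
  shows "cov n H K \<longleftrightarrow> finite (cosets H K) \<and> card (cosets H K) \<le> n"
proof
  assume "cov n H K"
  then obtain F where F: "finite F" "card F \<le> n" "F \<subseteq> H" "\<And>h. h \<in> H \<Longrightarrow> \<exists>f\<in>F. inv f \<otimes> h \<in> K"
    unfolding cov_def by blast
  have "cosets H K \<subseteq> (\<lambda>f. (\<otimes>) f ` K) ` F"
  proof
    fix c assume "c \<in> cosets H K"
    then obtain h where h: "h \<in> H" "c = (\<otimes>) h ` K" by (auto simp: cosets_def)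
    obtain f where f: "f \<in> F" "inv f \<otimes> h \<in> K" using F(4)[OF h(1)] by blast
    then have "c = (\<otimes>) f ` K" using coset_eq_iff[OF K, of h f] h F(3) H by blast
    then show "c \<in> (\<lambda>f. (\<otimes>) f ` K) ` F" using f by blast
  qed
  then show "finite (cosets H K) \<and> card (cosets H K) \<le> n"
    using F(1,2) by (meson card_image_le card_mono finite_imageI finite_subset order_trans)
next
  assume c: "finite (cosets H K) \<and> card (cosets H K) \<le> n"
  obtain F where F: "F \<subseteq> H" "inj_on (\<lambda>h. (\<otimes>) h ` K) F" "cosets H K = (\<lambda>h. (\<otimes>) h ` K) ` F"
    using subset_image_inj[of "cosets H K" "\<lambda>h. (\<otimes>) h ` K" H] by (auto simp: cosets_def)
  have "finite F" using c F finite_imageD by metis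
  moreover have "card F \<le> n" using c F by (simp add: card_image)
  moreover have "\<exists>f\<in>F. inv f \<otimes> h \<in> K" if h: "h \<in> H" for h
  proof -
    have "(\<otimes>) h ` K \<in> (\<lambda>h. (\<otimes>) h ` K) ` F" using F(3) h by (auto simp: cosets_def)
    then obtain f where f: "f \<in> F" "(\<otimes>) h ` K = (\<otimes>) f ` K" by blast
    have "f \<in> carrier G" "h \<in> carrier G" using f(1) F(1) H h by auto
    then show ?thesis using coset_eq_iff[OF K] f by blast
  qed
  ultimately show "cov n H K" unfolding cov_def using F(1) by blast
qed

lemma cov_mono: "cov n H K \<Longrightarrow> n \<le> m \<Longrightarrow> K \<subseteq> L \<Longrightarrow> cov m H L"
  unfolding cov_def by (meson order_trans subsetD)

lemma cov_trans:
  assumes H: "subgroup H G" and LH: "L \<subseteq> H" and 1: "cov n H L" and 2: "cov m L K"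
  shows "cov (n * m) H K"
proof -
  obtain F where F: "finite F" "card F \<le> n" "F \<subseteq> H" "\<And>h. h \<in> H \<Longrightarrow> \<exists>f\<in>F. inv f \<otimes> h \<in> L"
    using 1 unfolding cov_def by blast
  obtain E where E: "finite E" "card E \<le> m" "E \<subseteq> L" "\<And>h. h \<in> L \<Longrightarrow> \<exists>f\<in>E. inv f \<otimes> h \<in> K"
    using 2 unfolding cov_def by blast
  have Hc: "h \<in> carrier G" if "h \<in> H" for h using subgroup.mem_carrier[OF H that] .
  let ?D = "(\<lambda>(f, e). f \<otimes> e) ` (F \<times> E)"
  have "card ?D \<le> card (F \<times> E)" using F(1) E(1) by (intro card_image_le) auto
  also have "\<dots> \<le> n * m" using F(2) E(2) by (simp add: card_cartesian_product mult_le_mono)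
  finally have "card ?D \<le> n * m" .
  moreover have "?D \<subseteq> H" using F(3) E(3) LH by (auto intro!: subgroup.m_closed[OF H])
  moreover have "\<exists>d\<in>?D. inv d \<otimes> h \<in> K" if h: "h \<in> H" for h
  proof -
    obtain f where f: "f \<in> F" "inv f \<otimes> h \<in> L" using F(4)[OF h] by blast
    obtain e where e: "e \<in> E" "inv e \<otimes> (inv f \<otimes> h) \<in> K" using E(4)[OF f(2)] by blast
    have "f \<in> carrier G" "e \<in> carrier G" using f e F(3) E(3) LH Hc by auto
    then have "inv (f \<otimes> e) \<otimes> h = inv e \<otimes> (inv f \<otimes> h)" using Hc[OF h] by (simp add: inv_mult_group m_assoc)
    then show ?thesis using e f by (intro bexI[of _ "f \<otimes> e"]) auto
  qed
  ultimately show ?thesis unfolding cov_def using F(1) E(1) by (intro exI[of _ ?D]) blast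
qed

text \<open>A representative of a coset of \<open>K\<close> may lie outside \<open>M\<close>. It is
  replaced by an element of \<open>H \<inter> M\<close> in the same coset, and cosets containing
  none are dropped.\<close>

lemma cov_inter:
  assumes H: "subgroup H G" and K: "subgroup K G" and M: "subgroup M G" and 1: "cov n H K"
  shows "cov n (H \<inter> M) (K \<inter> M)"
proof -
  obtain F where F: "finite F" "card F \<le> n" "F \<subseteq> H" "\<And>h. h \<in> H \<Longrightarrow> \<exists>f\<in>F. inv f \<otimes> h \<in> K"
    using 1 unfolding cov_def by blast
  have Hc: "h \<in> carrier G" if "h \<in> H" for h using subgroup.mem_carrier[OF H that] .
  let ?P = "\<lambda>f x. x \<in> H \<inter> M \<and> inv f \<otimes> x \<in> K"
  let ?x = "\<lambda>f. SOME x. ?P f x"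
  let ?D = "?x ` {f \<in> F. \<exists>x. ?P f x}"
  have x: "?P f (?x f)" if "\<exists>x. ?P f x" for f using someI_ex[OF that] .
  have "card ?D \<le> card {f \<in> F. \<exists>x. ?P f x}" using F(1) by (intro card_image_le) auto
  also have "\<dots> \<le> card F" using F(1) by (intro card_mono) auto
  also have "\<dots> \<le> n" by (rule F(2))
  finally have "card ?D \<le> n" .
  moreover have "?D \<subseteq> H \<inter> M" using x by blast
  moreover have "\<exists>d\<in>?D. inv d \<otimes> h \<in> K \<inter> M" if h: "h \<in> H \<inter> M" for h
  proof -
    obtain f where f: "f \<in> F" "inv f \<otimes> h \<in> K" using F(4) h by blast
    then have ex: "\<exists>x. ?P f x" using h by blast
    have p: "?P f (?x f)" by (rule x[OF ex])
    have c: "f \<in> carrier G" "?x f \<in> carrier G" "h \<in> carrier G" using f F(3) Hc p h by auto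
    have "inv (?x f) \<otimes> h = inv (inv f \<otimes> ?x f) \<otimes> (inv f \<otimes> h)"
      using c by (simp add: inv_mult_group m_assoc) (simp add: m_assoc[symmetric])
    also have "\<dots> \<in> K" using p f(2) subgroup.m_closed[OF K subgroup.m_inv_closed[OF K]] by blast
    finally have "inv (?x f) \<otimes> h \<in> K" .
    moreover have "inv (?x f) \<otimes> h \<in> M" using p h subgroup.m_closed[OF M subgroup.m_inv_closed[OF M]] by blast
    ultimately show ?thesis using f(1) ex by blast
  qed
  ultimately show ?thesis unfolding cov_def using F(1) by (intro exI[of _ ?D]) simp
qed

definition conjg :: "'a \<Rightarrow> 'a set \<Rightarrow> 'a set" where "conjg g H = (\<lambda>h. g \<otimes> h \<otimes> inv g) ` H"

lemma conj_mult:
  "g \<in> carrier G \<Longrightarrow> x \<in> carrier G \<Longrightarrow> y \<in> carrier G \<Longrightarrow> g \<otimes> x \<otimes> inv g \<otimes> (g \<otimes> y \<otimes> inv g) = g \<otimes> (x \<otimes> y) \<otimes> inv g"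
proof -
  assume a: "g \<in> carrier G" "x \<in> carrier G" "y \<in> carrier G"
  have "g \<otimes> x \<otimes> inv g \<otimes> (g \<otimes> y \<otimes> inv g) = g \<otimes> x \<otimes> (inv g \<otimes> g) \<otimes> (y \<otimes> inv g)"
    using a by (simp only: m_assoc m_closed inv_closed)
  then show ?thesis using a by (simp add: m_assoc)
qed

lemma conj_inv: "g \<in> carrier G \<Longrightarrow> x \<in> carrier G \<Longrightarrow> inv (g \<otimes> x \<otimes> inv g) = g \<otimes> inv x \<otimes> inv g"
  by (simp add: inv_mult_group m_assoc)

lemma subgroup_conjg:
  assumes g: "g \<in> carrier G" and H: "subgroup H G"
  shows "subgroup (conjg g H) G"
proof (rule subgroupI)
  have Hc: "h \<in> carrier G" if "h \<in> H" for h using subgroup.mem_carrier[OF H that] .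
  show "conjg g H \<subseteq> carrier G" using g Hc by (auto simp: conjg_def)
  show "conjg g H \<noteq> {}" using subgroup.one_closed[OF H] by (auto simp: conjg_def)
  fix a assume "a \<in> conjg g H"
  then obtain x where x: "x \<in> H" "a = g \<otimes> x \<otimes> inv g" by (auto simp: conjg_def)
  then show "inv a \<in> conjg g H"
    using conj_inv[OF g Hc[OF x(1)]] subgroup.m_inv_closed[OF H x(1)] by (auto simp: conjg_def)
  fix b assume "b \<in> conjg g H"
  then obtain y where y: "y \<in> H" "b = g \<otimes> y \<otimes> inv g" by (auto simp: conjg_def)
  show "a \<otimes> b \<in> conjg g H"
    using conj_mult[OF g Hc[OF x(1)] Hc[OF y(1)]] x y subgroup.m_closed[OF H x(1) y(1)] by (auto simp: conjg_def)
qed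

lemma conjg_inter:
  assumes g: "g \<in> carrier G" and H: "H \<subseteq> carrier G" and K: "K \<subseteq> carrier G"
  shows "conjg g (H \<inter> K) = conjg g H \<inter> conjg g K"
proof -
  have "inj_on (\<lambda>h. g \<otimes> h \<otimes> inv g) (carrier G)" using g by (intro inj_onI) simp
  then show ?thesis unfolding conjg_def using H K by (rule inj_on_image_Int)
qed

lemma cov_conjg:
  assumes g: "g \<in> carrier G" and H: "H \<subseteq> carrier G" and 1: "cov n H K"
  shows "cov n (conjg g H) (conjg g K)"
proof -
  obtain F where F: "finite F" "card F \<le> n" "F \<subseteq> H" "\<And>h. h \<in> H \<Longrightarrow> \<exists>f\<in>F. inv f \<otimes> h \<in> K"
    using 1 unfolding cov_def by blast
  have "card (conjg g F) \<le> n" using card_image_le[OF F(1)] F(2) le_trans unfolding conjg_def by blast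
  moreover have "\<exists>f\<in>conjg g F. inv f \<otimes> h \<in> conjg g K" if hh: "h \<in> conjg g H" for h
  proof -
    obtain x where x: "x \<in> H" "h = g \<otimes> x \<otimes> inv g" using hh by (auto simp: conjg_def)
    obtain f where f: "f \<in> F" "inv f \<otimes> x \<in> K" using F(4)[OF x(1)] by blast
    have c: "f \<in> carrier G" "x \<in> carrier G" using f x F(3) H by auto
    have "inv (g \<otimes> f \<otimes> inv g) \<otimes> h = g \<otimes> (inv f \<otimes> x) \<otimes> inv g"
      unfolding x(2) conj_inv[OF g c(1)] using conj_mult[OF g _ c(2), of "inv f"] c by simp
    then show ?thesis using f by (auto simp: conjg_def)
  qed
  moreover have "conjg g F \<subseteq> conjg g H" "finite (conjg g F)" using F(1,3) by (auto simp: conjg_def)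
  ultimately show ?thesis unfolding cov_def by blast
qed

lemma subgroup_conjg_pow: "g \<in> carrier G \<Longrightarrow> subgroup H G \<Longrightarrow> subgroup ((conjg g ^^ n) H) G"
  by (induction n) (auto simp: subgroup_conjg)

text \<open>Consecutive conjugates have relative index at most \<open>d\<close>; intersecting step
  by step multiplies these bounds.\<close>

lemma cov_conjg_pow:
  assumes g: "g \<in> carrier G" and V: "subgroup V G" and d: "cov d (conjg g V) (conjg g V \<inter> V)"
  shows "cov (d ^ n) ((conjg g ^^ n) V) ((conjg g ^^ n) V \<inter> V)"
proof (induction n)
  case 0
  have "\<exists>f\<in>{\<one>}. inv f \<otimes> h \<in> V" if "h \<in> V" for h using subgroup.mem_carrier[OF V that] that by simp
  then show ?case unfolding cov_def using subgroup.one_closed[OF V] by (intro exI[of _ "{\<one>}"]) auto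
next
  case (Suc n)
  let ?V = "\<lambda>n. (conjg g ^^ n) V"
  have sg: "subgroup (?V n) G" for n by (rule subgroup_conjg_pow[OF g V])
  have sc: "?V n \<subseteq> carrier G" for n using subgroup.subset[OF sg] .
  have step: "cov d (?V (Suc n)) (?V (Suc n) \<inter> ?V n)" for n
  proof (induction n)
    case 0 then show ?case using d by simp
  next
    case (Suc n)
    have "cov d (conjg g (?V (Suc n))) (conjg g (?V (Suc n) \<inter> ?V n))" by (rule cov_conjg[OF g sc Suc])
    then show ?case unfolding conjg_inter[OF g sc sc] by simp
  qed
  have s1: "subgroup (?V n \<inter> V) G" using subgroups_Inter_pair[OF sg V] .
  have 2: "cov (d ^ n) (?V n \<inter> ?V (Suc n)) (?V n \<inter> V \<inter> ?V (Suc n))"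
    by (rule cov_inter[OF sg s1 sg Suc])
  have 1: "cov d (?V (Suc n)) (?V n \<inter> ?V (Suc n))" using step[of n] by (subst Int_commute)
  have "cov (d * d ^ n) (?V (Suc n)) (?V n \<inter> V \<inter> ?V (Suc n))"
    by (rule cov_trans[OF sg _ 1 2]) blast
  then show ?case by (rule cov_mono) auto
qed

text \<open>The chain passes from the conjugate of \<open>U\<close> to that of \<open>V\<close> at
  cost \<open>a\<close>, from there to \<open>V\<close> at cost \<open>d^n\<close>, and back to
  \<open>U\<close> at cost \<open>b\<close>. The outer costs are independent of
  \<open>n\<close>.\<close>

lemma cov_commensurable:
  assumes g: "g \<in> carrier G" and V: "subgroup V G" and U: "subgroup U G"
    and d: "cov d (conjg g V) (conjg g V \<inter> V)" and a: "cov a U (U \<inter> V)" and b: "cov b V (V \<inter> U)"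
  shows "cov (a * (d ^ n * b)) ((conjg g ^^ n) U) ((conjg g ^^ n) U \<inter> U)"
proof -
  let ?U = "(conjg g ^^ n) U" and ?V = "(conjg g ^^ n) V"
  have sU: "subgroup ?U G" and sV: "subgroup ?V G" using subgroup_conjg_pow[OF g] U V by auto
  have "cov a ?U (?U \<inter> ?V)"
  proof (induction n)
    case 0 then show ?case using a by simp
  next
    case (Suc n)
    have c: "(conjg g ^^ n) U \<subseteq> carrier G" "(conjg g ^^ n) V \<subseteq> carrier G"
      using subgroup.subset[OF subgroup_conjg_pow[OF g]] U V by auto
    show ?case using cov_conjg[OF g c(1) Suc] by (simp add: conjg_inter[OF g c])
  qed
  then have 1: "cov a ?U (?V \<inter> ?U)" by (subst Int_commute)
  have 2: "cov (d ^ n) (?V \<inter> ?U) (?V \<inter> V \<inter> ?U)"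
    by (rule cov_inter[OF sV subgroups_Inter_pair[OF sV V] sU cov_conjg_pow[OF g V d]])
  have 3: "cov b (?V \<inter> V \<inter> ?U) (V \<inter> U \<inter> (?V \<inter> ?U))"
  proof -
    have "cov b (V \<inter> (?V \<inter> ?U)) (V \<inter> U \<inter> (?V \<inter> ?U))"
      by (rule cov_inter[OF V subgroups_Inter_pair[OF V U] subgroups_Inter_pair[OF sV sU] b])
    moreover have "V \<inter> (?V \<inter> ?U) = ?V \<inter> V \<inter> ?U" by blast
    ultimately show ?thesis by simp
  qed
  have 4: "cov (d ^ n * b) (?V \<inter> ?U) (V \<inter> U \<inter> (?V \<inter> ?U))"
    by (rule cov_trans[OF subgroups_Inter_pair[OF sV sU] _ 2 3]) blast
  have "cov (a * (d ^ n * b)) ?U (V \<inter> U \<inter> (?V \<inter> ?U))"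
    by (rule cov_trans[OF sU _ 1 4]) blast
  then show ?thesis by (rule cov_mono) auto
qed

end

lemma card_image_cong_iff:
  assumes "\<And>x y. x \<in> A \<Longrightarrow> y \<in> A \<Longrightarrow> f x = f y \<longleftrightarrow> g x = g y"
  shows "card (f ` A) = card (g ` A)"
proof (rule bij_betw_same_card[of "\<lambda>y. g (inv_into A f y)"], rule bij_betw_imageI)
  have i: "inv_into A f (f x) \<in> A" "f (inv_into A f (f x)) = f x" if "x \<in> A" for x
    using that by (auto intro: inv_into_into f_inv_into_f)
  have k: "g (inv_into A f (f x)) = g x" if "x \<in> A" for x
    using assms[OF i(1)[OF that] that] i(2)[OF that] by blast
  show "inj_on (\<lambda>y. g (inv_into A f y)) (f ` A)" using k assms by (auto intro!: inj_onI)
  show "(\<lambda>y. g (inv_into A f y)) ` f ` A = g ` A" using k by (auto simp: image_iff)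
qed

section \<open>Automorphism groups\<close>

text \<open>Otherwise the powers of \<open>q / d\<close> would be unbounded; exponent 1 excludes
  \<open>d = 0\<close>.\<close>

lemma nat_growth:
  assumes "\<And>n. (q::nat) ^ n \<le> a * (d ^ n * b)"
  shows "q \<le> d"
proof (rule ccontr)
  assume "\<not> q \<le> d"
  then have dq: "d < q" by simp
  have "d \<noteq> 0"
  proof
    assume "d = 0"
    then show False using assms[of 1] dq by simp
  qed
  then have d: "0 < real d" by simp
  have "1 < real q / real d" using dq d by simp
  then obtain n where n: "real (a * b) < (real q / real d) ^ n" using real_arch_pow by blast
  have "real (q ^ n) \<le> real (a * (d ^ n * b))" using assms[of n] by (simp only: of_nat_le_iff)
  then have "(real q / real d) ^ n \<le> real (a * b)" using d by (simp add: power_divide field_simps)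
  then show False using n by simp
qed

context coxeter
begin

lemma normal_root:
  assumes J: "J \<subseteq> S" and n: "normalizes J t" and s: "s \<in> J"
  shows "\<exists>s'\<in>J. act t (bas s) = bas s'"
proof -
  obtain s' where s': "s' \<in> J" "t \<otimes> s = s' \<otimes> t" using n s by (auto simp: normalizes_def)
  have c: "t \<in> carrier W" "s \<in> S" "s' \<in> S" using n s s' J by (auto simp: normalizes_def rmin_def)
  have p: "posv (act t (bas s))" using root_sign(1)[OF c(1,2)] n s by (auto simp: normalizes_def rmin_def)
  have "refl s' (act t (bas s)) = act (s' \<otimes> t) (bas s)" using c by (simp add: act_Cons)
  also have "\<dots> = act (t \<otimes> s) (bas s)" using s' by simp
  also have "\<dots> = (\<lambda>x. - act t (bas s) x)" using c by (simp add: act_mult act_S refl_bas act_uminus)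
  finally have "\<not> posv (refl s' (act t (bas s)))" using p not_posv_negv by simp
  then have "act t (bas s) = bas s'" using refl_pos[OF _ p c(3)] c by auto
  then show ?thesis using s' by blast
qed

text \<open>Minimality in the coset is not visibly inherited by products. The proof follows simple
  roots instead: \<open>t\<close> maps those of \<open>J\<close> to those of \<open>J\<close>, hence
  so do its powers, and both parts of \<open>normalizes\<close> can be read off from this.\<close>

lemma normalizes_pow:
  assumes J: "J \<subseteq> S" and n: "normalizes J t"
  shows "normalizes J (t [^] (m::nat))"
proof -
  have tc: "t \<in> carrier W" using n by (auto simp: normalizes_def rmin_def)
  have root: "\<exists>s'\<in>J. act (t [^] m) (bas s) = bas s'" if "s \<in> J" for s
    using that
  proof (induction m arbitrary: s)
    case 0 then show ?case by auto
  next
    case (Suc m)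
    obtain s' where "s' \<in> J" "act t (bas s) = bas s'" using normal_root[OF J n Suc(2)] by blast
    then show ?case using Suc(1)[of s'] tc by (simp add: act_mult)
  qed
  have p: "t [^] m \<in> carrier W" using tc by simp
  have "len (t [^] m) < len (t [^] m \<otimes> s)" "\<exists>s'\<in>J. t [^] m \<otimes> s = s' \<otimes> t [^] m" if s: "s \<in> J" for s
  proof -
    obtain s' where s': "s' \<in> J" "act (t [^] m) (bas s) = bas s'" using root[OF s] by blast
    have c: "s \<in> S" "s' \<in> S" using s s' J by auto
    show "len (t [^] m) < len (t [^] m \<otimes> s)" using root_sign(1)[OF p c(1)] s' posv_bas[OF c(2)] by simp
    show "\<exists>s'\<in>J. t [^] m \<otimes> s = s' \<otimes> t [^] m" using simple_root_eq[OF p c s'(2)] s' by blast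
  qed
  then show ?thesis using p by (simp add: normalizes_def rmin_def)
qed

end

lemma topspace_perm_top [simp]: "topspace (perm_top C) = C \<rightarrow>\<^sub>E C"
  by (simp add: perm_top_def topspace_product_topology)

lemma openin_cylinder:
  assumes "x \<in> C"
  shows "openin (perm_top C) {f \<in> C \<rightarrow>\<^sub>E C. P (f x)}"
proof -
  have "continuous_map (perm_top C) (discrete_topology C) (\<lambda>f. f x)"
    unfolding perm_top_def by (rule continuous_map_product_projection[OF assms])
  then have "openin (perm_top C) {f \<in> topspace (perm_top C). f x \<in> {c \<in> C. P c}}"
    by (rule openin_continuous_map_preimage) auto
  moreover have "{f \<in> topspace (perm_top C). f x \<in> {c \<in> C. P c}} = {f \<in> C \<rightarrow>\<^sub>E C. P (f x)}"
    using assms by auto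
  ultimately show ?thesis by simp
qed

lemma openin_cylinder2:
  assumes "x \<in> C" "y \<in> C"
  shows "openin (perm_top C) {f \<in> C \<rightarrow>\<^sub>E C. P (f x) (f y)}"
proof -
  have "{f \<in> C \<rightarrow>\<^sub>E C. P (f x) (f y)} =
      (\<Union>a\<in>C. {f \<in> C \<rightarrow>\<^sub>E C. f x = a} \<inter> {f \<in> C \<rightarrow>\<^sub>E C. P a (f y)})" using assms by auto
  moreover have "openin (perm_top C) \<dots>"
    by (intro openin_Union ballI) (auto intro!: openin_Int openin_cylinder assms)
  ultimately show ?thesis by simp
qed

lemma closedin_cylinder2:
  assumes "x \<in> C" "y \<in> C"
  shows "closedin (perm_top C) {f \<in> C \<rightarrow>\<^sub>E C. P (f x) (f y)}"
proof -
  have "(C \<rightarrow>\<^sub>E C) - {f \<in> C \<rightarrow>\<^sub>E C. P (f x) (f y)} = {f \<in> C \<rightarrow>\<^sub>E C. \<not> P (f x) (f y)}" by blast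
  then show ?thesis using openin_cylinder2[OF assms, of "\<lambda>a b. \<not> P a b"] by (auto simp: closedin_def)
qed

locale aut_group = building W S C \<delta>
  for W :: "('w,'b) monoid_scheme" (structure) and S and C :: "'c set" and \<delta> :: "'c \<Rightarrow> 'c \<Rightarrow> 'w" +
  fixes G :: "('c \<Rightarrow> 'c) set"
  assumes locally_finite: "locally_finite_building S C \<delta>"
    and closed_group: "closed_aut_group C \<delta> G"
    and transitive: "weyl_transitive C \<delta> G"
begin

lemma G_aut: "h \<in> G \<Longrightarrow> h \<in> type_pres_aut C \<delta>"
  using closed_group by (auto simp: closed_aut_group_def is_subgroup_of_def)

lemma G_ext: "h \<in> G \<Longrightarrow> h \<in> extensional C"
  using G_aut by (auto simp: type_pres_aut_def)

lemma G_bij: "h \<in> G \<Longrightarrow> bij_betw h C C"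
  using G_aut by (auto simp: type_pres_aut_def)

lemma G_dist: "h \<in> G \<Longrightarrow> x \<in> C \<Longrightarrow> y \<in> C \<Longrightarrow> \<delta> (h x) (h y) = \<delta> x y"
  using G_aut by (auto simp: type_pres_aut_def)

lemma G_closed [simp]: "h \<in> G \<Longrightarrow> x \<in> C \<Longrightarrow> h x \<in> C"
  using G_bij by (auto simp: bij_betw_def)

lemma gmult_apply [simp]: "x \<in> C \<Longrightarrow> gmult C g h x = g (h x)"
  by (simp add: gmult_def compose_def)

lemma G_one: "restrict id C \<in> G"
  using closed_group by (auto simp: closed_aut_group_def is_subgroup_of_def)

lemma G_mult: "g \<in> G \<Longrightarrow> h \<in> G \<Longrightarrow> gmult C g h \<in> G"
  using closed_group by (auto simp: closed_aut_group_def is_subgroup_of_def)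

lemma G_inv: "g \<in> G \<Longrightarrow> ginv C g \<in> G"
  using closed_group by (auto simp: closed_aut_group_def is_subgroup_of_def)

lemma ginv_left [simp]: "g \<in> G \<Longrightarrow> x \<in> C \<Longrightarrow> ginv C g (g x) = x"
  using G_bij[of g] by (simp add: ginv_def bij_betw_def)

lemma ginv_right [simp]: "g \<in> G \<Longrightarrow> x \<in> C \<Longrightarrow> g (ginv C g x) = x"
  using G_bij[of g] by (simp add: ginv_def bij_betw_def f_inv_into_f)

lemma G_eqI: "g \<in> G \<Longrightarrow> h \<in> G \<Longrightarrow> (\<And>x. x \<in> C \<Longrightarrow> g x = h x) \<Longrightarrow> g = h"
  by (rule extensionalityI[of _ C]) (auto intro: G_ext)

definition GG :: "('c \<Rightarrow> 'c) monoid" where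
  "GG = \<lparr>carrier = G, monoid.mult = gmult C, one = restrict id C\<rparr>"

lemma GG_simps [simp]: "carrier GG = G" "monoid.mult GG = gmult C" "one GG = restrict id C"
  by (simp_all add: GG_def)

lemma group_GG: "group GG"
proof (rule groupI)
  fix x y z assume a: "x \<in> carrier GG" "y \<in> carrier GG" "z \<in> carrier GG"
  show "x \<otimes>\<^bsub>GG\<^esub> y \<otimes>\<^bsub>GG\<^esub> z = x \<otimes>\<^bsub>GG\<^esub> (y \<otimes>\<^bsub>GG\<^esub> z)"
    by (rule G_eqI) (use a G_mult in auto)
next
  fix x assume a: "x \<in> carrier GG"
  show "\<one>\<^bsub>GG\<^esub> \<otimes>\<^bsub>GG\<^esub> x = x" by (rule G_eqI) (use a G_mult G_one in auto)
  have "ginv C x \<otimes>\<^bsub>GG\<^esub> x = \<one>\<^bsub>GG\<^esub>" by (rule G_eqI) (use a G_mult G_one G_inv in auto)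
  then show "\<exists>y\<in>carrier GG. y \<otimes>\<^bsub>GG\<^esub> x = \<one>\<^bsub>GG\<^esub>" using G_inv a by auto
qed (use G_mult G_one in auto)

end

sublocale aut_group \<subseteq> GG: group GG
  by (rule group_GG)

context aut_group
begin

lemma GG_inv [simp]: "g \<in> G \<Longrightarrow> inv\<^bsub>GG\<^esub> g = ginv C g"
proof (rule GG.inv_equality)
  assume g: "g \<in> G"
  show "ginv C g \<otimes>\<^bsub>GG\<^esub> g = \<one>\<^bsub>GG\<^esub>" by (rule G_eqI) (use g G_mult G_one G_inv in auto)
qed (use G_inv in auto)

lemma conj_set_eq: "g \<in> G \<Longrightarrow> conj_set C g U = GG.conjg g U"
  by (simp add: conj_set_def GG.conjg_def)

lemma sg_index_eq: "sg_index C H K = card (GG.cosets H K)"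
  by (simp add: sg_index_def GG.cosets_def)

lemma subgroup_iff: "is_subgroup_of C H G \<Longrightarrow> subgroup H GG"
  by (rule subgroup.intro) (auto simp: is_subgroup_of_def)

lemma displacement_eq: "g \<in> G \<Longrightarrow>
    displacement C g U = card (GG.cosets (GG.conjg g U) (GG.conjg g U \<inter> U))"
  by (simp add: displacement_def sg_index_eq conj_set_eq)

text \<open>Together with \<open>finite_orbits\<close>, the combinatorial trace of openness and
  compactness used in the index estimates.\<close>

definition contains_fixator :: "('c \<Rightarrow> 'c) set \<Rightarrow> bool" where
  "contains_fixator V \<longleftrightarrow> (\<exists>F. finite F \<and> F \<subseteq> C \<and> {h \<in> G. \<forall>c\<in>F. h c = c} \<subseteq> V)"

definition finite_orbits :: "('c \<Rightarrow> 'c) set \<Rightarrow> bool" where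
  "finite_orbits V \<longleftrightarrow> (\<forall>c\<in>C. finite ((\<lambda>h. h c) ` V))"

text \<open>Elements of \<open>V\<close> that agree on the finite set \<open>F\<close> lie in the
  same coset, and finite orbits leave only finitely many restrictions to \<open>F\<close>.\<close>

lemma cov_exists:
  assumes V: "subgroup V GG" and fo: "finite_orbits V" and U: "contains_fixator U"
  shows "\<exists>n. GG.cov n V (V \<inter> U)"
proof -
  obtain F where F: "finite F" "F \<subseteq> C" "{h \<in> G. \<forall>c\<in>F. h c = c} \<subseteq> U"
    using U unfolding contains_fixator_def by blast
  have VG: "h \<in> G" if "h \<in> V" for h using subgroup.subset[OF V] that by auto
  let ?r = "\<lambda>h. restrict h F"
  have "?r ` V \<subseteq> (\<Pi>\<^sub>E c\<in>F. (\<lambda>h. h c) ` V)" by auto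
  moreover have "finite (\<Pi>\<^sub>E c\<in>F. (\<lambda>h. h c) ` V)"
    using fo F(1,2) by (intro finite_PiE) (auto simp: finite_orbits_def)
  ultimately have fin: "finite (?r ` V)" by (rule finite_subset)
  obtain D where D: "D \<subseteq> V" "finite D" "?r ` V = ?r ` D"
    using finite_subset_image[OF fin, of ?r V] by blast
  have "\<exists>f\<in>D. inv\<^bsub>GG\<^esub> f \<otimes>\<^bsub>GG\<^esub> h \<in> V \<inter> U" if h: "h \<in> V" for h
  proof -
    have "?r h \<in> ?r ` D" using D(3) h by blast
    then obtain f where f: "f \<in> D" "?r h = ?r f" by blast
    have fh: "f \<in> G" "h \<in> G" "f \<in> V" using f D h VG by auto
    have eq: "h c = f c" if "c \<in> F" for c using fun_cong[OF f(2), of c] that by simp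
    have "gmult C (ginv C f) h c = c" if "c \<in> F" for c
    proof -
      have "c \<in> C" using that F by blast
      then show ?thesis using eq[OF that] fh by simp
    qed
    then have "gmult C (ginv C f) h \<in> U" using F(3) G_mult G_inv fh by blast
    moreover have "inv\<^bsub>GG\<^esub> f \<otimes>\<^bsub>GG\<^esub> h \<in> V"
      using subgroup.m_closed[OF V subgroup.m_inv_closed[OF V fh(3)] h] .
    ultimately show ?thesis using f fh by (intro bexI[of _ f]) auto
  qed
  then show ?thesis unfolding GG.cov_def using D(1,2) by blast
qed

text \<open>A basic neighbourhood of the identity in the product topology constrains finitely many
  coordinates.\<close>

lemma compact_open_fixator:
  assumes "compact_open_subgroup C G V"
  shows "contains_fixator V"
proof -
  have op: "openin (subtopology (perm_top C) G) V" and sub: "is_subgroup_of C V G"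
    using assms by (auto simp: compact_open_subgroup_def)
  obtain T where T: "openin (perm_top C) T" "V = T \<inter> G" using op by (auto simp: openin_subtopology)
  have "restrict id C \<in> T" using sub T by (auto simp: is_subgroup_of_def)
  then obtain U where U: "finite {i \<in> C. U i \<noteq> topspace (discrete_topology C)}"
      "restrict id C \<in> Pi\<^sub>E C U" "Pi\<^sub>E C U \<subseteq> T"
    using T(1) unfolding perm_top_def openin_product_topology_alt by blast
  let ?F = "{i \<in> C. U i \<noteq> C}"
  have "h \<in> V" if h: "h \<in> G" "\<forall>c\<in>?F. h c = c" for h
  proof -
    have "h \<in> Pi\<^sub>E C U"
    proof (rule PiE_I)
      fix c assume c: "c \<in> C"
      show "h c \<in> U c"
      proof (cases "c \<in> ?F")
        case True
        then show ?thesis using U(2) h c by (auto simp: PiE_iff)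
      next
        case False then show ?thesis using c h by simp
      qed
    next
      fix c assume "c \<notin> C"
      then show "h c = undefined" using G_ext[OF h(1)] by (simp add: extensional_def)
    qed
    then show ?thesis using U(3) T h by blast
  qed
  then show ?thesis unfolding contains_fixator_def using U(1) by (intro exI[of _ ?F]) auto
qed

lemma compact_open_orbits:
  assumes "compact_open_subgroup C G V"
  shows "finite_orbits V"
  unfolding finite_orbits_def
proof
  fix c assume c: "c \<in> C"
  have "compactin (perm_top C) V"
    using assms by (auto simp: compact_open_subgroup_def compactin_subtopology)
  moreover have "continuous_map (perm_top C) (discrete_topology C) (\<lambda>f. f c)"
    unfolding perm_top_def by (rule continuous_map_product_projection[OF c])
  ultimately have "compactin (discrete_topology C) ((\<lambda>f. f c) ` V)" by (rule image_compactin)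
  then show "finite ((\<lambda>f. f c) ` V)" by (simp add: compactin_discrete_topology)
qed

lemma finite_orbits_conj:
  assumes g: "g \<in> G" and V: "subgroup V GG" and fo: "finite_orbits V"
  shows "finite_orbits (GG.conjg g V)"
  unfolding finite_orbits_def
proof
  fix c assume c: "c \<in> C"
  have VG: "h \<in> G" if "h \<in> V" for h using subgroup.subset[OF V] that by auto
  have ic: "ginv C g c \<in> C" using G_inv[OF g] c by simp
  have "(\<lambda>h. h c) ` GG.conjg g V \<subseteq> g ` (\<lambda>h. h (ginv C g c)) ` V"
    using c g ic VG by (auto simp: GG.conjg_def)
  moreover have "finite (g ` (\<lambda>h. h (ginv C g c)) ` V)" using fo ic by (simp add: finite_orbits_def)
  ultimately show "finite ((\<lambda>h. h c) ` GG.conjg g V)" by (rule finite_subset)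
qed

lemma finite_sphere:
  assumes x: "x \<in> C" and w: "w \<in> carrier W"
  shows "finite (sphere x w)"
proof -
  have "finite (sphere x (wprod xs))" if "x \<in> C" "set xs \<subseteq> S" for xs x
    using that
  proof (induction xs arbitrary: x)
    case Nil
    have "sphere x \<one> \<subseteq> {x}" using dist_one_iff[OF Nil(1)] by (auto simp: sphere_def)
    then show ?case using finite_subset by auto
  next
    case (Cons s xs)
    have s: "s \<in> S" "set xs \<subseteq> S" using Cons by auto
    have "sphere x (wprod (s # xs)) \<subseteq> (\<Union>z\<in>s_adjacent C \<delta> s x. sphere z (wprod xs))"
    proof
      fix y assume y: "y \<in> sphere x (wprod (s # xs))"
      then have "y \<in> C" "\<delta> x y = s \<otimes> wprod xs" by (auto simp: sphere_def)
      then obtain z where "z \<in> C" "\<delta> x z = s" "\<delta> z y = wprod xs"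
        using dist_split[OF Cons(2), of y s "wprod xs"] s by auto
      then show "y \<in> (\<Union>z\<in>s_adjacent C \<delta> s x. sphere z (wprod xs))"
        using \<open>y \<in> C\<close> by (auto simp: s_adjacent_def sphere_def)
    qed
    moreover have "finite (\<Union>z\<in>s_adjacent C \<delta> s x. sphere z (wprod xs))"
      using locally_finite Cons s by (auto simp: locally_finite_building_def s_adjacent_def)
    ultimately show ?case by (rule finite_subset)
  qed
  then show ?thesis using ex_word[OF w] x by blast
qed

lemma G_moves: "x \<in> C \<Longrightarrow> y \<in> C \<Longrightarrow> x' \<in> C \<Longrightarrow> y' \<in> C \<Longrightarrow> \<delta> x y = \<delta> x' y' \<Longrightarrow>
    \<exists>h\<in>G. h x = x' \<and> h y = y'"
  using transitive by (auto simp: weyl_transitive_def)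

lemma sphere_image:
  assumes h: "h \<in> G" and x: "x \<in> C"
  shows "h ` sphere x w = sphere (h x) w"
proof
  show "h ` sphere x w \<subseteq> sphere (h x) w" using h x G_dist by (auto simp: sphere_def)
  show "sphere (h x) w \<subseteq> h ` sphere x w"
  proof
    fix z assume z: "z \<in> sphere (h x) w"
    then obtain y where y: "y \<in> C" "z = h y" using G_bij[OF h] by (auto simp: sphere_def bij_betw_def)
    then have "y \<in> sphere x w" using z G_dist[OF h x y(1)] by (auto simp: sphere_def)
    then show "z \<in> h ` sphere x w" using y by blast
  qed
qed

lemma card_sphere:
  assumes x: "x \<in> C" and y: "y \<in> C"
  shows "card (sphere x w) = card (sphere y w)"
proof -
  obtain h where h: "h \<in> G" "h x = y" using G_moves[OF x x y y] x y by auto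
  have "inj_on h (sphere x w)" using G_bij[OF h(1)] by (auto simp: bij_betw_def sphere_def inj_on_def)
  then show ?thesis using sphere_image[OF h(1) x, of w] h(2) card_image by metis
qed

end

sublocale aut_group \<subseteq> hom_building W S C \<delta> "\<lambda>w. card (sphere (SOME x. x \<in> C) w)"
proof unfold_locales
  fix x w assume x: "x \<in> C" and w: "w \<in> carrier W"
  have "(SOME x. x \<in> C) \<in> C" by (rule someI[of _ x]) (rule x)
  then show "finite (sphere x w) \<and> card (sphere x w) = card (sphere (SOME x. x \<in> C) w)"
    using finite_sphere[OF x w] card_sphere[OF x] by blast
qed

section \<open>Stabilisers of residues: index, compactness and displacement\<close>

context aut_group
begin

definition Qd :: "'w \<Rightarrow> nat" where "Qd w = card (sphere (SOME x. x \<in> C) w)"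

lemma res_image:
  assumes h: "h \<in> G" and x: "x \<in> C"
  shows "h ` res J x = res J (h x)"
proof
  show "h ` res J x \<subseteq> res J (h x)" using h x G_dist by (auto simp: residue_def)
  show "res J (h x) \<subseteq> h ` res J x"
  proof
    fix z assume z: "z \<in> res J (h x)"
    then obtain y where y: "y \<in> C" "z = h y" using G_bij[OF h] by (auto simp: residue_def bij_betw_def)
    then have "y \<in> res J x" using z G_dist[OF h x y(1)] by (auto simp: residue_def)
    then show "z \<in> h ` res J x" using y by blast
  qed
qed

lemma gmult_image: "B \<subseteq> C \<Longrightarrow> gmult C g h ` B = g ` h ` B"
  by (auto simp: image_iff subset_iff)

lemma ginv_image: "g \<in> G \<Longrightarrow> B \<subseteq> C \<Longrightarrow> ginv C g ` g ` B = B"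
  by (force simp: image_iff subset_iff)

lemma stabilizer_subgroup:
  assumes B: "B \<subseteq> C"
  shows "subgroup (stabilizer G B) GG"
proof (rule GG.subgroupI)
  show "stabilizer G B \<subseteq> carrier GG" by (auto simp: stabilizer_def)
  have "restrict id C ` B = B" using B by (force simp: image_iff)
  then have "restrict id C \<in> stabilizer G B" using G_one by (simp add: stabilizer_def)
  then show "stabilizer G B \<noteq> {}" by blast
  fix a assume a: "a \<in> stabilizer G B"
  then have aG: "a \<in> G" "a ` B = B" by (auto simp: stabilizer_def)
  have "ginv C a ` B = B" using ginv_image[OF aG(1) B] aG(2) by simp
  then show "inv\<^bsub>GG\<^esub> a \<in> stabilizer G B" using aG G_inv by (simp add: stabilizer_def)
  fix b assume "b \<in> stabilizer G B"
  then show "a \<otimes>\<^bsub>GG\<^esub> b \<in> stabilizer G B" using aG G_mult gmult_image[OF B, of a b] by (simp add: stabilizer_def)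
qed

lemma stabilizer_is_subgroup: "B \<subseteq> C \<Longrightarrow> is_subgroup_of C (stabilizer G B) G"
proof -
  assume B: "B \<subseteq> C"
  note s = stabilizer_subgroup[OF B]
  have sub: "stabilizer G B \<subseteq> G" by (auto simp: stabilizer_def)
  show ?thesis unfolding is_subgroup_of_def
    using sub subgroup.one_closed[OF s] subgroup.m_closed[OF s] subgroup.m_inv_closed[OF s]
    by (auto simp: subset_iff)
qed

lemma conj_stabilizer:
  assumes g: "g \<in> G" and B: "B \<subseteq> C"
  shows "GG.conjg g (stabilizer G B) = stabilizer G (g ` B)"
proof
  have gB: "g ` B \<subseteq> C" using g B by auto
  have tr: "gmult C (gmult C g u) (ginv C g) \<in> stabilizer G (g ` B)" if "u \<in> stabilizer G B" "g \<in> G" "B \<subseteq> C" for g u B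
  proof -
    have u: "u \<in> G" "u ` B = B" using that by (auto simp: stabilizer_def)
    have gB: "g ` B \<subseteq> C" using that by auto
    have "gmult C (gmult C g u) (ginv C g) ` g ` B = g ` u ` ginv C g ` g ` B"
      using gmult_image[OF gB] gmult_image[OF that(3)] ginv_image[OF that(2,3)] by simp
    then show ?thesis using u that G_mult G_inv ginv_image[OF that(2,3)] by (simp add: stabilizer_def)
  qed
  show "GG.conjg g (stabilizer G B) \<subseteq> stabilizer G (g ` B)"
    using tr[OF _ g B] g by (auto simp: GG.conjg_def)
  show "stabilizer G (g ` B) \<subseteq> GG.conjg g (stabilizer G B)"
  proof
    fix h assume h: "h \<in> stabilizer G (g ` B)"
    let ?u = "gmult C (gmult C (ginv C g) h) g"
    have hG: "h \<in> G" "h ` g ` B = g ` B" using h by (auto simp: stabilizer_def)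
    have u: "?u \<in> G" using g hG G_mult G_inv by simp
    have "?u ` B = ginv C g ` h ` g ` B" using gmult_image[OF B] gmult_image[OF gB] by simp
    then have "?u \<in> stabilizer G B" using u hG ginv_image[OF g B] by (simp add: stabilizer_def)
    moreover have "h = g \<otimes>\<^bsub>GG\<^esub> ?u \<otimes>\<^bsub>GG\<^esub> inv\<^bsub>GG\<^esub> g"
      by (rule G_eqI) (use g hG u G_mult G_inv in simp_all)
    ultimately show "h \<in> GG.conjg g (stabilizer G B)" unfolding GG.conjg_def by blast
  qed
qed

text \<open>Cosets correspond to the translates of \<open>res J x\<close> under the stabiliser of
  \<open>res J y\<close>. Each translate contains exactly one chamber at distance
  \<open>\<delta> y x\<close> from \<open>y\<close>: existence is \<open>normal_shift\<close>,
  uniqueness the gate property, and transitivity reaches the whole sphere.\<close>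

lemma index_stabilizer:
  assumes J: "J \<subseteq> S" and x: "x \<in> C" and y: "y \<in> C" and n: "normalizes J (\<delta> y x)"
  shows "card (GG.cosets (stabilizer G (res J y)) (stabilizer G (res J y) \<inter> stabilizer G (res J x))) = Qd (\<delta> y x)"
proof -
  let ?b = "res J x" and ?c = "res J y" and ?t = "\<delta> y x"
  let ?H = "stabilizer G ?c" and ?B = "stabilizer G ?b"
  have sH: "subgroup ?H GG" and sB: "subgroup ?B GG" using stabilizer_subgroup res_sub by auto
  have sK: "subgroup (?H \<inter> ?B) GG" by (rule GG.subgroups_Inter_pair[OF sH sB])
  have 1: "(\<otimes>\<^bsub>GG\<^esub>) h ` (?H \<inter> ?B) = (\<otimes>\<^bsub>GG\<^esub>) f ` (?H \<inter> ?B) \<longleftrightarrow> h ` ?b = f ` ?b"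
    if "h \<in> ?H" "f \<in> ?H" for h f
  proof -
    have hf: "h \<in> G" "f \<in> G" using that by (auto simp: stabilizer_def)
    have "inv\<^bsub>GG\<^esub> f \<otimes>\<^bsub>GG\<^esub> h \<in> ?H"
      by (rule subgroup.m_closed[OF sH subgroup.m_inv_closed[OF sH that(2)] that(1)])
    then have "(\<otimes>\<^bsub>GG\<^esub>) h ` (?H \<inter> ?B) = (\<otimes>\<^bsub>GG\<^esub>) f ` (?H \<inter> ?B) \<longleftrightarrow> gmult C (ginv C f) h \<in> ?B"
      using GG.coset_eq_iff[OF sK, of h f] hf by simp
    also have "\<dots> \<longleftrightarrow> ginv C f ` h ` ?b = ?b"
      using gmult_image[OF res_sub, of "ginv C f" h] G_mult G_inv hf by (simp add: stabilizer_def)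
    also have "\<dots> \<longleftrightarrow> h ` ?b = f ` ?b"
    proof
      assume e: "ginv C f ` h ` ?b = ?b"
      have "f ` ginv C f ` h ` ?b = h ` ?b"
      proof -
        have hb: "h ` ?b \<subseteq> C" using G_closed[OF hf(1)] res_sub[of J x] by blast
        then show ?thesis using hf by (force simp: image_iff subset_iff)
      qed
      then show "h ` ?b = f ` ?b" using e by simp
    next
      assume "h ` ?b = f ` ?b"
      then show "ginv C f ` h ` ?b = ?b" using ginv_image[OF hf(2) res_sub] by simp
    qed
    finally show ?thesis .
  qed
  have "card (GG.cosets ?H (?H \<inter> ?B)) = card ((\<lambda>h. h ` ?b) ` ?H)"
    unfolding GG.cosets_def by (rule card_image_cong_iff) (rule 1)
  also have "(\<lambda>h. h ` ?b) ` ?H = res J ` sphere y ?t"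
  proof
    show "(\<lambda>h. h ` ?b) ` ?H \<subseteq> res J ` sphere y ?t"
    proof (rule image_subsetI)
      fix h assume h: "h \<in> ?H"
      then have hG: "h \<in> G" "h ` ?c = ?c" by (auto simp: stabilizer_def)
      have d: "\<delta> (h y) (h x) = ?t" using G_dist[OF hG(1) y x] .
      have hy: "res J (h y) = ?c" using res_image[OF hG(1) y] hG(2) by simp
      have "y \<in> res J (h y)" using hy res_self[OF y] by simp
      then obtain x' where x': "x' \<in> res J (h x)" "\<delta> y x' = ?t"
        using normal_shift[OF J _ _ _ , of "h y" "h x" y] hG x y n d by auto
      have "x' \<in> C" using x' res_sub by blast
      then have "x' \<in> sphere y ?t" using x' by (simp add: sphere_def)
      moreover have "h ` ?b = res J x'" using res_image[OF hG(1) x] res_eq[OF J _ x'(1)] hG x by simp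
      ultimately show "h ` ?b \<in> res J ` sphere y ?t" by blast
    qed
    show "res J ` sphere y ?t \<subseteq> (\<lambda>h. h ` ?b) ` ?H"
    proof (rule image_subsetI)
      fix x' assume "x' \<in> sphere y ?t"
      then have x': "x' \<in> C" "\<delta> y x' = ?t" by (auto simp: sphere_def)
      obtain h where h: "h \<in> G" "h y = y" "h x = x'" using G_moves[OF y x y x'(1)] x' by auto
      have "h ` ?c = ?c" using res_image[OF h(1) y] h by simp
      then have "h \<in> ?H" using h by (simp add: stabilizer_def)
      moreover have "res J x' = h ` ?b" using res_image[OF h(1) x] h by simp
      ultimately show "res J x' \<in> (\<lambda>h. h ` ?b) ` ?H" by blast
    qed
  qed
  also have "card (res J ` sphere y ?t) = card (sphere y ?t)"
  proof (rule card_image, rule inj_onI)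
    fix a b assume a: "a \<in> sphere y ?t" and b: "b \<in> sphere y ?t" and e: "res J a = res J b"
    have ab: "a \<in> C" "b \<in> C" "\<delta> y a = ?t" "\<delta> y b = ?t" using a b by (auto simp: sphere_def)
    have "b \<in> res J a" using e res_self[OF ab(2)] by simp
    then have "len ?t = len ?t + len (\<delta> a b)"
      using gate(2)[OF J y ab(1), of b] n ab by (simp add: normalizes_def)
    then have "\<delta> a b = \<one>" using len_0_iff[of "\<delta> a b"] ab by simp
    then show "a = b" using dist_one_iff ab by blast
  qed
  also have "\<dots> = Qd ?t" using sph[OF y] x y by (simp add: Qd_def)
  finally show ?thesis .
qed

text \<open>Surjectivity comes from counting: \<open>f\<close> maps a finite sphere around
  \<open>y\<close> injectively into the sphere of the same radius around \<open>f y\<close>, which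
  has the same size, and the radius is chosen so that \<open>y\<close> lies in the latter.\<close>

lemma isometry_aut:
  assumes f: "f \<in> C \<rightarrow>\<^sub>E C" and d: "\<And>x y. x \<in> C \<Longrightarrow> y \<in> C \<Longrightarrow> \<delta> (f x) (f y) = \<delta> x y"
  shows "f \<in> type_pres_aut C \<delta>"
proof -
  have fC: "f x \<in> C" if "x \<in> C" for x using f that by auto
  have inj: "inj_on f C"
  proof (rule inj_onI)
    fix x y assume a: "x \<in> C" "y \<in> C" "f x = f y"
    then have "\<delta> x y = \<one>" using d[OF a(1,2)] fC by simp
    then show "x = y" using dist_one_iff a by blast
  qed
  have "y \<in> f ` C" if y: "y \<in> C" for y
  proof -
    let ?w = "\<delta> (f y) y"
    have wc: "?w \<in> carrier W" using fC y by simp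
    have sub: "f ` sphere y ?w \<subseteq> sphere (f y) ?w" using d[OF y] fC by (auto simp: sphere_def)
    have "card (f ` sphere y ?w) = card (sphere y ?w)"
      by (rule card_image, rule inj_on_subset[OF inj]) (auto simp: sphere_def)
    also have "\<dots> = card (sphere (f y) ?w)" by (rule card_sphere[OF y fC[OF y]])
    finally have "f ` sphere y ?w = sphere (f y) ?w"
      using card_subset_eq[OF finite_sphere[OF fC[OF y] wc] sub] by simp
    moreover have "y \<in> sphere (f y) ?w" using y by (simp add: sphere_def)
    ultimately show ?thesis by (auto simp: sphere_def)
  qed
  then have "f ` C = C" using fC by blast
  then show ?thesis using f d inj by (auto simp: type_pres_aut_def bij_betw_def PiE_iff)
qed

text \<open>Bijectivity is not in itself a closed condition; \<open>isometry_aut\<close> derives it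
  from the isometry equations, each of which involves two coordinates only.\<close>

lemma closed_aut: "closedin (perm_top C) (type_pres_aut C \<delta>)"
proof -
  have e: "type_pres_aut C \<delta> = (\<Inter>p\<in>C \<times> C. {f \<in> C \<rightarrow>\<^sub>E C. \<delta> (f (fst p)) (f (snd p)) = \<delta> (fst p) (snd p)})" (is "_ = ?R")
  proof
    show "type_pres_aut C \<delta> \<subseteq> ?R" by (auto simp: type_pres_aut_def bij_betw_def PiE_iff)
    show "?R \<subseteq> type_pres_aut C \<delta>"
    proof
      fix f assume f: "f \<in> ?R"
      obtain x where x: "x \<in> C" using base_chamber by blast
      have "f \<in> C \<rightarrow>\<^sub>E C" using f x by auto
      then show "f \<in> type_pres_aut C \<delta>" by (rule isometry_aut) (use f in auto)
    qed
  qed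
  obtain x where x: "x \<in> C" using base_chamber by blast
  show ?thesis unfolding e
    by (rule closedin_Inter) (use x in \<open>auto intro!: closedin_cylinder2\<close>)
qed

lemma closed_G: "closedin (perm_top C) G"
  using closed_group closed_aut closedin_trans_full by (auto simp: closed_aut_group_def)

lemma stabilizer_res_eq:
  assumes J: "J \<subseteq> S" and x: "x \<in> C"
  shows "stabilizer G (res J x) = {h \<in> G. h x \<in> res J x}"
proof -
  have "h ` res J x = res J x \<longleftrightarrow> h x \<in> res J x" if h: "h \<in> G" for h
    unfolding res_image[OF h x] using res_self[of "h x" J] res_eq[OF J x, of "h x"] h x by auto
  then show ?thesis by (auto simp: stabilizer_def)
qed

text \<open>For compactness, \<open>h x\<close> ranges over a finite residue and \<open>h c\<close>
  over finite spheres around its chambers, so the stabiliser is a closed subset of a product of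
  finite sets.\<close>

lemma stabilizer_compact_open:
  assumes J: "J \<subseteq> S" and fin: "finite (par J)" and x: "x \<in> C"
  shows "compact_open_subgroup C G (stabilizer G (res J x))"
  unfolding compact_open_subgroup_def
proof (intro conjI)
  let ?A = "res J x" and ?U = "stabilizer G (res J x)"
  have GE: "G \<subseteq> C \<rightarrow>\<^sub>E C"
  proof
    fix h assume h: "h \<in> G"
    show "h \<in> C \<rightarrow>\<^sub>E C" unfolding PiE_iff using G_closed[OF h] G_ext[OF h] by blast
  qed
  have eU: "?U = G \<inter> {f \<in> C \<rightarrow>\<^sub>E C. f x \<in> ?A}" using stabilizer_res_eq[OF J x] GE by auto
  show "is_subgroup_of C ?U G" by (rule stabilizer_is_subgroup[OF res_sub])
  have "openin (perm_top C) {f \<in> C \<rightarrow>\<^sub>E C. f x \<in> ?A}" by (rule openin_cylinder[OF x])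
  then show "openin (subtopology (perm_top C) G) ?U" unfolding eU openin_subtopology by blast
  have "closedin (perm_top C) {f \<in> C \<rightarrow>\<^sub>E C. f x \<in> ?A}"
    using closedin_cylinder2[OF x x, of "\<lambda>a b. a \<in> ?A"] by simp
  then have clU: "closedin (perm_top C) ?U" unfolding eU by (rule closedin_Int[OF closed_G])
  have "?A = (\<Union>k\<in>par J. sphere x k)" by (auto simp: residue_def sphere_def)
  then have finA: "finite ?A" using fin finite_sphere[OF x] par_carrier[OF J] by simp
  let ?K = "\<lambda>c. \<Union>a\<in>?A. sphere a (\<delta> x c)"
  have "compactin (perm_top C) (Pi\<^sub>E C ?K)"
    unfolding perm_top_def compactin_PiE
  proof (intro disjI2 ballI)
    fix c assume c: "c \<in> C"
    have "finite (?K c)" using finA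
    proof (rule finite_UN_I)
      fix a assume "a \<in> ?A"
      then show "finite (sphere a (\<delta> x c))" using finite_sphere[of a "\<delta> x c"] res_sub[of J x] x c by auto
    qed
    moreover have "?K c \<subseteq> C" by (auto simp: sphere_def)
    ultimately show "compactin (discrete_topology C) (?K c)" by (simp add: compactin_discrete_topology)
  qed
  moreover have "?U \<subseteq> Pi\<^sub>E C ?K"
  proof
    fix h assume h: "h \<in> ?U"
    then have hG: "h \<in> G" "h x \<in> ?A" unfolding eU by auto
    show "h \<in> Pi\<^sub>E C ?K"
    proof (rule PiE_I)
      fix c assume c: "c \<in> C"
      have "h c \<in> sphere (h x) (\<delta> x c)" using G_dist[OF hG(1) x c] hG c by (simp add: sphere_def)
      then show "h c \<in> ?K c" using hG by blast
    next
      fix c assume "c \<notin> C"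
      then show "h c = undefined" using G_ext[OF hG(1)] by (simp add: extensional_def)
    qed
  qed
  ultimately have "compactin (perm_top C) ?U" using closed_compactin clU by blast
  moreover have "?U \<subseteq> G" by (auto simp: stabilizer_def)
  ultimately show "compactin (subtopology (perm_top C) G) ?U" by (simp add: compactin_subtopology)
qed

lemma displacement_stabilizer:
  assumes g: "g \<in> G" and J: "J \<subseteq> S" and x: "x \<in> C" and y: "y \<in> C" and n: "normalizes J (\<delta> y x)"
    and gx: "g ` res J x = res J y"
  shows "displacement C g (stabilizer G (res J x)) = qdist W S C \<delta> (g ` res J x) (res J x)"
  unfolding displacement_eq[OF g] conj_stabilizer[OF g res_sub] gx
  using index_stabilizer[OF J x y n] qdist_normal[OF J y x n] by (simp add: Qd_def)

text \<open>The factor \<open>v\<close> is absorbed by the residue: it leads from \<open>x1\<close>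
  to a chamber \<open>x\<close> of \<open>res J x1\<close> whose distance to \<open>g x1\<close> is
  \<open>t\<close>. Accordingly \<open>y\<close> is \<open>g x1\<close>, which need not be
  \<open>g x\<close>.\<close>

lemma straight_residue:
  assumes g: "g \<in> G"
  obtains J x y where "J \<subseteq> S" "finite (par J)" "x \<in> C" "y \<in> C" "normalizes J (\<delta> x y)"
    "g ` res J x = res J y" "\<And>n::nat. len (\<delta> x y [^] n) = n * len (\<delta> x y)"
proof -
  have bij: "bij_betw g C C" and d: "\<And>x y. x \<in> C \<Longrightarrow> y \<in> C \<Longrightarrow> \<delta> (g x) (g y) = \<delta> x y"
    using G_bij[OF g] G_dist[OF g] by auto
  obtain x0 where x0: "x0 \<in> C" "lossless (\<delta> x0 (g x0))"
    "\<And>w'. reach (\<delta> x0 (g x0)) w' \<Longrightarrow> \<exists>y\<in>C. \<delta> y (g y) = w'"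
    using min_displacement[OF bij d] by blast
  obtain J t v where J: "J \<subseteq> S" "finite (par J)" and v: "v \<in> par J" and t: "normalizes J t"
    and r: "reach (\<delta> x0 (g x0)) (v \<otimes> t)" and st: "\<And>n::nat. len (t [^] n) = n * len t"
    using straight_decomposition[OF x0(2)] by blast
  obtain x1 where x1: "x1 \<in> C" "\<delta> x1 (g x1) = v \<otimes> t" using x0(3)[OF r] by blast
  have gx1: "g x1 \<in> C" using g x1 by simp
  have tc: "t \<in> carrier W" using t by (simp add: normalizes_def rmin_def)
  obtain x where x: "x \<in> C" "\<delta> x1 x = v" "\<delta> x (g x1) = t"
    using dist_split[OF x1(1) gx1 par_carrier[OF J(1) v] tc x1(2)] .
  have "x \<in> res J x1" using x v by (simp add: residue_def)
  then have "res J x = res J x1" by (rule res_eq[OF J(1) x1(1)])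
  then have "g ` res J x = res J (g x1)" using res_image[OF g x1(1)] by simp
  then show ?thesis using that[OF J x(1) gx1] t st x(3) by simp
qed

lemma pow_image:
  assumes g: "g \<in> G"
  shows "x \<in> C \<Longrightarrow> (g ^^ n) x \<in> C" "x \<in> C \<Longrightarrow> (g ^^ n) ` res J x = res J ((g ^^ n) x)"
    "x \<in> C \<Longrightarrow> y \<in> C \<Longrightarrow> \<delta> ((g ^^ n) x) ((g ^^ n) y) = \<delta> x y"
proof -
  show c: "x \<in> C \<Longrightarrow> (g ^^ n) x \<in> C" for x n by (induction n) (auto simp: g)
  show "x \<in> C \<Longrightarrow> (g ^^ n) ` res J x = res J ((g ^^ n) x)"
  proof (induction n)
    case (Suc n)
    have "(g ^^ Suc n) ` res J x = g ` (g ^^ n) ` res J x" by (simp add: image_comp)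
    then show ?case using Suc res_image[OF g c[OF Suc(2)]] by simp
  qed simp
  show "x \<in> C \<Longrightarrow> y \<in> C \<Longrightarrow> \<delta> ((g ^^ n) x) ((g ^^ n) y) = \<delta> x y"
    by (induction n) (auto simp: G_dist[OF g] c)
qed

lemma conj_pow_stabilizer:
  assumes g: "g \<in> G" and x: "x \<in> C"
  shows "(GG.conjg g ^^ n) (stabilizer G (res J x)) = stabilizer G ((g ^^ n) ` res J x)"
proof (induction n)
  case (Suc n)
  have "(g ^^ n) ` res J x \<subseteq> C" unfolding pow_image(2)[OF g x] by (rule res_sub)
  then show ?case using Suc conj_stabilizer[OF g, of "(g ^^ n) ` res J x"] by (simp add: image_comp)
qed simp

text \<open>The residue and its translate by the \<open>m\<close>-th power of \<open>g\<close>
  contain chambers at distance \<open>t^m\<close>, so by straightness the corresponding index is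
  exactly the \<open>m\<close>-th power of \<open>Qd t\<close>. Commensurability with
  \<open>V\<close> then allows a comparison of growth rates.\<close>

lemma straight_lower_bound:
  assumes g: "g \<in> G" and J: "J \<subseteq> S" "finite (par J)" and x: "x \<in> C" and y: "y \<in> C"
    and n: "normalizes J (\<delta> x y)" and gx: "g ` res J x = res J y"
    and st: "\<And>n::nat. len (\<delta> x y [^] n) = n * len (\<delta> x y)"
    and V: "compact_open_subgroup C G V"
  shows "qdist W S C \<delta> (g ` res J x) (res J x) \<le> displacement C g V"
proof -
  let ?t = "\<delta> x y" and ?U = "stabilizer G (res J x)"
  have tc: "?t \<in> carrier W" using x y by simp
  have U: "compact_open_subgroup C G ?U" by (rule stabilizer_compact_open[OF J x])
  have sg: "subgroup V GG" "subgroup ?U GG"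
    using U V subgroup_iff by (auto simp: compact_open_subgroup_def)
  have sc: "subgroup (GG.conjg g V) GG" by (rule GG.subgroup_conjg) (use g sg in auto)
  obtain a where a: "GG.cov a ?U (?U \<inter> V)"
    using cov_exists[OF sg(2) compact_open_orbits[OF U] compact_open_fixator[OF V]] by blast
  obtain b where b: "GG.cov b V (V \<inter> ?U)"
    using cov_exists[OF sg(1) compact_open_orbits[OF V] compact_open_fixator[OF U]] by blast
  \<comment> \<open>Needed because \<open>card\<close> would give the junk value 0 for an infinite index.\<close>
  obtain d0 where d0: "GG.cov d0 (GG.conjg g V) (GG.conjg g V \<inter> V)"
    using cov_exists[OF sc finite_orbits_conj[OF g sg(1) compact_open_orbits[OF V]] compact_open_fixator[OF V]] by blast
  let ?d = "displacement C g V"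
  have sK: "subgroup (GG.conjg g V \<inter> V) GG" by (rule GG.subgroups_Inter_pair[OF sc sg(1)])
  have d: "GG.cov ?d (GG.conjg g V) (GG.conjg g V \<inter> V)"
    using d0 GG.cov_iff[OF subgroup.subset[OF sc] sK] displacement_eq[OF g] by simp
  \<comment> \<open>Normality lets the next translate be entered from any chamber of the current
    one, and straightness keeps the lengths additive.\<close>
  have pt: "\<exists>z\<in>(g ^^ m) ` res J x. \<delta> x z = ?t [^] m" for m :: nat
  proof (induction m)
    case 0 then show ?case using res_self[OF x] x dist_one_iff[OF x x] by (auto intro!: bexI[of _ x])
  next
    case (Suc m)
    then obtain z where z: "z \<in> res J ((g ^^ m) x)" "\<delta> x z = ?t [^] m" unfolding pow_image(2)[OF g x] by blast
    have zC: "z \<in> C" using z res_sub by blast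
    have c: "(g ^^ m) x \<in> C" "(g ^^ m) y \<in> C" using pow_image(1)[OF g] x y by auto
    have dm: "\<delta> ((g ^^ m) x) ((g ^^ m) y) = ?t" by (rule pow_image(3)[OF g x y])
    obtain z' where z': "z' \<in> res J ((g ^^ m) y)" "\<delta> z z' = ?t"
      using normal_shift[OF J(1) c _ z(1)] n dm by auto
    have z'C: "z' \<in> C" using z' res_sub by blast
    have "\<delta> x z' = ?t [^] m \<otimes> ?t"
      using dist_add[OF x zC z'C] z z' st[of m] st[of "Suc m"] by simp
    moreover have "(g ^^ Suc m) ` res J x = res J ((g ^^ m) y)"
    proof -
      have "(g ^^ Suc m) ` res J x = (g ^^ m) ` g ` res J x" by (simp only: funpow_Suc_right image_comp)
      then show ?thesis using gx pow_image(2)[OF g y] by simp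
    qed
    ultimately show ?case using z' by auto
  qed
  \<comment> \<open>The index is taken at the translated residue, whose distance back to
    \<open>x\<close> is the inverse of \<open>t^m\<close>.\<close>
  have Qp: "Qd (inv (?t [^] m)) = Qd ?t ^ m" for m :: nat
    unfolding Qd_def using Q_inv[of "?t [^] m"] Q_pow[OF tc st] tc by simp
  have "Qd ?t ^ m \<le> a * (?d ^ m * b)" for m
  proof -
    obtain z where z: "z \<in> (g ^^ m) ` res J x" "\<delta> x z = ?t [^] m" using pt by blast
    have zC: "z \<in> C" using z(1) res_sub unfolding pow_image(2)[OF g x] by blast
    have rz: "(g ^^ m) ` res J x = res J z"
      using z(1) res_eq[OF J(1) pow_image(1)[OF g x]] unfolding pow_image(2)[OF g x] by simp
    have zx: "\<delta> z x = inv (?t [^] m)" using dist_sym[OF x zC] z by simp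
    have nz: "normalizes J (\<delta> z x)" unfolding zx by (rule normalizes_inv[OF J(1) normalizes_pow[OF J(1) n]])
    have cp: "(GG.conjg g ^^ m) ?U = stabilizer G (res J z)" using conj_pow_stabilizer[OF g x] rz by simp
    have sz: "subgroup (stabilizer G (res J z)) GG" by (rule stabilizer_subgroup[OF res_sub])
    have "GG.cov (a * (?d ^ m * b)) ((GG.conjg g ^^ m) ?U) ((GG.conjg g ^^ m) ?U \<inter> ?U)"
      by (rule GG.cov_commensurable[OF _ sg d a b]) (use g in simp)
    then have "card (GG.cosets (stabilizer G (res J z)) (stabilizer G (res J z) \<inter> ?U)) \<le> a * (?d ^ m * b)"
      unfolding cp using GG.cov_iff[OF subgroup.subset[OF sz] GG.subgroups_Inter_pair[OF sz sg(2)]] by blast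
    then show ?thesis using index_stabilizer[OF J(1) x zC nz] Qp zx by simp
  qed
  then have "Qd ?t \<le> ?d" by (rule nat_growth)
  moreover have "qdist W S C \<delta> (g ` res J x) (res J x) = Qd ?t"
  proof -
    have yx: "\<delta> y x = inv ?t" using dist_sym[OF x y] .
    have "normalizes J (\<delta> y x)" unfolding yx by (rule normalizes_inv[OF J(1) n])
    then show ?thesis unfolding gx using qdist_normal[OF J(1) y x] Q_inv[OF tc] yx by (simp add: Qd_def)
  qed
  ultimately show ?thesis by simp
qed

lemma tidy_minimal:
  assumes g: "g \<in> G" and A: "is_simplex W S C \<delta> A" and al: "aligned W S \<delta> A (g ` A)"
    and min: "\<forall>B. is_simplex W S C \<delta> B \<and> aligned W S \<delta> B (g ` B) \<longrightarrow>
      qdist W S C \<delta> (g ` A) A \<le> qdist W S C \<delta> (g ` B) B"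
  shows "tidy C G g (stabilizer G A) \<and> scale C G g = qdist W S C \<delta> (g ` A) A"
proof -
  obtain J x0 where J: "J \<subseteq> S" "finite (par J)" and x0: "x0 \<in> C" "A = res J x0"
    using A unfolding is_simplex_def by blast
  have gA: "g ` A = res J (g x0)" using res_image[OF g x0(1)] x0 by simp
  \<comment> \<open>Projecting from \<open>g A\<close> onto \<open>A\<close> matches the direction
    of the index in \<open>displacement\<close>.\<close>
  have "proj_set W S \<delta> (res J x0) (res J (g x0)) = res J x0" using al x0 gA unfolding aligned_def by simp
  then obtain y x where xy: "y \<in> res J (g x0)" "x \<in> res J x0" "normalizes J (\<delta> y x)"
    using normal_of_aligned[OF J(1) _ x0(1), of "g x0"] g x0 by auto
  have c: "y \<in> C" "x \<in> C" using xy res_sub by auto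
  have Ax: "A = res J x" using res_eq[OF J(1) x0(1) xy(2)] x0 by simp
  have gx: "g ` res J x = res J y" using res_eq[OF J(1) _ xy(1)] gA g x0 Ax by simp
  have dA: "displacement C g (stabilizer G A) = qdist W S C \<delta> (g ` A) A"
    unfolding Ax by (rule displacement_stabilizer[OF g J(1) c(2,1) xy(3) gx])
  have coA: "compact_open_subgroup C G (stabilizer G A)" unfolding Ax by (rule stabilizer_compact_open[OF J c(2)])
  obtain K x' y' where K: "K \<subseteq> S" "finite (par K)" "x' \<in> C" "y' \<in> C" "normalizes K (\<delta> x' y')"
    "g ` res K x' = res K y'" "\<And>n::nat. len (\<delta> x' y' [^] n) = n * len (\<delta> x' y')"
    using straight_residue[OF g] by blast
  have "is_simplex W S C \<delta> (res K x')" unfolding is_simplex_def using K by blast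
  moreover have "aligned W S \<delta> (res K x') (g ` res K x')"
    unfolding K(6) by (rule aligned_normal[OF K(1,3,4,5)])
  ultimately have "qdist W S C \<delta> (g ` A) A \<le> qdist W S C \<delta> (g ` res K x') (res K x')" using min by blast
  then have low: "qdist W S C \<delta> (g ` A) A \<le> displacement C g V" if "compact_open_subgroup C G V" for V
    using straight_lower_bound[OF g K that] by simp
  have "tidy C G g (stabilizer G A)" unfolding tidy_def dA using coA low by blast
  moreover have "scale C G g = qdist W S C \<delta> (g ` A) A"
    unfolding scale_def by (rule Least_equality) (use coA dA low in blast)+
  ultimately show ?thesis by blast
qed

end

theorem theorem4p8:
  fixes W :: "'w monoid" and S :: "'w set" and C :: "'c set" and \<delta> :: "'c \<Rightarrow> 'c \<Rightarrow> 'w"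
    and G :: "('c \<Rightarrow> 'c) set" and g :: "'c \<Rightarrow> 'c" and A :: "'c set"
  assumes "is_building W S C \<delta>"
    and "thick_building S C \<delta>"
    and "locally_finite_building S C \<delta>"
    and "closed_aut_group C \<delta> G"
    and "weyl_transitive C \<delta> G"
    and "g \<in> G"
    and "is_simplex W S C \<delta> A"
    and "aligned W S \<delta> A (g ` A)"
    and "\<forall>B. is_simplex W S C \<delta> B \<and> aligned W S \<delta> B (g ` B) \<longrightarrow>
           qdist W S C \<delta> (g ` A) A \<le> qdist W S C \<delta> (g ` B) B"
  shows "tidy C G g (stabilizer G A) \<and> scale C G g = qdist W S C \<delta> (g ` A) A"
proof -
  interpret aut_group W S C \<delta> G
    using assms(1,3-5) by (simp add: aut_group_def building_def aut_group_axioms_def)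
  show ?thesis by (rule tidy_minimal[OF assms(6-9)])
qed

end
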